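(* Let $\mathbf{D},\mathbf{C}\in\mathbb{R}^{d\times d}$ satisfy Conditions (A)-(C), and consider the Fokker-Planck equation $\partial_t f=\operatorname{div}(\mathbf{D}\nabla f+\mathbf{C}xf)$, $t>0$, $x\in\mathbb{R}^d$. Let $\mu:=\min\{\operatorname{Re}(\lambda)\mid\lambda\text{ is an eigenvalue of }\mathbf{C}\}$ and assume that one or more of the eigenvalues of $\mathbf{C}$ with real part $\mu$ are defective. Denote by $n>0$ the maximal defect of these eigenvalues. Let $\mathbf{P_0}$ be the fixed positive definite matrix described in the context. Then there is a constant $c>0$ such that, for any $1<p\le2$, the solution $f(t)$ with initial datum $f_0\in L^1_+(\mathbb{R}^d)$ of unit mass and with $I_p^{\mathbf{P_0}}(f_0|f_\infty)<\infty$ satisfies $$I_p^{\mathbf{D}}(f(t)|f_\infty)\le c\,I_p^{\mathbf{P_0}}(f(t)|f_\infty)\le c_p(f_0)\,(1+t^{2n})e^{-2\mu t},\qquad t\ge0,$$ where the constant $c_p(f_0)$ depends on $f_0$ through $I_p^{\mathbf{P_0}}(f_0|f_\infty)$.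
   Context: Conditions: (A) $\mathbf{D}$ is (symmetric) positive semidefinite with $1\le \operatorname{rank}\mathbf{D}\le d$. (B) All eigenvalues of $\mathbf{C}$ have positive real part. (C) There is no non-trivial $\mathbf{C}^T$-invariant subspace of $\operatorname{Ker}\mathbf{D}$. $L^1_+(\mathbb{R}^d)$ is the set of non-negative functions in $L^1(\mathbb{R}^d)$. Under (A)-(C), for every $f_0\in L^1_+(\mathbb{R}^d)$ the equation has a unique classical solution $f\in C^\infty((0,\infty)\times\mathbb{R}^d)$ with initial datum $f_0$, strictly positive for $t>0$ if $f_0\ne0$. $f_\infty(x)=c_{\mathbf{K}}e^{-\frac12x^T\mathbf{K}^{-1}x}$ is the unique unit mass stationary state, where $\mathbf{K}$ is the unique symmetric positive definite solution of $2\mathbf{D}=\mathbf{C}\mathbf{K}+\mathbf{K}\mathbf{C}^T$. The defect of an eigenvalue is its algebraic multiplicity minus its geometric multiplicity; it is defective if its defect is positive. For a positive semidefinite matrix $\mathbf{P}$ and a twice differentiable $\psi$ on $(0,\infty)$, the relative Fisher information is $$I_\psi^{\mathbf{P}}(f|f_\infty):=\int_{\mathbb{R}^d}\psi''\Big(\frac{f(x)}{f_\infty(x)}\Big)\nabla\Big(\frac{f(x)}{f_\infty(x)}\Big)^T\mathbf{P}\,\nabla\Big(\frac{f(x)}{f_\infty(x)}\Big)f_\infty(x)\,dx .$$ For $1<p\le 2$, $I_p^{\mathbf{P}}:=I_{\psi_p}^{\mathbf{P}}$ with $\psi_p(y):=\frac{y^p-p(y-1)-1}{p(p-1)}$ (so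 $\psi_p''(y)=y^{p-2}$), and $e_p(f|f_\infty):=\int\psi_p(f/f_\infty)f_\infty\,dx$. $\mathbf{P_0}\in\mathbb{R}^{d\times d}$ is a fixed symmetric positive definite matrix (depending only on the equation) for which there is $\lambda>0$ with $I_{p}^{\mathbf{P_0}}(f|f_\infty)\ge\lambda e_{p}(f|f_\infty)$ for all unit mass $f\in L^1_+(\mathbb{R}^d)$ and all $1<p\le2$. *)

theory Defs
  imports "HOL-Analysis.Analysis" "HOL-Computational_Algebra.Polynomial"
begin

section \<open>Matrices\<close>

definition pos_semidef :: "real^'n^'n \<Rightarrow> bool" where
  "pos_semidef P \<longleftrightarrow> transpose P = P \<and> (\<forall>x. 0 \<le> x \<bullet> (P *v x))"

definition pos_def :: "real^'n^'n \<Rightarrow> bool" where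
  "pos_def P \<longleftrightarrow> transpose P = P \<and> (\<forall>x. x \<noteq> 0 \<longrightarrow> 0 < x \<bullet> (P *v x))"

definition complexify :: "real^'n^'n \<Rightarrow> complex^'n^'n" where
  "complexify A = map_matrix complex_of_real A"

definition eigenspace :: "real^'n^'n \<Rightarrow> complex \<Rightarrow> (complex^'n) set" where
  "eigenspace A z = {v. complexify A *v v = z *s v}"

definition eigenvalues :: "real^'n^'n \<Rightarrow> complex set" where
  "eigenvalues A = {z. \<exists>v. v \<noteq> 0 \<and> v \<in> eigenspace A z}"

definition char_polynomial :: "real^'n^'n \<Rightarrow> complex poly" where
  "char_polynomial A = det (mat [:0, 1:] - map_matrix (\<lambda>a. [:a:]) (complexify A))"

definition alg_multiplicity :: "real^'n^'n \<Rightarrow> complex \<Rightarrow> nat" where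
  "alg_multiplicity A z = order z (char_polynomial A)"

definition geom_multiplicity :: "real^'n^'n \<Rightarrow> complex \<Rightarrow> nat" where
  "geom_multiplicity A z = vec.dim (eigenspace A z)"

text \<open>The truncated subtraction is harmless, since the geometric multiplicity never exceeds
  the algebraic one.\<close>
definition defect :: "real^'n^'n \<Rightarrow> complex \<Rightarrow> nat" where
  "defect A z = alg_multiplicity A z - geom_multiplicity A z"

definition spectral_gap :: "real^'n^'n \<Rightarrow> real" where
  "spectral_gap A = Min (Re ` eigenvalues A)"

definition condition_A :: "real^'n^'n \<Rightarrow> bool" where
  "condition_A D \<longleftrightarrow> pos_semidef D \<and> 1 \<le> rank D \<and> rank D \<le> CARD('n)"

definition condition_B :: "real^'n^'n \<Rightarrow> bool" where
  "condition_B C \<longleftrightarrow> (\<forall>z\<in>eigenvalues C. 0 < Re z)"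

definition condition_C :: "real^'n^'n \<Rightarrow> real^'n^'n \<Rightarrow> bool" where
  "condition_C D C \<longleftrightarrow>
     (\<forall>V. subspace V \<and> V \<subseteq> {x. D *v x = 0} \<and> (\<forall>v\<in>V. transpose C *v v \<in> V) \<longrightarrow> V = {0})"


section \<open>Differential operators, smoothness and weak gradients\<close>

primrec higher_differentiable_on ::
    "'a::real_normed_vector set \<Rightarrow> ('a \<Rightarrow> real) \<Rightarrow> nat \<Rightarrow> bool" where
  "higher_differentiable_on S f 0 \<longleftrightarrow> continuous_on S f"
| "higher_differentiable_on S f (Suc k) \<longleftrightarrow>
     (\<forall>x\<in>S. f differentiable (at x)) \<and>
     (\<forall>v. higher_differentiable_on S (\<lambda>x. frechet_derivative f (at x) v) k)"

text \<open>Meant for open sets \<open>S\<close> only, as the derivatives are the unrestricted ones.\<close>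
definition smooth_on :: "'a::real_normed_vector set \<Rightarrow> ('a \<Rightarrow> real) \<Rightarrow> bool" where
  "smooth_on S f \<longleftrightarrow> (\<forall>k. higher_differentiable_on S f k)"

definition grad :: "(real^'n \<Rightarrow> real) \<Rightarrow> real^'n \<Rightarrow> real^'n" where
  "grad f x = (\<chi> i. frechet_derivative f (at x) (axis i 1))"

definition divergence :: "(real^'n \<Rightarrow> real^'n) \<Rightarrow> real^'n \<Rightarrow> real" where
  "divergence F x = trace (jacobian F (at x))"

definition test_function :: "(real^'n \<Rightarrow> real) \<Rightarrow> bool" where
  "test_function \<phi> \<longleftrightarrow> smooth_on UNIV \<phi> \<and> compact (closure {x. \<phi> x \<noteq> 0})"

definition locally_integrable :: "(real^'n \<Rightarrow> 'b::{banach, second_countable_topology}) \<Rightarrow> bool" where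
  "locally_integrable g \<longleftrightarrow> (\<forall>S. compact S \<longrightarrow> set_integrable lborel S g)"

definition is_weak_grad :: "(real^'n \<Rightarrow> real) \<Rightarrow> (real^'n \<Rightarrow> real^'n) \<Rightarrow> bool" where
  "is_weak_grad h G \<longleftrightarrow> locally_integrable h \<and> locally_integrable G \<and>
     (\<forall>\<phi>. test_function \<phi> \<longrightarrow>
        (\<integral>x. h x *\<^sub>R grad \<phi> x \<partial>lborel) = - (\<integral>x. \<phi> x *\<^sub>R G x \<partial>lborel))"


section \<open>The Fokker--Planck equation\<close>

definition L1_plus :: "(real^'n \<Rightarrow> real) \<Rightarrow> bool" where
  "L1_plus f \<longleftrightarrow> integrable lborel f \<and> (AE x in lborel. 0 \<le> f x)"

definition unit_mass :: "(real^'n \<Rightarrow> real) \<Rightarrow> bool" where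
  "unit_mass f \<longleftrightarrow> (\<integral>x. f x \<partial>lborel) = 1"

text \<open>Classical solutions of \<open>\<partial>\<^sub>t f = div (D \<nabla>f + C x f)\<close>. The initial datum is attained in
  \<open>L\<^sup>1\<close>, along a continuous curve \<open>[0,\<infinity>) \<rightarrow> L\<^sup>1\<close>: smoothness for \<open>t > 0\<close> and a pointwise
  initial condition alone would not determine the solution (Tychonoff).\<close>
definition fp_solution ::
    "real^'n^'n \<Rightarrow> real^'n^'n \<Rightarrow> (real^'n \<Rightarrow> real) \<Rightarrow> (real \<Rightarrow> real^'n \<Rightarrow> real) \<Rightarrow> bool" where
  "fp_solution D C f0 f \<longleftrightarrow>
     smooth_on ({0<..} \<times> UNIV) (\<lambda>(t, x). f t x) \<and>
     (\<forall>t>0. \<forall>x. ((\<lambda>s. f s x) has_real_derivative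
        divergence (\<lambda>y. D *v grad (f t) y + f t y *\<^sub>R (C *v y)) x) (at t)) \<and>
     (\<forall>t\<ge>0. integrable lborel (f t)) \<and>
     (\<forall>t\<ge>0. ((\<lambda>s. \<integral>x. \<bar>f s x - f t x\<bar> \<partial>lborel) \<longlongrightarrow> 0) (at t within {0..})) \<and>
     (AE x in lborel. f 0 x = f0 x)"

text \<open>\<open>steady_state K\<close> is \<open>f\<^sub>\<infinity>\<close>; dividing by the integral is the normalisation \<open>c\<^sub>K\<close> to unit mass.\<close>
definition steady_state :: "real^'n^'n \<Rightarrow> real^'n \<Rightarrow> real" where
  "steady_state K x =
     exp (- (x \<bullet> (matrix_inv K *v x)) / 2)
       / (\<integral>y. exp (- (y \<bullet> (matrix_inv K *v y)) / 2) \<partial>lborel)"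


section \<open>Relative entropy and relative Fisher information\<close>

text \<open>The Fisher information is applied to initial data that are merely in \<open>L\<^sup>1\<close>, so \<open>\<nabla>(f/g)\<close> is
  the weak gradient (unique up to null sets, and the classical gradient for smooth \<open>f/g\<close>), and the
  value is \<open>\<infinity>\<close> if there is none. Since \<open>\<psi>\<close> lives on \<open>(0,\<infinity>)\<close>, the integral is over
  \<open>{f/g > 0}\<close>; nothing is lost for \<open>f \<ge> 0\<close>, as the weak gradient vanishes almost everywhere
  on \<open>{f/g = 0}\<close>. The integrand is nonnegative for convex \<open>\<psi>\<close> and positive
  semidefinite \<open>P\<close>.\<close>
definition fisher_information ::
    "(real \<Rightarrow> real) \<Rightarrow> real^'n^'n \<Rightarrow> (real^'n \<Rightarrow> real) \<Rightarrow> (real^'n \<Rightarrow> real) \<Rightarrow> ennreal" where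
  "fisher_information \<psi> P f g =
     (let h = (\<lambda>x. f x / g x) in
      if \<exists>G. is_weak_grad h G then
        (let G = (SOME G. is_weak_grad h G) in
          \<integral>\<^sup>+x\<in>{x. 0 < h x}. ennreal (deriv (deriv \<psi>) (h x) * (G x \<bullet> (P *v G x)) * g x) \<partial>lborel)
      else \<infinity>)"

definition psi :: "real \<Rightarrow> real \<Rightarrow> real" where
  "psi p y = (y powr p - p * (y - 1) - 1) / (p * (p - 1))"

definition fisher_p ::
    "real \<Rightarrow> real^'n^'n \<Rightarrow> (real^'n \<Rightarrow> real) \<Rightarrow> (real^'n \<Rightarrow> real) \<Rightarrow> ennreal" where
  "fisher_p p P f g = fisher_information (psi p) P f g"

text \<open>For \<open>1 < p\<close> the function \<open>psi p\<close> is nonnegative on \<open>[0,\<infinity>)\<close>, so the integral is well defined in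
  \<open>[0,\<infinity>]\<close>.\<close>
definition entropy_p :: "real \<Rightarrow> (real^'n \<Rightarrow> real) \<Rightarrow> (real^'n \<Rightarrow> real) \<Rightarrow> ennreal" where
  "entropy_p p f g = (\<integral>\<^sup>+x. ennreal (psi p (f x / g x) * g x) \<partial>lborel)"

end

theory Submission
  imports Defs "HOL-Computational_Algebra.Fundamental_Theorem_Algebra"
begin

text \<open>Write \<open>E(t)\<close> for the exponential of \<open>-tC\<close> and \<open>Q = K - E(t) K E(t)\<^sup>T\<close>, which Condition (C)
  makes positive definite for \<open>t > 0\<close>. Testing the equation against the backward solutions
  \<open>exp (-q(s)) cos (a(s) \<bullet> x + \<theta>)\<close> determines the Fourier transform of \<open>f(t)\<close>, so every solution is
  given by Mehler's formula: \<open>f(t)\<close> is the image of \<open>f\<^sub>0\<close> under a Gaussian transition kernel with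
  covariance \<open>Q\<close>. The detailed balance relation with the time reversed kernel turns this into
  \<open>h\<^sub>t(y) = \<integral> h\<^sub>0(x) k(x - My) dx\<close> for \<open>h = f/f\<^sub>\<infinity>\<close>, where \<open>k\<close> is a Gaussian density and
  \<open>M = K E(t)\<^sup>T K\<^sup>-\<^sup>1\<close>. Hence \<open>\<nabla>h\<^sub>t = M\<^sup>T \<integral> \<nabla>h\<^sub>0(x) k(x - My) dx\<close>, and Jensen's inequality
  for the jointly convex function \<open>h\<^sup>p\<^sup>-\<^sup>2 (G \<bullet> P\<^sub>0 G)\<close> bounds the Fisher information at time \<open>t\<close> by the
  initial one times the square of the norm of \<open>E(t)\<close>, up to a constant. For \<open>p < 2\<close> this needs that
  the weak gradient of a nonnegative function vanishes on its zero set. Finally, Jordan chains at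
  an eigenvalue of defect \<open>m\<close> have length at most \<open>m + 1\<close>, so \<open>E(t)\<close> is bounded by a
  multiple of \<open>(1 + t\<^sup>n) exp (-\<mu>t)\<close>.\<close>

section \<open>The matrix exponential and the defect\<close>

text \<open>A solution is any function satisfying \<open>fp_solution\<close>: beyond integrability
  nothing is known about it, or about its gradient, at infinity, so its Fisher information cannot
  simply be differentiated in time. After a cutoff it can be tested against bounded smooth
  functions, and this suffices to determine it; from then on only the initial datum has to be
  handled. Mehler's formula by itself does not have the shape required by Jensen's inequality, since
  its weights are normalised in the end point. Detailed balance trades them for probability
  densities in the starting point, and what they average is the ratio to the stationary state. Real
  cosines with an arbitrary phase take the place of complex characters. The exponent
  \<open>2 * n\<close> is that of a squared operator norm, the Fisher information being quadratic in
  the gradient. The constant that compares \<open>D\<close> with \<open>P0\<close> depends neither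
  on \<open>p\<close> nor on time, and the final bound is linear in the initial Fisher
  information.\<close>

lemma power_le_fact_exp:
  assumes "0 \<le> (x::real)" shows "x ^ k \<le> fact k * exp x"
proof -
  have "(\<Sum>i\<in>{k}. x ^ i /\<^sub>R fact i) \<le> exp x"
    unfolding exp_def by (rule sum_le_suminf[OF summable_exp_generic]) (use assms in auto)
  then have "x ^ k / fact k \<le> exp x" by (simp add: divide_inverse mult.commute)
  then show ?thesis by (simp add: pos_divide_le_eq mult.commute)
qed

section \<open>Characteristic polynomials and kernel dimensions\<close>

lemma matrix_diff_rdistrib: "(A - B) ** C = A ** C - B ** (C :: 'a::comm_ring_1^'n^'m)"
  by (simp add: matrix_matrix_mult_def vec_eq_iff left_diff_distrib sum_subtractf)

text \<open>The Leibniz formula only uses sums, products and signs, so a ring homomorphism passes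
  through it. It is applied to evaluation and substitution of polynomials and to the embedding of
  constants.\<close>

lemma det_map_matrix:
  fixes A :: "'a::comm_ring_1^'n^'n" and h :: "'a \<Rightarrow> 'b::comm_ring_1"
  assumes add: "\<And>x y. h (x + y) = h x + h y" and mult: "\<And>x y. h (x * y) = h x * h y"
    and one: "h 1 = 1"
  shows "det (map_matrix h A) = h (det A)"
proof -
  have h0: "h 0 = 0" using add[of 0 0] by simp
  have hm: "h (- x) = - h x" for x
    using add[of x "- x"] h0 by (simp add: eq_neg_iff_add_eq_0 add.commute)
  have hs: "h (sum f S) = (\<Sum>x\<in>S. h (f x))" for f :: "('n \<Rightarrow> 'n) \<Rightarrow> 'a" and S
    by (induction S rule: infinite_finite_induct) (simp_all add: h0 add)
  have hp: "h (prod f S) = (\<Prod>x\<in>S. h (f x))" for f :: "'n \<Rightarrow> 'a" and S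
    by (induction S rule: infinite_finite_induct) (simp_all add: one mult)
  have hsg: "h (of_int (sign p)) = of_int (sign p)" for p :: "'n \<Rightarrow> 'n"
    by (simp add: sign_def one hm)
  show ?thesis
    unfolding det_def hs mult hp hsg by (simp add: map_matrix_def)
qed

text \<open>Stated for complex matrices, unlike \<open>char_polynomial\<close>, because it is
  applied to shifts by a complex eigenvalue and to their powers, which need not come from real
  matrices.\<close>

definition cpoly :: "complex^'n^'n \<Rightarrow> complex poly" where
  "cpoly L = det (mat [:0, 1:] - map_matrix (\<lambda>a. [:a:]) L)"

lemma pcompose_cpoly:
  "pcompose (cpoly L) r = det (mat r - map_matrix (\<lambda>a. [:a:]) L)"
proof -
  have "pcompose (cpoly L) r = det (map_matrix (\<lambda>p. pcompose p r) (mat [:0, 1:] - map_matrix (\<lambda>a. [:a:]) L))"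
    unfolding cpoly_def
    by (subst det_map_matrix) (auto simp: pcompose_add pcompose_mult pcompose_1)
  also have "map_matrix (\<lambda>p. pcompose p r) (mat [:0, 1:] - map_matrix (\<lambda>a. [:a:]) L)
      = mat r - map_matrix (\<lambda>a. [:a:]) L"
    by (simp add: map_matrix_def mat_def vec_eq_iff pcompose_diff pcompose_idR pcompose_pCons)
  finally show ?thesis .
qed

lemma poly_cpoly: "poly (cpoly L) x = det (mat x - L)"
proof -
  have "poly (cpoly L) x = det (map_matrix (\<lambda>p. poly p x) (mat [:0, 1:] - map_matrix (\<lambda>a. [:a:]) L))"
    unfolding cpoly_def by (subst det_map_matrix) auto
  also have "map_matrix (\<lambda>p. poly p x) (mat [:0, 1:] - map_matrix (\<lambda>a. [:a:]) L) = mat x - L"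
    by (simp add: map_matrix_def mat_def vec_eq_iff)
  finally show ?thesis .
qed

lemma mat_vector_mult: "mat z *v v = z *s (v :: 'a::comm_ring_1^'n)"
  by (simp add: matrix_vector_mult_def mat_def vec_eq_iff if_distrib if_distribR sum.delta cong: if_cong)

lemma det_eq_0_iff_kernel:
  fixes A :: "'a::field^'n^'n"
  shows "det A = 0 \<longleftrightarrow> (\<exists>v. v \<noteq> 0 \<and> A *v v = 0)"
  using invertible_det_nz[of A] invertible_left_inverse[of A] matrix_left_invertible_ker[of A]
  by auto

text \<open>A scalar exceeding an operator bound of \<open>L\<close> in modulus is no eigenvalue, so
  the polynomial does not vanish there. This avoids computing the leading coefficient.\<close>

lemma cpoly_nonzero: "cpoly L \<noteq> 0"
proof
  assume 0: "cpoly L = 0"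
  have lin: "linear (\<lambda>v. L *v v)" 
    by (rule linearI) (simp_all add: matrix_vector_right_distrib, simp add: matrix_vector_mult_def
        vec_eq_iff scaleR_sum_right)
  then obtain B where B: "\<And>v. norm (L *v v) \<le> B * norm v"
    using linear_bounded by blast
  define x where "x = complex_of_real (\<bar>B\<bar> + 1)"
  have "det (mat x - L) = 0" using poly_cpoly[of L x] 0 by simp
  then obtain v where v: "v \<noteq> 0" "(mat x - L) *v v = 0"
    by (auto simp: det_eq_0_iff_kernel)
  then have "L *v v = x *s v" by (simp add: matrix_vector_mult_diff_rdistrib mat_vector_mult)
  moreover have "x *s v = (\<bar>B\<bar> + 1) *\<^sub>R v"
    by (simp add: x_def vec_eq_iff complex_eq_iff distrib_right)
  ultimately have "(\<bar>B\<bar> + 1) * norm v \<le> B * norm v" using B[of v] by simp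
  then have "\<bar>B\<bar> + 1 \<le> B" using v(1) by simp
  then show False by linarith
qed

text \<open>Every product in the Leibniz formula takes one entry from each row in
  \<open>I\<close>.\<close>

lemma power_dvd_det:
  fixes A :: "'a::comm_ring_1^'n^'n"
  assumes "\<And>i j. i \<in> I \<Longrightarrow> x dvd A $ i $ j"
  shows "x ^ card I dvd det A"
proof -
  have "x ^ card I dvd (\<Prod>i\<in>UNIV. A $ i $ p i)" for p
  proof -
    have "(\<Prod>i\<in>UNIV. A $ i $ p i) = (\<Prod>i\<in>I. A $ i $ p i) * (\<Prod>i\<in>-I. A $ i $ p i)"
      by (metis Compl_eq_Diff_UNIV finite mult.commute prod.subset_diff subset_UNIV)
    moreover have "(\<Prod>i\<in>I. x) dvd (\<Prod>i\<in>I. A $ i $ p i)"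
      by (rule prod_dvd_prod) (auto intro: assms)
    ultimately show ?thesis by (simp add: dvd_mult2)
  qed
  then show ?thesis unfolding det_def by (intro dvd_sum dvd_mult) auto
qed

lemma kernel_subspace: "vec.subspace {v. (L :: 'a::field^'n^'n) *v v = 0}"
  by (auto simp: vec.subspace_def matrix_vector_right_distrib vec.scale vec.linear_scale)

text \<open>A basis of the kernel is extended to a basis of the whole space, the columns of
  \<open>Q\<close>. Multiplying \<open>X - L\<close> by \<open>Q\<close> turns each kernel column
  into \<open>X\<close> times a constant column, so the determinant contains one factor
  \<open>X\<close> per kernel vector; \<open>det Q\<close> is a nonzero constant. The transpose
  appears because \<open>power_dvd_det\<close> speaks of rows.\<close>

lemma order_cpoly_ge_kernel: "vec.dim {v. L *v v = 0} \<le> order 0 (cpoly L)"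
proof -
  let ?K = "{v. L *v v = 0}"
  obtain B0 where B0: "B0 \<subseteq> ?K" "vec.independent B0" "?K \<subseteq> vec.span B0" "card B0 = vec.dim ?K"
    using vec.basis_exists[of ?K] by blast
  define B where "B = vec.extend_basis B0"
  have BB: "B0 \<subseteq> B" "vec.independent B" "vec.span B = UNIV"
    using vec.extend_basis_superset[OF B0(2)] vec.independent_extend_basis[OF B0(2)]
      vec.span_extend_basis[OF B0(2)] by (auto simp: B_def)
  have "card B = CARD('a)" using vec.dim_eq_card[of B UNIV] BB vec_dim_card
      by (metis vec.dim_span vec.dim_eq_card_independent)
  moreover have finB: "finite B" using BB(2) vec.finiteI_independent by blast
  ultimately obtain g where g: "bij_betw g (UNIV::'a set) B"
    by (metis finite finite_same_card_bij)
  define Q :: "complex^'a^'a" where "Q = (\<chi> i j. g j $ i)"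
  have colQ: "column j Q = g j" for j by (simp add: column_def Q_def vec_eq_iff)
  have "columns Q = B" using g by (auto simp: columns_def colQ bij_betw_def)
  then have "det Q \<noteq> 0"
    using BB(3) matrix_right_invertible_span_columns invertible_det_nz invertible_right_inverse
    by metis
  let ?h = "map_matrix (\<lambda>a::complex. [:a:])"
  have hQ: "det (?h Q) = [:det Q:]" by (rule det_map_matrix) auto
  have hmul: "?h L ** ?h Q = ?h (L ** Q)"
  proof -
    have "sum (\<lambda>x. [:f x:]) S = [:sum f S:]" for f :: "'a \<Rightarrow> complex" and S
      by (induction S rule: infinite_finite_induct) auto
    from this[symmetric] show ?thesis
      by (simp add: map_matrix_def matrix_matrix_mult_def vec_eq_iff mult.commute)
  qed
  have matmul: "mat x ** M = (\<chi> i j. x * M $ i $ j)" for x :: "complex poly" and M :: "complex poly^'a^'a"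
    by (simp add: matrix_matrix_mult_def mat_def vec_eq_iff if_distrib if_distribR sum.delta cong: if_cong)
  define M where "M = (mat [:0, 1:] - ?h L) ** ?h Q"
  have M: "M $ i $ j = [:0, 1:] * [:Q $ i $ j:] - [:(L ** Q) $ i $ j:]" for i j
    unfolding M_def matrix_diff_rdistrib hmul matmul by (simp add: map_matrix_def)
  define I where "I = {j. g j \<in> B0}"
  have cI: "card I = card B0"
  proof -
    have "bij_betw g I B0" using g BB(1) unfolding I_def bij_betw_def
      by (auto simp: inj_on_def)
    then show ?thesis by (rule bij_betw_same_card)
  qed
  have "[:0, 1:] dvd transpose M $ j $ i" if "j \<in> I" for i j
  proof -
    have "L *v g j = 0" using that B0(1) by (auto simp: I_def)
    then have "(L ** Q) $ i $ j = 0"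
      by (simp add: vec_eq_iff matrix_vector_mult_def matrix_matrix_mult_def Q_def)
    then have "transpose M $ j $ i = [:0, 1:] * [:Q $ i $ j:]" by (simp add: transpose_def M)
    then show ?thesis by (metis dvd_triv_left)
  qed
  then have "[:0, 1:] ^ card I dvd det (transpose M)" by (rule power_dvd_det)
  then have "[:0, 1:] ^ card I dvd cpoly L * [:det Q:]"
    by (simp add: M_def det_mul hQ cpoly_def)
  then have "[:-0, 1:] ^ card I dvd cpoly L"
    using \<open>det Q \<noteq> 0\<close> by (simp add: dvd_smult_iff mult.commute)
  then have "card I \<le> order 0 (cpoly L)" using cpoly_nonzero order_divides by metis
  then show ?thesis using cI B0(4) by simp
qed

lemma pcompose_power: "pcompose (p ^ k) r = pcompose p r ^ k"
  by (induction k) (simp_all add: pcompose_1 pcompose_mult)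

text \<open>Split off the full power of \<open>X\<close> from \<open>p\<close>: the substitution
  turns it into a power of \<open>monom c k\<close>, while the cofactor keeps its nonzero value at
  0.\<close>

lemma order_0_pcompose:
  fixes p r :: "complex poly"
  assumes "p \<noteq> 0" "r = monom c k" "c \<noteq> 0" "0 < k"
  shows "order 0 (pcompose p r) = k * order 0 p"
proof -
  obtain q where q: "p = [:-0, 1:] ^ order 0 p * q" "\<not> [:-0, 1:] dvd q"
    using order_decomp[OF assms(1)] by blast
  have q0: "poly q 0 \<noteq> 0" using q(2) by (simp add: poly_eq_0_iff_dvd)
  have "poly (pcompose q r) 0 \<noteq> 0" using q0 assms(2,4) by (simp add: poly_pcompose poly_monom zero_power)
  then have nd: "\<not> [:-0, 1:] dvd pcompose q r" by (simp add: poly_eq_0_iff_dvd)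
  have "pcompose p r = pcompose [:0, 1:] r ^ order 0 p * pcompose q r"
    using arg_cong[OF q(1), of "\<lambda>p. pcompose p r"] by (simp add: pcompose_mult pcompose_power)
  also have "pcompose [:0, 1:] r = r" by (simp add: pcompose_pCons)
  also have "r ^ order 0 p = smult (c ^ order 0 p) ([:-0, 1:] ^ (k * order 0 p))"
    by (simp add: assms(2) monom_altdef smult_power power_mult)
  finally have e: "pcompose p r = [:-0, 1:] ^ (k * order 0 p) * smult (c ^ order 0 p) (pcompose q r)"
    by simp
  have nd': "\<not> [:-0, 1:] dvd smult (c ^ order 0 p) (pcompose q r)"
    using nd assms(3) by (simp add: dvd_smult_iff)
  have nz: "pcompose p r \<noteq> 0" using e nd' assms(3) by auto
  have "\<not> [:-0, 1:] ^ Suc (k * order 0 p) dvd pcompose p r"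
    unfolding e power_Suc2 using nd' by (subst dvd_mult_cancel_left) auto
  then show ?thesis using order_unique_lemma e by (metis dvd_triv_left)
qed

text \<open>Since \<open>det (X\<^sup>2 - L\<^sup>2) = det (X - L) det (X + L)\<close>, repeated squaring transfers bounds for
  the kernel of \<open>L\<close> to those of its powers without any block decomposition.\<close>
lemma order_cpoly_square: "order 0 (cpoly (L ** L)) = order 0 (cpoly L)"
proof -
  let ?h = "map_matrix (\<lambda>a::complex. [:a:])"
  let ?X = "[:0, 1:] :: complex poly"
  have hmul: "?h L ** ?h L = ?h (L ** L)"
  proof -
    have "sum (\<lambda>x. [:f x:]) S = [:sum f S:]" for f :: "'a \<Rightarrow> complex" and S
      by (induction S rule: infinite_finite_induct) auto
    from this[symmetric] show ?thesis by (simp add: map_matrix_def matrix_matrix_mult_def vec_eq_iff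
        mult.commute)
  qed
  have ml: "mat x ** M = (\<chi> i j. x * M $ i $ j)" for x :: "complex poly" and M :: "complex poly^'a^'a"
    by (simp add: matrix_matrix_mult_def mat_def vec_eq_iff if_distrib if_distribR sum.delta cong: if_cong)
  have mr: "M ** mat x = (\<chi> i j. x * M $ i $ j)" for x :: "complex poly" and M :: "complex poly^'a^'a"
    by (simp add: matrix_matrix_mult_def mat_def vec_eq_iff if_distrib if_distribR sum.delta mult.commute
        cong: if_cong)
  have "mat (?X * ?X) - ?h (L ** L) = (mat ?X - ?h L) ** (mat ?X + ?h L)"
    by (simp add: matrix_add_ldistrib matrix_diff_rdistrib hmul[symmetric])
      (simp add: ml mr vec_eq_iff, simp add: mat_def)
  then have 1: "pcompose (cpoly (L ** L)) (?X * ?X) = cpoly L * det (mat ?X + ?h L)"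
    unfolding pcompose_cpoly by (simp add: det_mul cpoly_def del: mult_pCons_left mult_pCons_right)
  \<comment> \<open>Up to the sign \<open>(-1) ^ CARD('a)\<close>, the second factor is the
    characteristic polynomial of \<open>L\<close> at \<open>- X\<close>, which has the same order at
    0 as the first. The substitution of the square of \<open>X\<close> on the other side doubles the
    order, so the factor 2 cancels.\<close>
  have "mat ?X + ?h L = mat (-1) ** (mat (- ?X) - ?h L)"
    by (simp add: ml vec_eq_iff) (simp add: mat_def)
  then have 2: "det (mat ?X + ?h L) = det (mat (-1) :: complex poly^'a^'a) * pcompose (cpoly L) (- ?X)"
    by (simp add: det_mul pcompose_cpoly)
  have d: "det (mat (-1) :: complex poly^'a^'a) = (-1) ^ CARD('a)"
    by (subst det_diagonal) (auto simp: mat_def)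
  have X2: "?X * ?X = monom 1 2" by (simp add: monom_altdef power2_eq_square)
  have mX: "- ?X = monom (-1) 1" by (simp add: monom_altdef)
  have o2: "order 0 (pcompose (cpoly L) (- ?X)) = order 0 (cpoly L)"
    using order_0_pcompose[OF cpoly_nonzero mX, of L] by simp
  have o1: "order 0 (pcompose (cpoly (L ** L)) (?X * ?X)) = 2 * order 0 (cpoly (L ** L))"
    using order_0_pcompose[OF cpoly_nonzero X2, of "L ** L"] by simp
  have nz: "pcompose (cpoly (L ** L)) (?X * ?X) \<noteq> 0"
    using cpoly_nonzero[of "L ** L"] by (simp add: pcompose_eq_0_iff)
  have "order 0 ((-1) ^ CARD('a) * pcompose (cpoly L) (- ?X)) = order 0 (cpoly L)"
    by (cases "even (CARD('a))") (simp_all add: o2[simplified])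
  then have "2 * order 0 (cpoly (L ** L)) = 2 * order 0 (cpoly L)"
    using nz o1 unfolding 1 2 d by (subst (asm) order_mult) auto
  then show ?thesis by simp
qed

primrec matpow :: "'a::comm_ring_1^'n^'n \<Rightarrow> nat \<Rightarrow> 'a^'n^'n" where
  "matpow A 0 = mat 1"
| "matpow A (Suc k) = A ** matpow A k"

lemma matpow_add: "matpow A (i + j) = matpow A i ** matpow A j"
  by (induction i) (simp_all add: matrix_mul_assoc)

lemma matpow_Suc_vector: "matpow A (Suc k) *v v = matpow A k *v (A *v v)"
  using matpow_add[of A k 1] by (simp add: matrix_vector_mul_assoc)

text \<open>Squaring reaches only exponents that are powers of two. This is enough, since kernels of
  powers increase with the exponent.\<close>

lemma order_cpoly_matpow: "order 0 (cpoly (matpow L (2 ^ k))) = order 0 (cpoly L)"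
proof (induction k)
  case (Suc k)
  then show ?case by (simp add: mult_2 matpow_add order_cpoly_square)
qed simp

lemma char_polynomial_eq: "char_polynomial A = cpoly (complexify A)"
  by (simp add: char_polynomial_def cpoly_def)

text \<open>Substituting \<open>X - z\<close> turns divisibility by a power of \<open>X\<close> into
  divisibility by the same power of \<open>X - z\<close>. Together with the kernel estimate at 0
  this bounds generalised eigenspaces at any \<open>z\<close>.\<close>

lemma order_cpoly_shift: "order 0 (cpoly (L - mat z)) \<le> order z (cpoly L)"
proof -
  have "pcompose (cpoly (L - mat z)) [:-z, 1:] = cpoly L"
    unfolding pcompose_cpoly unfolding cpoly_def
    by (rule arg_cong[of _ _ det]) (simp add: map_matrix_def mat_def vec_eq_iff)
  moreover have "[:-0, 1:] ^ order 0 (cpoly (L - mat z)) dvd cpoly (L - mat z)"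
    by (rule order_1)
  then obtain q where "cpoly (L - mat z) = [:-0, 1:] ^ order 0 (cpoly (L - mat z)) * q" by (elim dvdE)
  ultimately have "cpoly L = pcompose ([:-0, 1:] ^ order 0 (cpoly (L - mat z)) * q) [:-z, 1:]" by metis
  then have "cpoly L = [:-z, 1:] ^ order 0 (cpoly (L - mat z)) * pcompose q [:-z, 1:]"
    by (simp add: pcompose_mult pcompose_power pcompose_pCons)
  then have "[:-z, 1:] ^ order 0 (cpoly (L - mat z)) dvd cpoly L" by (metis dvd_triv_left)
  then show ?thesis using cpoly_nonzero order_divides by metis
qed

text \<open>Otherwise the kernels of the powers of \<open>N\<close> would grow strictly up to exponent \<open>n + 2\<close>, which
  forces the algebraic multiplicity to exceed the geometric one by more than \<open>n\<close>.\<close>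
lemma kernel_index_le_defect:
  fixes C :: "real^'n^'n"
  defines "N \<equiv> \<lambda>z. complexify C - mat z"
  assumes "defect C z \<le> n" and "matpow (N z) j *v v = 0"
  shows "matpow (N z) (Suc n) *v v = 0"
proof (rule ccontr)
  assume nz: "matpow (N z) (Suc n) *v v \<noteq> 0"
  let ?W = "\<lambda>i. {v. matpow (N z) i *v v = 0}"
  have mono: "?W i \<subseteq> ?W (Suc i)" for i
    by (auto simp: matrix_vector_mul_assoc[symmetric])
  have mono': "?W i \<subseteq> ?W (i + d)" for i d
    by (induction d) (use mono in auto)
  have stab: "?W (Suc i + d) \<subseteq> ?W (i + d)" if "?W (Suc i) \<subseteq> ?W i" for i d
    using that
  proof (induction d)
    case (Suc d)
    then show ?case
      using matpow_Suc_vector[of "N z" "Suc i + d"] matpow_Suc_vector[of "N z" "i + d"]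
      by (auto simp del: matpow.simps)
  qed simp
  \<comment> \<open>If the chain of kernels stopped growing at such an \<open>i\<close>, then
    \<open>v\<close>, which lies in \<open>?W j\<close>, would already lie in
    \<open>?W (Suc n)\<close>, against \<open>nz\<close>.\<close>
  have strict: "\<not> ?W (Suc i) \<subseteq> ?W i" if "i \<le> Suc n" for i
  proof
    assume s: "?W (Suc i) \<subseteq> ?W i"
    have "?W (i + d) \<subseteq> ?W i" for d
    proof (induction d)
      case (Suc d)
      then show ?case using stab[OF s, of d] by auto
    qed simp
    moreover have "matpow (N z) (i + j) *v v = 0"
      using assms(3) by (simp add: matpow_add matrix_vector_mul_assoc[symmetric])
    ultimately have "v \<in> ?W i" by blast
    then have "v \<in> ?W (Suc n)" using mono'[of i "Suc n - i"] that by auto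
    then show False using nz by simp
  qed
  have sub: "vec.subspace (?W i)" for i by (rule kernel_subspace)
  have dim: "vec.dim (?W 1) + i \<le> vec.dim (?W (Suc i))" if "i \<le> Suc n" for i
    using that
  proof (induction i)
    case (Suc i)
    have "vec.dim (?W (Suc i)) < vec.dim (?W (Suc (Suc i)))"
    proof (rule ccontr)
      assume "\<not> ?thesis"
      then have "?W (Suc i) = ?W (Suc (Suc i))"
        by (intro vec.subspace_dim_equal sub mono) simp
      then show False using strict[of "Suc i"] Suc.prems by simp
    qed
    then show ?case using Suc by simp
  qed simp
  have W1: "?W 1 = eigenspace C z"
    by (auto simp: eigenspace_def N_def matrix_vector_mult_diff_rdistrib mat_vector_mult)
  \<comment> \<open>The exponent is raised to a power of two, where the kernel dimension is
    controlled by the algebraic multiplicity.\<close>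
  obtain d where "2 ^ Suc (Suc n) = Suc (Suc n) + d"
    using less_imp_le[OF less_exp[of "Suc (Suc n)"]] le_Suc_ex by blast
  then have "?W (Suc (Suc n)) \<subseteq> ?W (2 ^ Suc (Suc n))"
    using mono'[of "Suc (Suc n)" d] by metis
  then have "vec.dim (?W (Suc (Suc n))) \<le> vec.dim (?W (2 ^ Suc (Suc n)))"
    by (rule vec.dim_subset)
  also have "\<dots> \<le> order 0 (cpoly (N z))"
    using order_cpoly_ge_kernel order_cpoly_matpow by metis
  also have "\<dots> \<le> alg_multiplicity C z"
    using order_cpoly_shift by (simp add: alg_multiplicity_def char_polynomial_eq N_def)
  finally have "geom_multiplicity C z + Suc n \<le> alg_multiplicity C z"
    using dim[of "Suc n"] by (simp add: geom_multiplicity_def W1[symmetric])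
  then show False using assms(2) by (simp add: defect_def)
qed

section \<open>Generalised eigenvectors span the space\<close>

definition gen_eigenvector :: "complex^'n^'n \<Rightarrow> complex \<Rightarrow> complex^'n \<Rightarrow> bool" where
  "gen_eigenvector A z v \<longleftrightarrow> (\<exists>m. matpow (A - mat z) m *v v = 0)"

definition gen_span :: "complex^'n^'n \<Rightarrow> (complex^'n) set" where
  "gen_span A = vec.span {v. \<exists>z. gen_eigenvector A z v}"

lemma matpow_kernel_mono:
  assumes "matpow N m *v v = 0" "m \<le> k" shows "matpow N k *v v = 0"
  using assms matpow_add[of N "k - m" m] by (simp add: matrix_vector_mul_assoc[symmetric])

lemma gen_eigenvector_add:
  assumes "gen_eigenvector A z u" "gen_eigenvector A z v"
  shows "gen_eigenvector A z (u + v)"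
proof -
  obtain m k where "matpow (A - mat z) m *v u = 0" "matpow (A - mat z) k *v v = 0"
    using assms by (auto simp: gen_eigenvector_def)
  then have "matpow (A - mat z) (max m k) *v (u + v) = 0"
    using matpow_kernel_mono[of "A - mat z" m u "max m k"] matpow_kernel_mono[of "A - mat z" k v "max m k"]
    by (simp add: matrix_vector_right_distrib)
  then show ?thesis unfolding gen_eigenvector_def ..
qed

lemma gen_eigenvector_scale:
  "gen_eigenvector A z v \<Longrightarrow> gen_eigenvector A z (c *s v)"
  by (auto simp: gen_eigenvector_def vec.scale)

text \<open>On the generalised eigenspace at \<open>z'\<close> the matrix \<open>A - z\<close> is
  the nonzero scalar \<open>z' - z\<close> plus a nilpotent part, hence invertible. Dividing by the
  scalar leaves an error that is one step shorter in the chain, and the induction removes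
  it.\<close>

lemma gen_eigenvector_solve:
  fixes A :: "complex^'n^'n"
  assumes "matpow (A - mat z') m *v u = 0" "z \<noteq> z'"
  shows "\<exists>u'. matpow (A - mat z') m *v u' = 0 \<and> (A - mat z) *v u' = u"
  using assms(1)
proof (induction m arbitrary: u)
  case (Suc m)
  let ?c = "1 / (z' - z)"
  let ?N = "A - mat z'"
  have "matpow ?N m *v (?N *v (?c *s u)) = 0"
    using Suc.prems by (simp add: matpow_Suc_vector[symmetric] vec.scale del: matpow.simps)
  from Suc.IH[OF this] obtain u'' where
    u'': "matpow ?N m *v u'' = 0" "(A - mat z) *v u'' = ?N *v (?c *s u)" by blast
  have "(A - mat z) *v (?c *s u) = ?N *v (?c *s u) + (z' - z) *s (?c *s u)"
    by (simp add: matrix_vector_mult_diff_rdistrib mat_vector_mult) (simp add: vec_eq_iff field_simps)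
  then have "(A - mat z) *v (?c *s u - u'') = u"
    using u''(2) assms(2) by (simp add: vec.diff)
  moreover have "matpow ?N (Suc m) *v (?c *s u - u'') = 0"
    using Suc.prems matpow_kernel_mono[OF u''(1), of "Suc m"]
    by (simp add: vec.diff vec.scale del: matpow.simps)
  ultimately show ?case by blast
qed simp

text \<open>Up to a generalised eigenvector at \<open>z\<close>, every element of the span has a
  preimage under \<open>A - z\<close> inside the span. Comparing this preimage with \<open>w\<close>
  leaves a vector that \<open>A - z\<close> sends to a generalised eigenvector at \<open>z\<close>,
  hence again one.\<close>

lemma gen_span_closed:
  assumes "(A - mat z) *v w \<in> gen_span A"
  shows "w \<in> gen_span A"
proof -
  have sub: "vec.subspace (gen_span A)" by (simp add: gen_span_def)
  have base: "v \<in> gen_span A" if "gen_eigenvector A z' v" for z' v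
    unfolding gen_span_def using that by (intro vec.span_base) auto
  \<comment> \<open>The vectors for which such a preimage exists. At \<open>z\<close> itself the
    preimage 0 serves, and at other eigenvalues \<open>gen_eigenvector_solve\<close> supplies
    one.\<close>
  define S where "S = {u. \<exists>u'\<in>gen_span A. \<exists>g. gen_eigenvector A z g \<and> (A - mat z) *v u' = u + g}"
  have "u \<in> S" if "u \<in> vec.span {v. \<exists>z. gen_eigenvector A z v}" for u
    using that
  proof (induction rule: vec.span_induct)
    show "vec.subspace {u. u \<in> S}"
    proof (rule vec.subspaceI, unfold mem_Collect_eq)
      have "gen_eigenvector A z 0" unfolding gen_eigenvector_def by simp
      then show "0 \<in> S" unfolding S_def using vec.subspace_0[OF sub] by force
    next
      fix x y assume "x \<in> S" "y \<in> S"
      then obtain x' g y' h where *: "x' \<in> gen_span A" "gen_eigenvector A z g" "(A - mat z) *v x' = x + g"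
        "y' \<in> gen_span A" "gen_eigenvector A z h" "(A - mat z) *v y' = y + h" unfolding S_def by blast
      have "(A - mat z) *v (x' + y') = (x + y) + (g + h)"
        using * by (simp add: matrix_vector_right_distrib)
      then show "x + y \<in> S"
        unfolding S_def using vec.subspace_add[OF sub *(1,4)] gen_eigenvector_add[OF *(2,5)] by blast
    next
      fix c x assume "x \<in> S"
      then obtain x' g where *: "x' \<in> gen_span A" "gen_eigenvector A z g" "(A - mat z) *v x' = x + g"
        unfolding S_def by blast
      have "(A - mat z) *v (c *s x') = c *s x + c *s g"
        using * by (simp add: vec.scale vec.scale_right_distrib)
      then show "c *s x \<in> S"
        unfolding S_def using vec.subspace_scale[OF sub *(1)] gen_eigenvector_scale[OF *(2)] by blast
    qed
  next
    fix u assume "u \<in> {v. \<exists>z. gen_eigenvector A z v}"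
    then obtain z' m where u: "matpow (A - mat z') m *v u = 0" unfolding gen_eigenvector_def by blast
    show "u \<in> S"
    proof (cases "z = z'")
      case True
      have "gen_eigenvector A z (- 1 *s u)"
        by (rule gen_eigenvector_scale) (use u True in \<open>auto simp: gen_eigenvector_def\<close>)
      moreover have "(A - mat z) *v 0 = u + - 1 *s u" by (simp add: vec.scale_minus_left[symmetric])
      ultimately show ?thesis unfolding S_def using vec.subspace_0[OF sub] by blast
    next
      case False
      obtain u' where u': "matpow (A - mat z') m *v u' = 0" "(A - mat z) *v u' = u"
        using gen_eigenvector_solve[OF u False] by blast
      have "u' \<in> gen_span A" by (rule base[of z']) (use u' in \<open>auto simp: gen_eigenvector_def\<close>)
      moreover have "gen_eigenvector A z 0" unfolding gen_eigenvector_def by simp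
      ultimately show ?thesis unfolding S_def using u'(2) by force
    qed
  qed
  then have "(A - mat z) *v w \<in> S" using assms unfolding gen_span_def by blast
  then obtain u' g where *: "u' \<in> gen_span A" "gen_eigenvector A z g"
    "(A - mat z) *v u' = (A - mat z) *v w + g" unfolding S_def by blast
  then have "(A - mat z) *v (u' - w) = g" by (simp add: vec.diff)
  then have "gen_eigenvector A z (u' - w)"
    using *(2) unfolding gen_eigenvector_def by (metis matpow_Suc_vector)
  then have "u' - w \<in> gen_span A" by (rule base)
  then have "u' - (u' - w) \<in> gen_span A" using *(1) vec.subspace_diff[OF sub] by blast
  then show ?thesis by simp
qed

text \<open>The vector \<open>p(A) v\<close> by Horner's scheme, which avoids forming polynomials of
  matrices.\<close>

definition apply_poly :: "complex^'n^'n \<Rightarrow> complex poly \<Rightarrow> complex^'n \<Rightarrow> complex^'n" where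
  "apply_poly A p v = fold_coeffs (\<lambda>a w. a *s v + A *v w) p 0"

lemma apply_poly_0 [simp]: "apply_poly A 0 v = 0"
  by (simp add: apply_poly_def)

lemma apply_poly_pCons [simp]: "apply_poly A (pCons a p) v = a *s v + A *v apply_poly A p v"
  by (cases "p = 0 \<and> a = 0") (auto simp: apply_poly_def)

lemma apply_poly_add: "apply_poly A (p + q) v = apply_poly A p v + apply_poly A q v"
  by (induction p q rule: poly_induct2)
    (simp_all add: matrix_vector_right_distrib vec.scale_left_distrib)

lemma apply_poly_smult: "apply_poly A (smult c p) v = c *s apply_poly A p v"
  by (induction p) (simp_all add: vec.scale vec.scale_right_distrib)

lemma apply_poly_vector: "apply_poly A p (A *v v) = A *v apply_poly A p v"
  by (induction p) (simp_all add: matrix_vector_right_distrib vec.scale)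

lemma apply_poly_vec_add: "apply_poly A p (u + v) = apply_poly A p u + apply_poly A p v"
  by (induction p) (simp_all add: matrix_vector_right_distrib vec.scale_right_distrib)

lemma apply_poly_vec_scale: "apply_poly A p (c *s v) = c *s apply_poly A p v"
  by (induction p) (simp_all add: vec.scale vec.scale_right_distrib mult.commute)

lemma apply_poly_root: "apply_poly A ([:-z, 1:] * p) v = apply_poly A p ((A - mat z) *v v)"
proof -
  have "apply_poly A ([:-z, 1:] * p) v = (- z) *s apply_poly A p v + A *v apply_poly A p v"
    using apply_poly_add[of A "smult (-z) p" "pCons 0 p" v]
    by (simp add: apply_poly_smult del: smult_minus_left)
  also have "\<dots> = apply_poly A p ((- z) *s v + A *v v)"
    by (simp only: apply_poly_vec_add apply_poly_vec_scale apply_poly_vector)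
  also have "(- z) *s v + A *v v = (A - mat z) *v v"
    by (simp add: matrix_vector_mult_diff_rdistrib mat_vector_mult vec.scale_minus_left)
  finally show ?thesis .
qed

lemma apply_poly_monom: "apply_poly A (monom c k) v = c *s (matpow A k *v v)"
  by (induction k) (simp_all add: monom_0 monom_Suc vec.scale matrix_vector_mul_assoc)

lemma apply_poly_sum: "apply_poly A (sum p S) v = (\<Sum>i\<in>S. apply_poly A (p i) v)"
  by (induction S rule: infinite_finite_induct) (simp_all add: apply_poly_add)

text \<open>The vectors obtained from \<open>v\<close> by the powers of \<open>A\<close> up to the
  dimension are one too many to be independent; a linear relation between them is a
  polynomial.\<close>

lemma annihilating_poly: "\<exists>p. p \<noteq> 0 \<and> apply_poly A p v = 0"
proof -
  let ?N = "CARD('a)"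
  let ?g = "\<lambda>i. matpow A i *v v"
  show ?thesis
  proof (cases "inj_on ?g {..?N}")
    \<comment> \<open>A repeated vector is invisible to dependence of the set of powers, but already
      yields a difference of two monomials.\<close>
    case False
    then obtain i j where ij: "i \<noteq> j" "?g i = ?g j" unfolding inj_on_def by blast
    have "apply_poly A (monom 1 i + monom (-1) j) v = 0"
      by (simp add: apply_poly_add apply_poly_monom ij(2) vec.scale_minus_left)
    moreover have "monom 1 i + monom (-1::complex) j \<noteq> 0"
    proof
      assume "monom 1 i + monom (-1::complex) j = 0"
      then have "coeff (monom 1 i + monom (-1::complex) j) i = 0" by simp
      then show False using ij(1) by simp
    qed
    ultimately show ?thesis by blast
  next
    case True
    then have "card (?g ` {..?N}) = Suc ?N" by (simp add: card_image)
    then have "vec.dependent (?g ` {..?N})"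
      using vec.independent_card_le_dim[of "?g ` {..?N}" UNIV] vec_dim_card[where 'a=complex and 'n='a]
      by (metis Suc_n_not_le_n subset_UNIV)
    then obtain c w where c: "w \<in> ?g ` {..?N}" "c w \<noteq> 0" "(\<Sum>w\<in>?g ` {..?N}. c w *s w) = 0"
      using vec.dependent_finite[of "?g ` {..?N}"] by auto
    then obtain k where k: "k \<le> ?N" "c (?g k) \<noteq> 0" by auto
    let ?p = "\<Sum>i\<le>?N. monom (c (?g i)) i"
    have "apply_poly A ?p v = 0"
      using c(3) by (simp add: apply_poly_sum apply_poly_monom sum.reindex[OF True])
    moreover have "coeff ?p k = c (?g k)"
      using k(1) by (simp add: coeff_sum)
    then have "?p \<noteq> 0" using k(2) by auto
    ultimately show ?thesis by blast
  qed
qed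

text \<open>Induction on the degree of an annihilating polynomial of \<open>v\<close>: a root
  \<open>z\<close> is split off by the fundamental theorem of algebra, the remaining factor
  annihilates \<open>(A - z) v\<close>, and \<open>gen_span_closed\<close> returns from there to
  \<open>v\<close>.\<close>

lemma gen_span_UNIV: "gen_span A = UNIV"
proof -
  have "v \<in> gen_span A" if "p \<noteq> 0" "apply_poly A p v = 0" for p v
    using that
  proof (induction "degree p" arbitrary: p v)
    case 0
    then obtain a where "p = [:a:]" by (metis degree_eq_zeroE)
    with 0 have "v = 0" by simp
    then show ?case by (simp add: gen_span_def vec.span_zero)
  next
    case (Suc d)
    then obtain z where "poly p z = 0"
      by (metis constant_degree fundamental_theorem_of_algebra nat.distinct(1))
    then obtain q where q: "p = [:-z, 1:] * q" by (metis poly_eq_0_iff_dvd dvdE)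
    then have "q \<noteq> 0" using Suc.prems by auto
    moreover have "d = degree q" using q \<open>q \<noteq> 0\<close> Suc.hyps(2) by (simp add: degree_mult_eq del: mult_pCons_left)
    moreover have "apply_poly A q ((A - mat z) *v v) = 0" using Suc.prems q apply_poly_root by metis
    ultimately have "(A - mat z) *v v \<in> gen_span A" using Suc.hyps(1) by blast
    then show ?case by (rule gen_span_closed)
  qed
  then show ?thesis using annihilating_poly by blast
qed

section \<open>Growth of the exponential along generalised eigenvectors\<close>

lemma norm_smult_complex: "norm (c *s (v :: complex^'n)) = norm c * norm v"
  by (simp add: norm_vec_def norm_mult L2_set_right_distrib)

lemma bounded_bilinear_smult: "bounded_bilinear (\<lambda>(c::complex) (v::complex^'n). c *s v)"
proof
  show "\<exists>K. \<forall>(a::complex) (b::complex^'n). norm (a *s b) \<le> norm a * norm b * K"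
    by (intro exI[of _ 1]) (simp add: norm_smult_complex)
qed (simp_all add: vec_eq_iff complex_eq_iff algebra_simps)

text \<open>The first \<open>m\<close> terms of the exponential series of \<open>- t N\<close>
  applied to \<open>u\<close>; on a Jordan chain of length at most \<open>m\<close> they are the
  whole series.\<close>

definition exp_partial :: "complex^'n^'n \<Rightarrow> nat \<Rightarrow> complex^'n \<Rightarrow> real \<Rightarrow> complex^'n" where
  "exp_partial N m u t = (\<Sum>j<m. complex_of_real ((- t) ^ j / fact j) *s (matpow N j *v u))"

text \<open>Differentiation lowers each exponent and thereby costs one term. On a Jordan chain the
  missing term vanishes, so the differential equation becomes exact there.\<close>

lemma exp_partial_deriv:
  "(exp_partial N (Suc m) u has_vector_derivative - (N *v exp_partial N m u t)) (at t)"
proof (induction m)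
  case 0
  have "exp_partial N 0 u t = 0" "exp_partial N (Suc 0) u = (\<lambda>t. u)" by (auto simp: exp_partial_def fun_eq_iff)
  then show ?case by simp
next
  case (Suc m)
  have "((\<lambda>t. (- t) ^ Suc m / fact (Suc m)) has_real_derivative
      ((1 + real m) * (- 1 * (- t) ^ m) / fact (Suc m))) (at t)"
    by (rule DERIV_cdivide[OF DERIV_power_Suc]) (auto intro!: derivative_eq_intros)
  also have "(1 + real m) * (- 1 * (- t) ^ m) / fact (Suc m) = - ((- t) ^ m / fact m)"
  proof -
    have "(1 + real m) * (- 1 * (- t) ^ m) / fact (Suc m)
        = - ((1 + real m) * (- t) ^ m / ((1 + real m) * fact m))"
      by simp
    also have "\<dots> = - ((- t) ^ m / fact m)" by (subst mult_divide_mult_cancel_left) auto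
    finally show ?thesis .
  qed
  finally have "((\<lambda>t. complex_of_real ((- t) ^ Suc m / fact (Suc m))) has_vector_derivative
      complex_of_real (- ((- t) ^ m / fact m))) (at t)"
    by (intro has_vector_derivative_of_real) (simp add: has_real_derivative_iff_has_vector_derivative)
  from bounded_bilinear.has_vector_derivative[OF bounded_bilinear_smult this
      has_vector_derivative_const[of "matpow N (Suc m) *v u"]]
  have d: "((\<lambda>t. complex_of_real ((- t) ^ Suc m / fact (Suc m)) *s (matpow N (Suc m) *v u))
      has_vector_derivative
      complex_of_real (- ((- t) ^ m / fact m)) *s (matpow N (Suc m) *v u)) (at t)"
    by (simp del: fact_Suc power_Suc matpow.simps)
  have e: "exp_partial N (Suc (Suc m)) u =
      (\<lambda>t. exp_partial N (Suc m) u t + complex_of_real ((- t) ^ Suc m / fact (Suc m)) *s (matpow N (Suc m)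
          *v u))"
    unfolding exp_partial_def by (simp only: sum.lessThan_Suc)
  have "- (N *v exp_partial N (Suc m) u t) = - (N *v exp_partial N m u t)
      + complex_of_real (- ((- t) ^ m / fact m)) *s (matpow N (Suc m) *v u)"
    by (simp add: exp_partial_def matrix_vector_right_distrib vec.scale matrix_vector_mul_assoc)
  then show ?case unfolding e using has_vector_derivative_add[OF Suc d] by simp
qed

lemma exp_partial_bound:
  assumes "0 \<le> t"
  shows "norm (exp_partial N (Suc k) u t) \<le> (\<Sum>j<Suc k. norm (matpow N j *v u)) * (1 + t ^ k)"
proof -
  have "norm (exp_partial N (Suc k) u t)
      \<le> (\<Sum>j<Suc k. norm (complex_of_real ((- t) ^ j / fact j) *s (matpow N j *v u)))"
    unfolding exp_partial_def by (rule norm_sum)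
  also have "\<dots> \<le> (\<Sum>j<Suc k. norm (matpow N j *v u) * (1 + t ^ k))"
  proof (rule sum_mono)
    fix j assume j: "j \<in> {..<Suc k}"
    have "t ^ j \<le> 1 + t ^ k"
    proof (cases "t \<le> 1")
      case True
      then show ?thesis using assms power_le_one[of t j] by (simp add: add_increasing2)
    next
      case False
      then have "1 \<le> t" by simp
      then show ?thesis using j power_increasing[of j k t] by (simp add: less_Suc_eq_le)
    qed
    moreover have "norm (complex_of_real ((- t) ^ j / fact j)) \<le> t ^ j"
    proof -
      have "norm (complex_of_real ((- t) ^ j / fact j)) = t ^ j / fact j"
        using assms by (simp add: norm_divide norm_power del: of_real_power of_real_divide)
      also have "\<dots> \<le> t ^ j" using assms by (simp add: divide_le_eq mult_le_cancel_left1 fact_ge_1)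
      finally show ?thesis .
    qed
    ultimately have "norm (complex_of_real ((- t) ^ j / fact j)) \<le> 1 + t ^ k" by linarith
    then show "norm (complex_of_real ((- t) ^ j / fact j) *s (matpow N j *v u))
        \<le> norm (matpow N j *v u) * (1 + t ^ k)"
      unfolding norm_smult_complex by (subst mult.commute) (intro mult_left_mono, auto)
  qed
  finally show ?thesis by (simp only: sum_distrib_right)
qed

text \<open>The curve is \<open>exp (- z t)\<close> times the exponential of the nilpotent part,
  which stops after \<open>k + 1\<close> terms and is therefore a polynomial of degree at most
  \<open>k\<close> in \<open>t\<close>.\<close>

lemma gen_eigenvector_curve:
  assumes "matpow (A - mat z) (Suc k) *v u = 0"
  shows "\<exists>w K. w 0 = u \<and> 0 \<le> K \<and> (\<forall>t. (w has_vector_derivative - (A *v w t)) (at t)) \<and>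
    (\<forall>t\<ge>0. norm (w t) \<le> K * (1 + t ^ k) * exp (- Re z * t))"
proof -
  let ?N = "A - mat z"
  let ?S = "exp_partial ?N (Suc k) u"
  define w where "w = (\<lambda>t. exp (- z * of_real t) *s ?S t)"
  have S: "(?S has_vector_derivative - (?N *v ?S t)) (at t)" for t
  proof -
    have "?N *v ?S t = ?N *v exp_partial ?N k u t
        + complex_of_real ((- t) ^ k / fact k) *s (matpow ?N (Suc k) *v u)"
      by (simp add: exp_partial_def matrix_vector_right_distrib vec.scale matrix_vector_mul_assoc)
    then show ?thesis using exp_partial_deriv[of ?N k u t] assms by simp
  qed
  have e: "((\<lambda>t. exp (- z * of_real t)) has_vector_derivative (- z * exp (- z * of_real t))) (at t)" for t
  proof -
    have "((\<lambda>s. exp (- z * s)) has_field_derivative (- z * exp (- z * of_real t))) (at (of_real t))"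
      by (auto intro!: derivative_eq_intros)
    then show ?thesis by (rule has_vector_derivative_real_field)
  qed
  have "(w has_vector_derivative - (A *v w t)) (at t)" for t
  proof -
    have "(w has_vector_derivative (exp (- z * of_real t) *s (- (?N *v ?S t)) + (- z * exp (- z * of_real
        t)) *s ?S t)) (at t)"
      unfolding w_def by (rule bounded_bilinear.has_vector_derivative[OF bounded_bilinear_smult e S])
    also have "exp (- z * of_real t) *s (- (?N *v ?S t)) + (- z * exp (- z * of_real t)) *s ?S t = - (A *v w t)"
      unfolding w_def by (simp add: matrix_vector_mult_diff_rdistrib mat_vector_mult vec.scale vec_eq_iff
          algebra_simps)
    finally show ?thesis .
  qed
  moreover have "norm (w t) \<le> (\<Sum>j<Suc k. norm (matpow ?N j *v u)) * (1 + t ^ k) * exp (- Re z * t)" if "0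
      \<le> t" for t
  proof -
    have "norm (w t) = exp (- Re z * t) * norm (?S t)"
      by (simp add: w_def norm_smult_complex)
    then show ?thesis using exp_partial_bound[OF that, of ?N k u]
      by (simp add: mult.commute mult_left_mono)
  qed
  moreover have "w 0 = u" 
  proof -
    have "?S 0 = (\<Sum>j<Suc k. if j = 0 then u else 0)"
      unfolding exp_partial_def by (rule sum.cong) (auto simp: zero_power)
    then show ?thesis by (simp add: w_def sum.delta)
  qed
  moreover have "0 \<le> (\<Sum>j<Suc k. norm (matpow ?N j *v u))" by (intro sum_nonneg) auto
  ultimately show ?thesis by blast
qed

lemma power_exp_bounded:
  assumes "0 < (d::real)" obtains B where "0 \<le> B" "\<And>t. 0 \<le> t \<Longrightarrow> t ^ k * exp (- d * t) \<le> B"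
proof
  show "0 \<le> fact k / d ^ k" using assms by simp
  fix t :: real assume t: "0 \<le> t"
  have "(d * t) ^ k \<le> fact k * exp (d * t)" by (rule power_le_fact_exp) (use assms t in simp)
  then show "t ^ k * exp (- d * t) \<le> fact k / d ^ k"
    using assms by (simp add: exp_minus field_simps power_mult_distrib)
qed

lemma finite_eigenvalues: "finite (eigenvalues C)"
proof -
  have "eigenvalues C \<subseteq> {z. poly (cpoly (complexify C)) z = 0}"
  proof
    fix z assume "z \<in> eigenvalues C"
    then obtain v where "v \<noteq> 0" "complexify C *v v = z *s v"
      by (auto simp: eigenvalues_def eigenspace_def)
    then have "(mat z - complexify C) *v v = 0" by (simp add: matrix_vector_mult_diff_rdistrib mat_vector_mult)
    then show "z \<in> {z. poly (cpoly (complexify C)) z = 0}"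
      using \<open>v \<noteq> 0\<close> by (auto simp: poly_cpoly det_eq_0_iff_kernel)
  qed
  then show ?thesis using poly_roots_finite[OF cpoly_nonzero] finite_subset by blast
qed

text \<open>The last nonzero vector of the chain produced by repeated application of
  \<open>A - z\<close> is an eigenvector.\<close>

lemma gen_eigenvector_eigenvalue:
  assumes "matpow (complexify C - mat z) m *v u = 0" "u \<noteq> 0"
  shows "z \<in> eigenvalues C"
  using assms
proof (induction m arbitrary: u)
  case (Suc m)
  show ?case
  proof (cases "(complexify C - mat z) *v u = 0")
    case True
    then have "complexify C *v u = z *s u" by (simp add: matrix_vector_mult_diff_rdistrib mat_vector_mult)
    then show ?thesis using Suc.prems(2) by (auto simp: eigenvalues_def eigenspace_def)
  next
    case False
    then show ?thesis using Suc.IH[of "(complexify C - mat z) *v u"] Suc.prems(1)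
      by (simp add: matpow_Suc_vector del: matpow.simps)
  qed
qed simp

text \<open>The initial vectors admitting such a curve form a subspace, so generalised eigenvectors
  suffice. At real part \<open>\<mu>\<close> the chain length is controlled by the defect; the
  constant \<open>K\<close> still depends on \<open>v\<close>.\<close>

lemma complex_curve_exists:
  fixes C :: "real^'n^'n"
  assumes \<mu>: "\<mu> = spectral_gap C"
    and n: "n = Max (defect C ` {z\<in>eigenvalues C. Re z = \<mu>})"
  shows "\<exists>w K. w 0 = v \<and> 0 \<le> K \<and> (\<forall>t. (w has_vector_derivative - (complexify C *v w t)) (at t)) \<and>
    (\<forall>t\<ge>0. norm (w t) \<le> K * (1 + t ^ n) * exp (- \<mu> * t))"
proof -
  let ?A = "complexify C"
  define S where "S = {v. \<exists>w K. w 0 = v \<and> 0 \<le> K \<and> (\<forall>t. (w has_vector_derivative - (?A *v w t)) (at t)) \<and>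
    (\<forall>t\<ge>0. norm (w t) \<le> K * (1 + t ^ n) * exp (- \<mu> * t))}"
  have SI: "v \<in> S" if "w 0 = v" "0 \<le> K" "\<And>t. (w has_vector_derivative - (?A *v w t)) (at t)"
    "\<And>t. 0 \<le> t \<Longrightarrow> norm (w t) \<le> K * (1 + t ^ n) * exp (- \<mu> * t)" for v w K
    using that unfolding S_def by blast
  have zero: "0 \<in> S" by (rule SI[of "\<lambda>t. 0" 0 0]) auto
  have "vec.subspace {v. v \<in> S}"
  proof (rule vec.subspaceI, unfold mem_Collect_eq)
    fix x y assume "x \<in> S" "y \<in> S"
    then obtain wx Kx wy Ky where
      x: "wx 0 = x" "0 \<le> Kx" "\<And>t. (wx has_vector_derivative - (?A *v wx t)) (at t)"
        "\<And>t. 0 \<le> t \<Longrightarrow> norm (wx t) \<le> Kx * (1 + t ^ n) * exp (- \<mu> * t)"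
      and y: "wy 0 = y" "0 \<le> Ky" "\<And>t. (wy has_vector_derivative - (?A *v wy t)) (at t)"
        "\<And>t. 0 \<le> t \<Longrightarrow> norm (wy t) \<le> Ky * (1 + t ^ n) * exp (- \<mu> * t)"
      unfolding S_def by blast
    show "x + y \<in> S"
    proof (rule SI[of "\<lambda>t. wx t + wy t" _ "Kx + Ky"])
      fix t show "((\<lambda>t. wx t + wy t) has_vector_derivative - (?A *v (wx t + wy t))) (at t)"
        using has_vector_derivative_add[OF x(3) y(3)] by (simp add: matrix_vector_right_distrib)
    next
      fix t :: real assume "0 \<le> t"
      then show "norm (wx t + wy t) \<le> (Kx + Ky) * (1 + t ^ n) * exp (- \<mu> * t)"
        using x(4)[of t] y(4)[of t] norm_triangle_ineq[of "wx t" "wy t"] by (simp add: algebra_simps)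
    qed (use x y in auto)
  next
    fix c x assume "x \<in> S"
    then obtain wx Kx where
      x: "wx 0 = x" "0 \<le> Kx" "\<And>t. (wx has_vector_derivative - (?A *v wx t)) (at t)"
        "\<And>t. 0 \<le> t \<Longrightarrow> norm (wx t) \<le> Kx * (1 + t ^ n) * exp (- \<mu> * t)"
      unfolding S_def by blast
    show "c *s x \<in> S"
    proof (rule SI[of "\<lambda>t. c *s wx t" _ "norm c * Kx"])
      fix t show "((\<lambda>t. c *s wx t) has_vector_derivative - (?A *v (c *s wx t))) (at t)"
        using bounded_bilinear.has_vector_derivative[OF bounded_bilinear_smult has_vector_derivative_const
            x(3), of c t]
        by (simp add: vec.scale)
    next
      fix t :: real assume "0 \<le> t"
      then show "norm (c *s wx t) \<le> norm c * Kx * (1 + t ^ n) * exp (- \<mu> * t)"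
        using x(4)[of t] by (simp add: norm_smult_complex mult.assoc mult_left_mono)
    qed (use x in auto)
  qed (rule zero)
  moreover have "v \<in> S" if "v \<in> {v. \<exists>z. gen_eigenvector ?A z v}" for v
  proof (cases "v = 0")
    case True then show ?thesis using zero by simp
  next
    case False
    obtain z m where zm: "matpow (?A - mat z) m *v v = 0"
      using \<open>v \<in> {v. \<exists>z. gen_eigenvector ?A z v}\<close> by (auto simp: gen_eigenvector_def)
    have z: "z \<in> eigenvalues C" using gen_eigenvector_eigenvalue[OF zm False] .
    then have "\<mu> \<le> Re z" unfolding \<mu> spectral_gap_def using finite_eigenvalues by (intro Min_le) auto
    show ?thesis
    proof (cases "Re z = \<mu>")
      case True
      have "defect C z \<le> n" unfolding n using True z
        by (intro Max_ge finite_imageI finite_subset[OF _ finite_eigenvalues[of C]]) auto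
      then have "matpow (?A - mat z) (Suc n) *v v = 0" using kernel_index_le_defect[OF _ zm] by blast
      from gen_eigenvector_curve[OF this] show ?thesis unfolding S_def True by simp
    next
      case False
      with \<open>\<mu> \<le> Re z\<close> have d: "0 < Re z - \<mu>" by simp
      have "matpow (?A - mat z) (Suc m) *v v = 0" by (rule matpow_kernel_mono[OF zm]) simp
      from gen_eigenvector_curve[OF this] obtain w K where
        w: "w 0 = v" "0 \<le> K" "\<And>t. (w has_vector_derivative - (?A *v w t)) (at t)"
          "\<And>t. 0 \<le> t \<Longrightarrow> norm (w t) \<le> K * (1 + t ^ m) * exp (- Re z * t)" by blast
      \<comment> \<open>Here the chain length \<open>m\<close> may exceed \<open>n\<close>; the gap
        \<open>Re z - \<mu>\<close> absorbs the additional polynomial growth into the constant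
        \<open>B\<close>.\<close>
      obtain B where B: "0 \<le> B" "\<And>t. 0 \<le> t \<Longrightarrow> t ^ m * exp (- (Re z - \<mu>) * t) \<le> B"
        using power_exp_bounded[OF d] by blast
      show ?thesis
      proof (rule SI[OF w(1) _ w(3)])
        show "0 \<le> K * (1 + B)" using w(2) B(1) by simp
        fix t :: real assume t: "0 \<le> t"
        have "exp (- (Re z - \<mu>) * t) \<le> 1" using t d by (simp add: mult_nonpos_nonneg)
        then have "(1 + t ^ m) * exp (- (Re z - \<mu>) * t) \<le> 1 + B"
          using add_mono[OF _ B(2)[OF t]] by (simp only: distrib_right mult_1)
        also have "\<dots> \<le> (1 + B) * (1 + t ^ n)" using B(1) t by (simp add: mult_le_cancel_left1)
        finally have le: "(1 + t ^ m) * exp (- (Re z - \<mu>) * t) \<le> (1 + B) * (1 + t ^ n)" .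
        have "norm (w t) \<le> K * (1 + t ^ m) * exp (- Re z * t)" by (rule w(4)[OF t])
        also have "exp (- Re z * t) = exp (- (Re z - \<mu>) * t) * exp (- \<mu> * t)"
          by (simp add: exp_add[symmetric] algebra_simps)
        also have "K * (1 + t ^ m) * (exp (- (Re z - \<mu>) * t) * exp (- \<mu> * t))
          = K * exp (- \<mu> * t) * ((1 + t ^ m) * exp (- (Re z - \<mu>) * t))" by (simp add: algebra_simps)
        also have "\<dots> \<le> K * exp (- \<mu> * t) * ((1 + B) * (1 + t ^ n))"
          by (rule mult_left_mono[OF le]) (use w(2) in simp)
        finally show "norm (w t) \<le> K * (1 + B) * (1 + t ^ n) * exp (- \<mu> * t)" by (simp add: algebra_simps)
      qed
    qed
  qed
  ultimately have "v \<in> S" if "v \<in> vec.span {v. \<exists>z. gen_eigenvector ?A z v}" for v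
    using vec.span_induct[OF that] by blast
  then show ?thesis using gen_span_UNIV[of ?A] unfolding gen_span_def S_def by blast
qed

section \<open>Uniqueness for linear equations and the propagator\<close>

lemma matrix_minus_vector: "(- A) *v x = - ((A :: 'a::ring_1^'n^'m) *v x)"
  by (simp add: matrix_vector_mult_def vec_eq_iff sum_negf)

text \<open>With \<open>L\<close> an operator bound of \<open>A\<close>, the squared norm of
  \<open>y\<close> damped by \<open>exp (- 2 L s)\<close> is nonincreasing, and it starts at
  0.\<close>

lemma linear_ode_zero:
  fixes y :: "real \<Rightarrow> real^'n" and A :: "real^'n^'n"
  assumes d: "\<And>t. (y has_vector_derivative A *v y t) (at t)" and "y 0 = 0" and t: "0 \<le> t"
  shows "y t = 0"
proof -
  obtain L where L: "\<And>v. norm (A *v v) \<le> L * norm v" 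
    using linear_bounded[OF matrix_vector_mul_linear] by blast
  define g where "g s = exp (- 2 * L * s) * (y s \<bullet> y s)" for s
  have dg: "(g has_real_derivative exp (- 2 * L * s) * (2 * (y s \<bullet> (A *v y s)) - 2 * L * (y s \<bullet> y s))) (at
      s)" for s
  proof -
    have "((\<lambda>s. y s \<bullet> y s) has_real_derivative 2 * (y s \<bullet> (A *v y s))) (at s)"
      using bounded_bilinear.has_vector_derivative[OF bounded_bilinear_inner d d, of s]
      by (simp add: has_real_derivative_iff_has_vector_derivative inner_commute)
    then show ?thesis unfolding g_def
      by (auto intro!: derivative_eq_intros simp: algebra_simps)
  qed
  have "exp (- 2 * L * s) * (2 * (y s \<bullet> (A *v y s)) - 2 * L * (y s \<bullet> y s)) \<le> 0" for s
  proof -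
    have "y s \<bullet> (A *v y s) \<le> norm (y s) * norm (A *v y s)" by (rule norm_cauchy_schwarz)
    also have "\<dots> \<le> norm (y s) * (L * norm (y s))" by (intro mult_left_mono L) auto
    finally have "2 * (y s \<bullet> (A *v y s)) - 2 * L * (y s \<bullet> y s) \<le> 0"
      by (simp add: dot_square_norm power2_eq_square algebra_simps)
    then show ?thesis by (simp add: mult_le_0_iff)
  qed
  then have "g t \<le> g 0" using dg t DERIV_nonpos_imp_nonincreasing[of 0 t g] by blast
  then have "y t \<bullet> y t \<le> 0" using assms(2) by (simp add: g_def mult_le_0_iff)
  then show ?thesis using inner_ge_zero[of "y t"] by (metis antisym inner_eq_zero_iff)
qed

lemma linear_ode_zero':
  fixes y :: "real \<Rightarrow> real^'n" and A :: "real^'n^'n"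
  assumes d: "\<And>t. (y has_vector_derivative A *v y t) (at t)" and "y 0 = 0"
  shows "y t = 0"
proof (cases "0 \<le> t")
  case False
  have "((\<lambda>t. y (- t)) has_vector_derivative (- A) *v y (- t)) (at t)" for t
  proof -
    have "((y \<circ> uminus) has_vector_derivative (- 1) *\<^sub>R (A *v y (- t))) (at t)"
      by (rule vector_diff_chain_at) (auto intro!: derivative_eq_intros d)
    then show ?thesis by (simp add: o_def matrix_minus_vector)
  qed
  from linear_ode_zero[OF this, of "- t"] show ?thesis using False assms(2) by simp
qed (use linear_ode_zero[OF assms] in simp)

text \<open>The columns of \<open>E t\<close> are the real parts of the complex curves starting at
  the unit vectors, which makes the bound uniform in \<open>v\<close>. Commutation with
  \<open>C\<close> and inversion at \<open>- t\<close> are not read off from a series: in each case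
  two solutions of the same linear equation have the same initial value.\<close>

theorem propagator_exists:
  fixes C :: "real^'n^'n"
  assumes \<mu>: "\<mu> = spectral_gap C"
    and n: "n = Max (defect C ` {z\<in>eigenvalues C. Re z = \<mu>})"
  obtains E :: "real \<Rightarrow> real^'n^'n" and K where "E 0 = mat 1"
    "\<And>t v. ((\<lambda>t. E t *v v) has_vector_derivative - (C *v (E t *v v))) (at t)"
    "\<And>t v. C *v (E t *v v) = E t *v (C *v v)"
    "\<And>t v. E (- t) *v (E t *v v) = v"
    "0 \<le> K" "\<And>t v. 0 \<le> t \<Longrightarrow> norm (E t *v v) \<le> K * (1 + t ^ n) * exp (- \<mu> * t) * norm v"
proof -
  define rv where "rv w = (\<chi> i. Re (w $ i))" for w :: "complex^'n"
  have blrv: "bounded_linear rv"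
    by (subst linear_conv_bounded_linear[symmetric]) (rule linearI; simp add: rv_def vec_eq_iff)
  have nrv: "norm (rv w) \<le> norm w" for w
    unfolding norm_vec_def by (rule L2_set_mono) (auto simp: rv_def abs_Re_le_cmod)
  have rvC: "rv (complexify C *v w) = C *v rv w" for w
    by (simp add: rv_def vec_eq_iff complexify_def map_matrix_def matrix_vector_mult_def)
  define cv where "cv v = (\<chi> i. complex_of_real (v $ i))" for v :: "real^'n"
  have rvcv: "rv (cv v) = v" for v by (simp add: rv_def cv_def)
  have "\<exists>w K. w 0 = v \<and> 0 \<le> K \<and> (\<forall>t. (w has_vector_derivative - (C *v w t)) (at t)) \<and>
    (\<forall>t\<ge>0. norm (w t) \<le> K * (1 + t ^ n) * exp (- \<mu> * t))" for v
  proof -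
    obtain w K where w: "w 0 = cv v" "0 \<le> K" "\<And>t. (w has_vector_derivative - (complexify C *v w t)) (at t)"
      "\<And>t. 0 \<le> t \<Longrightarrow> norm (w t) \<le> K * (1 + t ^ n) * exp (- \<mu> * t)"
      using complex_curve_exists[OF assms, of "cv v"] by blast
    have "((\<lambda>t. rv (w t)) has_vector_derivative - (C *v rv (w t))) (at t)" for t
      using bounded_linear.has_vector_derivative[OF blrv w(3), of t]
      by (simp add: linear_neg bounded_linear.linear[OF blrv] rvC)
    moreover have "norm (rv (w t)) \<le> K * (1 + t ^ n) * exp (- \<mu> * t)" if "0 \<le> t" for t
      using order_trans[OF nrv w(4)[OF that]] .
    ultimately show ?thesis using w(1,2) rvcv
      by (intro exI[of _ "\<lambda>t. rv (w t)"] exI[of _ K]) simp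
  qed
  then obtain w K where w: "\<And>v. w v 0 = v" "\<And>v. 0 \<le> K v"
    "\<And>v t. (w v has_vector_derivative - (C *v w v t)) (at t)"
    "\<And>v t. 0 \<le> t \<Longrightarrow> norm (w v t) \<le> K v * (1 + t ^ n) * exp (- \<mu> * t)" by metis
  define E :: "real \<Rightarrow> real^'n^'n" where "E t = (\<chi> i j. w (axis j 1) t $ i)" for t
  have Ev: "E t *v v = (\<Sum>j\<in>UNIV. v $ j *\<^sub>R w (axis j 1) t)" for t v
    by (simp add: E_def matrix_vector_mult_def vec_eq_iff mult.commute)
  have E0: "E 0 = mat 1" by (simp add: E_def w(1) vec_eq_iff mat_def axis_def)
  have dE: "((\<lambda>t. E t *v v) has_vector_derivative - (C *v (E t *v v))) (at t)" for t v
    unfolding Ev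
    by (auto intro!: derivative_eq_intros w(3)
        simp: linear_sum[OF matrix_vector_mul_linear] linear_scale[OF matrix_vector_mul_linear] sum_negf)
  have com: "C *v (E t *v v) = E t *v (C *v v)" for t v
  proof -
    have "((\<lambda>t. C *v (E t *v v) - E t *v (C *v v)) has_vector_derivative
        (- C) *v (C *v (E t *v v) - E t *v (C *v v))) (at t)" for t
      using has_vector_derivative_diff[OF bounded_linear.has_vector_derivative[OF
          matrix_vector_mul_bounded_linear dE, of C v t] dE[of "C *v v" t]]
      by (simp add: matrix_vector_mult_diff_distrib matrix_minus_vector linear_neg[OF matrix_vector_mul_linear])
    from linear_ode_zero'[OF this, of t] show ?thesis by (simp add: E0)
  qed
  have inv: "E (- t) *v (E t *v v) = v" for t v
  proof -
    define y where "y s = E s *v (E t *v v) - E (s + t) *v v" for s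
    have sh: "((\<lambda>s. E (s + t) *v v) has_vector_derivative - (C *v (E (s + t) *v v))) (at s)" for s
    proof -
      have "(((\<lambda>s. E s *v v) \<circ> (\<lambda>s. s + t)) has_vector_derivative 1 *\<^sub>R (- (C *v (E (s + t) *v v)))) (at s)"
        by (rule vector_diff_chain_at) (auto intro!: derivative_eq_intros dE)
      then show ?thesis by (simp add: o_def)
    qed
    then have "(y has_vector_derivative (- C) *v y s) (at s)" for s
      unfolding y_def using has_vector_derivative_diff[OF dE[of "E t *v v" s] sh[of s]]
      by (simp add: matrix_vector_mult_diff_distrib matrix_minus_vector)
    from linear_ode_zero'[OF this, of "- t"] show ?thesis by (simp add: y_def E0)
  qed
  have bnd: "norm (E t *v v) \<le> (\<Sum>j\<in>UNIV. K (axis j 1)) * (1 + t ^ n) * exp (- \<mu> * t) * norm v"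
    if t: "0 \<le> t" for t v
  proof -
    have "norm (E t *v v) \<le> (\<Sum>j\<in>UNIV. norm (v $ j *\<^sub>R w (axis j 1) t))" unfolding Ev by (rule norm_sum)
    also have "\<dots> \<le> (\<Sum>j\<in>UNIV. norm v * (K (axis j 1) * (1 + t ^ n) * exp (- \<mu> * t)))"
      by (rule sum_mono) (use w(4)[OF t] in \<open>auto intro!: mult_mono component_le_norm_cart\<close>)
    also have "\<dots> = (\<Sum>j\<in>UNIV. K (axis j 1)) * (1 + t ^ n) * exp (- \<mu> * t) * norm v"
      by (simp add: sum_distrib_left sum_distrib_right algebra_simps)
    finally show ?thesis .
  qed
  show thesis
    by (rule that[of E "\<Sum>j\<in>UNIV. K (axis j 1)", OF E0 dE com inv _ bnd]) (auto intro!: sum_nonneg w(2))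
qed

section \<open>Test functions and weak gradients\<close>

abbreviation hdiff :: "('a::real_normed_vector \<Rightarrow> real) \<Rightarrow> nat \<Rightarrow> bool" where
  "hdiff \<equiv> higher_differentiable_on UNIV"

text \<open>Lets an explicit derivative stand in for \<open>frechet_derivative\<close>, so that the
  closure properties below follow from the usual derivative rules.\<close>

lemma hdiff_SucI:
  assumes "\<And>x. (f has_derivative f' x) (at x)" "\<And>v. hdiff (\<lambda>x. f' x v) k"
  shows "hdiff f (Suc k)"
proof -
  have "frechet_derivative f (at x) = f' x" for x
    using frechet_derivative_at[OF assms(1)] by simp
  then show ?thesis using assms by (auto simp: differentiable_def)
qed

lemma hdiff_continuous: "hdiff f k \<Longrightarrow> continuous_on UNIV f"
  by (cases k) (auto intro!: differentiable_imp_continuous_on simp: differentiable_on_eq_differentiable_at)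

lemma hdiff_mono: "hdiff f (Suc k) \<Longrightarrow> hdiff f k"
proof (induction k arbitrary: f)
  case 0
  then show ?case using hdiff_continuous by fastforce
next
  case (Suc k)
  then show ?case by (metis higher_differentiable_on.simps(2))
qed

lemma hdiff_const: "hdiff (\<lambda>x. c) k"
  by (induction k arbitrary: c) auto

lemma hdiff_linear:
  assumes "bounded_linear f" shows "hdiff f k"
proof (cases k)
  case 0
  then show ?thesis using linear_continuous_on[OF assms] by simp
next
  case (Suc j)
  show ?thesis unfolding Suc
    by (rule hdiff_SucI[OF bounded_linear_imp_has_derivative[OF assms] hdiff_const])
qed

lemma hdiff_D:
  assumes "hdiff f (Suc k)"
  obtains f' where "\<And>x. (f has_derivative f' x) (at x)" "\<And>v. hdiff (\<lambda>x. f' x v) k"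
  using assms frechet_derivative_works by (metis UNIV_I higher_differentiable_on.simps(2))

lemma hdiff_add: "hdiff f k \<Longrightarrow> hdiff g k \<Longrightarrow> hdiff (\<lambda>x. f x + g x) k"
proof (induction k arbitrary: f g)
  case 0
  then show ?case by (auto intro: continuous_on_add)
next
  case (Suc k)
  obtain f' where f': "\<And>x. (f has_derivative f' x) (at x)" "\<And>v. hdiff (\<lambda>x. f' x v) k"
    using hdiff_D[OF Suc.prems(1)] by metis
  obtain g' where g': "\<And>x. (g has_derivative g' x) (at x)" "\<And>v. hdiff (\<lambda>x. g' x v) k"
    using hdiff_D[OF Suc.prems(2)] by metis
  show ?case
    by (rule hdiff_SucI[OF has_derivative_add[OF f'(1) g'(1)]]) (rule Suc.IH[OF f'(2) g'(2)])
qed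

lemma hdiff_mult: "hdiff f k \<Longrightarrow> hdiff g k \<Longrightarrow> hdiff (\<lambda>x. f x * g x) k"
proof (induction k arbitrary: f g)
  case 0
  then show ?case by (auto intro: continuous_on_mult)
next
  case (Suc k)
  obtain f' where f': "\<And>x. (f has_derivative f' x) (at x)" "\<And>v. hdiff (\<lambda>x. f' x v) k"
    using hdiff_D[OF Suc.prems(1)] by metis
  obtain g' where g': "\<And>x. (g has_derivative g' x) (at x)" "\<And>v. hdiff (\<lambda>x. g' x v) k"
    using hdiff_D[OF Suc.prems(2)] by metis
  show ?case
    by (rule hdiff_SucI[OF has_derivative_mult[OF f'(1) g'(1)]])
      (intro hdiff_add Suc.IH f'(2) g'(2) hdiff_mono[OF Suc.prems(1)] hdiff_mono[OF Suc.prems(2)])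
qed

lemma hdiff_compose:
  fixes g :: "real \<Rightarrow> real"
  shows "hdiff g k \<Longrightarrow> hdiff f k \<Longrightarrow> hdiff (\<lambda>x. g (f x)) k"
proof (induction k arbitrary: f g)
  case 0
  then have "continuous_on UNIV (g \<circ> f)"
    by (intro continuous_on_compose) (auto intro: continuous_on_subset)
  then show ?case by (simp add: o_def)
next
  case (Suc k)
  obtain f' where f': "\<And>x. (f has_derivative f' x) (at x)" "\<And>v. hdiff (\<lambda>x. f' x v) k"
    using hdiff_D[OF Suc.prems(2)] by metis
  obtain g' where g': "\<And>x. (g has_derivative g' x) (at x)" "\<And>v. hdiff (\<lambda>x. g' x v) k"
    using hdiff_D[OF Suc.prems(1)] by metis
  have "((\<lambda>x. g (f x)) has_derivative (\<lambda>v. g' (f x) 1 * f' x v)) (at x)" for x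
  proof -
    have "((g \<circ> f) has_derivative (g' (f x) \<circ> f' x)) (at x)"
      by (rule diff_chain_at[OF f'(1) g'(1)])
    moreover have "g' (f x) r = g' (f x) 1 * r" for r
      using linear_scale[OF has_derivative_linear[OF g'(1)], of "f x" r 1]
      by (metis mult.commute mult.right_neutral real_scaleR_def)
    then have "g' (f x) \<circ> f' x = (\<lambda>v. g' (f x) 1 * f' x v)" unfolding o_def by blast
    ultimately show ?thesis by (simp add: o_def)
  qed
  then show ?case
    by (rule hdiff_SucI) (rule hdiff_mult[OF Suc.IH[OF g'(2) hdiff_mono[OF Suc.prems(2)]] f'(2)])
qed

lemma hdiff_prod: "(\<And>i. i \<in> I \<Longrightarrow> hdiff (f i) k) \<Longrightarrow> hdiff (\<lambda>x. \<Prod>i\<in>I. f i x) k"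
  by (induction I rule: infinite_finite_induct) (auto intro: hdiff_const hdiff_mult)

lemma hdiff_sum: "(\<And>i. i \<in> I \<Longrightarrow> hdiff (f i) k) \<Longrightarrow> hdiff (\<lambda>x. \<Sum>i\<in>I. f i x) k"
  by (induction I rule: infinite_finite_induct) (auto intro: hdiff_const hdiff_add)

lemma hdiff_power: "hdiff f k \<Longrightarrow> hdiff (\<lambda>x. f x ^ m) k"
  by (induction m) (auto intro: hdiff_const hdiff_mult)

lemma hdiff_minus: "hdiff f k \<Longrightarrow> hdiff (\<lambda>x. - f x) k"
  using hdiff_mult[OF hdiff_const[of "-1"]] by force

lemma hdiff_diff: "hdiff f k \<Longrightarrow> hdiff g k \<Longrightarrow> hdiff (\<lambda>x. f x - g x) k"
  using hdiff_add[OF _ hdiff_minus] by force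

lemma hdiff_exp: "hdiff (exp :: real \<Rightarrow> real) k"
proof (induction k)
  case 0
  then show ?case by (simp add: continuous_on_exp)
next
  case (Suc k)
  show ?case
    by (rule hdiff_SucI[of _ "\<lambda>x v. v * exp x"])
      (auto intro!: derivative_eq_intros hdiff_mult hdiff_const Suc simp: fun_eq_iff)
qed

text \<open>The linear span of these functions is closed under differentiation.\<close>
definition flat :: "nat \<Rightarrow> real \<Rightarrow> real" where
  "flat j s = (if 0 < s then (1 / s) ^ j * exp (- (1 / s)) else 0)"

text \<open>Only the origin needs an argument: there the difference quotient at \<open>y\<close> is
  at most \<open>fact (j + 2) * \<bar>y\<bar>\<close>, because a power of \<open>1 / y\<close> is
  dominated by a factorial times \<open>exp (1 / y)\<close>.\<close>

lemma flat_deriv: "(flat j has_real_derivative flat (j + 2) s - j * flat (j + 1) s) (at s)"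
proof -
  consider "0 < s" | "s < 0" | "s = 0" by linarith
  then show ?thesis
  proof cases
    case 1
    have "((\<lambda>s. (1 / s) ^ j * exp (- (1 / s))) has_real_derivative flat (j + 2) s - j * flat (j + 1) s) (at s)"
    proof (cases j)
      case 0
      then show ?thesis using 1 by (auto intro!: derivative_eq_intros simp: flat_def power2_eq_square)
    next
      case (Suc i)
      have "((\<lambda>s. 1 / s) has_real_derivative - (1 / s ^ 2)) (at s)"
        using 1 by (auto intro!: derivative_eq_intros simp: power2_eq_square)
      from DERIV_mult[OF DERIV_power_Suc[OF this, of i] DERIV_fun_exp[OF DERIV_minus[OF this]]]
      have "((\<lambda>s. (1 / s) ^ j * exp (- (1 / s))) has_real_derivative
        (1 + real i) * (- (1 / s\<^sup>2) * (1 / s) ^ i) * exp (- (1 / s)) + exp (- (1 / s)) * - (- (1 / s\<^sup>2)) *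
            (1 / s) ^ Suc i) (at s)"
        by (simp only: Suc)
      moreover have "(1 + real i) * (- (1 / s\<^sup>2) * (1 / s) ^ i) * exp (- (1 / s)) + exp (- (1 / s)) * - (-
          (1 / s\<^sup>2)) * (1 / s) ^ Suc i
        = flat (j + 2) s - j * flat (j + 1) s"
        using 1 by (simp add: flat_def Suc power_one_over power_add algebra_simps power2_eq_square)
      ultimately show ?thesis by metis
    qed
    then show ?thesis
      by (rule DERIV_cong_ev[THEN iffD1, rotated -1])
        (use eventually_nhds_in_open[of "{0<..}" s] 1 in \<open>auto simp: flat_def elim!: eventually_mono\<close>)
  next
    case 2
    have "((\<lambda>s. 0) has_real_derivative flat (j + 2) s - j * flat (j + 1) s) (at s)"
      using 2 by (simp add: flat_def)
    then show ?thesis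
      by (rule DERIV_cong_ev[THEN iffD1, rotated -1])
        (use eventually_nhds_in_open[of "{..<0}" s] 2 in \<open>auto simp: flat_def elim!: eventually_mono\<close>)
  next
    case 3
    have "\<bar>flat j y / y\<bar> \<le> fact (j + 2) * \<bar>y\<bar>" for y
    proof (cases "0 < y")
      case True
      have "(1 / y) ^ (j + 2) \<le> fact (j + 2) * exp (1 / y)"
        by (rule power_le_fact_exp) (use True in simp)
      then have "(1 / y) ^ (j + 2) * exp (- (1 / y)) \<le> fact (j + 2)"
        by (simp add: exp_minus divide_inverse[symmetric] pos_divide_le_eq del: fact_Suc power_Suc power_add)
      then have "(1 / y) ^ (j + 2) * exp (- (1 / y)) * y \<le> fact (j + 2) * y"
        using True by (intro mult_right_mono) auto
      moreover have "(1 / y) ^ (j + 2) * exp (- (1 / y)) * y = flat j y / y"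
        using True by (simp add: flat_def power_add power2_eq_square)
      moreover have "0 \<le> flat j y / y" using True by (simp add: flat_def)
      ultimately show ?thesis using True by simp
    next
      case False
      then have "flat j y = 0" by (simp add: flat_def)
      then show ?thesis using mult_nonneg_nonneg[of "fact (j + 2)" "\<bar>y\<bar>"] by (simp del: fact_Suc)
    qed
    note flat_bound = this
    have "((\<lambda>y. fact (j + 2) * \<bar>y :: real\<bar>) \<longlongrightarrow> fact (j + 2) * \<bar>0\<bar>) (at 0)"
      by (intro tendsto_intros)
    then have "((\<lambda>y. fact (j + 2) * \<bar>y :: real\<bar>) \<longlongrightarrow> 0) (at 0)"
      by (simp only: abs_zero mult_zero_right)
    then have "((\<lambda>y. flat j y / y) \<longlongrightarrow> 0) (at 0)"
      by (rule Lim_null_comparison[rotated]) (simp only: real_norm_def flat_bound eventually_True)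
    then show ?thesis using 3 by (simp add: DERIV_def flat_def)
  qed
qed

lemma hdiff_flat: "hdiff (flat j) k"
proof (induction k arbitrary: j)
  case 0
  have "continuous_on UNIV (flat j)"
    by (rule continuous_at_imp_continuous_on) (auto intro!: DERIV_isCont flat_deriv)
  then show ?case by simp
next
  case (Suc k)
  show ?case
  proof (rule hdiff_SucI[of _ "\<lambda>s v. v * (flat (j + 2) s - j * flat (j + 1) s)"])
    show "(flat j has_derivative (\<lambda>v. v * (flat (j + 2) s - j * flat (j + 1) s))) (at s)" for s
      using flat_deriv[of j s] by (simp add: has_field_derivative_def mult.commute[of _ "flat _ _ - _"])
  qed (intro hdiff_mult hdiff_diff hdiff_const Suc)
qed

section \<open>Smooth bumps and approximate indicators of boxes\<close>

lemma hdiff_vec_nth: "hdiff (\<lambda>x :: real^'n. x $ i) k"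
  by (rule hdiff_linear[OF bounded_linear_vec_nth])

definition box_bump :: "real^'n \<Rightarrow> real^'n \<Rightarrow> real^'n \<Rightarrow> real" where
  "box_bump a b x = (\<Prod>i\<in>UNIV. flat 0 (x $ i - a $ i) * flat 0 (b $ i - x $ i))"

lemma flat0_range: "0 \<le> flat 0 s" "flat 0 s \<le> 1" "0 < flat 0 s \<longleftrightarrow> 0 < s"
  by (auto simp: flat_def)

lemma hdiff_box_bump: "hdiff (box_bump a b) k"
  unfolding box_bump_def[abs_def]
  by (intro hdiff_prod hdiff_mult hdiff_compose[OF hdiff_flat] hdiff_diff hdiff_vec_nth hdiff_const)

lemma box_bump_range: "0 \<le> box_bump a b x" "box_bump a b x \<le> 1"
  unfolding box_bump_def
  by (auto intro!: prod_nonneg prod_le_1 mult_nonneg_nonneg mult_le_one flat0_range)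

lemma box_bump_pos_iff: "0 < box_bump a b x \<longleftrightarrow> x \<in> box a b"
proof
  assume "x \<in> box a b"
  then show "0 < box_bump a b x" unfolding box_bump_def
    by (intro prod_pos mult_pos_pos ballI) (auto simp: flat0_range mem_box_cart)
next
  assume *: "0 < box_bump a b x"
  have "0 < flat 0 (x $ i - a $ i) * flat 0 (b $ i - x $ i)" for i
  proof (rule ccontr)
    assume "\<not> ?thesis"
    then have "flat 0 (x $ i - a $ i) * flat 0 (b $ i - x $ i) = 0"
      using flat0_range(1) by (simp add: mult_eq_0_iff not_less antisym mult_le_0_iff) (metis antisym)
    then have "box_bump a b x = 0" unfolding box_bump_def by (intro prod_zero) auto
    then show False using * by simp
  qed
  then have "0 < x $ i - a $ i \<and> 0 < b $ i - x $ i" for i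
    using flat0_range by (metis less_eq_real_def mult_zero_left mult_zero_right order_less_irrefl)
  then show "x \<in> box a b" by (auto simp: mem_box_cart)
qed

lemma smooth_onI: "(\<And>k. hdiff f k) \<Longrightarrow> smooth_on UNIV f"
  by (simp add: smooth_on_def)

lemma test_functionI:
  assumes "\<And>k. hdiff f k" "\<And>x. f x \<noteq> 0 \<Longrightarrow> x \<in> S" "bounded S"
  shows "test_function f"
proof -
  have "bounded {x. f x \<noteq> 0}" using assms(2) by (intro bounded_subset[OF assms(3)]) auto
  then show ?thesis unfolding test_function_def using assms(1)
      by (auto intro!: smooth_onI simp: compact_closure)
qed

lemma test_function_mult:
  assumes "test_function f" "\<And>k. hdiff g k" shows "test_function (\<lambda>x. g x * f x)"
proof (rule test_functionI[where S = "{x. f x \<noteq> 0}"])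
  show "bounded {x. f x \<noteq> 0}" using assms(1) by (auto simp: test_function_def compact_closure)
qed (use assms in \<open>auto intro!: hdiff_mult simp: test_function_def smooth_on_def\<close>)

text \<open>The power drives \<open>1 - box_bump\<close> to 0 wherever the bump is positive and
  leaves the value 1 elsewhere. Thus test functions increase to the indicator of an open box, and no
  mollification is required.\<close>

definition box_approx :: "real^'n \<Rightarrow> real^'n \<Rightarrow> nat \<Rightarrow> real^'n \<Rightarrow> real" where
  "box_approx a b m x = 1 - (1 - box_bump a b x) ^ m"

lemma box_approx_tendsto:
  shows "test_function (box_approx a b m)" "0 \<le> box_approx a b m x" "box_approx a b m x \<le> indicator (box a b) x"
    "(\<lambda>m. box_approx a b m x) \<longlonglongrightarrow> indicator (box a b) x"
proof -
  have 0: "x \<notin> box a b \<Longrightarrow> box_bump a b x = 0" for x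
    using box_bump_pos_iff[of a b x] box_bump_range[of a b x] by linarith
  show "test_function (box_approx a b m)"
    by (rule test_functionI[where S = "box a b"])
      (use 0 in \<open>force simp: box_approx_def[abs_def] intro!: hdiff_diff hdiff_const hdiff_power
          hdiff_box_bump\<close>)+
  show "0 \<le> box_approx a b m x" "box_approx a b m x \<le> indicator (box a b) x"
    using box_bump_range[of a b x] 0[of x]
    by (auto simp: box_approx_def indicator_def intro: power_le_one)
  show "(\<lambda>m. box_approx a b m x) \<longlonglongrightarrow> indicator (box a b) x"
  proof (cases "x \<in> box a b")
    case True
    then have "norm (1 - box_bump a b x) < 1"
      using box_bump_range[of a b x] box_bump_pos_iff[of a b x] by (simp add: abs_less_iff)
    from LIMSEQ_power_zero[OF this]
    have "(\<lambda>m. 1 - (1 - box_bump a b x) ^ m) \<longlonglongrightarrow> 1 - 0" by (rule tendsto_diff[OF tendsto_const])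
    then show ?thesis using True by (simp add: box_approx_def)
  next
    case False
    then show ?thesis by (simp add: box_approx_def 0)
  qed
qed

section \<open>Translations and null functions for Lebesgue measure\<close>

lemma integrable_translate:
  fixes f :: "'a::euclidean_space \<Rightarrow> 'b::{banach, second_countable_topology}"
  assumes "integrable lborel f" shows "integrable lborel (\<lambda>x. f (x + c))"
proof -
  have "integrable (distr lborel borel ((+) c)) f" using assms by (simp add: lborel_distr_plus)
  then show ?thesis using assms by (subst (asm) integrable_distr_eq) (auto simp: add.commute)
qed

lemma integral_translate:
  fixes f :: "'a::euclidean_space \<Rightarrow> 'b::{banach, second_countable_topology}"
  assumes [measurable]: "f \<in> borel_measurable borel"
  shows "(\<integral>x. f (x + c) \<partial>lborel) = (\<integral>x. f x \<partial>lborel)"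
proof -
  have "(\<integral>x. f x \<partial>lborel) = (\<integral>x. f x \<partial>distr lborel borel ((+) c))" by (simp add: lborel_distr_plus)
  also have "\<dots> = (\<integral>x. f (c + x) \<partial>lborel)" by (rule integral_distr) auto
  finally show ?thesis by (simp add: add.commute)
qed

text \<open>Open boxes form an intersection stable generator of the Borel sets, so a vanishing
  integral extends from boxes to all Borel sets.\<close>

lemma AE_zero_if_box_integrals_zero:
  fixes g :: "'a::euclidean_space \<Rightarrow> 'b::{banach, second_countable_topology}"
  assumes g: "integrable lborel g" and box: "\<And>a b. (\<integral>x\<in>box a b. g x \<partial>lborel) = 0"
  shows "AE x in lborel. g x = 0"
proof (rule sigma_finite_measure.density_zero[OF sigma_finite_lborel g])
  have si: "set_integrable lborel A g" if "A \<in> sets borel" for A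
    unfolding set_integrable_def using g that by (intro integrable_mult_indicator) auto
  \<comment> \<open>Passing to complements requires the total integral, which is a limit of
    integrals over growing boxes.\<close>
  have tot: "(\<integral>x. g x \<partial>lborel) = 0"
  proof -
    let ?B = "\<lambda>k::nat. box (- real k *\<^sub>R (One::'a)) (real k *\<^sub>R One)"
    have "(\<lambda>k. \<integral>x. indicator (?B k) x *\<^sub>R g x \<partial>lborel) \<longlonglongrightarrow> (\<integral>x. g x \<partial>lborel)"
    proof (rule integral_dominated_convergence[where w = "\<lambda>x. norm (g x)"])
      show "AE x in lborel. (\<lambda>k. indicator (?B k) x *\<^sub>R g x) \<longlonglongrightarrow> g x"
      proof (rule AE_I2)
        fix x :: 'a
        obtain k :: nat where k: "norm x < k" using reals_Archimedean2 by blast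
        have "x \<in> ?B j" if "k \<le> j" for j
        proof -
          have "norm x < j" using k that by (meson of_nat_le_iff order_less_le_trans)
          then have "\<bar>x \<bullet> i\<bar> < j" if "i \<in> Basis" for i using Basis_le_norm[OF that, of x] by linarith
          then show ?thesis by (auto simp: mem_box abs_less_iff minus_less_iff)
        qed
        then have "eventually (\<lambda>j. indicator (?B j) x *\<^sub>R g x = g x) sequentially"
          by (auto simp: eventually_sequentially intro!: exI[of _ k])
        then show "(\<lambda>k. indicator (?B k) x *\<^sub>R g x) \<longlonglongrightarrow> g x" by (rule tendsto_eventually)
      qed
    qed (use g in \<open>auto simp: indicator_def split: if_splits\<close>)
    moreover have "(\<integral>x. indicator (?B k) x *\<^sub>R g x \<partial>lborel) = 0" for k
      using box by (simp add: set_lebesgue_integral_def)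
    ultimately show ?thesis by (simp add: LIMSEQ_const_iff)
  qed
  fix A :: "'a set" assume "A \<in> sets lborel"
  then have A: "A \<in> sigma_sets UNIV (range (\<lambda>(a, b). box a b))" by (simp add: borel_eq_box)
  have "Int_stable (range (\<lambda>(a, b). box a b :: 'a set))"
    by (auto simp: Int_stable_def box_Int_box)
  moreover have "range (\<lambda>(a, b). box a b :: 'a set) \<subseteq> Pow UNIV" by auto
  moreover note A
  ultimately show "(\<integral>x\<in>A. g x \<partial>lborel) = 0"
  proof (induction A rule: sigma_sets_induct_disjoint)
    case (compl A)
    then have A: "A \<in> sets borel" by (simp add: borel_eq_box)
    have "(\<integral>x\<in>UNIV. g x \<partial>lborel) = (\<integral>x\<in>A. g x \<partial>lborel) + (\<integral>x\<in>UNIV - A. g x \<partial>lborel)"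
      using set_integral_Un[of A "UNIV - A" lborel g] si A by auto
    then show ?case using compl tot by (simp add: set_lebesgue_integral_def)
  next
    case (union A)
    then have A: "A i \<in> sets borel" for i by (auto simp: borel_eq_box)
    have "(\<integral>x\<in>(\<Union>i. A i). g x \<partial>lborel) = (\<Sum>i. \<integral>x\<in>A i. g x \<partial>lborel)"
      by (rule lebesgue_integral_countable_add) (use A union(1) si in \<open>auto simp: disjoint_family_on_def\<close>)
    then show ?case using union by simp
  qed (use box in \<open>auto simp: set_lebesgue_integral_def\<close>)
qed

text \<open>The property passes to sums and to dominated limits, so indicators of Borel sets
  suffice, and these are approximated from outside by open sets.\<close>

lemma L1_translation_continuous:
  fixes g :: "'a::euclidean_space \<Rightarrow> 'b::{banach, second_countable_topology}"
  assumes "integrable lborel g" and r: "r \<longlonglongrightarrow> 0"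
  shows "(\<lambda>n. \<integral>x. norm (g (x + r n) - g x) \<partial>lborel) \<longlonglongrightarrow> 0"
  using assms(1)
proof (induction rule: integrable_induct)
  case (base A c)
  have A[measurable]: "A \<in> sets borel" and fA: "emeasure lborel A < \<infinity>" using base by auto
  \<comment> \<open>For an open set only the loss
    \<open>indicator U x - indicator U (x + r n)\<close>, cut off at 0, tends to 0 at every point,
    and it is dominated by the indicator of \<open>U\<close>. As a translation preserves the
    measure, gain and loss have equal integrals; hence the factor 2.\<close>
  have opn: "(\<lambda>n. \<integral>x. norm (indicator U (x + r n) - indicator U x :: real) \<partial>lborel) \<longlonglongrightarrow> 0"
    if U: "open U" "emeasure lborel U < \<infinity>" for U :: "'a set"
  proof -
    have [measurable]: "U \<in> sets borel" using U by simp
    have iU: "integrable lborel (indicator U :: 'a \<Rightarrow> real)" using U by (simp add: integrable_indicator_iff)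
    have iUr: "integrable lborel (\<lambda>x. indicator U (x + c) :: real)" for c by (rule integrable_translate[OF iU])
    have "(\<lambda>n. \<integral>x. max 0 (indicator U x - indicator U (x + r n) :: real) \<partial>lborel)
        \<longlonglongrightarrow> (\<integral>x. 0 \<partial>(lborel :: 'a measure))"
    proof (rule integral_dominated_convergence[where w = "indicator U"])
      show "AE x in lborel. (\<lambda>n. max 0 (indicator U x - indicator U (x + r n)) :: real) \<longlonglongrightarrow> 0"
      proof (rule AE_I2)
        fix x
        show "(\<lambda>n. max 0 (indicator U x - indicator U (x + r n)) :: real) \<longlonglongrightarrow> 0"
        proof (cases "x \<in> U")
          case True
          have "(\<lambda>n. x + r n) \<longlonglongrightarrow> x + 0" by (intro tendsto_intros r)
          then have "eventually (\<lambda>n. x + r n \<in> U) sequentially"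
            using U(1) True by (auto dest: topological_tendstoD)
          then have "eventually (\<lambda>n. max 0 (indicator U x - indicator U (x + r n)) = (0::real)) sequentially"
            by eventually_elim (simp add: True)
          then show ?thesis by (rule tendsto_eventually)
        qed (simp add: indicator_def)
      qed
    qed (use iU in \<open>auto simp: indicator_def\<close>)
    then have "(\<lambda>n. 2 * (\<integral>x. max 0 (indicator U x - indicator U (x + r n) :: real) \<partial>lborel)) \<longlonglongrightarrow> 2 * 0"
      by (intro tendsto_intros) simp
    moreover have "2 * (\<integral>x. max 0 (indicator U x - indicator U (x + c) :: real) \<partial>lborel)
        = (\<integral>x. norm (indicator U (x + c) - indicator U x :: real) \<partial>lborel)" for c
    proof -
      have "norm (indicator U (x + c) - indicator U x :: real)
          = 2 * max 0 (indicator U x - indicator U (x + c)) - (indicator U x - indicator U (x + c))" for x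
        by (auto simp: indicator_def)
      moreover have "(\<integral>x. (indicator U x - indicator U (x + c) :: real) \<partial>lborel) = 0"
        using iU iUr integral_translate[of "indicator U :: 'a \<Rightarrow> real" c] by simp
      moreover have "integrable lborel (\<lambda>x. max 0 (indicator U x - indicator U (x + c)) :: real)"
        using iU iUr[of c] by auto
      ultimately show ?thesis using iU iUr[of c] by simp
    qed
    ultimately show ?thesis by simp
  qed
  show ?case
  proof (rule LIMSEQ_I)
    fix e :: real assume e: "0 < e"
    \<comment> \<open>The summand 1 keeps \<open>m\<close> positive when \<open>c = 0\<close>. Three
      errors of size \<open>d\<close> then add up to at most \<open>3 / 4 * e\<close>.\<close>
    define m where "m = 1 + norm c"
    have m: "0 < m" "norm c \<le> m" by (simp_all add: m_def add_pos_nonneg)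
    define d where "d = e / (4 * m)"
    have d: "0 < d" using e m by (simp add: d_def)
    obtain U where U: "open U" "A \<subseteq> U" "emeasure lborel (U - A) < d"
      using outer_regular_lborel[OF A d] by blast
    have [measurable]: "U \<in> sets borel" using U by simp
    have "emeasure lborel U \<le> emeasure lborel A + emeasure lborel (U - A)"
      using U(2) emeasure_subadditive[of A lborel "U - A"] by (simp add: Un_absorb1)
    also have "\<dots> < \<infinity>" using fA U(3) by (auto simp: less_top[symmetric] ennreal_add_eq_top)
    finally have fU: "emeasure lborel U < \<infinity>" .
    have "emeasure lborel (U - A) \<noteq> top" using U(3) by auto
    from emeasure_eq_ennreal_measure[OF this] have mUA: "measure lborel (U - A) < d"
      using U(3) d by (simp add: ennreal_less_iff)
    have iA: "integrable lborel (indicator A :: 'a \<Rightarrow> real)" "integrable lborel (indicator U :: 'a \<Rightarrow> real)"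
      "integrable lborel (indicator (U - A) :: 'a \<Rightarrow> real)"
      using fA fU U(3) by (auto simp: integrable_indicator_iff less_top[symmetric])
    obtain N where N: "\<And>n. N \<le> n \<Longrightarrow> norm ((\<integral>x. norm (indicator U (x + r n) - indicator U x :: real) \<partial>lborel)
        - 0) < d"
      using LIMSEQ_D[OF opn[OF U(1) fU] d] by blast
    have "norm ((\<integral>x. norm (indicator A (x + r n) *\<^sub>R c - indicator A x *\<^sub>R c) \<partial>lborel) - 0) < e" if "N \<le> n"
        for n
    proof -
      have pt: "norm (indicator A (x + r n) *\<^sub>R c - indicator A x *\<^sub>R c) \<le>
        (norm (indicator U (x + r n) - indicator U x :: real) + indicator (U - A) (x + r n) + indicator (U -
            A) x) * norm c" for x
        using U(2) by (auto simp: indicator_def)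
      have "(\<integral>x. norm (indicator A (x + r n) *\<^sub>R c - indicator A x *\<^sub>R c) \<partial>lborel)
        \<le> (\<integral>x. (norm (indicator U (x + r n) - indicator U x :: real) + indicator (U - A) (x + r n) +
            indicator (U - A) x) * norm c \<partial>lborel)"
        by (rule integral_mono) (use pt iA integrable_translate[OF iA(1)] integrable_translate[OF iA(2)]
            integrable_translate[OF iA(3)] in auto)
      also have "\<dots> = ((\<integral>x. norm (indicator U (x + r n) - indicator U x :: real) \<partial>lborel) + measure lborel (U
          - A) + measure lborel (U - A)) * norm c"
        using iA integrable_translate[OF iA(2)] integrable_translate[OF iA(3)]
          integral_translate[of "indicator (U - A) :: 'a \<Rightarrow> real" "r n"] by simp
      also have "\<dots> \<le> (d + d + d) * norm c"
        using N[OF that] mUA by (intro mult_right_mono) auto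
      also have "\<dots> < e"
      proof -
        have "3 * d * norm c \<le> 3 * d * m" using d m by simp
        also have "\<dots> = 3 / 4 * e" using m by (simp add: d_def)
        also have "\<dots> < e" using e by simp
        finally show ?thesis by simp
      qed
      finally show ?thesis by simp
    qed
    then show "\<exists>N. \<forall>n\<ge>N. norm ((\<integral>x. norm (indicator A (x + r n) *\<^sub>R c - indicator A x *\<^sub>R c) \<partial>lborel) - 0) < e"
      by blast
  qed
next
  case (add f g)
  show ?case
  proof (rule Lim_null_comparison[OF _ tendsto_add_zero[OF add.IH]])
    have "norm (\<integral>x. norm (f (x + r n) + g (x + r n) - (f x + g x)) \<partial>lborel)
      \<le> (\<integral>x. norm (f (x + r n) - f x) \<partial>lborel) + (\<integral>x. norm (g (x + r n) - g x) \<partial>lborel)" for n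
    proof -
      note i = add.hyps integrable_translate[OF add.hyps(1), of "r n"] integrable_translate[OF add.hyps(2),
          of "r n"]
      have "(\<integral>x. norm (f (x + r n) + g (x + r n) - (f x + g x)) \<partial>lborel)
        \<le> (\<integral>x. norm (f (x + r n) - f x) + norm (g (x + r n) - g x) \<partial>lborel)"
        by (rule integral_mono) (use i norm_diff_triangle_ineq in auto)
      then show ?thesis using i by simp
    qed
    then show "\<forall>\<^sub>F n in sequentially. norm (\<integral>x. norm (f (x + r n) + g (x + r n) - (f x + g x)) \<partial>lborel)
      \<le> (\<integral>x. norm (f (x + r n) - f x) \<partial>lborel) + (\<integral>x. norm (g (x + r n) - g x) \<partial>lborel)" by simp
  qed
next
  case (lim f s)
  have L: "(\<lambda>i. \<integral>x. norm (s i x - f x) \<partial>lborel) \<longlonglongrightarrow> (\<integral>x. 0 \<partial>(lborel :: 'a measure))"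
  proof (rule integral_dominated_convergence[where w = "\<lambda>x. 3 * norm (f x)"])
    show "AE x in lborel. (\<lambda>i. norm (s i x - f x)) \<longlonglongrightarrow> 0"
      using lim.hyps(2) by (auto simp: tendsto_norm_zero_iff LIM_zero)
    show "AE x in lborel. norm (norm (s i x - f x)) \<le> 3 * norm (f x)" for i
    proof (rule AE_I2)
      fix x show "norm (norm (s i x - f x)) \<le> 3 * norm (f x)"
        using lim.hyps(3)[of x i] norm_triangle_ineq4[of "s i x" "f x"] by simp
    qed
  qed (use lim.hyps in auto)
  show ?case
  proof (rule LIMSEQ_I)
    fix e :: real assume e: "0 < e"
    obtain i where i: "(\<integral>x. norm (s i x - f x) \<partial>lborel) < e / 3"
      using LIMSEQ_D[OF L, of "e / 3"] e by force
    obtain N where N: "\<And>n. N \<le> n \<Longrightarrow> (\<integral>x. norm (s i (x + r n) - s i x) \<partial>lborel) < e / 3"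
      using LIMSEQ_D[OF lim.IH[of i], of "e / 3"] e by force
    have "(\<integral>x. norm (f (x + r n) - f x) \<partial>lborel) < e" if "N \<le> n" for n
    proof -
      have si: "integrable lborel (\<lambda>x. norm (s i x - f x))" using lim.hyps by auto
      note ii = lim.hyps(1)[of i] lim.hyps(4) integrable_translate[OF lim.hyps(1)[of i], of "r n"]
          integrable_translate[OF lim.hyps(4), of "r n"]
        integrable_translate[OF si, of "r n"] si
      have "(\<integral>x. norm (f (x + r n) - f x) \<partial>lborel)
        \<le> (\<integral>x. norm (s i (x + r n) - f (x + r n)) + norm (s i (x + r n) - s i x) + norm (s i x - f x) \<partial>lborel)"
      proof (rule integral_mono)
        fix x
        have "f (x + r n) - f x = - (s i (x + r n) - f (x + r n)) + (s i (x + r n) - s i x) + (s i x - f x)"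
            by simp
        then have "norm (f (x + r n) - f x) = norm (- (s i (x + r n) - f (x + r n)) + (s i (x + r n) - s i
            x) + (s i x - f x))"
          by presburger
        then show "norm (f (x + r n) - f x) \<le> norm (s i (x + r n) - f (x + r n)) + norm (s i (x + r n) - s i
            x) + norm (s i x - f x)"
          using norm_triangle_ineq[of "- (s i (x + r n) - f (x + r n)) + (s i (x + r n) - s i x)" "s i x - f x"]
            norm_triangle_ineq[of "- (s i (x + r n) - f (x + r n))" "s i (x + r n) - s i x"]
            norm_minus_cancel[of "s i (x + r n) - f (x + r n)"] by linarith
      qed (use ii in auto)
      also have "\<dots> = (\<integral>x. norm (s i (x + r n) - f (x + r n)) \<partial>lborel) + (\<integral>x. norm (s i (x + r n) - s i x)
          \<partial>lborel) + (\<integral>x. norm (s i x - f x) \<partial>lborel)"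
        using ii by simp
      also have "(\<integral>x. norm (s i (x + r n) - f (x + r n)) \<partial>lborel) = (\<integral>x. norm (s i x - f x) \<partial>lborel)"
        using integral_translate[of "\<lambda>x. norm (s i x - f x)" "r n"] si by auto
      finally show ?thesis using i N[OF that] by simp
    qed
    then show "\<exists>N. \<forall>n\<ge>N. norm ((\<integral>x. norm (f (x + r n) - f x) \<partial>lborel) - 0) < e"
      by (auto intro!: exI[of _ N])
  qed
qed

section \<open>The fundamental lemma and uniqueness of weak gradients\<close>

lemma test_function_hdiff: "test_function \<phi> \<Longrightarrow> hdiff \<phi> k"
  by (simp add: test_function_def smooth_on_def)

lemma test_function_has_derivative:
  "test_function \<phi> \<Longrightarrow> (\<phi> has_derivative frechet_derivative \<phi> (at x)) (at x)"
  using test_function_hdiff[of \<phi> 1] frechet_derivative_works by auto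

lemma test_function_continuous: "test_function \<phi> \<Longrightarrow> continuous_on UNIV \<phi>"
  using test_function_hdiff[of \<phi> 0] by simp

lemma test_function_deriv:
  assumes "test_function \<phi>" shows "test_function (\<lambda>x. frechet_derivative \<phi> (at x) v)"
proof (rule test_functionI[where S = "closure {x. \<phi> x \<noteq> 0}"])
  show "hdiff (\<lambda>x. frechet_derivative \<phi> (at x) v) k" for k
    using test_function_hdiff[OF assms, of "Suc k"] by simp
  show "bounded (closure {x. \<phi> x \<noteq> 0})"
    using assms by (auto simp: test_function_def compact_imp_bounded)
  fix x assume nz: "frechet_derivative \<phi> (at x) v \<noteq> 0"
  show "x \<in> closure {x. \<phi> x \<noteq> 0}"
  proof (rule ccontr)
    assume x: "x \<notin> closure {x. \<phi> x \<noteq> 0}"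
    have "(\<phi> has_derivative (\<lambda>v. 0)) (at x)"
    proof (rule has_derivative_transform_within_open[of "\<lambda>x. 0" _ x UNIV "- closure {x. \<phi> x \<noteq> 0}"])
      show "\<And>y. y \<in> - closure {x. \<phi> x \<noteq> 0} \<Longrightarrow> 0 = \<phi> y"
        using closure_subset[of "{x. \<phi> x \<noteq> 0}"] by auto
    qed (use x in auto)
    then have "frechet_derivative \<phi> (at x) = (\<lambda>v. 0)" using frechet_derivative_at by metis
    then show False using nz by simp
  qed
qed

lemma grad_inner:
  assumes "\<phi> differentiable (at x)"
  shows "frechet_derivative \<phi> (at x) v = grad \<phi> x \<bullet> v"
proof -
  have l: "linear (frechet_derivative \<phi> (at x))" using assms by (rule linear_frechet_derivative)
  have "frechet_derivative \<phi> (at x) v = frechet_derivative \<phi> (at x) (\<Sum>i\<in>UNIV. v $ i *\<^sub>R axis i 1)"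
    by (simp add: basis_expansion scalar_mult_eq_scaleR[symmetric])
  also have "\<dots> = (\<Sum>i\<in>UNIV. v $ i * frechet_derivative \<phi> (at x) (axis i 1))"
    by (simp add: linear_sum[OF l] linear_scale[OF l])
  also have "\<dots> = grad \<phi> x \<bullet> v"
    by (simp add: grad_def inner_vec_def mult.commute)
  finally show ?thesis .
qed

lemma test_function_grad_inner:
  "test_function \<phi> \<Longrightarrow> frechet_derivative \<phi> (at x) v = grad \<phi> x \<bullet> v"
  by (rule grad_inner) (metis test_function_has_derivative differentiable_def)

lemma test_function_bounded:
  assumes "test_function \<phi>"
  obtains B S where "0 \<le> B" "compact S" "\<And>x. \<bar>\<phi> x\<bar> \<le> B * indicator S x"
proof -
  let ?S = "closure {x. \<phi> x \<noteq> 0}"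
  have S: "compact ?S" using assms by (simp add: test_function_def)
  have "compact (\<phi> ` ?S)"
    by (intro compact_continuous_image S continuous_on_subset[OF test_function_continuous[OF assms]]) simp
  then obtain B where B: "\<And>x. x \<in> ?S \<Longrightarrow> \<bar>\<phi> x\<bar> \<le> B"
    using compact_imp_bounded bounded_iff by (metis imageI real_norm_def)
  show thesis
  proof (rule that[of "max 0 B" ?S])
    show "\<bar>\<phi> x\<bar> \<le> max 0 B * indicator ?S x" for x
      using B[of x] closure_subset[of "{x. \<phi> x \<noteq> 0}"] by (auto simp: indicator_def max_def)
  qed (use S in auto)
qed

lemma test_function_measurable:
  "test_function \<phi> \<Longrightarrow> \<phi> \<in> borel_measurable borel"
  by (intro borel_measurable_continuous_onI test_function_continuous)

lemma locally_integrable_measurable: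
  fixes G :: "real^'n \<Rightarrow> 'b::{banach, second_countable_topology}"
  assumes "locally_integrable G" shows "G \<in> borel_measurable borel"
proof (rule borel_measurable_LIMSEQ_metric)
  show "(\<lambda>x. indicator (cball 0 (real k)) x *\<^sub>R G x) \<in> borel_measurable borel" for k :: nat
  proof -
    have "integrable lborel (\<lambda>x. indicator (cball 0 (real k)) x *\<^sub>R G x)"
      using assms unfolding locally_integrable_def set_integrable_def by simp
    from borel_measurable_integrable[OF this] show ?thesis by simp
  qed
  fix x :: "real^'n"
  obtain k :: nat where "norm x < k" using reals_Archimedean2 by blast
  then have "eventually (\<lambda>j. indicator (cball 0 (real j)) x *\<^sub>R G x = G x) sequentially"
    unfolding eventually_sequentially by (intro exI[of _ k]) auto
  then show "(\<lambda>j. indicator (cball 0 (real j)) x *\<^sub>R G x) \<longlonglongrightarrow> G x" by (rule tendsto_eventually)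
qed

lemma test_function_mult_integrable:
  fixes G :: "real^'n \<Rightarrow> 'b::{banach, second_countable_topology}"
  assumes "test_function \<phi>" "locally_integrable G"
  shows "integrable lborel (\<lambda>x. \<phi> x *\<^sub>R G x)"
proof -
  obtain B S where B: "0 \<le> B" "compact S" "\<And>x. \<bar>\<phi> x\<bar> \<le> B * indicator S x"
    using test_function_bounded[OF assms(1)] by blast
  have "integrable lborel (\<lambda>x. B *\<^sub>R (indicator S x *\<^sub>R G x))"
    by (rule integrable_scaleR_right)
      (use assms(2) B(2) in \<open>simp add: locally_integrable_def set_integrable_def\<close>)
  then show ?thesis
  proof (rule Bochner_Integration.integrable_bound)
    show "(\<lambda>x. \<phi> x *\<^sub>R G x) \<in> borel_measurable lborel"
      using test_function_measurable[OF assms(1)] locally_integrable_measurable[OF assms(2)] by simp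
    show "AE x in lborel. norm (\<phi> x *\<^sub>R G x) \<le> norm (B *\<^sub>R (indicator S x *\<^sub>R G x))"
      using B(1,3) by (intro AE_I2) (auto simp: mult.assoc[symmetric] intro!: mult_right_mono)
  qed
qed

text \<open>The functions \<open>box_approx\<close> carry the hypothesis over to indicators of boxes
  by dominated convergence. Since \<open>G\<close> is only locally integrable, it is first
  restricted to one large box at a time.\<close>

lemma fundamental_lemma:
  fixes G :: "real^'n \<Rightarrow> 'b::{banach, second_countable_topology}"
  assumes G: "locally_integrable G" and z: "\<And>\<phi>. test_function \<phi> \<Longrightarrow> (\<integral>x. \<phi> x *\<^sub>R G x \<partial>lborel) = 0"
  shows "AE x in lborel. G x = 0"
proof -
  note [measurable] = locally_integrable_measurable[OF G]
  have bz: "(\<integral>x. indicator (box a b) x *\<^sub>R G x \<partial>lborel) = 0" for a b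
  proof -
    have "(\<lambda>m. \<integral>x. box_approx a b m x *\<^sub>R G x \<partial>lborel) \<longlonglongrightarrow> (\<integral>x. indicator (box a b) x *\<^sub>R G x \<partial>lborel)"
    proof (rule integral_dominated_convergence[where w = "\<lambda>x. norm (indicator (cbox a b) x *\<^sub>R G x)"])
      show "integrable lborel (\<lambda>x. norm (indicator (cbox a b) x *\<^sub>R G x))"
        using G unfolding locally_integrable_def set_integrable_def by (metis compact_cbox integrable_norm)
      show "AE x in lborel. (\<lambda>m. box_approx a b m x *\<^sub>R G x) \<longlonglongrightarrow> indicator (box a b) x *\<^sub>R G x"
        by (intro AE_I2 tendsto_intros box_approx_tendsto(4))
      show "AE x in lborel. norm (box_approx a b m x *\<^sub>R G x) \<le> norm (indicator (cbox a b) x *\<^sub>R G x)" for m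
      proof (rule AE_I2)
        fix x
        have "\<bar>box_approx a b m x\<bar> \<le> \<bar>indicator (cbox a b) x\<bar>"
          using box_approx_tendsto(2,3)[of a b m x] box_subset_cbox[of a b]
              by (cases "x \<in> box a b") (auto simp: indicator_def)
        then show "norm (box_approx a b m x *\<^sub>R G x) \<le> norm (indicator (cbox a b) x *\<^sub>R G x)"
          by (simp add: mult_right_mono)
      qed
      show "(\<lambda>x. box_approx a b m x *\<^sub>R G x) \<in> borel_measurable lborel" for m
        using test_function_measurable[OF box_approx_tendsto(1)[of a b m]] by simp
    qed simp
    moreover have "(\<integral>x. box_approx a b m x *\<^sub>R G x \<partial>lborel) = 0" for m
      by (rule z[OF box_approx_tendsto(1)])
    ultimately show ?thesis by (simp add: LIMSEQ_const_iff)
  qed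
  let ?B = "\<lambda>k::nat. box (- real k *\<^sub>R (One::real^'n)) (real k *\<^sub>R One)"
  have "AE x in lborel. indicator (?B k) x *\<^sub>R G x = 0" for k
  proof (rule AE_zero_if_box_integrals_zero)
    have "integrable lborel (\<lambda>x. indicator (?B k) x *\<^sub>R (indicator (cbox (- real k *\<^sub>R (One::real^'n)) (real
        k *\<^sub>R One)) x *\<^sub>R G x))"
      by (rule integrable_mult_indicator)
        (use G compact_cbox in \<open>auto simp: locally_integrable_def set_integrable_def\<close>)
    then show "integrable lborel (\<lambda>x. indicator (?B k) x *\<^sub>R G x)"
      by (rule Bochner_Integration.integrable_bound) (use box_subset_cbox in \<open>auto simp: indicator_def\<close>)
    show "(\<integral>x\<in>box a b. indicator (?B k) x *\<^sub>R G x \<partial>lborel) = 0" for a b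
    proof -
      obtain c d where "box a b \<inter> ?B k = box c d" using box_Int_box by blast
      then have "indicator (box a b) x *\<^sub>R indicator (?B k) x *\<^sub>R G x = indicator (box c d) x *\<^sub>R G x" for x
        by (simp add: indicator_inter_arith[symmetric])
      then show ?thesis using bz unfolding set_lebesgue_integral_def by presburger
    qed
  qed
  then have "AE x in lborel. \<forall>k. indicator (?B k) x *\<^sub>R G x = 0" unfolding AE_all_countable by blast
  then show ?thesis
  proof eventually_elim
    case (elim x)
    obtain k :: nat where k: "norm x < k" using reals_Archimedean2 by blast
    have "\<bar>x \<bullet> i\<bar> < k" if "i \<in> Basis" for i using Basis_le_norm[OF that, of x] k by linarith
    then have "x \<in> ?B k" by (auto simp: mem_box abs_less_iff minus_less_iff)
    then show ?case using elim by (metis indicator_simps(1) scaleR_one)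
  qed
qed

lemma locally_integrable_diff:
  "locally_integrable f \<Longrightarrow> locally_integrable g \<Longrightarrow> locally_integrable (\<lambda>x. f x - g x)"
  unfolding locally_integrable_def by auto

lemma weak_grad_unique:
  assumes "is_weak_grad h G" "is_weak_grad h' G'" "AE x in lborel. h x = h' x"
  shows "AE x in lborel. G x = G' x"
proof -
  have li: "locally_integrable G" "locally_integrable G'" "locally_integrable h" "locally_integrable h'"
    using assms by (auto simp: is_weak_grad_def)
  note [measurable] = locally_integrable_measurable[OF li(3)] locally_integrable_measurable[OF li(4)]
  have "AE x in lborel. G x - G' x = 0"
  proof (rule fundamental_lemma)
    show "locally_integrable (\<lambda>x. G x - G' x)" using li by (intro locally_integrable_diff)
    fix \<phi> :: "real^'a \<Rightarrow> real" assume \<phi>: "test_function \<phi>"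
    have gm: "grad \<phi> \<in> borel_measurable borel"
      unfolding grad_def[abs_def] 
      by (subst borel_measurable_euclidean_space) (auto simp: Basis_vec_def inner_axis
        intro!: test_function_measurable test_function_deriv \<phi>)
    have "(\<integral>x. h x *\<^sub>R grad \<phi> x \<partial>lborel) = (\<integral>x. h' x *\<^sub>R grad \<phi> x \<partial>lborel)"
      by (rule integral_cong_AE) (use assms(3) gm in auto)
    then have "(\<integral>x. \<phi> x *\<^sub>R G x \<partial>lborel) = (\<integral>x. \<phi> x *\<^sub>R G' x \<partial>lborel)"
      using assms(1,2) \<phi> unfolding is_weak_grad_def by force
    then show "(\<integral>x. \<phi> x *\<^sub>R (G x - G' x) \<partial>lborel) = 0"
      using test_function_mult_integrable[OF \<phi> li(1)] test_function_mult_integrable[OF \<phi> li(2)]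
      by (simp add: scaleR_diff_right)
  qed
  then show ?thesis by simp
qed

lemma weak_grad_inner:
  assumes "is_weak_grad h G" "test_function \<phi>"
  shows "(\<integral>x. h x * frechet_derivative \<phi> (at x) v \<partial>lborel) = - (\<integral>x. \<phi> x * (G x \<bullet> v) \<partial>lborel)"
proof -
  have li: "locally_integrable G" "locally_integrable h" using assms by (auto simp: is_weak_grad_def)
  have "integrable lborel (\<lambda>x. h x *\<^sub>R grad \<phi> x)"
  proof -
    have "integrable lborel (\<lambda>x. \<Sum>i\<in>UNIV. (frechet_derivative \<phi> (at x) (axis i 1) *\<^sub>R h x) *\<^sub>R (axis i 1 ::
        real^'a))"
      by (intro Bochner_Integration.integrable_sum integrable_scaleR_left
        test_function_mult_integrable test_function_deriv assms li)
    moreover have "h x *\<^sub>R grad \<phi> x = (\<Sum>i\<in>UNIV. (frechet_derivative \<phi> (at x) (axis i 1) *\<^sub>R h x) *\<^sub>R (axis i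
        1 :: real^'a))" for x
      by (simp add: vec_eq_iff grad_def axis_def if_distrib sum.delta cong: if_cong)
    ultimately show ?thesis by simp
  qed
  then have "(\<integral>x. (h x *\<^sub>R grad \<phi> x) \<bullet> v \<partial>lborel) = (\<integral>x. h x *\<^sub>R grad \<phi> x \<partial>lborel) \<bullet> v"
    by (rule integral_inner_left)
  also have "\<dots> = - ((\<integral>x. \<phi> x *\<^sub>R G x \<partial>lborel) \<bullet> v)"
    using assms by (simp add: is_weak_grad_def)
  also have "(\<integral>x. \<phi> x *\<^sub>R G x \<partial>lborel) \<bullet> v = (\<integral>x. (\<phi> x *\<^sub>R G x) \<bullet> v \<partial>lborel)"
    by (rule integral_inner_left[symmetric]) (rule test_function_mult_integrable[OF assms(2) li(1)])
  finally show ?thesis by (simp add: test_function_grad_inner[OF assms(2)])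
qed

lemma test_function_translate:
  assumes "test_function \<phi>"
  shows "test_function (\<lambda>x. \<phi> (x + w))" "frechet_derivative (\<lambda>x. \<phi> (x + w)) (at x)
      = frechet_derivative \<phi> (at (x + w))"
proof -
  have d: "((\<lambda>x. \<psi> (x + w)) has_derivative frechet_derivative \<psi> (at (x + w))) (at x)"
    if "test_function \<psi>" for \<psi> :: "real^'a \<Rightarrow> real" and x
  proof -
    have "((\<psi> \<circ> (\<lambda>x. x + w)) has_derivative (frechet_derivative \<psi> (at (x + w)) \<circ> (\<lambda>v. v))) (at x)"
      by (rule diff_chain_at) (auto intro!: derivative_eq_intros test_function_has_derivative that)
    then show ?thesis by (simp add: o_def)
  qed
  show "frechet_derivative (\<lambda>x. \<phi> (x + w)) (at x) = frechet_derivative \<phi> (at (x + w))"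
    by (rule frechet_derivative_at[symmetric, OF d[OF assms]])
  have h: "hdiff (\<lambda>x. \<psi> (x + w)) k" if "test_function \<psi>" for \<psi> :: "real^'a \<Rightarrow> real" and k
    using that
  proof (induction k arbitrary: \<psi>)
    case 0
    have "continuous_on UNIV (\<psi> \<circ> (\<lambda>x. x + w))"
      by (rule continuous_on_compose) (auto intro!: continuous_intros continuous_on_subset[OF
          test_function_continuous[OF 0]])
    then show ?case by (simp add: o_def)
  next
    case (Suc k)
    show ?case by (rule hdiff_SucI[OF d[OF Suc.prems]]) (rule Suc.IH[OF test_function_deriv[OF Suc.prems]])
  qed
  obtain B S where B: "0 \<le> B" "compact S" "\<And>x. \<bar>\<phi> x\<bar> \<le> B * indicator S x"
    using test_function_bounded[OF assms] by blast
  show "test_function (\<lambda>x. \<phi> (x + w))"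
  proof (rule test_functionI[where S = "(\<lambda>x. x - w) ` S"])
    show "bounded ((\<lambda>x. x - w) ` S)"
      using bounded_translation_minus[of S w] B(2) compact_imp_bounded by blast
    fix x assume "\<phi> (x + w) \<noteq> 0"
    then have "x + w \<in> S" using B(3)[of "x + w"] by (cases "x + w \<in> S") auto
    then show "x \<in> (\<lambda>x. x - w) ` S" by (intro image_eqI[of _ _ "x + w"]) auto
  qed (rule h[OF assms])
qed

section \<open>Weak derivatives on the zero set\<close>

lemma segment_integrable:
  fixes f :: "real^'n \<Rightarrow> real"
  assumes f: "integrable lborel f"
  shows "integrable (lborel \<Otimes>\<^sub>M lborel) (\<lambda>(u::real, x). indicator {0..1} u * f (x + (s * u) *\<^sub>R v))"
proof (rule lborel_pair.Fubini_integrable)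
  have [measurable]: "f \<in> borel_measurable borel" using f by auto
  show "(\<lambda>(u::real, x). indicator {0..1} u * f (x + (s * u) *\<^sub>R v)) \<in> borel_measurable (lborel \<Otimes>\<^sub>M lborel)"
    by measurable
  have "(\<integral>x. norm (indicator {0..1} u * f (x + (s * u) *\<^sub>R v)) \<partial>lborel)
      = (\<integral>x. norm (f x) \<partial>lborel) * indicator {0..1} u" for u
    using integral_translate[of "\<lambda>x. norm (f x)" "(s * u) *\<^sub>R v"] by (auto simp: indicator_def)
  then show "integrable lborel (\<lambda>u. \<integral>x. norm (case (u, x) of (u, x) \<Rightarrow> indicator {0..1} u * f (x + (s * u)
      *\<^sub>R v)) \<partial>lborel)"
    by simp
  show "AE u in lborel. integrable lborel (\<lambda>x. case (u, x) of (u, x) \<Rightarrow> indicator {0..1} u * f (x + (s * u)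
      *\<^sub>R v))"
    using integrable_translate[OF f] by simp
qed

context
  fixes h g :: "real^'n \<Rightarrow> real" and v :: "real^'n"
  assumes h: "integrable lborel h" and g: "integrable lborel g"
    and wd: "\<And>\<phi>. test_function \<phi> \<Longrightarrow> (\<integral>x. h x * frechet_derivative \<phi> (at x) v \<partial>lborel)
        = - (\<integral>x. \<phi> x * g x \<partial>lborel)"
begin

lemma g_measurable: "g \<in> borel_measurable borel"
  using g by auto

lemma h_measurable: "h \<in> borel_measurable borel"
  using h by auto

definition segment_avg :: "real \<Rightarrow> real^'n \<Rightarrow> real" where
  "segment_avg s x = (\<integral>u. indicator {0..1} u * g (x + (s * u) *\<^sub>R v) \<partial>lborel)"

lemma segment_avg_integrable: "integrable lborel (segment_avg s)"
  unfolding segment_avg_def[abs_def] by (rule lborel_pair.integrable_snd[OF segment_integrable[OF g]])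

text \<open>The fundamental theorem of calculus for a weak derivative: tested against
  \<open>\<phi>\<close>, Fubini and a translation move the segment onto \<open>\<phi>\<close>, where
  the classical theorem applies.\<close>

lemma difference_eq_segment_avg: "AE x in lborel. h (x + s *\<^sub>R v) - h x = s * segment_avg s x"
proof -
  let ?k = "\<lambda>x. h (x + s *\<^sub>R v) - h x - s * segment_avg s x"
  have ik: "integrable lborel ?k"
    using h integrable_translate[OF h] segment_avg_integrable by auto
  have "AE x in lborel. ?k x = 0"
  proof (rule fundamental_lemma)
    show "locally_integrable ?k"
      unfolding locally_integrable_def set_integrable_def
      using ik by (auto intro!: integrable_mult_indicator simp: compact_imp_closed simp del: real_scaleR_def)
    fix \<phi> :: "real^'n \<Rightarrow> real" assume \<phi>: "test_function \<phi>"
    note \<phi>t = test_function_translate[OF \<phi>]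
    let ?D = "\<lambda>x. frechet_derivative \<phi> (at x) v"
    have D: "test_function ?D" by (rule test_function_deriv[OF \<phi>])
    note [measurable] = test_function_measurable[OF \<phi>] test_function_measurable[OF D] g_measurable h_measurable
    obtain B where B: "\<And>x. \<bar>\<phi> x\<bar> \<le> B" "0 \<le> B"
      using test_function_bounded[OF \<phi>] by (metis indicator_le_1 mult.right_neutral mult_left_mono order_trans)
    obtain B' where B': "\<And>x. \<bar>?D x\<bar> \<le> B'" "0 \<le> B'"
      using test_function_bounded[OF D] by (metis indicator_le_1 mult.right_neutral mult_left_mono order_trans)
    have i\<phi>: "integrable lborel (\<lambda>x. \<phi> (x + w) * f x)" if "integrable lborel f" for w and f :: "real^'n \<Rightarrow> real"
      by (rule Bochner_Integration.integrable_bound[of _ "\<lambda>x. B * f x"])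
        (use that B in \<open>auto simp: abs_mult intro!: mult_right_mono\<close>)
    have inner: "(\<integral>x. \<phi> x * (indicator {0..1} u * g (x + (s * u) *\<^sub>R v)) \<partial>lborel)
      = - (\<integral>x. h x * (indicator {0..1} u * ?D (x - (s * u) *\<^sub>R v)) \<partial>lborel)" for u
    proof -
      let ?w = "(s * u) *\<^sub>R v"
      have "(\<integral>x. \<phi> x * g (x + ?w) \<partial>lborel) = (\<integral>x. \<phi> (x + - ?w) * g x \<partial>lborel)"
        using integral_translate[of "\<lambda>x. \<phi> (x - ?w) * g x" ?w] by simp
      also have "\<dots> = - (\<integral>x. h x * ?D (x + - ?w) \<partial>lborel)"
        using wd[OF \<phi>t(1)[of "- ?w"]] unfolding \<phi>t(2) by simp
      finally have e: "(\<integral>x. \<phi> x * g (x + ?w) \<partial>lborel) = - (\<integral>x. h x * ?D (x - ?w) \<partial>lborel)" by simp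
      show ?thesis using e by (cases "u \<in> {0..1}") auto
    qed
    have int1: "integrable (lborel \<Otimes>\<^sub>M lborel) (\<lambda>(u, x). \<phi> x * (indicator {0..1} u * g (x + (s * u) *\<^sub>R v)))"
      by (rule Bochner_Integration.integrable_bound[OF integrable_mult_right[OF segment_integrable[OF g, of
          s], of B]])
        (use B in \<open>auto simp: abs_mult case_prod_unfold intro!: mult_mono\<close>)
    have int2: "integrable (lborel \<Otimes>\<^sub>M lborel) (\<lambda>(u::real, x). h x * (indicator {0..1} u * ?D (x - (s * u)
        *\<^sub>R v)))"
    proof (rule Bochner_Integration.integrable_bound)
      show "integrable (lborel \<Otimes>\<^sub>M lborel) (\<lambda>(u::real, x). indicator {0..1} u * (B' * h x))"
        using lborel_pair.integrable_product_swap_iff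
        by (intro lborel_pair.Fubini_integrable) (use h in \<open>auto simp: abs_mult mult.assoc\<close>)
      show "AE p in lborel \<Otimes>\<^sub>M lborel. norm (case p of (u::real, x) \<Rightarrow> h x * (indicator {0..1} u * ?D (x - (s
          * u) *\<^sub>R v)))
        \<le> norm (case p of (u, x) \<Rightarrow> indicator {0..1} u * (B' * h x))"
      proof (intro AE_I2, clarify)
        fix u :: real and x
        have "\<bar>h x\<bar> * \<bar>?D (x - (s * u) *\<^sub>R v)\<bar> \<le> \<bar>h x\<bar> * B'" by (intro mult_left_mono B') simp
        then show "norm (h x * (indicator {0..1} u * ?D (x - (s * u) *\<^sub>R v)))
            \<le> norm (indicator {0..1} u * (B' * h x))"
          using B'(2) by (cases "u \<in> {0..1}") (auto simp: abs_mult mult.commute)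
      qed
    qed simp
    have ftc: "s * (\<integral>u. indicator {0..1} u * ?D (x - (s * u) *\<^sub>R v) \<partial>lborel) = \<phi> x - \<phi> (x - s *\<^sub>R v)" for x
    proof -
      have der: "((\<lambda>u. - \<phi> (x - (s * u) *\<^sub>R v)) has_real_derivative s * ?D (x - (s * u) *\<^sub>R v)) (at u)" for u
      proof -
        have "((\<phi> \<circ> (\<lambda>u. x - (s * u) *\<^sub>R v)) has_derivative
          (frechet_derivative \<phi> (at (x - (s * u) *\<^sub>R v)) \<circ> (\<lambda>d. - ((s * d) *\<^sub>R v)))) (at u)"
          by (rule diff_chain_at) (auto intro!: derivative_eq_intros test_function_has_derivative \<phi>)
        moreover have "(frechet_derivative \<phi> (at y) \<circ> (\<lambda>d. - ((s * d) *\<^sub>R v)))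
            = (\<lambda>d. - (s * frechet_derivative \<phi> (at y) v) * d)" for y
          by (simp add: o_def test_function_grad_inner[OF \<phi>] fun_eq_iff)
        ultimately have "((\<lambda>u. \<phi> (x - (s * u) *\<^sub>R v)) has_real_derivative - (s * ?D (x - (s * u) *\<^sub>R v)))
            (at u)"
          unfolding has_field_derivative_def by (simp only: o_def)
        from DERIV_minus[OF this] show ?thesis by simp
      qed
      have "continuous_on UNIV (?D \<circ> (\<lambda>u. x - (s * u) *\<^sub>R v))"
        by (intro continuous_on_compose continuous_intros continuous_on_subset[OF
            test_function_continuous[OF D]]) auto
      then have c: "isCont (\<lambda>u. s * ?D (x - (s * u) *\<^sub>R v)) u" for u
        by (intro continuous_intros) (simp add: o_def continuous_on_eq_continuous_at)
      have "(\<integral>u. (s * ?D (x - (s * u) *\<^sub>R v)) * indicator {0..1} u \<partial>lborel)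
        = - \<phi> (x - (s * 1) *\<^sub>R v) - - \<phi> (x - (s * 0) *\<^sub>R v)"
        by (rule integral_FTC_Icc_real) (use der c in auto)
      then show ?thesis by (simp add: mult.commute[of _ "indicator _ _"] mult.left_commute[of _ s])
    qed
    have "(\<integral>x. \<phi> x * segment_avg s x \<partial>lborel) = (\<integral>x. \<integral>u. \<phi> x * (indicator {0..1} u * g (x + (s * u) *\<^sub>R v))
        \<partial>lborel \<partial>lborel)"
      unfolding segment_avg_def by simp
    also have "\<dots> = (\<integral>u. \<integral>x. \<phi> x * (indicator {0..1} u * g (x + (s * u) *\<^sub>R v)) \<partial>lborel \<partial>lborel)"
      by (rule lborel_pair.Fubini_integral[OF int1])
    also have "\<dots> = - (\<integral>u. \<integral>x. h x * (indicator {0..1} u * ?D (x - (s * u) *\<^sub>R v)) \<partial>lborel \<partial>lborel)"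
      unfolding inner by simp
    also have "(\<integral>u. \<integral>x. h x * (indicator {0..1} u * ?D (x - (s * u) *\<^sub>R v)) \<partial>lborel \<partial>lborel)
      = (\<integral>x. h x * (\<integral>u. indicator {0..1} u * ?D (x - (s * u) *\<^sub>R v) \<partial>lborel) \<partial>lborel)"
      using lborel_pair.Fubini_integral[OF int2] by simp
    finally have "s * (\<integral>x. \<phi> x * segment_avg s x \<partial>lborel)
      = - (\<integral>x. h x * (s * (\<integral>u. indicator {0..1} u * ?D (x - (s * u) *\<^sub>R v) \<partial>lborel)) \<partial>lborel)"
      by (simp add: mult.left_commute)
    also have "\<dots> = - (\<integral>x. h x * (\<phi> x - \<phi> (x - s *\<^sub>R v)) \<partial>lborel)" unfolding ftc ..
    also have "- (\<integral>x. h x * (\<phi> x - \<phi> (x - s *\<^sub>R v)) \<partial>lborel)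
        = (\<integral>x. \<phi> (x + - s *\<^sub>R v) * h x \<partial>lborel) - (\<integral>x. \<phi> (x + 0) * h x \<partial>lborel)"
      using i\<phi>[OF h, of "- s *\<^sub>R v"] i\<phi>[OF h, of 0] by (simp add: algebra_simps)
    also have "(\<integral>x. \<phi> (x + - s *\<^sub>R v) * h x \<partial>lborel) = (\<integral>x. \<phi> x * h (x + s *\<^sub>R v) \<partial>lborel)"
      using integral_translate[of "\<lambda>x. \<phi> (x - s *\<^sub>R v) * h x" "s *\<^sub>R v"] by simp
    finally show "(\<integral>x. \<phi> x *\<^sub>R ?k x \<partial>lborel) = 0"
      using i\<phi>[OF h, of 0] i\<phi>[OF integrable_translate[OF h, of "s *\<^sub>R v"], of 0] i\<phi>[OF
          segment_avg_integrable[of s], of 0]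
      by (simp add: right_diff_distrib mult.left_commute[of _ s])
  qed
  then show ?thesis by simp
qed

text \<open>At a zero of \<open>h\<close> the difference quotient \<open>h (x + s v) / s\<close> is nonnegative, and it converges to
  \<open>g\<close> in \<open>L\<^sup>1\<close> as \<open>s\<close> decreases to 0.\<close>
lemma weak_derivative_nonneg_on_zeros:
  assumes pos: "AE x in lborel. 0 \<le> h x"
  shows "AE x in lborel. h x = 0 \<longrightarrow> 0 \<le> g x"
proof -
  note [measurable] = g_measurable h_measurable
  let ?Z = "{x. h x = 0}"
  have "AE x in lborel. 0 \<le> indicator ?Z x * g x"
  proof (rule sigma_finite_measure.density_nonneg[OF sigma_finite_lborel])
    show "integrable lborel (\<lambda>x. indicator ?Z x * g x)"
      by (rule Bochner_Integration.integrable_bound[OF g]) (auto simp: indicator_def)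
    fix A :: "(real^'n) set" assume A: "A \<in> sets lborel"
    then have [measurable]: "A \<in> sets borel" by simp
    let ?I = "\<lambda>x. indicator A x * indicator ?Z x :: real"
    let ?s = "\<lambda>n. 1 / real (Suc n)"
    let ?F = "\<lambda>n u x. indicator {0..1::real} u * (g (x + (?s n * u) *\<^sub>R v) - g x)"
    let ?b = "\<lambda>n. \<integral>u. \<integral>x. norm (?F n u x) \<partial>lborel \<partial>lborel"
    have iI: "integrable lborel (\<lambda>x. ?I x * f x)" if "integrable lborel f" for f :: "real^'n \<Rightarrow> real"
      by (rule Bochner_Integration.integrable_bound[OF that]) (use that in \<open>auto simp: indicator_def\<close>)
    have iF: "integrable (lborel \<Otimes>\<^sub>M lborel) (\<lambda>(u, x). ?F n u x)" for n
    proof -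
      have "integrable (lborel \<Otimes>\<^sub>M lborel) (\<lambda>p. (case p of (u, x) \<Rightarrow> indicator {0..1} u * g (x + (?s n * u)
          *\<^sub>R v))
          - (case p of (u, x) \<Rightarrow> indicator {0..1} u * g (x + (0 * u) *\<^sub>R v)))"
        by (intro Bochner_Integration.integrable_diff segment_integrable g)
      then show ?thesis by (simp add: case_prod_unfold right_diff_distrib)
    qed
    \<comment> \<open>\<open>?b n\<close> dominates the distance in \<open>L1\<close> between the
      average of \<open>g\<close> over a segment of length parameter \<open>?s n\<close> and
      \<open>g\<close> itself. It tends to 0 by continuity of translations for each
      \<open>u\<close>, with a bound that is integrable in \<open>u\<close>.\<close>
    have b0: "?b \<longlonglongrightarrow> (\<integral>u. 0 \<partial>(lborel :: real measure))"
    proof (rule integral_dominated_convergence[where w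
        = "\<lambda>u. 2 * (\<integral>x. norm (g x) \<partial>lborel) * indicator {0..1} u"])
      show "AE u in lborel. (\<lambda>n. \<integral>x. norm (?F n u x) \<partial>lborel) \<longlonglongrightarrow> 0"
      proof (rule AE_I2)
        fix u :: real
        have "(\<lambda>n. \<integral>x. norm (g (x + (?s n * u) *\<^sub>R v) - g x) \<partial>lborel) \<longlonglongrightarrow> 0"
        proof (rule L1_translation_continuous[OF g])
          have "(\<lambda>n. (?s n * u) *\<^sub>R v) \<longlonglongrightarrow> (0 * u) *\<^sub>R v"
            using LIMSEQ_Suc[OF lim_inverse_n'] by (intro tendsto_intros)
          then show "(\<lambda>n. (?s n * u) *\<^sub>R v) \<longlonglongrightarrow> 0" by simp
        qed
        then show "(\<lambda>n. \<integral>x. norm (?F n u x) \<partial>lborel) \<longlonglongrightarrow> 0"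
          by (cases "u \<in> {0..1}") auto
      qed
      show "AE u in lborel. norm (\<integral>x. norm (?F n u x) \<partial>lborel)
          \<le> 2 * (\<integral>x. norm (g x) \<partial>lborel) * indicator {0..1} u" for n
      proof (rule AE_I2)
        fix u :: real
        have "(\<integral>x. norm (g (x + (?s n * u) *\<^sub>R v) - g x) \<partial>lborel)
            \<le> (\<integral>x. norm (g (x + (?s n * u) *\<^sub>R v)) + norm (g x) \<partial>lborel)"
          by (rule integral_mono) (use g integrable_translate[OF g] norm_triangle_ineq4 in auto)
        also have "\<dots> = 2 * (\<integral>x. norm (g x) \<partial>lborel)"
          using g integrable_translate[OF g] integral_translate[of "\<lambda>x. norm (g x)" "(?s n * u) *\<^sub>R v"] by simp
        finally show "norm (\<integral>x. norm (?F n u x) \<partial>lborel) \<le> 2 * (\<integral>x. norm (g x) \<partial>lborel) * indicator {0..1} u"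
          by (cases "u \<in> {0..1}") auto
      qed
    qed simp_all
    have le: "(\<integral>x. ?I x * g x \<partial>lborel) \<ge> - ?b n" for n
    proof -
      have "AE x in lborel. ?I x * segment_avg (?s n) x \<ge> 0"
      proof -
        have "AE x in lborel. 0 \<le> h (x + ?s n *\<^sub>R v)"
        proof -
          have "AE x in distr lborel borel ((+) (?s n *\<^sub>R v)). 0 \<le> h x" by (subst lborel_distr_plus) (rule pos)
          then show ?thesis by (subst (asm) AE_distr_iff) (auto simp: add.commute)
        qed
        with difference_eq_segment_avg[of "?s n"] show ?thesis
        proof eventually_elim
          case (elim x)
          show ?case
          proof (cases "h x = 0")
            case True
            then have "0 \<le> ?s n * segment_avg (?s n) x" using elim by simp
            moreover have "0 < ?s n" by simp
            ultimately have "0 \<le> segment_avg (?s n) x" unfolding zero_le_mult_iff by linarith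
            then show ?thesis by simp
          qed simp
        qed
      qed
      then have 1: "0 \<le> (\<integral>x. ?I x * segment_avg (?s n) x \<partial>lborel)" by (rule integral_nonneg_AE)
      have "(\<integral>x. ?I x * segment_avg (?s n) x \<partial>lborel) - (\<integral>x. ?I x * g x \<partial>lborel)
        = (\<integral>x. ?I x * (segment_avg (?s n) x - g x) \<partial>lborel)"
        using iI[OF segment_avg_integrable[of "?s n"]] iI[OF g] by (simp add: right_diff_distrib)
      also have "\<dots> \<le> (\<integral>x. (\<integral>u. norm (?F n u x) \<partial>lborel) \<partial>lborel)"
      proof (rule integral_mono_AE)
        show "integrable lborel (\<lambda>x. ?I x * (segment_avg (?s n) x - g x))"
          by (rule iI) (use segment_avg_integrable g in auto)
        have "integrable (lborel \<Otimes>\<^sub>M lborel) (\<lambda>(u, x). norm (?F n u x))"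
          using integrable_norm[OF iF[of n]] by (simp add: case_prod_unfold)
        then show "integrable lborel (\<lambda>x. \<integral>u. norm (?F n u x) \<partial>lborel)"
          by (rule lborel_pair.integrable_snd)
        have "AE x in lborel. integrable lborel (\<lambda>u. indicator {0..1} u * g (x + (?s n * u) *\<^sub>R v))"
          using lborel_pair.AE_integrable_snd[OF segment_integrable[OF g, of "?s n"]] .
        then show "AE x in lborel. ?I x * (segment_avg (?s n) x - g x) \<le> (\<integral>u. norm (?F n u x) \<partial>lborel)"
        proof eventually_elim
          case (elim x)
          have "segment_avg (?s n) x - g x = (\<integral>u. ?F n u x \<partial>lborel)"
            unfolding segment_avg_def right_diff_distrib using elim
            by (subst Bochner_Integration.integral_diff) (auto intro!: integrable_mult_left)
          also have "\<bar>\<dots>\<bar> \<le> (\<integral>u. norm (?F n u x) \<partial>lborel)" 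
            using integral_norm_bound[of lborel "\<lambda>u. ?F n u x"] by simp
          finally have "\<bar>segment_avg (?s n) x - g x\<bar> \<le> (\<integral>u. norm (?F n u x) \<partial>lborel)" .
          moreover have "?I x * (segment_avg (?s n) x - g x) \<le> \<bar>segment_avg (?s n) x - g x\<bar>"
            by (auto simp: indicator_def)
          ultimately show ?case by linarith
        qed
      qed
      also have "\<dots> = ?b n"
        by (rule lborel_pair.Fubini_integral) (use integrable_norm[OF iF[of n]] in \<open>simp add: case_prod_unfold\<close>)
      finally show ?thesis using 1 by linarith
    qed
    have "0 \<le> (\<integral>x. ?I x * g x \<partial>lborel)"
    proof (rule LIMSEQ_le_const2)
      show "(\<lambda>n. - ?b n) \<longlonglongrightarrow> 0" using tendsto_minus[OF b0] by simp
      show "\<exists>N. \<forall>n\<ge>N. - ?b n \<le> (\<integral>x. ?I x * g x \<partial>lborel)" using le by blast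
    qed
    then show "0 \<le> (\<integral>x\<in>A. indicator ?Z x * g x \<partial>lborel)"
      by (simp add: set_lebesgue_integral_def mult.assoc)
  qed
  then show ?thesis by eventually_elim (auto simp: indicator_def)
qed

end

text \<open>Multiplying by a bump makes \<open>h\<close> and its derivative integrable, as the
  one-dimensional lemma requires; at a zero of \<open>h\<close> the term with the derivative of the
  bump disappears. Both directions of each axis give opposite signs, and countably many bumps cover
  the space.\<close>

theorem weak_grad_zero_on_zeros:
  fixes h :: "real^'n \<Rightarrow> real"
  assumes wg: "is_weak_grad h G" and pos: "AE x in lborel. 0 \<le> h x"
  shows "AE x in lborel. h x = 0 \<longrightarrow> G x = 0"
proof -
  have li: "locally_integrable G" "locally_integrable h" using wg by (auto simp: is_weak_grad_def)
  let ?a = "\<lambda>k::nat. (\<chi> i. - real k) :: real^'n" and ?b = "\<lambda>k::nat. (\<chi> i. real k) :: real^'n"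
  let ?c = "\<lambda>k. box_bump (?a k) (?b k)"
  have c: "test_function (?c k)" for k
  proof (rule test_functionI[where S = "box (?a k) (?b k)"])
    show "?c k x \<noteq> 0 \<Longrightarrow> x \<in> box (?a k) (?b k)" for x
      using box_bump_pos_iff[of "?a k" "?b k" x] box_bump_range(1)[of "?a k" "?b k" x] by linarith
  qed (auto intro: hdiff_box_bump)
  have key: "AE x in lborel. ?c k x * h x = 0 \<longrightarrow> 0 \<le> ?c k x * (G x \<bullet> v) + h x * frechet_derivative (?c k) (at
      x) v" for k v
  proof (rule weak_derivative_nonneg_on_zeros)
    have Gv: "locally_integrable (\<lambda>x. G x \<bullet> v)"
      unfolding locally_integrable_def set_integrable_def
    proof safe
      fix S :: "(real^'n) set" assume "compact S"
      then have "integrable lborel (\<lambda>x. (indicator S x *\<^sub>R G x) \<bullet> v)"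
        using li(1) by (intro integrable_inner_left) (auto simp: locally_integrable_def set_integrable_def)
      then show "integrable lborel (\<lambda>x. indicator S x *\<^sub>R (G x \<bullet> v))" by simp
    qed
    note i1 = test_function_mult_integrable[OF c[of k] li(2)] test_function_mult_integrable[OF c[of k] Gv]
      test_function_mult_integrable[OF test_function_deriv[OF c[of k]] li(2), of v]
    show "integrable lborel (\<lambda>x. ?c k x * h x)" using i1(1) by simp
    show "integrable lborel (\<lambda>x. ?c k x * (G x \<bullet> v) + h x * frechet_derivative (?c k) (at x) v)"
      using i1(2,3) by (simp add: mult.commute)
    show "AE x in lborel. 0 \<le> ?c k x * h x" using pos
      by eventually_elim (simp add: box_bump_range)
    fix \<phi> :: "real^'n \<Rightarrow> real" assume \<phi>: "test_function \<phi>"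
    have c\<phi>: "test_function (\<lambda>x. ?c k x * \<phi> x)" by (rule test_function_mult[OF \<phi> hdiff_box_bump])
    have d: "frechet_derivative (\<lambda>x. ?c k x * \<phi> x) (at x) v
        = ?c k x * frechet_derivative \<phi> (at x) v + frechet_derivative (?c k) (at x) v * \<phi> x" for x
      by (subst frechet_derivative_at[symmetric, OF has_derivative_mult[OF test_function_has_derivative[OF
          c] test_function_has_derivative[OF \<phi>]]]) simp
    have i2: "integrable lborel (\<lambda>x. (?c k x * frechet_derivative \<phi> (at x) v) * h x)"
      "integrable lborel (\<lambda>x. (frechet_derivative (?c k) (at x) v * \<phi> x) * h x)"
      "integrable lborel (\<lambda>x. (?c k x * \<phi> x) * (G x \<bullet> v))"
      using test_function_mult_integrable[OF test_function_mult[OF test_function_deriv[OF \<phi>]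
          hdiff_box_bump[of "?a k" "?b k"]] li(2)]
        test_function_mult_integrable[OF test_function_mult[OF \<phi> test_function_hdiff[OF
            test_function_deriv[OF c]]] li(2)]
        test_function_mult_integrable[OF c\<phi> Gv] by simp_all
    have "(\<integral>x. h x * (?c k x * frechet_derivative \<phi> (at x) v + frechet_derivative (?c k) (at x) v * \<phi> x)
        \<partial>lborel)
      = - (\<integral>x. ?c k x * \<phi> x * (G x \<bullet> v) \<partial>lborel)"
      using weak_grad_inner[OF wg c\<phi>, of v] unfolding d .
    also have "(\<integral>x. h x * (?c k x * frechet_derivative \<phi> (at x) v + frechet_derivative (?c k) (at x) v * \<phi>
        x) \<partial>lborel)
      = (\<integral>x. (?c k x * frechet_derivative \<phi> (at x) v) * h x \<partial>lborel) + (\<integral>x. (frechet_derivative (?c k) (at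
          x) v * \<phi> x) * h x \<partial>lborel)"
      using i2(1,2) by (simp add: distrib_left mult.commute)
    finally show "(\<integral>x. ?c k x * h x * frechet_derivative \<phi> (at x) v \<partial>lborel)
      = - (\<integral>x. \<phi> x * (?c k x * (G x \<bullet> v) + h x * frechet_derivative (?c k) (at x) v) \<partial>lborel)"
      using i2(2,3) by (simp add: distrib_left mult_ac)
  qed
  have "AE x in lborel. \<forall>k. \<forall>i\<in>UNIV. \<forall>s\<in>{-1,1}. ?c k x * h x = 0 \<longrightarrow>
    0 \<le> ?c k x * (G x \<bullet> axis i s) + h x * frechet_derivative (?c k) (at x) (axis i s)"
    unfolding AE_all_countable by (intro allI AE_finite_allI finite finite.intros key)
  then show ?thesis
  proof eventually_elim
    case (elim x)
    show ?case
    proof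
      assume hx: "h x = 0"
      obtain k :: nat where k: "norm x < k" using reals_Archimedean2 by blast
      have "\<bar>x $ i\<bar> < k" for i using component_le_norm_cart[of x i] k by linarith
      then have "x \<in> box (?a k) (?b k)" by (auto simp: mem_box_cart abs_less_iff minus_less_iff)
      then have cp: "0 < ?c k x" by (simp add: box_bump_pos_iff)
      have "G x $ i = 0" for i
      proof -
        have "0 \<le> ?c k x * (G x \<bullet> axis i (-1))" "0 \<le> ?c k x * (G x \<bullet> axis i 1)"
          using elim hx by (metis (no_types, lifting) UNIV_I add_0_right insertCI mult_zero_left
              mult_zero_right)+
        then show ?thesis using cp by (simp add: inner_axis zero_le_mult_iff mult_le_0_iff)
      qed
      then show "G x = 0" by (simp add: vec_eq_iff)
    qed
  qed
qed

text \<open>Averaging \<open>F'\<close> over a unit segment gives \<open>F (x + v) - F x\<close>,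
  whose integral vanishes by translation invariance. Only integrability of \<open>F\<close> and
  \<open>F'\<close> enters, with no boundary terms at infinity.\<close>

lemma integral_directional_derivative_zero:
  fixes F :: "real^'n \<Rightarrow> real"
  assumes F: "integrable lborel F" and F': "integrable lborel F'" and c: "continuous_on UNIV F'"
    and d: "\<And>x. ((\<lambda>u. F (x + u *\<^sub>R v)) has_real_derivative F' x) (at 0)"
  shows "(\<integral>x. F' x \<partial>lborel) = 0"
proof -
  have [measurable]: "F' \<in> borel_measurable borel" "F \<in> borel_measurable borel" using F F' by auto
  have d': "((\<lambda>u. F (x + u *\<^sub>R v)) has_real_derivative F' (x + u *\<^sub>R v)) (at u)" for x u
  proof -
    have "((\<lambda>r. F ((x + u *\<^sub>R v) + (r - u) *\<^sub>R v)) has_real_derivative F' (x + u *\<^sub>R v)) (at u)"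
      using DERIV_chain2[where g = "\<lambda>r. r - u" and x = u and s = UNIV and f
          = "\<lambda>r. F ((x + u *\<^sub>R v) + r *\<^sub>R v)", OF _ ]
        d[of "x + u *\<^sub>R v"] DERIV_shift[of "\<lambda>r. F ((x + u *\<^sub>R v) + r *\<^sub>R v)" _ u "- u"] by simp
    then show ?thesis by (simp add: algebra_simps)
  qed
  have seg: "(\<integral>u. indicator {0..1} u * F' (x + u *\<^sub>R v) \<partial>lborel) = F (x + v) - F x" for x
  proof -
    have "continuous_on UNIV (F' \<circ> (\<lambda>u. x + u *\<^sub>R v))"
      by (intro continuous_on_compose continuous_intros continuous_on_subset[OF c]) auto
    then have "isCont (\<lambda>u. F' (x + u *\<^sub>R v)) u" for u
      by (simp add: o_def continuous_on_eq_continuous_at)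
    then have "(\<integral>u. F' (x + u *\<^sub>R v) * indicator {0..1} u \<partial>lborel) = F (x + 1 *\<^sub>R v) - F (x + 0 *\<^sub>R v)"
      by (intro integral_FTC_Icc_real) (use d' in auto)
    then show ?thesis by (simp add: mult.commute)
  qed
  have "(\<integral>x. F' x \<partial>lborel) = (\<integral>u. indicator {0..1} u * (\<integral>x. F' x \<partial>lborel) \<partial>(lborel :: real measure))"
    by simp
  also have "\<dots> = (\<integral>u. \<integral>x. indicator {0..1} u * F' (x + u *\<^sub>R v) \<partial>lborel \<partial>lborel)"
    using integral_translate[of F'] by simp
  also have "\<dots> = (\<integral>x. \<integral>u. indicator {0..1} u * F' (x + u *\<^sub>R v) \<partial>lborel \<partial>lborel)"
    by (rule lborel_pair.Fubini_integral[symmetric]) (use segment_integrable[OF F', of 1 v] in simp)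
  also have "\<dots> = (\<integral>x. F (x + v) - F x \<partial>lborel)" by (simp add: seg)
  also have "\<dots> = 0" using F integrable_translate[OF F] integral_translate[of F v] by simp
  finally show ?thesis .
qed

text \<open>The mean value inequality on the ball bounds all difference quotients by
  \<open>w\<close>, so dominated convergence applies.\<close>

lemma has_real_derivative_integral:
  fixes f :: "real \<Rightarrow> 'a \<Rightarrow> real"
  assumes e: "0 < e"
    and d: "\<And>s x. s \<in> ball s0 e \<Longrightarrow> x \<in> space M \<Longrightarrow> ((\<lambda>s. f s x) has_real_derivative f' s x) (at s)"
    and w: "integrable M w" "\<And>s x. s \<in> ball s0 e \<Longrightarrow> x \<in> space M \<Longrightarrow> \<bar>f' s x\<bar> \<le> w x"
    and f: "\<And>s. s \<in> ball s0 e \<Longrightarrow> integrable M (f s)" and m: "f' s0 \<in> borel_measurable M"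
  shows "((\<lambda>s. \<integral>x. f s x \<partial>M) has_real_derivative (\<integral>x. f' s0 x \<partial>M)) (at s0)"
proof -
  have s0: "s0 \<in> ball s0 e" using e by simp
  have "((\<lambda>s. ((\<integral>x. f s x \<partial>M) - (\<integral>x. f s0 x \<partial>M)) / (s - s0)) \<longlongrightarrow> (\<integral>x. f' s0 x \<partial>M)) (at s0 within ball s0 e)"
    unfolding tendsto_at_iff_sequentially
  proof safe
    fix X :: "nat \<Rightarrow> real" assume X: "\<forall>i. X i \<in> ball s0 e - {s0}" "X \<longlonglongrightarrow> s0"
    have "(\<lambda>i. \<integral>x. (f (X i) x - f s0 x) / (X i - s0) \<partial>M) \<longlonglongrightarrow> (\<integral>x. f' s0 x \<partial>M)"
    proof (rule integral_dominated_convergence[OF m _ w(1)])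
      show "(\<lambda>x. (f (X i) x - f s0 x) / (X i - s0)) \<in> borel_measurable M" for i
        using borel_measurable_integrable[OF f[of "X i"]] borel_measurable_integrable[OF f[OF s0]] X by auto
      show "AE x in M. (\<lambda>i. (f (X i) x - f s0 x) / (X i - s0)) \<longlonglongrightarrow> f' s0 x"
      proof (rule AE_I2)
        fix x assume "x \<in> space M"
        from d[OF s0 this] have "((\<lambda>s. (f s x - f s0 x) / (s - s0)) \<longlongrightarrow> f' s0 x) (at s0)"
          by (simp add: has_field_derivative_iff)
        moreover have "filterlim X (at s0) sequentially"
          using X by (auto simp: filterlim_at)
        ultimately show "(\<lambda>i. (f (X i) x - f s0 x) / (X i - s0)) \<longlonglongrightarrow> f' s0 x"
          by (rule filterlim_compose)
      qed
      show "AE x in M. norm ((f (X i) x - f s0 x) / (X i - s0)) \<le> w x" for i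
      proof (rule AE_I2)
        fix x assume x: "x \<in> space M"
        have "norm (f (X i) x - f s0 x) \<le> w x * norm (X i - s0)"
        proof (rule field_differentiable_bound[of "ball s0 e" "\<lambda>s. f s x" "\<lambda>s. f' s x"])
          show "((\<lambda>s. f s x) has_field_derivative f' s x) (at s within ball s0 e)" if "s \<in> ball s0 e" for s
            using d[OF that x] by (rule has_field_derivative_at_within)
        qed (use w(2) x X s0 in auto)
        then show "norm ((f (X i) x - f s0 x) / (X i - s0)) \<le> w x"
          using X by (simp add: pos_divide_le_eq)
      qed
    qed
    moreover have "(\<integral>x. (f (X i) x - f s0 x) / (X i - s0) \<partial>M)
        = ((\<integral>x. f (X i) x \<partial>M) - (\<integral>x. f s0 x \<partial>M)) / (X i - s0)" for i
      using f[of "X i"] f[OF s0] X by simp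
    ultimately show "((\<lambda>s. ((\<integral>x. f s x \<partial>M) - (\<integral>x. f s0 x \<partial>M)) / (s - s0)) \<circ> X) \<longlonglongrightarrow> (\<integral>x. f' s0 x \<partial>M)"
      by (simp only: o_def)
  qed
  then show ?thesis using e by (simp add: has_field_derivative_iff at_within_open[OF s0])
qed

section \<open>Gaussian integrals and Fourier uniqueness\<close>

definition gauss :: "real^'n^'n \<Rightarrow> real^'n \<Rightarrow> real" where
  "gauss S x = exp (- (x \<bullet> (S *v x)) / 2)"

lemma gauss_pos: "0 < gauss S x" by (simp add: gauss_def)

lemma pos_def_lower_bound:
  assumes "pos_def (S :: real^'n^'n)"
  obtains c where "0 < c" "\<And>x. c * (norm x)\<^sup>2 \<le> x \<bullet> (S *v x)"
proof -
  let ?q = "\<lambda>x :: real^'n. x \<bullet> (S *v x)"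
  have ne: "sphere (0 :: real^'n) 1 \<noteq> {}" by simp
  have "continuous_on (sphere 0 1) ?q" by (intro continuous_intros)
  then obtain y where y: "y \<in> sphere 0 1" "\<And>x. x \<in> sphere 0 1 \<Longrightarrow> ?q y \<le> ?q x"
    using continuous_attains_inf[OF compact_sphere ne] by blast
  show thesis
  proof (rule that)
    have "y \<noteq> 0" using y(1) by auto
    then show "0 < ?q y" using assms by (auto simp: pos_def_def)
    fix x :: "real^'n"
    show "?q y * (norm x)\<^sup>2 \<le> ?q x"
    proof (cases "x = 0")
      case False
      have "?q y \<le> ?q ((1 / norm x) *\<^sub>R x)" by (rule y(2)) (use False in simp)
      also have "\<dots> = ?q x / (norm x)\<^sup>2"
        by (simp add: linear_scale[OF matrix_vector_mul_linear] power2_eq_square divide_simps)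
      finally show ?thesis using False by (simp add: pos_le_divide_eq)
    qed simp
  qed
qed

lemma integrable_exp_norm_square:
  assumes c: "0 < (c::real)"
  shows "integrable lborel (\<lambda>x :: real^'n. exp (- c * (norm x)\<^sup>2))"
proof -
  let ?f = "\<lambda>x :: real^'n. exp (- c * (norm x)\<^sup>2)"
  let ?N = "CARD('n)"
  let ?V = "measure lborel (cball (0::real^'n) 1)"
  have ptw: "ennreal (?f x) \<le> (\<Sum>k. ennreal (exp (- c * real k)) * indicator (cball 0 (real (Suc k))) x)" for x
  proof -
    \<comment> \<open>The space is split into shells between consecutive integers. As
      \<open>k\<close> is at most its square, the value on a shell is at most
      \<open>exp (- c k)\<close>, a geometric term that wins against the polynomial volume of the
      ball.\<close>
    define k where "k = nat \<lfloor>norm x\<rfloor>"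
    have k: "real k \<le> norm x" "norm x \<le> real (Suc k)"
      using norm_ge_zero[of x] by (auto simp: k_def) linarith+
    have "real k \<le> (real k)\<^sup>2" by (cases k) (auto simp: power2_eq_square)
    also have "\<dots> \<le> (norm x)\<^sup>2" using k by (intro power_mono) auto
    finally have "?f x \<le> exp (- c * real k)" using c by simp
    then have "ennreal (?f x) \<le> ennreal (exp (- c * real k)) * indicator (cball 0 (real (Suc k))) x"
      using k by (simp add: ennreal_leI)
    also have "\<dots> = (\<Sum>j\<in>{k}. ennreal (exp (- c * real j)) * indicator (cball 0 (real (Suc j))) x)"
      by (simp only: sum.empty sum.insert finite.emptyI empty_iff not_False_eq_True add_0_right)
    also have "\<dots> \<le> (\<Sum>k. ennreal (exp (- c * real k)) * indicator (cball 0 (real (Suc k))) x)"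
      by (rule sum_le_suminf) auto
    finally show ?thesis .
  qed
  obtain B where B: "0 \<le> B" "\<And>t. 0 \<le> t \<Longrightarrow> t ^ ?N * exp (- (c / 2) * t) \<le> B"
  proof (rule that)
    have d: "0 < c / 2" using c by simp
    show "0 \<le> fact ?N / (c / 2) ^ ?N" using d by simp
    fix t :: real assume t: "0 \<le> t"
    have "((c / 2) * t) ^ ?N \<le> fact ?N * exp ((c / 2) * t)" by (rule power_le_fact_exp) (use d t in simp)
    then show "t ^ ?N * exp (- (c / 2) * t) \<le> fact ?N / (c / 2) ^ ?N"
      using c unfolding power_mult_distrib by (simp add: exp_minus field_simps)
  qed
  have bd: "exp (- c * real k) * real (Suc k) ^ ?N \<le> (exp c * B) * exp (- (c / 2)) ^ k" for k
  proof -
    have "exp (- c * real k) * real (Suc k) ^ ?N = exp c * exp (- (c / 2) * real (Suc k)) * (real (Suc k) ^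
        ?N * exp (- (c / 2) * real (Suc k)))"
      by (simp add: exp_add[symmetric] mult.commute mult.left_commute) (simp add: algebra_simps)
    also have "\<dots> \<le> exp c * exp (- (c / 2) * real (Suc k)) * B"
      by (intro mult_left_mono B(2)) auto
    also have "\<dots> \<le> exp c * exp (- (c / 2)) ^ k * B"
      using c B(1) by (intro mult_mono) (simp_all add: exp_of_nat_mult[symmetric] algebra_simps)
    finally show ?thesis by (simp add: mult_ac)
  qed
  have vol: "emeasure lborel (cball (0::real^'n) (real (Suc k))) = ennreal (real (Suc k) ^ ?N * ?V)" for k
    using emeasure_cball[of "real (Suc k)" "0::real^'n"] content_cball[of 1 "0::real^'n"]
        by (simp add: mult.commute)
  have "(\<integral>\<^sup>+x. ennreal (?f x) \<partial>lborel) \<le> (\<integral>\<^sup>+x. (\<Sum>k. ennreal (exp (- c * real k)) * indicator (cball 0 (real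
      (Suc k))) (x :: real^'n)) \<partial>lborel)"
    by (intro nn_integral_mono ptw)
  also have "\<dots> = (\<Sum>k. \<integral>\<^sup>+x. ennreal (exp (- c * real k)) * indicator (cball 0 (real (Suc k))) (x :: real^'n)
      \<partial>lborel)"
    by (rule nn_integral_suminf) (intro borel_measurable_times_ennreal borel_measurable_const
        borel_measurable_indicator, simp)
  also have "\<dots> = (\<Sum>k. ennreal (exp (- c * real k) * real (Suc k) ^ ?N * ?V))"
    by (simp add: nn_integral_cmult_indicator vol ennreal_mult'[symmetric] mult.assoc del: of_nat_Suc)
  also have "\<dots> \<le> (\<Sum>k. ennreal ((exp c * B) * exp (- (c / 2)) ^ k * ?V))"
    by (intro suminf_le ennreal_leI mult_right_mono bd) auto
  also have "\<dots> < \<infinity>"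
  proof -
    have "summable (\<lambda>k. (exp c * B) * exp (- (c / 2)) ^ k * ?V)"
      by (intro summable_mult summable_mult2 summable_geometric) (use c in simp)
    then show ?thesis by (subst suminf_ennreal2) (use B in auto)
  qed
  finally have "(\<integral>\<^sup>+x. ennreal (norm (?f x)) \<partial>lborel) < \<infinity>" by simp
  moreover have "?f \<in> borel_measurable lborel" by simp
  ultimately show ?thesis by (intro integrableI_bounded)
qed

lemma gauss_continuous: "continuous_on UNIV (gauss S)"
  unfolding gauss_def[abs_def] by (intro continuous_intros) auto

lemma gauss_measurable [measurable]: "gauss S \<in> borel_measurable borel"
  by (intro borel_measurable_continuous_onI gauss_continuous)

text \<open>A lower bound \<open>c\<close> of the form gives the Gaussian the rate
  \<open>c / 2\<close>; half of it pays for the linear factor, through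
  \<open>1 + r \<le> 2 + r * r\<close> and the inequality \<open>1 + u \<le> exp u\<close>.\<close>

lemma norm_mult_gauss_bound:
  assumes "pos_def (S :: real^'n^'n)"
  obtains c B where "0 < c" "\<And>x. (1 + norm x) * gauss S x \<le> B * exp (- c * (norm x)\<^sup>2)" "0 \<le> B"
proof -
  obtain c where c: "0 < c" "\<And>x. c * (norm x)\<^sup>2 \<le> x \<bullet> (S *v x)" using pos_def_lower_bound[OF assms] by blast
  show thesis
  proof (rule that)
    show "0 < c / 4" using c by simp
    show "0 \<le> 2 + 4 / c" using c by simp
    fix x :: "real^'n"
    have "1 + norm x \<le> 2 + (norm x)\<^sup>2" using sum_power2_ge_zero[of "norm x - 1" 0]
        by (simp add: power2_eq_square algebra_simps) (smt (verit) norm_ge_zero mult_nonneg_nonneg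
        zero_le_square)
    also have "(norm x)\<^sup>2 \<le> (4 / c) * exp ((c / 4) * (norm x)\<^sup>2)"
      using exp_ge_add_one_self[of "(c / 4) * (norm x)\<^sup>2"] c by (simp add: field_simps)
    also have "2 + (4 / c) * exp ((c / 4) * (norm x)\<^sup>2) \<le> (2 + 4 / c) * exp ((c / 4) * (norm x)\<^sup>2)"
      using c by (simp add: distrib_right)
    finally have 1: "1 + norm x \<le> (2 + 4 / c) * exp ((c / 4) * (norm x)\<^sup>2)" by simp
    have 2: "gauss S x \<le> exp (- (c / 2) * (norm x)\<^sup>2)"
      using c(2)[of x] by (simp add: gauss_def)
    have "(1 + norm x) * gauss S x \<le> (2 + 4 / c) * exp ((c / 4) * (norm x)\<^sup>2) * exp (- (c / 2) * (norm x)\<^sup>2)"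
      by (intro mult_mono 1 2) (use c in \<open>auto intro: less_imp_le gauss_pos\<close>)
    also have "\<dots> = (2 + 4 / c) * exp (- (c / 4) * (norm x)\<^sup>2)"
      by (simp add: exp_add[symmetric] mult.assoc)
    finally show "(1 + norm x) * gauss S x \<le> (2 + 4 / c) * exp (- (c / 4) * (norm x)\<^sup>2)" .
  qed
qed

lemma gauss_integrable:
  assumes "pos_def (S :: real^'n^'n)"
  shows "integrable lborel (\<lambda>x. (1 + norm x) * gauss S x)" "integrable lborel (gauss S)"
proof -
  obtain c B where c: "0 < c" "\<And>x. (1 + norm x) * gauss S x \<le> B * exp (- c * (norm x)\<^sup>2)" "0 \<le> B"
    using norm_mult_gauss_bound[OF assms] by blast
  show 1: "integrable lborel (\<lambda>x. (1 + norm x) * gauss S x)"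
    by (rule Bochner_Integration.integrable_bound[OF integrable_mult_right[OF integrable_exp_norm_square[OF
        c(1)], of B]])
      (use c gauss_pos[of S] in \<open>auto simp: abs_mult less_imp_le\<close>)
  show "integrable lborel (gauss S)"
    by (rule Bochner_Integration.integrable_bound[OF 1])
      (use gauss_pos[of S] in \<open>auto simp: abs_mult less_imp_le algebra_simps\<close>)
qed

lemma gauss_integral_pos:
  assumes "pos_def (S :: real^'n^'n)" shows "0 < (\<integral>x. gauss S x \<partial>lborel)"
proof -
  have "(\<integral>x. gauss S x \<partial>lborel) \<noteq> 0"
  proof
    assume "(\<integral>x. gauss S x \<partial>lborel) = 0"
    then have "AE x in lborel. gauss S x = 0"
      using integral_nonneg_eq_0_iff_AE[OF gauss_integrable(2)[OF assms] AE_I2[OF less_imp_le[OF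
          gauss_pos]]] by simp
    then have "AE x in (lborel :: (real^'n) measure). False"
      by (rule eventually_mono) (use gauss_pos[of S] in \<open>metis less_irrefl\<close>)
    then show False by (simp add: eventually_False ae_filter_eq_bot_iff emeasure_lborel_UNIV)
  qed
  moreover have "0 \<le> (\<integral>x. gauss S x \<partial>lborel)" by (intro Bochner_Integration.integral_nonneg) (simp add:
      gauss_pos less_imp_le)
  ultimately show ?thesis by simp
qed

lemma gauss_deriv:
  assumes "transpose S = S"
  shows "((\<lambda>u. gauss S (x + u *\<^sub>R v)) has_real_derivative - (x \<bullet> (S *v v)) * gauss S x) (at 0)"
proof -
  have sym: "v \<bullet> (S *v x) = x \<bullet> (S *v v)"
    by (metis assms dot_lmul_matrix inner_commute transpose_matrix_vector)
  have "(x + u *\<^sub>R v) \<bullet> (S *v (x + u *\<^sub>R v)) = x \<bullet> (S *v x) + 2 * u * (x \<bullet> (S *v v)) + u\<^sup>2 * (v \<bullet> (S *v v))"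
      for u
    by (simp add: matrix_vector_right_distrib linear_scale[OF matrix_vector_mul_linear] inner_add_left
        inner_add_right sym power2_eq_square algebra_simps)
  then have e: "(\<lambda>u. gauss S (x + u *\<^sub>R v)) = (\<lambda>u. exp (- (x \<bullet> (S *v x) + 2 * u * (x \<bullet> (S *v v)) + u\<^sup>2 * (v
      \<bullet> (S *v v))) / 2))"
    by (simp add: gauss_def)
  show ?thesis unfolding e by (auto intro!: derivative_eq_intros simp: gauss_def)
qed

lemma symmetric_inner:
  assumes "transpose S = (S :: real^'n^'n)"
  shows "(S *v x) \<bullet> y = x \<bullet> (S *v y)"
  by (metis assms dot_lmul_matrix transpose_matrix_vector)

text \<open>As a function of a scaling \<open>s\<close> of the frequency, the integral
  \<open>F\<close> satisfies \<open>F' = - s ?q F\<close>. The integration by parts is in the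
  direction \<open>\<eta>\<close> with \<open>S \<eta> = \<xi>\<close>, which makes the derivative
  of the Gaussian produce exactly the factor \<open>\<xi> \<bullet> x\<close>.\<close>

lemma gauss_cos_integral:
  fixes S R :: "real^'n^'n"
  assumes S: "pos_def S" and inv: "S ** R = mat 1"
  shows "(\<integral>x. gauss S x * cos (\<xi> \<bullet> x) \<partial>lborel) = (\<integral>x. gauss S x \<partial>lborel) * exp (- (\<xi> \<bullet> (R *v \<xi>)) / 2)"
proof -
  have sym: "transpose S = S" using S by (simp add: pos_def_def)
  let ?q = "\<xi> \<bullet> (R *v \<xi>)"
  define \<eta> where "\<eta> = R *v \<xi>"
  have S\<eta>: "S *v \<eta> = \<xi>" using inv by (simp add: \<eta>_def matrix_vector_mul_assoc)
  define F where "F s = (\<integral>x. gauss S x * cos (s * (\<xi> \<bullet> x)) \<partial>lborel)" for s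
  note gi = gauss_integrable[OF S]
  have bnd: "\<bar>\<xi> \<bullet> x\<bar> * gauss S x \<le> norm \<xi> * ((1 + norm x) * gauss S x)" for x
  proof -
    have "\<bar>\<xi> \<bullet> x\<bar> \<le> norm \<xi> * (1 + norm x)"
      using Cauchy_Schwarz_ineq2[of \<xi> x] by (simp add: distrib_left add_increasing)
    then show ?thesis using gauss_pos[of S x] by (simp add: mult.assoc[symmetric] mult_right_mono)
  qed
  have i1: "integrable lborel (\<lambda>x. gauss S x * (\<xi> \<bullet> x) * f x)" if "\<And>x. \<bar>f x\<bar>
      \<le> 1" "f \<in> borel_measurable borel" for f
  proof (rule Bochner_Integration.integrable_bound[OF integrable_mult_right[OF gi(1), of "norm \<xi>"]])
    show "AE x in lborel. norm (gauss S x * (\<xi> \<bullet> x) * f x) \<le> norm (norm \<xi> * ((1 + norm x) * gauss S x))"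
    proof (rule AE_I2)
      fix x
      have "\<bar>gauss S x * (\<xi> \<bullet> x)\<bar> * \<bar>f x\<bar> \<le> \<bar>gauss S x * (\<xi> \<bullet> x)\<bar> * 1"
        by (intro mult_left_mono that) simp
      also have "\<dots> \<le> norm \<xi> * ((1 + norm x) * gauss S x)"
        using bnd[of x] gauss_pos[of S x] by (simp add: abs_mult mult.commute)
      finally show "norm (gauss S x * (\<xi> \<bullet> x) * f x) \<le> norm (norm \<xi> * ((1 + norm x) * gauss S x))"
        using gauss_pos[of S x] by (simp add: abs_mult)
    qed
  qed (use that in simp)
  have i0: "integrable lborel (\<lambda>x. gauss S x * f x)" if "\<And>x. \<bar>f x\<bar> \<le> 1" "f \<in> borel_measurable borel" for f
    by (rule Bochner_Integration.integrable_bound[OF gi(2)])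
      (use that gauss_pos[of S] in \<open>auto simp: abs_mult intro!: mult_left_le\<close>)
  have dF: "(F has_real_derivative (\<integral>x. - (gauss S x * (\<xi> \<bullet> x) * sin (s * (\<xi> \<bullet> x))) \<partial>lborel)) (at s)" for s
    unfolding F_def
  proof (rule has_real_derivative_integral[where e = 1 and w = "\<lambda>x. norm \<xi> * ((1 + norm x) * gauss S x)"])
    fix t x
    show "((\<lambda>s. gauss S x * cos (s * (\<xi> \<bullet> x))) has_real_derivative - (gauss S x * (\<xi> \<bullet> x) * sin (t * (\<xi> \<bullet>
        x)))) (at t)"
      by (auto intro!: derivative_eq_intros)
    have "\<bar>gauss S x * (\<xi> \<bullet> x) * sin (t * (\<xi> \<bullet> x))\<bar> \<le> \<bar>gauss S x * (\<xi> \<bullet> x)\<bar> * 1"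
      unfolding abs_mult by (intro mult_mono) auto
    also have "\<dots> \<le> norm \<xi> * ((1 + norm x) * gauss S x)"
      using bnd[of x] gauss_pos[of S x] by (simp add: abs_mult mult.commute)
    finally show "\<bar>- (gauss S x * (\<xi> \<bullet> x) * sin (t * (\<xi> \<bullet> x)))\<bar> \<le> norm \<xi> * ((1 + norm x) * gauss S x)" by simp
  qed (use gi in \<open>auto intro!: i0\<close>)
  have ibp: "(\<integral>x. - (gauss S x * (\<xi> \<bullet> x) * sin (s * (\<xi> \<bullet> x))) \<partial>lborel) = - (s * ?q * F s)" for s
  proof -
    let ?F' = "\<lambda>x. - (gauss S x * (\<xi> \<bullet> x) * sin (s * (\<xi> \<bullet> x))) + s * ?q * (gauss S x * cos (s * (\<xi> \<bullet> x)))"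
    have i: "integrable lborel (\<lambda>x. gauss S x * (\<xi> \<bullet> x) * sin (s * (\<xi> \<bullet> x)))" "integrable lborel (\<lambda>x. gauss
        S x * cos (s * (\<xi> \<bullet> x)))"
      by (auto intro!: i0 i1)
    have "(\<integral>x. ?F' x \<partial>lborel) = 0"
    proof (rule integral_directional_derivative_zero[where v = \<eta>])
      show "integrable lborel (\<lambda>x. gauss S x * sin (s * (\<xi> \<bullet> x)))" by (auto intro!: i0)
      show "integrable lborel ?F'" using i by auto
      show "continuous_on UNIV ?F'" by (intro continuous_intros continuous_on_subset[OF gauss_continuous]) auto
      fix x
      have s: "((\<lambda>u. sin (s * (\<xi> \<bullet> (x + u *\<^sub>R \<eta>)))) has_real_derivative s * ?q * cos (s * (\<xi> \<bullet> x))) (at 0)"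
        by (auto intro!: derivative_eq_intros simp: inner_add_right \<eta>_def)
      have "x \<bullet> (S *v \<eta>) = \<xi> \<bullet> x" by (simp add: S\<eta> inner_commute)
      with DERIV_mult[OF gauss_deriv[OF sym, of x \<eta>] s]
      show "((\<lambda>u. gauss S (x + u *\<^sub>R \<eta>) * sin (s * (\<xi> \<bullet> (x + u *\<^sub>R \<eta>)))) has_real_derivative ?F' x) (at 0)"
        by (simp add: mult_ac)
    qed
    then show ?thesis using i by (simp add: F_def)
  qed
  define H where "H s = F s * exp (s\<^sup>2 * ?q / 2)" for s
  have "(H has_real_derivative 0) (at s)" for s
  proof -
    have "(F has_real_derivative - (s * ?q * F s)) (at s)" using dF[of s] ibp[of s] by simp
    then show ?thesis unfolding H_def by (auto intro!: derivative_eq_intros)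
  qed
  then have "H 1 = H 0" using DERIV_isconst_all by metis
  then have "F 1 * exp (?q / 2) = F 0" by (simp add: H_def)
  then have "F 1 = F 0 * exp (- (?q / 2))" by (simp add: exp_minus field_simps)
  then show ?thesis by (simp add: F_def)
qed

lemma gauss_even: "gauss S (- x) = gauss S x"
  by (simp add: gauss_def linear_neg[OF matrix_vector_mul_linear])

lemma integral_affine:
  fixes f :: "'a::euclidean_space \<Rightarrow> real"
  assumes [measurable]: "f \<in> borel_measurable borel" and c: "c \<noteq> 0"
  shows "(\<integral>x. f x \<partial>lborel) = \<bar>c\<bar> ^ DIM('a) * (\<integral>x. f (t + c *\<^sub>R x) \<partial>lborel)"
proof -
  have "(\<integral>x. f x \<partial>lborel) = (\<integral>x. f x \<partial>density (distr lborel borel (\<lambda>x. t + c *\<^sub>R x)) (\<lambda>_. \<bar>c\<bar> ^ DIM('a)))"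
    using lborel_affine[OF c, of t] by simp
  also have "\<dots> = (\<integral>x. \<bar>c\<bar> ^ DIM('a) *\<^sub>R f x \<partial>distr lborel borel (\<lambda>x. t + c *\<^sub>R x))"
    using integral_density[of f "distr lborel borel (\<lambda>x. t + c *\<^sub>R x)" "\<lambda>_. \<bar>c\<bar> ^ DIM('a)"]
        by (simp add: ennreal_power)
  also have "\<dots> = (\<integral>x. \<bar>c\<bar> ^ DIM('a) *\<^sub>R f (t + c *\<^sub>R x) \<partial>lborel)"
    by (rule integral_distr) auto
  finally show ?thesis by simp
qed

text \<open>Supplies the hypothesis of Fubini for a product of integrable functions coupled by a
  bounded factor.\<close>

lemma integrable_prod_bounded:
  fixes f :: "'a::euclidean_space \<Rightarrow> real" and g :: "'b::euclidean_space \<Rightarrow> real"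
  assumes f: "integrable lborel f" and g: "integrable lborel g"
    and b[measurable]: "(\<lambda>(x, y). b x y) \<in> borel_measurable (borel \<Otimes>\<^sub>M borel)" and le: "\<And>x y. \<bar>b x y\<bar> \<le> B"
  shows "integrable (lborel \<Otimes>\<^sub>M lborel) (\<lambda>(x, y). f x * g y * b x y)"
proof -
  have [measurable]: "f \<in> borel_measurable borel" "g \<in> borel_measurable borel" using f g by auto
  have "integrable (lborel \<Otimes>\<^sub>M lborel) (\<lambda>(x, y). f x * g y)"
    by (rule lborel_pair.Fubini_integrable) (use f g in \<open>auto simp: abs_mult\<close>)
  then have "integrable (lborel \<Otimes>\<^sub>M lborel) (\<lambda>p. B * (case p of (x, y) \<Rightarrow> f x * g y))"
    by (rule integrable_mult_right)
  then show ?thesis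
  proof (rule Bochner_Integration.integrable_bound)
    show "AE p in lborel \<Otimes>\<^sub>M lborel. norm (case p of (x, y) \<Rightarrow> f x * g y * b x y)
        \<le> norm (B * (case p of (x, y) \<Rightarrow> f x * g y))"
    proof (intro AE_I2, clarify)
      fix x y
      have "\<bar>f x * g y\<bar> * \<bar>b x y\<bar> \<le> \<bar>f x * g y\<bar> * \<bar>B\<bar>"
        using le[of x y] by (intro mult_left_mono) auto
      then show "norm (f x * g y * b x y) \<le> norm (B * (f x * g y))" by (simp add: abs_mult mult_ac)
    qed
  qed measurable
qed

lemma pos_def_mat_1: "pos_def (mat 1 :: real^'n^'n)"
  by (auto simp: pos_def_def transpose_mat)

text \<open>A Gaussian is itself a superposition of cosines, so every Gaussian average of
  \<open>g\<close> vanishes. Fubini moves the averaging onto a test function, where shrinking its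
  width recovers that function. The phase \<open>\<theta>\<close> makes cosines alone carry the
  information of sines as well.\<close>

lemma fourier_uniqueness:
  fixes g :: "real^'n \<Rightarrow> real"
  assumes g: "integrable lborel g" and z: "\<And>\<xi> \<theta>. (\<integral>x. g x * cos (\<xi> \<bullet> x + \<theta>) \<partial>lborel) = 0"
  shows "AE x in lborel. g x = 0"
proof (rule fundamental_lemma)
  have [measurable]: "g \<in> borel_measurable borel" using g by auto
  show "locally_integrable g"
    unfolding locally_integrable_def set_integrable_def
    using g by (auto intro!: integrable_mult_indicator simp: compact_imp_closed simp del: real_scaleR_def)
  let ?G = "gauss (mat 1 :: real^'n^'n)"
  let ?Z = "\<integral>x. ?G x \<partial>lborel"
  note G = gauss_integrable(2)[OF pos_def_mat_1[where 'n='n]] and Zpos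
      = gauss_integral_pos[OF pos_def_mat_1[where 'n='n]]
  have conv: "(\<integral>x. g x * ?G (\<sigma> *\<^sub>R (x - y)) \<partial>lborel) = 0" for \<sigma> y
  proof -
    have "?Z * ?G (\<sigma> *\<^sub>R (x - y)) = (\<integral>\<xi>. ?G \<xi> * cos ((\<sigma> *\<^sub>R (x - y)) \<bullet> \<xi>) \<partial>lborel)" for x
      using gauss_cos_integral[OF pos_def_mat_1, of "mat 1" "\<sigma> *\<^sub>R (x - y)"] by (simp add: gauss_def)
    then have "?Z * (\<integral>x. g x * ?G (\<sigma> *\<^sub>R (x - y)) \<partial>lborel)
        = (\<integral>x. \<integral>\<xi>. g x * ?G \<xi> * cos ((\<sigma> *\<^sub>R (x - y)) \<bullet> \<xi>) \<partial>lborel \<partial>lborel)"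
      by (simp add: mult.assoc integral_mult_right_zero[symmetric] mult.left_commute[of ?Z] del:
          integral_mult_right_zero)
    also have "\<dots> = (\<integral>\<xi>. \<integral>x. g x * ?G \<xi> * cos ((\<sigma> *\<^sub>R (x - y)) \<bullet> \<xi>) \<partial>lborel \<partial>lborel)"
      by (rule lborel_pair.Fubini_integral[symmetric]) (rule integrable_prod_bounded[OF g G, where B = 1]; simp)
    also have "\<dots> = (\<integral>\<xi>. \<integral>x. ?G \<xi> * (g x * cos ((\<sigma> *\<^sub>R \<xi>) \<bullet> x + (- \<sigma> * (y \<bullet> \<xi>)))) \<partial>lborel \<partial>lborel)"
      by (simp add: inner_diff_left inner_commute algebra_simps)
    also have "\<dots> = (\<integral>\<xi>. ?G \<xi> * (\<integral>x. g x * cos ((\<sigma> *\<^sub>R \<xi>) \<bullet> x + (- \<sigma> * (y \<bullet> \<xi>))) \<partial>lborel) \<partial>lborel)"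
      by simp
    also have "\<dots> = 0" unfolding z by simp
    finally show ?thesis using Zpos by simp
  qed
  fix \<phi> :: "real^'n \<Rightarrow> real" assume \<phi>: "test_function \<phi>"
  note [measurable] = test_function_measurable[OF \<phi>]
  obtain B S where B: "0 \<le> B" "compact S" "\<And>x. \<bar>\<phi> x\<bar> \<le> B * indicator S x"
    using test_function_bounded[OF \<phi>] by blast
  have B': "\<bar>\<phi> x\<bar> \<le> B" for x using B(1) B(3)[of x] by (cases "x \<in> S") auto
  have i\<phi>: "integrable lborel \<phi>"
  proof -
    have "locally_integrable (\<lambda>x :: real^'n. 1 :: real)"
      unfolding locally_integrable_def set_integrable_def
      using emeasure_compact_finite by (auto intro!: integrable_real_indicator simp: compact_imp_closed)
    from test_function_mult_integrable[OF \<phi> this] show ?thesis by simp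
  qed
  have G1: "\<bar>?G z\<bar> \<le> 1" for z by (simp add: gauss_def)
  have zero: "(\<integral>x. g x * (\<integral>w. \<phi> (x + (1 / \<sigma>) *\<^sub>R w) * ?G w \<partial>lborel) \<partial>lborel) = 0" if s: "0 < \<sigma>" for \<sigma>
  proof -
    have "0 = (\<integral>y. \<phi> y * (\<integral>x. g x * ?G (\<sigma> *\<^sub>R (x - y)) \<partial>lborel) \<partial>lborel)" by (simp add: conv)
    also have "\<dots> = (\<integral>y. (\<integral>x. \<phi> y * (g x * ?G (\<sigma> *\<^sub>R (x - y))) \<partial>lborel) \<partial>lborel)" by simp
    also have "\<dots> = (\<integral>y. (\<integral>x. g x * \<phi> y * ?G (\<sigma> *\<^sub>R (x - y)) \<partial>lborel) \<partial>lborel)"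
      by (simp only: mult_ac)
    also have "\<dots> = (\<integral>x. (\<integral>y. g x * \<phi> y * ?G (\<sigma> *\<^sub>R (x - y)) \<partial>lborel) \<partial>lborel)"
      by (rule lborel_pair.Fubini_integral, rule integrable_prod_bounded[OF g i\<phi>, where B = 1])
        (use gauss_measurable in measurable, rule G1)
    also have "\<dots> = (\<integral>x. g x * (\<bar>1 / \<sigma>\<bar> ^ CARD('n) * (\<integral>w. \<phi> (x + (1 / \<sigma>) *\<^sub>R w) * ?G w \<partial>lborel)) \<partial>lborel)"
    proof (rule Bochner_Integration.integral_cong[OF refl])
      fix x :: "real^'n"
      have "(\<integral>y. \<phi> y * ?G (\<sigma> *\<^sub>R (x - y)) \<partial>lborel)
        = \<bar>1 / \<sigma>\<bar> ^ CARD('n) * (\<integral>w. \<phi> (x + (1 / \<sigma>) *\<^sub>R w) * ?G (\<sigma> *\<^sub>R (x - (x + (1 / \<sigma>) *\<^sub>R w))) \<partial>lborel)"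
        using integral_affine[of "\<lambda>y. \<phi> y * ?G (\<sigma> *\<^sub>R (x - y))" "1 / \<sigma>" x] s by simp
      also have "(\<lambda>w. ?G (\<sigma> *\<^sub>R (x - (x + (1 / \<sigma>) *\<^sub>R w)))) = ?G"
        using s by (simp add: fun_eq_iff gauss_even)
      finally show "(\<integral>y. g x * \<phi> y * ?G (\<sigma> *\<^sub>R (x - y)) \<partial>lborel)
          = g x * (\<bar>1 / \<sigma>\<bar> ^ CARD('n) * (\<integral>w. \<phi> (x + (1 / \<sigma>) *\<^sub>R w) * ?G w \<partial>lborel))"
        by (simp add: mult.assoc fun_eq_iff)
    qed
    also have "\<dots> = \<bar>1 / \<sigma>\<bar> ^ CARD('n) * (\<integral>x. g x * (\<integral>w. \<phi> (x + (1 / \<sigma>) *\<^sub>R w) * ?G w \<partial>lborel) \<partial>lborel)"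
      by (simp only: mult.left_commute[of "g _"] integral_mult_right_zero)
    finally show ?thesis using s by simp
  qed
  \<comment> \<open>The averages of \<open>\<phi>\<close> at width \<open>1 / (m + 1)\<close>, left
    unnormalised; their limit is \<open>\<phi> x\<close> times the total mass
    \<open>?Z\<close>.\<close>
  let ?A = "\<lambda>m x. \<integral>w. \<phi> (x + (1 / real (Suc m)) *\<^sub>R w) * ?G w \<partial>lborel"
  have bw: "\<bar>\<phi> y * ?G w\<bar> \<le> B * ?G w" for y w
    using B'[of y] gauss_pos[of "mat 1" w] by (simp add: abs_mult)
  have Alim: "(\<lambda>m. ?A m x) \<longlonglongrightarrow> (\<integral>w. \<phi> x * ?G w \<partial>lborel)" for x
  proof (rule integral_dominated_convergence[where w = "\<lambda>w. B * ?G w"])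
    show "AE w in lborel. (\<lambda>m. \<phi> (x + (1 / real (Suc m)) *\<^sub>R w) * ?G w) \<longlonglongrightarrow> \<phi> x * ?G w"
    proof (intro AE_I2 tendsto_mult tendsto_const)
      fix w :: "real^'n"
      have "(\<lambda>m. x + (1 / real (Suc m)) *\<^sub>R w) \<longlonglongrightarrow> x + 0 *\<^sub>R w"
        using LIMSEQ_Suc[OF lim_inverse_n'] by (intro tendsto_intros)
      then show "(\<lambda>m. \<phi> (x + (1 / real (Suc m)) *\<^sub>R w)) \<longlonglongrightarrow> \<phi> x"
        using continuous_on_tendsto_compose[OF test_function_continuous[OF \<phi>]] by force
    qed
  qed (use bw G in auto)
  have Abd: "\<bar>?A m x\<bar> \<le> B * ?Z" for m x
  proof -
    have "\<bar>?A m x\<bar> \<le> (\<integral>w. B * ?G w \<partial>lborel)"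
      by (rule order_trans[OF integral_abs_bound integral_mono'])
        (use bw G B in \<open>auto intro!: mult_nonneg_nonneg less_imp_le[OF gauss_pos]\<close>)
    then show ?thesis by simp
  qed
  have "(\<lambda>m. \<integral>x. g x * ?A m x \<partial>lborel) \<longlonglongrightarrow> (\<integral>x. g x * (\<integral>w. \<phi> x * ?G w \<partial>lborel) \<partial>lborel)"
  proof (rule integral_dominated_convergence[where w = "\<lambda>x. \<bar>g x\<bar> * (B * ?Z)"])
    show "AE x in lborel. norm (g x * ?A m x) \<le> \<bar>g x\<bar> * (B * ?Z)" for m
      unfolding real_norm_def abs_mult by (intro AE_I2 mult_left_mono Abd) auto
    show "AE x in lborel. (\<lambda>m. g x * ?A m x) \<longlonglongrightarrow> g x * (\<integral>w. \<phi> x * ?G w \<partial>lborel)"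
      by (intro AE_I2 tendsto_mult tendsto_const Alim)
  qed (use g in \<open>auto simp del: of_nat_Suc\<close>)
  moreover have "(\<integral>x. g x * ?A m x \<partial>lborel) = 0" for m
    by (rule zero) simp
  ultimately have "(\<integral>x. g x * (\<integral>w. \<phi> x * ?G w \<partial>lborel) \<partial>lborel) = 0"
    by (simp only: LIMSEQ_const_iff)
  then have "(\<integral>x. (\<phi> x * g x) * ?Z \<partial>lborel) = 0"
    by (simp only: integral_mult_right_zero mult_ac)
  then have "(\<integral>x. \<phi> x * g x \<partial>lborel) * ?Z = 0"
    by (simp only: integral_mult_left_zero)
  then show "(\<integral>x. \<phi> x *\<^sub>R g x \<partial>lborel) = 0" using Zpos by simp
qed

lemma flat_bound: "\<bar>flat j s\<bar> \<le> fact j"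
proof (cases "0 < s")
  case True
  have "(1 / s) ^ j \<le> fact j * exp (1 / s)" by (rule power_le_fact_exp) (use True in simp)
  then show ?thesis using True by (simp add: flat_def exp_minus divide_inverse[symmetric] pos_divide_le_eq)
qed (simp add: flat_def)

section \<open>Duality with backward solutions\<close>

text \<open>The logarithm makes the gradient decay like \<open>1 / (R \<bar>x\<bar>)\<close>, which compensates the linear growth
  of the drift \<open>C x\<close>.\<close>
definition cutoff :: "real \<Rightarrow> real^'n \<Rightarrow> real" where
  "cutoff R x = flat 0 (1 - ln (1 + x \<bullet> x) / R)"

definition cutoff_grad :: "real \<Rightarrow> real^'n \<Rightarrow> real^'n" where
  "cutoff_grad R x = (flat 2 (1 - ln (1 + x \<bullet> x) / R) * (- 2 / (R * (1 + x \<bullet> x)))) *\<^sub>R x"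

text \<open>The derivative of \<open>cutoff_grad\<close> in the direction \<open>v\<close>. The
  combination of \<open>flat 4\<close> and \<open>flat 3\<close> is the derivative of
  \<open>flat 2\<close>, as \<open>flat 2\<close> was that of \<open>flat 0\<close>.\<close>

definition cutoff_hess :: "real \<Rightarrow> real^'n \<Rightarrow> real^'n \<Rightarrow> real^'n" where
  "cutoff_hess R x v =
     ((flat 4 (1 - ln (1 + x \<bullet> x) / R) - 2 * flat 3 (1 - ln (1 + x \<bullet> x) / R)) * (4 * (x \<bullet> v) / (R * (1 + x \<bullet>
         x))\<^sup>2)
      + flat 2 (1 - ln (1 + x \<bullet> x) / R) * (4 * (x \<bullet> v) / (R * (1 + x \<bullet> x)\<^sup>2))) *\<^sub>R x
     + (flat 2 (1 - ln (1 + x \<bullet> x) / R) * (- 2 / (R * (1 + x \<bullet> x)))) *\<^sub>R v"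

lemma one_plus_inner_pos: "0 < 1 + x \<bullet> (x :: 'a::real_inner)"
  by (simp add: add_pos_nonneg)

context
  fixes R :: real assumes R: "1 \<le> R"
begin

lemma cutoff_arg_deriv:
  fixes x :: "real^'n"
  shows "((\<lambda>x. 1 - ln (1 + x \<bullet> x) / R) has_derivative (\<lambda>v. - (2 * (x \<bullet> v) / (R * (1 + x \<bullet> x))))) (at x)"
  using one_plus_inner_pos[of x] R
  by (auto intro!: derivative_eq_intros simp: fun_eq_iff inner_commute divide_simps)

lemma flat_arg_deriv:
  fixes x :: "real^'n"
  shows "((\<lambda>x. flat j (1 - ln (1 + x \<bullet> x) / R)) has_derivative
    (\<lambda>v. (flat (j + 2) (1 - ln (1 + x \<bullet> x) / R) - j * flat (j + 1) (1 - ln (1 + x \<bullet> x) / R)) * - (2 * (x \<bullet>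
        v) / (R * (1 + x \<bullet> x))))) (at x)"
  using diff_chain_at[OF cutoff_arg_deriv[of x] flat_deriv[unfolded has_field_derivative_def, of j]]
  by (simp add: o_def)

lemma cutoff_deriv: "(cutoff R has_derivative (\<lambda>v. cutoff_grad R x \<bullet> v)) (at (x :: real^'n))"
proof -
  have "(\<lambda>v. cutoff_grad R x \<bullet> v) = (\<lambda>v. (flat (0 + 2) (1 - ln (1 + x \<bullet> x) / R) - (0::nat) * flat (0 + 1) (1
      - ln (1 + x \<bullet> x) / R)) * - (2 * (x \<bullet> v) / (R * (1 + x \<bullet> x))))"
    by (simp add: cutoff_grad_def fun_eq_iff numeral_2_eq_2)
  then show ?thesis unfolding cutoff_def[abs_def] using flat_arg_deriv[of 0 x] by metis
qed

lemma cutoff_grad_deriv: "(cutoff_grad R has_derivative cutoff_hess R x) (at (x :: real^'n))"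
proof -
  note p = one_plus_inner_pos[of x]
  have 1: "((\<lambda>x :: real^'n. - 2 / (R * (1 + x \<bullet> x))) has_derivative (\<lambda>v. 4 * (x \<bullet> v) / (R * (1 + x \<bullet> x)\<^sup>2)))
      (at x)"
  proof -
    define c where "c = - 2 / R"
    have "((\<lambda>x :: real^'n. c * inverse (1 + x \<bullet> x)) has_derivative (\<lambda>v. c * - (inverse (1 + x \<bullet> x) * (x \<bullet> v
        + v \<bullet> x) * inverse (1 + x \<bullet> x)))) (at x)"
      using p by (auto intro!: derivative_eq_intros)
    note this[unfolded c_def]
    moreover have "(\<lambda>v. (- 2 / R) * - (inverse (1 + x \<bullet> x) * (x \<bullet> v + v \<bullet> x) * inverse (1 + x \<bullet> x)))
        = (\<lambda>v. 4 * (x \<bullet> v) / (R * (1 + x \<bullet> x)\<^sup>2))"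
      by (simp add: fun_eq_iff inner_commute divide_inverse power2_eq_square mult_ac)
    moreover have "(\<lambda>x :: real^'n. (- 2 / R) * inverse (1 + x \<bullet> x)) = (\<lambda>x. - 2 / (R * (1 + x \<bullet> x)))"
      by (simp add: fun_eq_iff divide_inverse mult_ac)
    ultimately show ?thesis by simp
  qed
  have n: "2 + 2 = (4::nat)" "2 + 1 = (3::nat)" by simp_all
  from has_derivative_scaleR[OF has_derivative_mult[OF flat_arg_deriv[of 2 x, unfolded n] 1]
      has_derivative_ident]
  show ?thesis
    unfolding cutoff_grad_def[abs_def]
    by (rule has_derivative_eq_rhs)
      (simp add: cutoff_hess_def fun_eq_iff power2_eq_square algebra_simps diff_divide_distrib)
qed

lemma flat_arg_continuous: "continuous_on UNIV (\<lambda>x :: real^'n. flat j (1 - ln (1 + x \<bullet> x) / R))"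
  by (rule has_derivative_continuous_on) (rule has_derivative_at_withinI[OF flat_arg_deriv])

lemma cutoff_continuous: "continuous_on UNIV (cutoff R :: real^'n \<Rightarrow> real)"
  unfolding cutoff_def[abs_def] by (rule flat_arg_continuous)

lemma cutoff_grad_continuous: "continuous_on UNIV (cutoff_grad R :: real^'n \<Rightarrow> real^'n)"
  by (rule has_derivative_continuous_on) (rule has_derivative_at_withinI[OF cutoff_grad_deriv])

lemma cutoff_hess_continuous: "continuous_on UNIV (\<lambda>x :: real^'n. cutoff_hess R x v)"
proof -
  have "R * (1 + x \<bullet> x) \<noteq> 0" "1 + x \<bullet> x \<noteq> 0" for x :: "real^'n"
    using one_plus_inner_pos[of x] R by auto
  then show ?thesis unfolding cutoff_hess_def
    by (intro continuous_intros flat_arg_continuous) auto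
qed

lemma cutoff_support:
  assumes "cutoff R (x :: real^'n) \<noteq> 0 \<or> cutoff_grad R x \<noteq> 0" shows "x \<in> cball 0 (exp R)"
proof -
  have "0 < 1 - ln (1 + x \<bullet> x) / R" using assms by (auto simp: cutoff_def cutoff_grad_def flat_def split:
      if_splits)
  then have "ln (1 + x \<bullet> x) < R" using R by (simp add: divide_less_eq)
  then have "1 + x \<bullet> x < exp R" using one_plus_inner_pos[of x] by (metis exp_less_cancel_iff exp_ln)
  then have "(norm x)\<^sup>2 < exp R" by (simp add: dot_square_norm)
  also have "\<dots> \<le> (exp R)\<^sup>2" using R by (simp add: power2_eq_square)
  finally have "norm x < exp R" by (rule power_less_imp_less_base) simp
  then show ?thesis by simp
qed

lemma norm_div_one_plus_inner:
  fixes x :: "'a::real_inner"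
  shows "2 * norm x / (1 + x \<bullet> x) \<le> 1" "norm x * norm x / (1 + x \<bullet> x) \<le> 1"
proof -
  have "0 \<le> (norm x - 1)\<^sup>2" by simp
  then have "2 * norm x \<le> 1 + x \<bullet> x" by (simp add: dot_square_norm power2_eq_square algebra_simps)
  then show "2 * norm x / (1 + x \<bullet> x) \<le> 1" using one_plus_inner_pos[of x] by simp
  have "norm x * norm x \<le> 1 + x \<bullet> x" by (simp add: dot_square_norm power2_eq_square)
  then show "norm x * norm x / (1 + x \<bullet> x) \<le> 1" using one_plus_inner_pos[of x] by simp
qed

lemma cutoff_bound: "0 \<le> cutoff R x" "cutoff R x \<le> 1"
  by (simp_all add: cutoff_def flat0_range)

lemma cutoff_grad_bound:
  fixes x :: "real^'n"
  shows "norm (cutoff_grad R x) \<le> 2 / R" "norm x * norm (cutoff_grad R x) \<le> 4 / R"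
proof -
  let ?f = "flat 2 (1 - ln (1 + x \<bullet> x) / R)"
  note p = one_plus_inner_pos[of x]
  have e: "norm (cutoff_grad R x) = \<bar>?f\<bar> * (1 / R) * (2 * norm x / (1 + x \<bullet> x))"
    using R p by (simp add: cutoff_grad_def abs_mult)
  have f: "\<bar>?f\<bar> \<le> 2" using flat_bound[of 2] by (simp add: numeral_2_eq_2)
  have "\<bar>?f\<bar> * (1 / R) * (2 * norm x / (1 + x \<bullet> x)) \<le> 2 * (1 / R) * 1"
    using R p by (intro mult_mono f norm_div_one_plus_inner) auto
  then show "norm (cutoff_grad R x) \<le> 2 / R" by (simp add: e)
  have "\<bar>?f\<bar> * (1 / R) * (2 * (norm x * norm x / (1 + x \<bullet> x))) \<le> 2 * (1 / R) * (2 * 1)"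
    using R p by (intro mult_mono f norm_div_one_plus_inner) auto
  then show "norm x * norm (cutoff_grad R x) \<le> 4 / R" by (simp add: e mult_ac)
qed

lemma cutoff_hess_bound:
  fixes x v :: "real^'n"
  shows "norm (cutoff_hess R x v) \<le> 156 / R * norm v"
proof -
  let ?r = "1 - ln (1 + x \<bullet> x) / R"
  let ?p = "1 / (1 + x \<bullet> x)"
  have p: "0 < ?p" "?p \<le> 1" "norm x * norm x * ?p \<le> 1"
    using one_plus_inner_pos[of x] norm_div_one_plus_inner(2)[of x] by simp_all
  have f: "\<bar>flat 2 ?r\<bar> \<le> 2" "\<bar>flat 3 ?r\<bar> \<le> 6" "\<bar>flat 4 ?r\<bar> \<le> 24"
    using flat_bound[of 2 ?r] flat_bound[of 3 ?r] flat_bound[of 4 ?r] by (simp_all add: eval_nat_numeral)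
  \<comment> \<open>Since \<open>\<bar>flat j r\<bar>\<close> is at most \<open>fact j\<close>, this
    factor is at most \<open>24 + 2 * 6 + 2 = 38\<close>; the final constant is
    \<open>156 = 38 * 4 + 2 * 2\<close>.\<close>
  let ?A = "(flat 4 ?r - 2 * flat 3 ?r) / R + flat 2 ?r"
  have A: "\<bar>?A\<bar> \<le> 38"
  proof -
    have "\<bar>(flat 4 ?r - 2 * flat 3 ?r) / R\<bar> \<le> \<bar>flat 4 ?r - 2 * flat 3 ?r\<bar>"
      using R by (simp add: divide_le_eq mult_le_cancel_left1)
    then show ?thesis using f by linarith
  qed
  have e: "cutoff_hess R x v = (?A * (4 / R) * ?p * ?p * (x \<bullet> v)) *\<^sub>R x + (flat 2 ?r * (- 2 / R) * ?p) *\<^sub>R v"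
  proof -
    have e1: "a * (4 * w / (R * q)\<^sup>2) + b * (4 * w / (R * q\<^sup>2))
        = (a / R + b) * (4 / R) * (1 / q) * (1 / q) * w" for a b w q :: real
      by (simp only: divide_inverse power2_eq_square inverse_mult_distrib distrib_left distrib_right mult_ac
          mult_1_left)
    have e2: "b * (- 2 / (R * q)) = b * (- 2 / R) * (1 / q)" for b q :: real by simp
    show ?thesis unfolding cutoff_hess_def by (simp only: e1 e2)
  qed
  have n1: "norm ((?A * (4 / R) * ?p * ?p * (x \<bullet> v)) *\<^sub>R x) \<le> 38 * (4 / R) * norm v"
  proof -
    have "?p * (norm x * \<bar>x \<bullet> v\<bar>) \<le> ?p * (norm x * (norm x * norm v))"
      using p(1) Cauchy_Schwarz_ineq2[of x v] by (intro mult_left_mono) auto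
    also have "\<dots> = (norm x * norm x * ?p) * norm v" by (simp add: mult_ac)
    also have "\<dots> \<le> 1 * norm v" by (intro mult_right_mono p) auto
    finally have "?p * (norm x * \<bar>x \<bullet> v\<bar>) \<le> norm v" by simp
    then have b: "\<bar>?A\<bar> * (4 / R) * ?p * (?p * (norm x * \<bar>x \<bullet> v\<bar>)) \<le> 38 * (4 / R) * 1 * norm v"
      using R p A by (intro mult_mono) auto
    have q: "norm ((a * (4 / R) * ?p * ?p * (x \<bullet> v)) *\<^sub>R x)
        = \<bar>a\<bar> * (4 / R) * ?p * (?p * (norm x * \<bar>x \<bullet> v\<bar>))" for a
      using R one_plus_inner_pos[of x] by (simp add: abs_mult mult_ac)
    show ?thesis using b by (simp only: q mult_1_right)
  qed
  have n2: "norm ((flat 2 ?r * (- 2 / R) * ?p) *\<^sub>R v) \<le> 2 * (2 / R) * norm v"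
  proof -
    have "\<bar>flat 2 ?r\<bar> * (2 / R) * ?p * norm v \<le> 2 * (2 / R) * 1 * norm v"
      using R p f by (intro mult_mono) auto
    then show ?thesis using R one_plus_inner_pos[of x] by (simp add: abs_mult)
  qed
  have "norm (cutoff_hess R x v) \<le> 38 * (4 / R) * norm v + 2 * (2 / R) * norm v"
    unfolding e by (rule norm_triangle_le[OF add_mono[OF n1 n2]])
  also have "\<dots> = 156 / R * norm v" by (simp add: field_simps)
  finally show ?thesis .
qed

end

section \<open>The divergence theorem and the weak form of the equation\<close>

lemma integrable_continuous_compact_support:
  fixes f :: "real^'n \<Rightarrow> real"
  assumes "continuous_on UNIV f" "\<And>x. f x \<noteq> 0 \<Longrightarrow> x \<in> cball 0 r"
  shows "integrable lborel f"
proof -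
  have "compact (f ` cball 0 r)" by (intro compact_continuous_image continuous_on_subset[OF assms(1)]) auto
  then obtain B where B: "\<And>x. x \<in> cball 0 r \<Longrightarrow> \<bar>f x\<bar> \<le> B"
    using compact_imp_bounded bounded_iff by (metis imageI real_norm_def)
  have "integrable lborel (\<lambda>x. B * indicator (cball (0::real^'n) r) x)"
    using emeasure_compact_finite[of "cball (0::real^'n) r"]
        by (intro integrable_mult_right integrable_real_indicator) auto
  then show ?thesis
  proof (rule Bochner_Integration.integrable_bound)
    show "AE x in lborel. norm (f x) \<le> norm (B * indicator (cball (0::real^'n) r) x)"
    proof (rule AE_I2)
      fix x show "norm (f x) \<le> norm (B * indicator (cball (0::real^'n) r) x)"
        using assms(2)[of x] B[of x] by (cases "x \<in> cball 0 r") (auto split: if_splits simp del: mem_cball)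
    qed
  qed (use assms(1) borel_measurable_continuous_onI in simp)
qed

text \<open>Each diagonal entry of the derivative is a directional derivative of an integrable
  function and integrates to 0 on its own.\<close>

lemma divergence_theorem_compact_support:
  fixes H :: "real^'n \<Rightarrow> real^'n"
  assumes d: "\<And>x. (H has_derivative H' x) (at x)"
    and c: "\<And>i. continuous_on UNIV (\<lambda>x. H' x (axis i 1) $ i)"
    and supp: "\<And>x. H x \<noteq> 0 \<Longrightarrow> x \<in> cball 0 r"
  shows "(\<integral>x. (\<Sum>i\<in>UNIV. H' x (axis i 1) $ i) \<partial>lborel) = 0"
    "integrable lborel (\<lambda>x. \<Sum>i\<in>UNIV. H' x (axis i 1) $ i)"
proof -
  have supp': "x \<in> cball 0 r" if "H' x v \<noteq> 0" for x v
  proof (rule ccontr)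
    assume x: "x \<notin> cball 0 r"
    have "(H has_derivative (\<lambda>v. 0)) (at x)"
    proof (rule has_derivative_transform_within_open[of "\<lambda>x. 0" _ x UNIV "- cball 0 r"])
      show "\<And>y. y \<in> - cball 0 r \<Longrightarrow> 0 = H y" using supp by force
    qed (use x in auto)
    then have "H' x = (\<lambda>v. 0)" using d[of x] has_derivative_unique by blast
    then show False using that by simp
  qed
  have i: "integrable lborel (\<lambda>x. H' x (axis i 1) $ i)" for i
    by (rule integrable_continuous_compact_support[OF c]) (use supp'[of _ "axis i 1"] in force)
  have cH: "continuous_on UNIV H"
    by (rule has_derivative_continuous_on) (rule has_derivative_at_withinI[OF d])
  have z: "(\<integral>x. H' x (axis i 1) $ i \<partial>lborel) = 0" for i
  proof (rule integral_directional_derivative_zero[OF _ i c, where v = "axis i 1"])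
    show "integrable lborel (\<lambda>x. H x $ i)"
      by (rule integrable_continuous_compact_support) (use supp in \<open>auto intro!: continuous_intros cH simp
          del: mem_cball\<close>, force)
    fix x
    have "((H \<circ> (\<lambda>u. x + u *\<^sub>R axis i 1)) has_derivative (H' x \<circ> (\<lambda>u. u *\<^sub>R axis i 1))) (at 0)"
      by (rule diff_chain_at) (auto intro!: derivative_eq_intros d)
    from bounded_linear.has_derivative[OF bounded_linear_vec_nth this, of i]
    have "((\<lambda>u. H (x + u *\<^sub>R axis i 1) $ i) has_derivative (\<lambda>u. H' x (u *\<^sub>R axis i 1) $ i)) (at 0)"
      by (simp add: o_def)
    moreover have "(\<lambda>u. H' x (u *\<^sub>R axis i 1) $ i) = (*) (H' x (axis i 1) $ i)"
      using linear_scale[OF has_derivative_linear[OF d[of x]]] by (simp add: fun_eq_iff mult.commute)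
    ultimately show "((\<lambda>u. H (x + u *\<^sub>R axis i 1) $ i) has_real_derivative H' x (axis i 1) $ i) (at 0)"
      by (simp add: has_field_derivative_def)
  qed
  show "integrable lborel (\<lambda>x. \<Sum>i\<in>UNIV. H' x (axis i 1) $ i)" using i by auto
  show "(\<integral>x. (\<Sum>i\<in>UNIV. H' x (axis i 1) $ i) \<partial>lborel) = 0" using i z by simp
qed

lemma has_derivative_vec_nth_iff:
  fixes f :: "'a::real_normed_vector \<Rightarrow> real^'n"
  shows "(f has_derivative f') (at x) \<longleftrightarrow> (\<forall>i. ((\<lambda>x. f x $ i) has_derivative (\<lambda>v. f' v $ i)) (at x))"
  unfolding has_derivative_componentwise_within[of f] by (auto simp: Basis_vec_def inner_axis)

lemma trace_jacobian:
  assumes "(F has_derivative F') (at x)"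
  shows "divergence F x = (\<Sum>i\<in>UNIV. F' (axis i 1) $ i)"
proof -
  have "frechet_derivative F (at x) = F'" using frechet_derivative_at[OF assms] by simp
  then show ?thesis by (simp add: divergence_def jacobian_def trace_def matrix_def)
qed

lemma bounded_linear_matrix: "bounded_linear (\<lambda>v. (A :: real^'n^'m) *v v)"
  by (rule matrix_vector_mul_bounded_linear)

locale smooth_space_time =
  fixes f :: "real \<Rightarrow> real^'n \<Rightarrow> real"
  assumes smooth: "smooth_on ({0<..} \<times> UNIV) (\<lambda>(t, x). f t x)"
begin

text \<open>Derivatives of \<open>f\<close> as a function on space-time, in the form that smoothness
  provides with joint continuity. The direction \<open>(1, 0)\<close> is the time derivative and
  \<open>(0, v)\<close> a spatial one; \<open>P2\<close> iterates this.\<close>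

definition P1 :: "real \<times> (real^'n) \<Rightarrow> real \<times> (real^'n) \<Rightarrow> real" where
  "P1 v p = frechet_derivative (\<lambda>(t, x). f t x) (at p) v"

definition P2 :: "real \<times> (real^'n) \<Rightarrow> real \<times> (real^'n) \<Rightarrow> real \<times> (real^'n) \<Rightarrow> real" where
  "P2 v w p = frechet_derivative (P1 v) (at p) w"

lemma higher: "higher_differentiable_on ({0<..} \<times> UNIV) (\<lambda>(t, x). f t x) k"
  using smooth by (simp add: smooth_on_def)

lemma P1_eq: "P1 v = (\<lambda>p. frechet_derivative (\<lambda>(t, x). f t x) (at p) v)"
  by (simp add: P1_def fun_eq_iff)

lemma P2_eq: "P2 v w = (\<lambda>p. frechet_derivative (P1 v) (at p) w)"
  by (simp add: P2_def fun_eq_iff)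

lemma derivs:
  "0 < s \<Longrightarrow> ((\<lambda>(t, x). f t x) has_derivative (\<lambda>v. P1 v (s, x))) (at (s, x))"
  "0 < s \<Longrightarrow> (P1 v has_derivative (\<lambda>w. P2 v w (s, x))) (at (s, x))"
  "continuous_on ({0<..} \<times> UNIV) (\<lambda>(t, x). f t x)"
  "continuous_on ({0<..} \<times> UNIV) (P1 v)"
  "continuous_on ({0<..} \<times> UNIV) (P2 v w)"
proof -
  show "continuous_on ({0<..} \<times> UNIV) (\<lambda>(t, x). f t x)" using higher[of 0] by simp
  have h1: "higher_differentiable_on ({0<..} \<times> UNIV) (P1 v) k" for k v
    using higher[of "Suc k"] by (cases v) (simp add: P1_eq)
  then show "continuous_on ({0<..} \<times> UNIV) (P1 v)" using h1[of v 0] by simp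
  have "higher_differentiable_on ({0<..} \<times> UNIV) (P2 v w) 0"
    using h1[of v "Suc 0"] by (cases w) (simp add: P2_eq)
  then show "continuous_on ({0<..} \<times> UNIV) (P2 v w)" by simp
  show "((\<lambda>(t, x). f t x) has_derivative (\<lambda>v. P1 v (s, x))) (at (s, x))" if "0 < s"
    using higher[of "Suc 0"] that frechet_derivative_works by (auto simp: P1_def)
  show "(P1 v has_derivative (\<lambda>w. P2 v w (s, x))) (at (s, x))" if "0 < s"
    using h1[of v "Suc 0"] that frechet_derivative_works by (auto simp: P2_def)
qed

lemma space_deriv:
  assumes "0 < s"
  shows "(f s has_derivative (\<lambda>v. P1 (0, v) (s, x))) (at x)"
    "((\<lambda>x. P1 v (s, x)) has_derivative (\<lambda>w. P2 v (0, w) (s, x))) (at x)"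
    "((\<lambda>s. f s x) has_real_derivative P1 (1, 0) (s, x)) (at s)"
proof -
  have g: "((\<lambda>x. (s, x)) has_derivative (\<lambda>v. (0, v))) (at x)" by (auto intro!: derivative_eq_intros)
  from diff_chain_at[OF g derivs(1)[OF assms]] show "(f s has_derivative (\<lambda>v. P1 (0, v) (s, x))) (at x)"
    by (simp add: o_def)
  from diff_chain_at[OF g derivs(2)[OF assms]] show "((\<lambda>x. P1 v (s, x)) has_derivative (\<lambda>w. P2 v (0, w) (s,
      x))) (at x)"
    by (simp add: o_def)
  have "((\<lambda>s. (s, x)) has_derivative (\<lambda>d. (d, 0))) (at s)" by (auto intro!: derivative_eq_intros)
  from diff_chain_at[OF this derivs(1)[OF assms]]
  have "((\<lambda>s. f s x) has_derivative (\<lambda>d. P1 (d, 0) (s, x))) (at s)" by (simp add: o_def)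
  moreover have "P1 (d, 0) (s, x) = P1 (1, 0) (s, x) * d" for d
    using linear_scale[OF has_derivative_linear[OF derivs(1)[OF assms, of x]], of d "(1, 0)"] by simp
  then have "(\<lambda>d. P1 (d, 0) (s, x)) = (*) (P1 (1, 0) (s, x))" by blast
  ultimately show "((\<lambda>s. f s x) has_real_derivative P1 (1, 0) (s, x)) (at s)"
    by (simp add: has_field_derivative_def)
qed

lemma space_continuous:
  assumes "0 < s"
  shows "continuous_on UNIV (f s)" "continuous_on UNIV (\<lambda>x. P1 v (s, x))" "continuous_on UNIV (\<lambda>x. P2 v w
      (s, x))"
proof -
  have g: "continuous_on UNIV (\<lambda>x :: real^'n. (s, x))" by (intro continuous_intros)
  have sub: "range (\<lambda>x :: real^'n. (s, x)) \<subseteq> {0<..} \<times> UNIV" using assms by auto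
  show "continuous_on UNIV (f s)"
    using continuous_on_compose[OF g continuous_on_subset[OF derivs(3) sub]] by (simp add: o_def)
  show "continuous_on UNIV (\<lambda>x. P1 v (s, x))"
    using continuous_on_compose[OF g continuous_on_subset[OF derivs(4) sub]] by (simp add: o_def)
  show "continuous_on UNIV (\<lambda>x. P2 v w (s, x))"
    using continuous_on_compose[OF g continuous_on_subset[OF derivs(5) sub]] by (simp add: o_def)
qed

text \<open>Here \<open>p\<close> and \<open>h\<close> are the gradient and the Hessian of the test
  function \<open>\<psi>\<close>. Compact support is what permits moving all derivatives from
  \<open>f s\<close> to \<open>\<psi>\<close> without growth assumptions on
  \<open>f s\<close>.\<close>

lemma weak_pde:
  fixes D C :: "real^'n^'n"
  assumes sym: "transpose D = D" and s: "0 < s"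
    and pde: "\<And>x. ((\<lambda>s. f s x) has_real_derivative divergence (\<lambda>y. D *v grad (f s) y + f s y *\<^sub>R (C *v y))
        x) (at s)"
    and \<psi>: "\<And>x. (\<psi> has_derivative (\<lambda>v. p x \<bullet> v)) (at x)" and p: "\<And>x. (p has_derivative h x) (at x)"
    and ch: "\<And>v. continuous_on UNIV (\<lambda>x. h x v)"
    and supp: "\<And>x. \<psi> x \<noteq> 0 \<or> p x \<noteq> 0 \<Longrightarrow> x \<in> cball 0 r"
  shows "(\<integral>x. P1 (1, 0) (s, x) * \<psi> x \<partial>lborel)
      = (\<integral>x. f s x * ((\<Sum>i\<in>UNIV. (D *v h x (axis i 1)) $ i) - p x \<bullet> (C *v x)) \<partial>lborel)"
    "integrable lborel (\<lambda>x. P1 (1, 0) (s, x) * \<psi> x)"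
    "integrable lborel (\<lambda>x. f s x * ((\<Sum>i\<in>UNIV. (D *v h x (axis i 1)) $ i) - p x \<bullet> (C *v x)))"
proof -
  have gr: "grad (f s) x = (\<chi> i. P1 (0, axis i 1) (s, x))" for x
    using frechet_derivative_at[OF space_deriv(1)[OF s, of x]] by (simp add: grad_def vec_eq_iff) (metis)
  define g2 where "g2 x v = (\<chi> i. P2 (0, axis i 1) (0, v) (s, x))" for x v
  have dgr: "(grad (f s) has_derivative g2 x) (at x)" for x
    unfolding has_derivative_vec_nth_iff by (simp add: gr g2_def space_deriv(2)[OF s])
  have P1g: "P1 (0, v) (s, x) = grad (f s) x \<bullet> v" for v x
  proof -
    have "frechet_derivative (f s) (at x) v = P1 (0, v) (s, x)"
      using fun_cong[OF frechet_derivative_at[OF space_deriv(1)[OF s, of x]], of v] by simp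
    moreover have "f s differentiable (at x)" using space_deriv(1)[OF s, of x]
        by (auto simp: differentiable_def)
    ultimately show ?thesis using grad_inner[of "f s" x v] by simp
  qed
  define F where "F = (\<lambda>y. D *v grad (f s) y + f s y *\<^sub>R (C *v y))"
  define F' where "F' x v = D *v g2 x v + (f s x *\<^sub>R (C *v v) + P1 (0, v) (s, x) *\<^sub>R (C *v x))" for x v
  have dF: "(F has_derivative F' x) (at x)" for x
    unfolding F_def F'_def
    by (intro has_derivative_add bounded_linear.has_derivative[OF bounded_linear_matrix] dgr
        has_derivative_scaleR space_deriv(1)[OF s] bounded_linear_imp_has_derivative bounded_linear_matrix)
  have dt: "P1 (1, 0) (s, x) = (\<Sum>i\<in>UNIV. F' x (axis i 1) $ i)" for x
    using DERIV_unique[OF space_deriv(3)[OF s, of x] pde] trace_jacobian[OF dF] by (simp add: F_def)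
  \<comment> \<open>This field performs both integrations by parts at once: in its divergence the
    two products of the first derivatives of \<open>f s\<close> and \<open>\<psi>\<close> cancel by
    the symmetry of \<open>D\<close>.\<close>
  define H where "H x = \<psi> x *\<^sub>R F x - f s x *\<^sub>R (D *v p x)" for x
  define H' where "H' x v = (\<psi> x *\<^sub>R F' x v + (p x \<bullet> v) *\<^sub>R F x) - (f s x *\<^sub>R (D *v h x v) + P1 (0, v) (s,
      x) *\<^sub>R (D *v p x))" for x v
  have dH: "(H has_derivative H' x) (at x)" for x
    unfolding H_def H'_def
    by (intro has_derivative_diff has_derivative_scaleR \<psi> dF space_deriv(1)[OF s]
        bounded_linear.has_derivative[OF bounded_linear_matrix] p)
  have c\<psi>: "continuous_on UNIV \<psi>"
    by (rule has_derivative_continuous_on) (rule has_derivative_at_withinI[OF \<psi>])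
  have cp: "continuous_on UNIV p"
    by (rule has_derivative_continuous_on) (rule has_derivative_at_withinI[OF p])
  have cF: "continuous_on UNIV F"
    by (rule has_derivative_continuous_on) (rule has_derivative_at_withinI[OF dF])
  have cg2: "continuous_on UNIV (\<lambda>x. g2 x v)" for v
    unfolding g2_def by (intro continuous_on_vec_lambda space_continuous s)
  have cm: "continuous_on UNIV (\<lambda>x. A *v q x)" if "continuous_on UNIV q"
      for A :: "real^'n^'n" and q :: "real^'n \<Rightarrow> real^'n"
    by (rule bounded_linear.continuous_on[OF bounded_linear_matrix that])
  have cF': "continuous_on UNIV (\<lambda>x. F' x v)" for v
    unfolding F'_def by (intro continuous_intros cm cg2 space_continuous s)
  have cH': "continuous_on UNIV (\<lambda>x. H' x v)" for v
    unfolding H'_def by (intro continuous_intros cm cF' cF cp c\<psi> ch space_continuous s)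
  have sH: "H x \<noteq> 0 \<Longrightarrow> x \<in> cball 0 r" for x using supp[of x] by (cases "\<psi> x = 0 \<and> p x = 0") (auto simp: H_def)
  have cHi: "continuous_on UNIV (\<lambda>x. H' x (axis i 1) $ i)" for i by (intro continuous_intros cH')
  note div = divergence_theorem_compact_support[OF dH cHi sH]
  have sum_e: "(\<Sum>i\<in>UNIV. (a \<bullet> axis i 1) * b $ i) = a \<bullet> b" for a b :: "real^'n"
    unfolding inner_axis by (simp add: inner_vec_def)
  have eq: "(\<Sum>i\<in>UNIV. H' x (axis i 1) $ i) = P1 (1, 0) (s, x) * \<psi> x
      - f s x * ((\<Sum>i\<in>UNIV. (D *v h x (axis i 1)) $ i) - p x \<bullet> (C *v x))" for x
  proof -
    have "(\<Sum>i\<in>UNIV. H' x (axis i 1) $ i) = (\<Sum>i\<in>UNIV. \<psi> x * F' x (axis i 1) $ i) + (\<Sum>i\<in>UNIV. (p x \<bullet> axis i 1)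
        * F x $ i)
      - (\<Sum>i\<in>UNIV. f s x * (D *v h x (axis i 1)) $ i) - (\<Sum>i\<in>UNIV. (grad (f s) x \<bullet> axis i 1) * (D *v p x) $ i)"
      by (simp add: H'_def P1g sum.distrib sum_subtractf)
    also have "\<dots> = \<psi> x * P1 (1, 0) (s, x) + p x \<bullet> F x - f s x * (\<Sum>i\<in>UNIV. (D *v h x (axis i 1)) $ i) - grad
        (f s) x \<bullet> (D *v p x)"
      by (simp add: sum_e dt sum_distrib_left)
    also have "p x \<bullet> F x = grad (f s) x \<bullet> (D *v p x) + f s x * (p x \<bullet> (C *v x))"
      using symmetric_inner[OF sym, of "p x" "grad (f s) x"] by (simp add: F_def inner_add_right inner_commute)
    finally show ?thesis by (simp add: algebra_simps)
  qed
  have cP1: "continuous_on UNIV (\<lambda>x. P1 (1, 0) (s, x) * \<psi> x)" by (intro continuous_intros c\<psi> space_continuous s)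
  show i1: "integrable lborel (\<lambda>x. P1 (1, 0) (s, x) * \<psi> x)"
    by (rule integrable_continuous_compact_support[OF cP1, of r]) (use supp in auto)
  have "integrable lborel (\<lambda>x. P1 (1, 0) (s, x) * \<psi> x - (\<Sum>i\<in>UNIV. H' x (axis i 1) $ i))"
    by (intro Bochner_Integration.integrable_diff i1 div(2))
  then show i2: "integrable lborel (\<lambda>x. f s x * ((\<Sum>i\<in>UNIV. (D *v h x (axis i 1)) $ i) - p x \<bullet> (C *v x)))"
    unfolding eq by simp
  show "(\<integral>x. P1 (1, 0) (s, x) * \<psi> x \<partial>lborel)
      = (\<integral>x. f s x * ((\<Sum>i\<in>UNIV. (D *v h x (axis i 1)) $ i) - p x \<bullet> (C *v x)) \<partial>lborel)"
    using div(1) i1 i2 unfolding eq by simp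
qed

end

text \<open>The exponential of \<open>- t C\<close> enters only through its value at 0, its
  differential equation, its commutation with \<open>C\<close> and its inverse.\<close>

locale fp_data =
  fixes D C K :: "real^'n^'n" and E :: "real \<Rightarrow> real^'n^'n"
  assumes D: "pos_semidef D" and K: "pos_def K" and lyap: "2 *\<^sub>R D = C ** K + K ** transpose C"
    and E0: "E 0 = mat 1"
    and dE: "\<And>t v. ((\<lambda>t. E t *v v) has_vector_derivative - (C *v (E t *v v))) (at t)"
    and com: "\<And>t v. C *v (E t *v v) = E t *v (C *v v)"
    and inv: "\<And>t v. E (- t) *v (E t *v v) = v"
begin

lemma transpose_inner: "(transpose A *v x) \<bullet> y = x \<bullet> (A *v y)" for A :: "real^'n^'n"
  by (metis dot_lmul_matrix transpose_matrix_vector)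

lemma Dsym: "transpose D = D" using D by (simp add: pos_semidef_def)
lemma Ksym: "transpose K = K" using K by (simp add: pos_def_def)

text \<open>Both terms of the Lyapunov equation contribute the same amount to a quadratic form,
  because \<open>K\<close> is symmetric.\<close>

lemma D_quad: "w \<bullet> (D *v w) = w \<bullet> (K *v (transpose C *v w))"
proof -
  have "2 * (w \<bullet> (D *v w)) = w \<bullet> ((2 *\<^sub>R D) *v w)" by (simp add: scaleR_matrix_vector_assoc[symmetric])
  also have "\<dots> = w \<bullet> (C *v (K *v w)) + w \<bullet> (K *v (transpose C *v w))"
    by (simp add: lyap matrix_vector_mult_add_rdistrib inner_add_right matrix_vector_mul_assoc[symmetric]
        del: transpose_matrix_vector)
  also have "w \<bullet> (C *v (K *v w)) = (transpose C *v w) \<bullet> (K *v w)" by (simp only: transpose_inner)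
  also have "\<dots> = w \<bullet> (K *v (transpose C *v w))" using symmetric_inner[OF Ksym, of w "transpose C *v w"]
    by (metis inner_commute)
  finally show ?thesis by simp
qed

lemma dET: "((\<lambda>s. transpose (E s) *v \<xi>) has_vector_derivative - (transpose C *v (transpose (E s) *v \<xi>))) (at s)"
  unfolding has_vector_derivative_def has_derivative_componentwise_within[of "\<lambda>s. transpose (E s) *v \<xi>"]
proof
  fix b :: "real^'n"
  have "((\<lambda>s. \<xi> \<bullet> (E s *v b)) has_vector_derivative \<xi> \<bullet> (- (C *v (E s *v b)))) (at s)"
    by (rule bounded_linear.has_vector_derivative[OF bounded_linear_inner_right dE])
  then show "((\<lambda>x. (transpose (E x) *v \<xi>) \<bullet> b) has_derivative (\<lambda>x. (x *\<^sub>R - (transpose C *v (transpose (E s)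
      *v \<xi>))) \<bullet> b)) (at s)"
    by (simp add: has_vector_derivative_def transpose_inner com del: transpose_matrix_vector)
qed

definition Qf :: "real \<Rightarrow> real^'n^'n" where
  "Qf t = K - E t ** K ** transpose (E t)"

lemma Qf_quad: "\<xi> \<bullet> (Qf t *v \<xi>) = \<xi> \<bullet> (K *v \<xi>) - (transpose (E t) *v \<xi>) \<bullet> (K *v (transpose (E t) *v \<xi>))"
  by (simp add: Qf_def matrix_vector_mult_diff_rdistrib inner_diff_right transpose_inner
      matrix_vector_mul_assoc[symmetric] del: transpose_matrix_vector)

text \<open>By the Lyapunov equation the derivative is a value of the form of \<open>D\<close>. This
  identity serves twice: it makes the damping factor of the backward solution correct, and it shows
  that the covariance grows with time.\<close>

lemma Qf_quad_deriv:
  "((\<lambda>t. \<xi> \<bullet> (Qf t *v \<xi>)) has_real_derivative 2 * ((transpose (E t) *v \<xi>) \<bullet> (D *v (transpose (E t) *v \<xi>))))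
      (at t)"
proof -
  let ?b = "\<lambda>t. transpose (E t) *v \<xi>"
  have "((\<lambda>t. ?b t \<bullet> (K *v ?b t)) has_vector_derivative
    (?b t \<bullet> (K *v (- (transpose C *v ?b t))) + (- (transpose C *v ?b t)) \<bullet> (K *v ?b t))) (at t)"
    by (rule bounded_bilinear.has_vector_derivative[OF bounded_bilinear_inner dET
        bounded_linear.has_vector_derivative[OF bounded_linear_matrix dET]])
  also have "?b t \<bullet> (K *v (- (transpose C *v ?b t))) + (- (transpose C *v ?b t)) \<bullet> (K *v ?b t)
      = - 2 * (?b t \<bullet> (D *v ?b t))"
    using symmetric_inner[OF Ksym, of "?b t" "transpose C *v ?b t"]
    by (simp add: linear_neg[OF matrix_vector_mul_linear] D_quad inner_commute)
  finally have "((\<lambda>t. ?b t \<bullet> (K *v ?b t)) has_real_derivative - 2 * (?b t \<bullet> (D *v ?b t))) (at t)"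
    by (simp add: has_real_derivative_iff_has_vector_derivative)
  then show ?thesis unfolding Qf_quad by (auto intro!: derivative_eq_intros)
qed

end

section \<open>Pairing a solution with a backward solution\<close>

locale fp_dual = fp_data D C K E + smooth_space_time f
  for D C K :: "real^'n^'n" and E and f :: "real \<Rightarrow> real^'n \<Rightarrow> real" +
  fixes f0 :: "real^'n \<Rightarrow> real" and t :: real and \<xi> :: "real^'n" and \<theta> :: real
  assumes sol: "fp_solution D C f0 f" and t: "0 < t"
begin

definition a :: "real \<Rightarrow> real^'n" where "a s = transpose (E (t - s)) *v \<xi>"

definition q :: "real \<Rightarrow> real" where "q s = (\<xi> \<bullet> (Qf (t - s) *v \<xi>)) / 2"

text \<open>A solution of the backward equation: its time derivative \<open>G'\<close> is minus
  \<open>div (D grad G) - (C x) \<bullet> grad G\<close>. The frequency \<open>a\<close> follows the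
  transposed drift and \<open>q\<close> accounts for diffusion; at \<open>s = t\<close> only the
  cosine with frequency \<open>\<xi>\<close> remains.\<close>

definition G :: "real \<Rightarrow> real^'n \<Rightarrow> real" where
  "G s x = exp (- q s) * cos (a s \<bullet> x + \<theta>)"

definition G' :: "real \<Rightarrow> real^'n \<Rightarrow> real" where
  "G' s x = exp (- q s) * ((a s \<bullet> (D *v a s)) * cos (a s \<bullet> x + \<theta>) - (a s \<bullet> (C *v x)) * sin (a s \<bullet> x + \<theta>))"

lemma da: "(a has_vector_derivative transpose C *v a s) (at s)"
proof -
  have "(((\<lambda>s. transpose (E s) *v \<xi>) \<circ> (\<lambda>s. t - s)) has_vector_derivative
    (- 1) *\<^sub>R (- (transpose C *v (transpose (E (t - s)) *v \<xi>)))) (at s)"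
    by (rule vector_diff_chain_at) (auto intro!: derivative_eq_intros dET simp del: transpose_matrix_vector)
  then show ?thesis by (simp add: o_def a_def[abs_def] del: transpose_matrix_vector)
qed

lemma dq: "(q has_real_derivative - (a s \<bullet> (D *v a s))) (at s)"
proof -
  have "((\<lambda>s. \<xi> \<bullet> (Qf (t - s) *v \<xi>)) has_real_derivative 2 * (a s \<bullet> (D *v a s)) * (- 1)) (at s)"
    unfolding a_def by (rule DERIV_chain2[OF Qf_quad_deriv]) (auto intro!: derivative_eq_intros)
  then show ?thesis unfolding q_def[abs_def] by (auto intro!: derivative_eq_intros)
qed

lemma dG: "((\<lambda>s. G s x) has_real_derivative G' s x) (at s)"
proof -
  have "((\<lambda>s. a s \<bullet> x) has_vector_derivative (transpose C *v a s) \<bullet> x) (at s)"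
    by (rule bounded_linear.has_vector_derivative[OF bounded_linear_inner_left da])
  then have "((\<lambda>s. a s \<bullet> x) has_real_derivative a s \<bullet> (C *v x)) (at s)"
    by (simp only: has_real_derivative_iff_has_vector_derivative transpose_inner)
  then show ?thesis unfolding G_def G'_def using dq[of s]
    by (auto intro!: derivative_eq_intros simp: algebra_simps)
qed

lemma a_continuous: "continuous_on UNIV a"
  by (rule has_derivative_continuous_on) (rule has_derivative_at_withinI[OF da[unfolded
      has_vector_derivative_def]])

lemma q_continuous: "continuous_on UNIV q"
  by (rule has_derivative_continuous_on) (rule has_derivative_at_withinI[OF dq[unfolded
      has_field_derivative_def]])

lemma integrable_f: "0 \<le> s \<Longrightarrow> integrable lborel (f s)"
  using sol by (simp add: fp_solution_def)

lemma f_measurable: "0 \<le> s \<Longrightarrow> f s \<in> borel_measurable borel"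
  using integrable_f[of s] by auto

text \<open>All three quantities are continuous on a compact time interval; for the mass of
  \<open>f s\<close> this is the continuity of the curve in \<open>L1\<close>, up to and including
  time 0.\<close>

lemma bounds:
  obtains A Bq Bf where "\<And>s. s \<in> {0..t} \<Longrightarrow> norm (a s) \<le> A" "\<And>s. s \<in> {0..t} \<Longrightarrow> exp (- q s) \<le> Bq"
    "\<And>s. s \<in> {0..t} \<Longrightarrow> (\<integral>x. \<bar>f s x\<bar> \<partial>lborel) \<le> Bf" "0 \<le> A" "0 \<le> Bq" "0 \<le> Bf"
proof -
  have bd: "\<exists>B\<ge>0. \<forall>s\<in>{0..t}. norm (g s) \<le> B" if "continuous_on {0..t} g"
      for g :: "real \<Rightarrow> 'b::real_normed_vector"
  proof -
    have "bounded (g ` {0..t})" by (intro compact_imp_bounded compact_continuous_image that) simp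
    then obtain B where B: "\<forall>y\<in>g ` {0..t}. norm y \<le> B" unfolding bounded_iff by blast
    then have "0 \<le> B" using t norm_ge_zero[of "g 0"]
        by (meson atLeastAtMost_iff imageI less_imp_le order_refl order_trans)
    then show ?thesis using B by blast
  qed
  obtain A where A: "A \<ge> 0" "\<forall>s\<in>{0..t}. norm (a s) \<le> A"
    using bd[OF continuous_on_subset[OF a_continuous]] by auto
  have "continuous_on {0..t} (\<lambda>s. exp (- q s))"
    by (intro continuous_intros continuous_on_subset[OF q_continuous]) auto
  from bd[OF this] obtain Bq where Bq: "Bq \<ge> 0" "\<forall>s\<in>{0..t}. norm (exp (- q s)) \<le> Bq" by blast
  have "continuous_on {0..} (\<lambda>s. \<integral>x. \<bar>f s x\<bar> \<partial>lborel)"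
    unfolding continuous_on_def
  proof
    fix s :: real assume s: "s \<in> {0..}"
    have "((\<lambda>r. \<integral>x. \<bar>f r x - f s x\<bar> \<partial>lborel) \<longlongrightarrow> 0) (at s within {0..})"
      using sol s by (simp add: fp_solution_def)
    then have "((\<lambda>r. (\<integral>x. \<bar>f r x\<bar> \<partial>lborel) - (\<integral>x. \<bar>f s x\<bar> \<partial>lborel)) \<longlongrightarrow> 0) (at s within {0..})"
    proof (rule Lim_null_comparison[rotated])
      have "norm ((\<integral>x. \<bar>f r x\<bar> \<partial>lborel) - (\<integral>x. \<bar>f s x\<bar> \<partial>lborel)) \<le> (\<integral>x. \<bar>f r x - f s x\<bar> \<partial>lborel)" if "0 \<le> r"
          for r
      proof -
        have "(\<integral>x. \<bar>f r x\<bar> \<partial>lborel) - (\<integral>x. \<bar>f s x\<bar> \<partial>lborel) = (\<integral>x. \<bar>f r x\<bar> - \<bar>f s x\<bar> \<partial>lborel)"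
          using integrable_f[OF that] integrable_f[of s] s by simp
        also have "norm \<dots> \<le> (\<integral>x. norm (\<bar>f r x\<bar> - \<bar>f s x\<bar>) \<partial>lborel)" by (rule integral_norm_bound)
        also have "\<dots> \<le> (\<integral>x. \<bar>f r x - f s x\<bar> \<partial>lborel)"
          by (rule integral_mono) (use integrable_f[OF that] integrable_f[of s] s in \<open>auto intro:
              abs_triangle_ineq3\<close>)
        finally show ?thesis .
      qed
      then show "eventually (\<lambda>r. norm ((\<integral>x. \<bar>f r x\<bar> \<partial>lborel) - (\<integral>x. \<bar>f s x\<bar> \<partial>lborel))
          \<le> (\<integral>x. \<bar>f r x - f s x\<bar> \<partial>lborel)) (at s within {0..})"
        by (auto simp: eventually_at_filter)
    qed
    then show "((\<lambda>s. \<integral>x. \<bar>f s x\<bar> \<partial>lborel) \<longlongrightarrow> (\<integral>x. \<bar>f s x\<bar> \<partial>lborel)) (at s within {0..})"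
      by (rule LIM_zero_cancel)
  qed
  then have "continuous_on {0..t} (\<lambda>s. \<integral>x. \<bar>f s x\<bar> \<partial>lborel)" by (rule continuous_on_subset) auto
  from bd[OF this] obtain Bf where Bf: "Bf \<ge> 0" "\<forall>s\<in>{0..t}. norm (\<integral>x. \<bar>f s x\<bar> \<partial>lborel) \<le> Bf" by blast
  show thesis
    by (rule that[of A Bq Bf]) (use A Bq Bf in auto)
qed

text \<open>Without the cutoff this pairing would not depend on \<open>s\<close>.\<close>

definition m :: "real \<Rightarrow> real \<Rightarrow> real" where
  "m R s = (\<integral>x. f s x * (cutoff R x * G s x) \<partial>lborel)"

text \<open>The commutator of the cutoff with the backward equation.\<close>
definition err :: "real \<Rightarrow> real \<Rightarrow> real^'n \<Rightarrow> real" where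
  "err R s x = cos (a s \<bullet> x + \<theta>) * ((\<Sum>i\<in>UNIV. (D *v cutoff_hess R x (axis i 1)) $ i) - cutoff_grad R x \<bullet> (C
      *v x))
    - 2 * sin (a s \<bullet> x + \<theta>) * (a s \<bullet> (D *v cutoff_grad R x))"

lemma G_bound: "\<bar>G s x\<bar> \<le> exp (- q s)"
  by (simp add: G_def abs_mult)

lemma G_measurable: "G s \<in> borel_measurable borel"
  unfolding G_def[abs_def] by simp

lemma cG_integrable:
  assumes "1 \<le> R" "0 \<le> s" "integrable lborel g"
  shows "integrable lborel (\<lambda>x. g x * (cutoff R x * G s x))"
proof (rule Bochner_Integration.integrable_bound[OF integrable_mult_right[OF assms(3), of "exp (- q s)"]])
  have [measurable]: "cutoff R \<in> borel_measurable borel"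
    by (intro borel_measurable_continuous_onI cutoff_continuous assms)
  note [measurable] = G_measurable
  show "(\<lambda>x. g x * (cutoff R x * G s x)) \<in> borel_measurable lborel" using assms(3) by auto
  show "AE x in lborel. norm (g x * (cutoff R x * G s x)) \<le> norm (exp (- q s) * g x)"
  proof (rule AE_I2)
    fix x
    have "\<bar>cutoff R x\<bar> * \<bar>G s x\<bar> \<le> 1 * exp (- q s)"
      using cutoff_bound[OF assms(1), of x] G_bound[of s x] by (intro mult_mono) auto
    then show "norm (g x * (cutoff R x * G s x)) \<le> norm (exp (- q s) * g x)"
      by (simp add: abs_mult mult.commute mult_left_mono)
  qed
qed

text \<open>Differentiation under the integral followed by \<open>weak_pde\<close>. The backward
  equation cancels every term in which the cutoff is not differentiated, and the rest is
  \<open>err\<close>.\<close>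

lemma m_deriv:
  assumes R: "1 \<le> R" and s: "0 < s"
  shows "(m R has_real_derivative exp (- q s) * (\<integral>x. f s x * err R s x \<partial>lborel)) (at s)"
    "integrable lborel (\<lambda>x. f s x * err R s x)"
proof -
  let ?c = "\<lambda>s x. cos (a s \<bullet> x + \<theta>)" and ?sn = "\<lambda>s x. sin (a s \<bullet> x + \<theta>)"
  let ?\<chi> = "cutoff R :: real^'n \<Rightarrow> real" and ?g = "cutoff_grad R" and ?h = "cutoff_hess R"
  define \<Psi> where "\<Psi> s x = P1 (1, 0) (s, x) * (?\<chi> x * G s x) + f s x * (?\<chi> x * G' s x)" for s x
  have c\<Psi>: "continuous_on ({0<..} \<times> UNIV) (\<lambda>p. \<Psi> (fst p) (snd p))"
  proof -
    have af: "continuous_on ({0<..} \<times> UNIV) (\<lambda>p :: real \<times> (real^'n). a (fst p))"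
      and qf: "continuous_on ({0<..} \<times> UNIV) (\<lambda>p :: real \<times> (real^'n). q (fst p))"
      and xf: "continuous_on ({0<..} \<times> UNIV) (\<lambda>p :: real \<times> (real^'n). ?\<chi> (snd p))"
      by (auto intro!: continuous_on_compose2[OF a_continuous] continuous_on_compose2[OF q_continuous]
          continuous_on_compose2[OF cutoff_continuous[OF R]] continuous_intros)
    have mv: "continuous_on ({0<..} \<times> UNIV) (\<lambda>p. A *v g p)" if "continuous_on ({0<..} \<times> UNIV) g"
      for A :: "real^'n^'n" and g :: "real \<times> (real^'n) \<Rightarrow> real^'n"
      by (rule bounded_linear.continuous_on[OF bounded_linear_matrix that])
    have ff: "continuous_on ({0<..} \<times> UNIV) (\<lambda>p :: real \<times> (real^'n). f (fst p) (snd p))"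
      using derivs(3) by (simp add: case_prod_unfold)
    have "continuous_on ({0<..} \<times> UNIV) (\<lambda>p :: real \<times> (real^'n). P1 (1, 0) p)" by (rule derivs(4))
    then have pf: "continuous_on ({0<..} \<times> UNIV) (\<lambda>p :: real \<times> (real^'n). P1 (1, 0) (fst p, snd p))" by simp
    show ?thesis unfolding \<Psi>_def G_def G'_def
      by (intro continuous_intros af qf xf mv ff pf)
  qed
  have d: "((\<lambda>s. f s x * (?\<chi> x * G s x)) has_real_derivative \<Psi> r x) (at r)" if "0 < r" for r x
  proof -
    have "((\<lambda>s. f s x * (?\<chi> x * G s x)) has_real_derivative
      P1 (1, 0) (r, x) * (?\<chi> x * G r x) + (?\<chi> x * G' r x) * f r x) (at r)"
      by (rule DERIV_mult[OF space_deriv(3)[OF that] DERIV_cmult[OF dG]])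
    then show ?thesis by (simp add: \<Psi>_def mult.commute)
  qed
  \<comment> \<open>The time interval stays above \<open>s / 2\<close>, where smoothness holds, and
    the cutoff confines space to a ball; compactness thus provides the dominating constant.\<close>
  have "compact ((\<lambda>p. \<Psi> (fst p) (snd p)) ` (cball s (s / 2) \<times> cball 0 (exp R)))"
  proof (intro compact_continuous_image compact_Times compact_cball continuous_on_subset[OF c\<Psi>])
    show "cball s (s / 2) \<times> cball 0 (exp R) \<subseteq> {0<..} \<times> (UNIV :: (real^'n) set)"
    proof clarify
      fix r :: real and x :: "real^'n" assume "r \<in> cball s (s / 2)"
      then have "\<bar>s - r\<bar> \<le> s / 2" by (simp add: dist_real_def)
      then have "s - r \<le> s / 2" by (rule abs_le_D1)
      then show "r \<in> {0<..} \<and> x \<in> UNIV" using s by simp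
    qed
  qed
  from compact_imp_bounded[OF this] obtain B where "\<forall>y\<in>(\<lambda>p. \<Psi> (fst p) (snd p)) ` (cball s (s / 2) \<times> cball 0
      (exp R)). norm y \<le> B"
    unfolding bounded_iff by blast
  then have B: "\<bar>\<Psi> r x\<bar> \<le> B" if "r \<in> cball s (s / 2)" "x \<in> cball 0 (exp R)" for r x
    using that by (auto simp del: mem_cball)
  have dm: "(m R has_real_derivative (\<integral>x. \<Psi> s x \<partial>lborel)) (at s)"
    unfolding m_def[abs_def]
  proof (rule has_real_derivative_integral[where e = "s / 2" and w
      = "\<lambda>x. B * indicator (cball (0 :: real^'n) (exp R)) x"])
    show "0 < s / 2" using s by simp
    fix r x assume r: "r \<in> ball s (s / 2)"
    then have "\<bar>s - r\<bar> < s / 2" by (simp add: dist_real_def)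
    then have "s - r < s / 2" by (rule order_le_less_trans[OF abs_ge_self])
    then have r0: "0 < r" using s by simp
    show "((\<lambda>s. f s x * (?\<chi> x * G s x)) has_real_derivative \<Psi> r x) (at r)" by (rule d[OF r0])
    show "\<bar>\<Psi> r x\<bar> \<le> B * indicator (cball (0 :: real^'n) (exp R)) x"
    proof (cases "x \<in> cball 0 (exp R)")
      case True
      then show ?thesis using B[of r x] r by (auto simp del: mem_cball simp: indicator_def) (auto simp:
          less_imp_le)
    next
      case False
      then have "?\<chi> x = 0" using cutoff_support[OF R, of x] by blast
      then show ?thesis using False by (simp add: \<Psi>_def del: mem_cball)
    qed
    show "integrable lborel (\<lambda>x. f r x * (?\<chi> x * G r x))"
      by (rule cG_integrable[OF R less_imp_le[OF r0] integrable_f]) (use r0 in simp)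
  next
    show "integrable lborel (\<lambda>x. B * indicator (cball (0 :: real^'n) (exp R)) x)"
      using emeasure_compact_finite[of "cball (0::real^'n) (exp R)"]
          by (intro integrable_mult_right integrable_real_indicator) auto
    have "continuous_on UNIV (\<lambda>x :: real^'n. (s, x))" by (intro continuous_intros)
    from continuous_on_compose2[OF c\<Psi> this] have "continuous_on UNIV (\<Psi> s)" using s by auto
    then show "\<Psi> s \<in> borel_measurable lborel" using borel_measurable_continuous_onI by auto
  qed
  \<comment> \<open>The cutoff times the cosine at the fixed time \<open>s\<close>, with its
    gradient \<open>p\<close> and Hessian \<open>h\<close>; the factor \<open>exp (- q s)\<close> is
    constant in space and split off.\<close>
  define \<psi> where "\<psi> = (\<lambda>x. ?\<chi> x * ?c s x)"
  define p where "p = (\<lambda>x. ?c s x *\<^sub>R ?g x - (?\<chi> x * ?sn s x) *\<^sub>R a s)"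
  define h where "h = (\<lambda>x v. (?c s x *\<^sub>R ?h x v + (- ?sn s x * (a s \<bullet> v)) *\<^sub>R ?g x)
      - (?\<chi> x * (?c s x * (a s \<bullet> v)) + (?g x \<bullet> v) * ?sn s x) *\<^sub>R a s)"
  have dc: "(?c s has_derivative (\<lambda>v. - ?sn s x * (a s \<bullet> v))) (at x)"
    and ds: "(?sn s has_derivative (\<lambda>v. ?c s x * (a s \<bullet> v))) (at x)" for x
    by (auto intro!: derivative_eq_intros)
  have d\<psi>: "(\<psi> has_derivative (\<lambda>v. p x \<bullet> v)) (at x)" for x
    unfolding \<psi>_def
    by (rule has_derivative_eq_rhs[OF has_derivative_mult[OF cutoff_deriv[OF R] dc]])
      (simp add: p_def fun_eq_iff inner_diff_left algebra_simps)
  have dp: "(p has_derivative h x) (at x)" for x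
    unfolding p_def h_def
    by (rule has_derivative_diff[OF has_derivative_scaleR[OF dc cutoff_grad_deriv[OF R]]
        has_derivative_scaleR_left[OF has_derivative_mult[OF cutoff_deriv[OF R] ds]]])
  have ch: "continuous_on UNIV (\<lambda>x. h x v)" for v
    unfolding h_def
    by (intro continuous_intros cutoff_continuous cutoff_grad_continuous cutoff_hess_continuous R)
  have supp: "x \<in> cball 0 (exp R)" if "\<psi> x \<noteq> 0 \<or> p x \<noteq> 0" for x
    using that cutoff_support[OF R, of x] unfolding \<psi>_def p_def by force
  have pde: "((\<lambda>s. f s x) has_real_derivative divergence (\<lambda>y. D *v grad (f s) y + f s y *\<^sub>R (C *v y)) x) (at
      s)" for x
    using sol s by (simp add: fp_solution_def)
  note w = weak_pde[OF Dsym s pde d\<psi> dp ch supp]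
  let ?L = "\<lambda>x. (\<Sum>i\<in>UNIV. (D *v h x (axis i 1)) $ i) - p x \<bullet> (C *v x)"
  have sum_e: "(\<Sum>i\<in>UNIV. (u \<bullet> axis i 1) * b $ i) = u \<bullet> b" for u b :: "real^'n"
    unfolding inner_axis by (simp add: inner_vec_def)
  \<comment> \<open>The second summand is the cutoff times the time derivative of the backward
    solution, up to \<open>exp (- q s)\<close>. It removes the undifferentiated cutoff from the
    product rule expansion of \<open>?L\<close>.\<close>
  have errL: "err R s x = ?L x + ?\<chi> x * ((a s \<bullet> (D *v a s)) * ?c s x - (a s \<bullet> (C *v x)) * ?sn s x)" for x
  proof -
    have "(D *v h x (axis i 1)) $ i = ?c s x * (D *v ?h x (axis i 1)) $ i - ?sn s x * ((a s \<bullet> axis i 1) * (D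
        *v ?g x) $ i)
      - ?\<chi> x * ?c s x * ((a s \<bullet> axis i 1) * (D *v a s) $ i) - ?sn s x * ((?g x \<bullet> axis i 1) * (D *v a s) $
          i)" for i
      by (simp add: h_def matrix_vector_mult_diff_distrib matrix_vector_right_distrib linear_scale[OF
          matrix_vector_mul_linear] algebra_simps)
    then have "(\<Sum>i\<in>UNIV. (D *v h x (axis i 1)) $ i) = ?c s x * (\<Sum>i\<in>UNIV. (D *v ?h x (axis i 1)) $ i)
      - ?sn s x * (a s \<bullet> (D *v ?g x)) - ?\<chi> x * ?c s x * (a s \<bullet> (D *v a s)) - ?sn s x * (?g x \<bullet> (D *v a s))"
      by (simp only: sum_subtractf sum_distrib_left[symmetric] sum_e)
    moreover have "?g x \<bullet> (D *v a s) = a s \<bullet> (D *v ?g x)"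
      using symmetric_inner[OF Dsym, of "?g x" "a s"] by (metis inner_commute)
    ultimately show ?thesis unfolding err_def by (simp add: p_def inner_diff_left algebra_simps)
  qed
  let ?T = "\<lambda>x. f s x * (?\<chi> x * ((a s \<bullet> (D *v a s)) * ?c s x - (a s \<bullet> (C *v x)) * ?sn s x))"
  have iT: "integrable lborel ?T"
  proof (rule integrable_continuous_compact_support)
    show "continuous_on UNIV ?T"
      by (intro continuous_intros space_continuous s cutoff_continuous R bounded_linear.continuous_on[OF
          bounded_linear_matrix])
    fix x assume "?T x \<noteq> 0"
    then have "?\<chi> x \<noteq> 0" by auto
    then show "x \<in> cball 0 (exp R)" using cutoff_support[OF R, of x] by blast
  qed
  have fe: "f s x * err R s x = f s x * ?L x + ?T x" for x unfolding errL by (simp add: distrib_left)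
  show ie: "integrable lborel (\<lambda>x. f s x * err R s x)"
    unfolding fe by (rule Bochner_Integration.integrable_add[OF w(3) iT])
  have "\<Psi> s x = exp (- q s) * (P1 (1, 0) (s, x) * \<psi> x + ?T x)" for x
    by (simp add: \<Psi>_def G_def G'_def \<psi>_def algebra_simps)
  then have "(\<integral>x. \<Psi> s x \<partial>lborel) = exp (- q s) * ((\<integral>x. P1 (1, 0) (s, x) * \<psi> x \<partial>lborel) + (\<integral>x. ?T x \<partial>lborel))"
    using Bochner_Integration.integral_add[OF w(2) iT] by simp
  also have "(\<integral>x. P1 (1, 0) (s, x) * \<psi> x \<partial>lborel) + (\<integral>x. ?T x \<partial>lborel) = (\<integral>x. f s x * err R s x \<partial>lborel)"
    unfolding fe using w(1) Bochner_Integration.integral_add[OF w(3) iT] by linarith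
  finally have "(\<integral>x. \<Psi> s x \<partial>lborel) = exp (- q s) * (\<integral>x. f s x * err R s x \<partial>lborel)" .
  with dm show "(m R has_real_derivative exp (- q s) * (\<integral>x. f s x * err R s x \<partial>lborel)) (at s)" by (simp only:)
qed

text \<open>Every term contains a derivative of the cutoff and hence a factor \<open>1 / R\<close>;
  in the drift term, the growth of \<open>C x\<close> is met by the bound on
  \<open>norm x * norm (cutoff_grad R x)\<close>. The bound is uniform in space, so integrability of
  \<open>f s\<close> suffices afterwards.\<close>

lemma err_bound:
  obtains M where "0 \<le> M" "\<And>R s x. 1 \<le> R \<Longrightarrow> s \<in> {0..t} \<Longrightarrow> \<bar>err R s x\<bar> \<le> M / R"
proof -
  obtain A Bq Bf where A: "\<And>s. s \<in> {0..t} \<Longrightarrow> norm (a s) \<le> A" "0 \<le> A" using bounds by metis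
  obtain L where L: "0 < L" "\<And>v. norm (D *v v) \<le> norm v * L"
    using bounded_linear.pos_bounded[OF bounded_linear_matrix[of D]] by blast
  obtain Lc where Lc: "0 < Lc" "\<And>v. norm (C *v v) \<le> norm v * Lc"
    using bounded_linear.pos_bounded[OF bounded_linear_matrix[of C]] by blast
  let ?N = "real CARD('n)"
  show thesis
  proof (rule that[of "?N * (156 * L) + 4 * Lc + 4 * A * L"])
    show "0 \<le> ?N * (156 * L) + 4 * Lc + 4 * A * L" using A(2) L(1) Lc(1) by simp
    fix R s :: real and x :: "real^'n" assume R: "1 \<le> R" and s: "s \<in> {0..t}"
    let ?T = "\<Sum>i\<in>UNIV. (D *v cutoff_hess R x (axis i 1)) $ i"
    have "\<bar>?T\<bar> \<le> (\<Sum>i\<in>(UNIV::'n set). 156 / R * L)"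
    proof (rule order_trans[OF sum_abs sum_mono])
      fix i :: 'n
      have "\<bar>(D *v cutoff_hess R x (axis i 1)) $ i\<bar> \<le> norm (D *v cutoff_hess R x (axis i 1))"
          by (rule component_le_norm_cart)
      also have "\<dots> \<le> norm (cutoff_hess R x (axis i 1)) * L" by (rule L)
      also have "\<dots> \<le> (156 / R) * L"
        using cutoff_hess_bound[OF R, of x "axis i 1"] L(1) by (intro mult_right_mono) auto
      finally show "\<bar>(D *v cutoff_hess R x (axis i 1)) $ i\<bar> \<le> 156 / R * L" .
    qed
    then have T: "\<bar>?T\<bar> \<le> ?N * (156 * L) / R" by simp
    have "\<bar>cutoff_grad R x \<bullet> (C *v x)\<bar> \<le> norm (cutoff_grad R x) * norm (C *v x)" by (rule Cauchy_Schwarz_ineq2)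
    also have "\<dots> \<le> norm (cutoff_grad R x) * (norm x * Lc)" by (intro mult_left_mono Lc) auto
    also have "\<dots> = (norm x * norm (cutoff_grad R x)) * Lc" by simp
    also have "\<dots> \<le> (4 / R) * Lc" using cutoff_grad_bound(2)[OF R, of x] Lc(1) by (intro mult_right_mono) auto
    finally have g: "\<bar>cutoff_grad R x \<bullet> (C *v x)\<bar> \<le> 4 * Lc / R" by simp
    have "\<bar>a s \<bullet> (D *v cutoff_grad R x)\<bar> \<le> norm (a s) * norm (D *v cutoff_grad R x)"
        by (rule Cauchy_Schwarz_ineq2)
    also have "\<dots> \<le> A * ((2 / R) * L)"
    proof (intro mult_mono A(1) s)
      have "norm (D *v cutoff_grad R x) \<le> norm (cutoff_grad R x) * L" by (rule L)
      also have "\<dots> \<le> (2 / R) * L" using cutoff_grad_bound(1)[OF R, of x] L(1) by (intro mult_right_mono) auto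
      finally show "norm (D *v cutoff_grad R x) \<le> (2 / R) * L" .
    qed (use A in auto)
    finally have d: "\<bar>a s \<bullet> (D *v cutoff_grad R x)\<bar> \<le> 2 * A * L / R" by (simp add: mult_ac)
    have c1: "\<bar>cos (a s \<bullet> x + \<theta>) * y\<bar> \<le> \<bar>y\<bar>" and s1: "\<bar>sin (a s \<bullet> x + \<theta>) * y\<bar> \<le> \<bar>y\<bar>" for y
      by (simp_all add: abs_mult mult_left_le_one_le)
    have "\<bar>err R s x\<bar> \<le> \<bar>?T - cutoff_grad R x \<bullet> (C *v x)\<bar> + 2 * \<bar>a s \<bullet> (D *v cutoff_grad R x)\<bar>"
      unfolding err_def using c1[of "?T - cutoff_grad R x \<bullet> (C *v x)"] s1[of "a s \<bullet> (D *v cutoff_grad R x)"]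
          by linarith
    also have "\<dots> \<le> ?N * (156 * L) / R + 4 * Lc / R + 2 * (2 * A * L / R)" using T g d by linarith
    also have "\<dots> = (?N * (156 * L) + 4 * Lc + 4 * A * L) / R" by (simp add: add_divide_distrib)
    finally show "\<bar>err R s x\<bar> \<le> (?N * (156 * L) + 4 * Lc + 4 * A * L) / R" .
  qed
qed

text \<open>The equation holds for positive times only, whereas the mean value theorem is used on an
  interval starting at 0. Continuity there rests on convergence of \<open>f\<close> in
  \<open>L1\<close>.\<close>

lemma m_continuous:
  assumes R: "1 \<le> R" shows "continuous_on {0..t} (m R)"
  unfolding continuous_on_sequentially
proof safe
  fix X s assume s: "s \<in> {0..t}" and X: "\<forall>n. X n \<in> {0..t}" "X \<longlonglongrightarrow> s"
  obtain A Bq Bf where Bq: "\<And>s. s \<in> {0..t} \<Longrightarrow> exp (- q s) \<le> Bq" "0 \<le> Bq" using bounds by metis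
  have cG: "\<bar>cutoff R x * G r x\<bar> \<le> Bq" if "r \<in> {0..t}" for r x
  proof -
    have "\<bar>cutoff R x\<bar> * \<bar>G r x\<bar> \<le> 1 * Bq"
      using cutoff_bound[OF R, of x] G_bound[of r x] Bq(1)[OF that] by (intro mult_mono) auto
    then show ?thesis by (simp add: abs_mult)
  qed
  have X0: "0 \<le> X n" for n using X by auto
  have s0: "0 \<le> s" using s by auto
  note iX = integrable_f[OF X0] and i_s = integrable_f[OF s0]
  have nm: "(\<lambda>n. \<integral>x. \<bar>f (X n) x - f s x\<bar> \<partial>lborel) \<longlonglongrightarrow> 0"
  proof -
    have "((\<lambda>r. \<integral>x. \<bar>f r x - f s x\<bar> \<partial>lborel) \<longlongrightarrow> 0) (at s within {0..})" using sol s
        by (simp add: fp_solution_def)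
    moreover have "(\<integral>x. \<bar>f s x - f s x\<bar> \<partial>lborel) = 0" by simp
    ultimately have "continuous (at s within {0..}) (\<lambda>r. \<integral>x. \<bar>f r x - f s x\<bar> \<partial>lborel)"
      by (simp add: continuous_within)
    from continuous_within_tendsto_compose'[OF this _ X(2)] X0 show ?thesis by auto
  qed
  have l1: "(\<lambda>n. \<integral>x. (f (X n) x - f s x) * (cutoff R x * G (X n) x) \<partial>lborel) \<longlonglongrightarrow> 0"
  proof (rule Lim_null_comparison[OF always_eventually])
    show "(\<lambda>n. Bq * (\<integral>x. \<bar>f (X n) x - f s x\<bar> \<partial>lborel)) \<longlonglongrightarrow> 0" using tendsto_mult_left[OF nm, of Bq] by simp
    show "\<forall>n. norm (\<integral>x. (f (X n) x - f s x) * (cutoff R x * G (X n) x) \<partial>lborel)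
        \<le> Bq * (\<integral>x. \<bar>f (X n) x - f s x\<bar> \<partial>lborel)"
    proof
      fix n
      have i: "integrable lborel (\<lambda>x. f (X n) x - f s x)" using iX i_s by auto
      have "norm (\<integral>x. (f (X n) x - f s x) * (cutoff R x * G (X n) x) \<partial>lborel)
        \<le> (\<integral>x. norm ((f (X n) x - f s x) * (cutoff R x * G (X n) x)) \<partial>lborel)" by (rule integral_norm_bound)
      also have "\<dots> \<le> (\<integral>x. Bq * \<bar>f (X n) x - f s x\<bar> \<partial>lborel)"
      proof (rule integral_mono)
        show "integrable lborel (\<lambda>x. norm ((f (X n) x - f s x) * (cutoff R x * G (X n) x)))"
          by (rule integrable_norm[OF cG_integrable[OF R X0 i]])
        fix x
        have "\<bar>f (X n) x - f s x\<bar> * \<bar>cutoff R x * G (X n) x\<bar> \<le> \<bar>f (X n) x - f s x\<bar> * Bq"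
          by (intro mult_left_mono cG) (use X in auto)
        then show "norm ((f (X n) x - f s x) * (cutoff R x * G (X n) x)) \<le> Bq * \<bar>f (X n) x - f s x\<bar>"
          by (simp add: abs_mult mult.commute)
      qed (use i in auto)
      finally show "norm (\<integral>x. (f (X n) x - f s x) * (cutoff R x * G (X n) x) \<partial>lborel)
          \<le> Bq * (\<integral>x. \<bar>f (X n) x - f s x\<bar> \<partial>lborel)"
        by simp
    qed
  qed
  have l2: "(\<lambda>n. \<integral>x. f s x * (cutoff R x * G (X n) x) \<partial>lborel) \<longlonglongrightarrow> m R s"
    unfolding m_def
  proof (rule integral_dominated_convergence[where w = "\<lambda>x. \<bar>f s x\<bar> * Bq"])
    show "(\<lambda>x. f s x * (cutoff R x * G s x)) \<in> borel_measurable lborel"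
      using cG_integrable[OF R s0 i_s] by auto
    show "(\<lambda>x. f s x * (cutoff R x * G (X n) x)) \<in> borel_measurable lborel" for n
      using cG_integrable[OF R X0 i_s] by auto
    show "integrable lborel (\<lambda>x. \<bar>f s x\<bar> * Bq)" using i_s by auto
    show "AE x in lborel. norm (f s x * (cutoff R x * G (X n) x)) \<le> \<bar>f s x\<bar> * Bq" for n
    proof (rule AE_I2)
      fix x
      have "\<bar>f s x\<bar> * \<bar>cutoff R x * G (X n) x\<bar> \<le> \<bar>f s x\<bar> * Bq"
        by (intro mult_left_mono cG) (use X in auto)
      then show "norm (f s x * (cutoff R x * G (X n) x)) \<le> \<bar>f s x\<bar> * Bq" by (simp add: abs_mult)
    qed
    show "AE x in lborel. (\<lambda>n. f s x * (cutoff R x * G (X n) x)) \<longlonglongrightarrow> f s x * (cutoff R x * G s x)"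
    proof (intro AE_I2 tendsto_mult tendsto_const)
      fix x
      have "isCont (\<lambda>r. G r x) s" using dG[of x s] by (rule DERIV_isCont)
      from isCont_tendsto_compose[OF this X(2)] show "(\<lambda>n. G (X n) x) \<longlonglongrightarrow> G s x" .
    qed
  qed
  have "m R (X n) = (\<integral>x. (f (X n) x - f s x) * (cutoff R x * G (X n) x) \<partial>lborel) + (\<integral>x. f s x * (cutoff R x
      * G (X n) x) \<partial>lborel)" for n
    unfolding m_def left_diff_distrib
    using cG_integrable[OF R X0 iX] cG_integrable[OF R X0 i_s] by simp
  then show "(m R \<circ> X) \<longlonglongrightarrow> m R s"
    using tendsto_add[OF l1 l2] by (simp add: o_def)
qed

text \<open>The cutoffs tend to \<open>flat 0 1\<close>, which is \<open>exp (- 1)\<close> and not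
  1. This common factor is divided out later.\<close>

lemma m_limit:
  assumes s: "0 \<le> s"
  shows "(\<lambda>k. m (real (Suc k)) s) \<longlonglongrightarrow> flat 0 1 * (\<integral>x. f s x * G s x \<partial>lborel)"
proof -
  have "(\<lambda>k. m (real (Suc k)) s) \<longlonglongrightarrow> (\<integral>x. f s x * (flat 0 1 * G s x) \<partial>lborel)"
    unfolding m_def
  proof (rule integral_dominated_convergence[where w = "\<lambda>x. \<bar>f s x\<bar> * exp (- q s)"])
    note [measurable] = f_measurable[OF s] G_measurable
    show "(\<lambda>x. f s x * (flat 0 1 * G s x)) \<in> borel_measurable lborel" by simp
    show "(\<lambda>x. f s x * (cutoff (real (Suc k)) x * G s x)) \<in> borel_measurable lborel" for k
      using cG_integrable[OF _ s integrable_f[OF s], of "real (Suc k)"] by (auto simp del: of_nat_Suc)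
    show "integrable lborel (\<lambda>x. \<bar>f s x\<bar> * exp (- q s))" using integrable_f[OF s] by auto
    show "AE x in lborel. norm (f s x * (cutoff (real (Suc k)) x * G s x)) \<le> \<bar>f s x\<bar> * exp (- q s)" for k
    proof (rule AE_I2)
      fix x :: "real^'n"
      have "1 \<le> real (Suc k)" by simp
      from cutoff_bound[OF this, of x] have "\<bar>cutoff (real (Suc k)) x\<bar> \<le> 1"
        by (simp only: abs_of_nonneg)
      then have "\<bar>cutoff (real (Suc k)) x\<bar> * \<bar>G s x\<bar> \<le> 1 * exp (- q s)"
        by (rule mult_mono[OF _ G_bound]) auto
      then show "norm (f s x * (cutoff (real (Suc k)) x * G s x)) \<le> \<bar>f s x\<bar> * exp (- q s)"
        unfolding real_norm_def abs_mult by (intro mult_left_mono) auto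
    qed
    show "AE x in lborel. (\<lambda>k. f s x * (cutoff (real (Suc k)) x * G s x)) \<longlonglongrightarrow> f s x * (flat 0 1 * G s x)"
    proof (intro AE_I2 tendsto_mult tendsto_const)
      fix x :: "real^'n"
      have "(\<lambda>k. 1 - ln (1 + x \<bullet> x) * (1 / real (Suc k))) \<longlonglongrightarrow> 1 - ln (1 + x \<bullet> x) * 0"
        using LIMSEQ_Suc[OF lim_inverse_n'] by (intro tendsto_intros)
      then have "(\<lambda>k. 1 - ln (1 + x \<bullet> x) / real (Suc k)) \<longlonglongrightarrow> 1" by simp
      moreover have "isCont (flat 0) 1" by (rule DERIV_isCont[OF flat_deriv])
      ultimately show "(\<lambda>k. cutoff (real (Suc k)) x) \<longlonglongrightarrow> flat 0 1"
        unfolding cutoff_def by (rule isCont_tendsto_compose[rotated])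
    qed
  qed
  then show ?thesis by (simp add: mult.left_commute[of "f _ _"])
qed

text \<open>The mean value theorem and \<open>err_bound\<close> make the pairings at times 0 and
  \<open>t\<close> differ by \<open>O(1 / R)\<close>, so they agree in the limit of large
  \<open>R\<close>.\<close>

theorem solution_fourier:
  "(\<integral>x. f t x * cos (\<xi> \<bullet> x + \<theta>) \<partial>lborel)
    = exp (- (\<xi> \<bullet> (Qf t *v \<xi>)) / 2) * (\<integral>x. f 0 x * cos ((transpose (E t) *v \<xi>) \<bullet> x + \<theta>) \<partial>lborel)"
proof -
  obtain M where M: "0 \<le> M" "\<And>R s x. 1 \<le> R \<Longrightarrow> s \<in> {0..t} \<Longrightarrow> \<bar>err R s x\<bar> \<le> M / R" using err_bound by metis
  obtain A Bq Bf where B: "\<And>s. s \<in> {0..t} \<Longrightarrow> exp (- q s) \<le> Bq"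
    "\<And>s. s \<in> {0..t} \<Longrightarrow> (\<integral>x. \<bar>f s x\<bar> \<partial>lborel) \<le> Bf" "0 \<le> Bq" "0 \<le> Bf" using bounds by metis
  have diff: "\<bar>m R t - m R 0\<bar> \<le> (t * Bq * M * Bf) / R" if R: "1 \<le> R" for R
  proof -
    have "((m R) has_derivative (\<lambda>d. exp (- q s) * (\<integral>x. f s x * err R s x \<partial>lborel) * d)) (at s)" if "0 < s"
        for s
      using m_deriv(1)[OF R that] by (simp add: has_field_derivative_def)
    from mvt[OF t m_continuous[OF R] this] obtain s where
      s: "0 < s" "s < t" "m R t - m R 0 = exp (- q s) * (\<integral>x. f s x * err R s x \<partial>lborel) * (t - 0)" by blast
    have "\<bar>\<integral>x. f s x * err R s x \<partial>lborel\<bar> \<le> (\<integral>x. \<bar>f s x * err R s x\<bar> \<partial>lborel)" by (rule integral_abs_bound)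
    also have "\<dots> \<le> (\<integral>x. \<bar>f s x\<bar> * (M / R) \<partial>lborel)"
    proof (rule integral_mono)
      show "integrable lborel (\<lambda>x. \<bar>f s x * err R s x\<bar>)" using m_deriv(2)[OF R s(1)] by auto
      show "integrable lborel (\<lambda>x. \<bar>f s x\<bar> * (M / R))" using integrable_f[of s] s by auto
      show "\<bar>f s x * err R s x\<bar> \<le> \<bar>f s x\<bar> * (M / R)" for x
        unfolding abs_mult by (intro mult_left_mono M(2) R) (use s in auto)
    qed
    also have "\<dots> = (\<integral>x. \<bar>f s x\<bar> \<partial>lborel) * (M / R)" by simp
    also have "\<dots> \<le> Bf * (M / R)" by (intro mult_right_mono B) (use s M R in auto)
    finally have 1: "\<bar>\<integral>x. f s x * err R s x \<partial>lborel\<bar> \<le> Bf * (M / R)" .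
    have "\<bar>m R t - m R 0\<bar> = exp (- q s) * \<bar>\<integral>x. f s x * err R s x \<partial>lborel\<bar> * t"
      using s t by (simp add: abs_mult)
    also have "\<dots> \<le> Bq * (Bf * (M / R)) * t"
      by (intro mult_mono 1 B) (use s t B M R in auto)
    finally show ?thesis by (simp add: mult_ac)
  qed
  have "(\<lambda>k. m (real (Suc k)) t - m (real (Suc k)) 0) \<longlonglongrightarrow> 0"
  proof (rule Lim_null_comparison[OF always_eventually])
    show "\<forall>k. norm (m (real (Suc k)) t - m (real (Suc k)) 0) \<le> (t * Bq * M * Bf) * (1 / real (Suc k))"
      using diff by simp
    show "(\<lambda>k. (t * Bq * M * Bf) * (1 / real (Suc k))) \<longlonglongrightarrow> 0"
      using tendsto_mult_left[OF LIMSEQ_Suc[OF lim_inverse_n'], of "t * Bq * M * Bf"] by simp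
  qed
  moreover have "(\<lambda>k. m (real (Suc k)) t - m (real (Suc k)) 0) \<longlonglongrightarrow>
      flat 0 1 * (\<integral>x. f t x * G t x \<partial>lborel) - flat 0 1 * (\<integral>x. f 0 x * G 0 x \<partial>lborel)"
    using t by (intro tendsto_diff m_limit) auto
  ultimately have "flat 0 1 * (\<integral>x. f t x * G t x \<partial>lborel) - flat 0 1 * (\<integral>x. f 0 x * G 0 x \<partial>lborel) = 0"
    using LIMSEQ_unique by blast
  then have "(\<integral>x. f t x * G t x \<partial>lborel) = (\<integral>x. f 0 x * G 0 x \<partial>lborel)"
    by (simp add: flat_def)
  moreover have "q t = 0" "a t = \<xi>"
    unfolding q_def Qf_quad a_def by (simp_all add: E0 transpose_mat)
  moreover have "(\<integral>x. f 0 x * G 0 x \<partial>lborel)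
      = exp (- (\<xi> \<bullet> (Qf t *v \<xi>)) / 2) * (\<integral>x. f 0 x * cos ((transpose (E t) *v \<xi>) \<bullet> x + \<theta>) \<partial>lborel)"
    unfolding G_def mult.left_commute[of "f 0 _"] integral_mult_right_zero by (simp add: q_def a_def)
  ultimately show ?thesis by (simp add: G_def)
qed

end

section \<open>Mehler's formula\<close>

text \<open>If \<open>D b\<close> were nonzero, moving from \<open>b\<close> by a small negative
  multiple of \<open>D b\<close> would make the form negative.\<close>

lemma pos_semidef_zero:
  fixes D :: "real^'n^'n"
  assumes D: "pos_semidef D" and z: "b \<bullet> (D *v b) = 0"
  shows "D *v b = 0"
proof (rule ccontr)
  assume nz: "D *v b \<noteq> 0"
  define w where "w = D *v b"
  define \<alpha> where "\<alpha> = w \<bullet> w"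
  define c where "c = w \<bullet> (D *v w)"
  have \<alpha>: "0 < \<alpha>" using nz by (simp add: \<alpha>_def w_def)
  have c: "0 \<le> c" using D by (simp add: c_def pos_semidef_def)
  have sym: "transpose D = D" using D by (simp add: pos_semidef_def)
  have bw: "b \<bullet> (D *v w) = \<alpha>" using symmetric_inner[OF sym, of b w] by (simp add: \<alpha>_def w_def)
  \<comment> \<open>The denominator \<open>c + 1\<close> is positive even if \<open>c = 0\<close>
    and ensures \<open>r * c \<ge> - \<alpha>\<close>, so that the linear term outweighs the
    quadratic one.\<close>
  define r where "r = - \<alpha> / (c + 1)"
  have "0 \<le> (b + r *\<^sub>R w) \<bullet> (D *v (b + r *\<^sub>R w))" using D by (simp add: pos_semidef_def)
  also have "\<dots> = 2 * r * \<alpha> + r\<^sup>2 * c"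
    using z bw by (simp add: matrix_vector_right_distrib linear_scale[OF matrix_vector_mul_linear]
        inner_add_left inner_add_right
        c_def[symmetric] w_def[symmetric] \<alpha>_def[symmetric] power2_eq_square algebra_simps)
  also have "\<dots> = r * (2 * \<alpha> + r * c)" by (simp add: power2_eq_square algebra_simps)
  finally have 1: "0 \<le> r * (2 * \<alpha> + r * c)" .
  have "r * c \<ge> - \<alpha>" using \<alpha> c by (simp add: r_def pos_divide_le_eq)
  then have "0 < 2 * \<alpha> + r * c" using \<alpha> by linarith
  moreover have "r < 0" using \<alpha> c by (simp add: r_def divide_neg_pos)
  ultimately show False using 1 by (simp add: zero_le_mult_iff)
qed

lemma pos_def_inv:
  fixes S :: "real^'n^'n"
  assumes S: "pos_def S"
  shows "S ** matrix_inv S = mat 1" "matrix_inv S ** S = mat 1" "pos_def (matrix_inv S)"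
proof -
  have "\<forall>x. S *v x = 0 \<longrightarrow> x = 0" using S by (auto simp: pos_def_def)
  then have "invertible S" by (simp add: invertible_left_inverse matrix_left_invertible_ker)
  then have "S ** matrix_inv S = mat 1 \<and> matrix_inv S ** S = mat 1"
    unfolding invertible_def matrix_inv_def by (rule someI_ex)
  then show 1: "S ** matrix_inv S = mat 1" "matrix_inv S ** S = mat 1" by simp_all
  have sym: "transpose S = S" using S by (simp add: pos_def_def)
  have "transpose (matrix_inv S) ** S = mat 1"
    using arg_cong[OF 1(1), of transpose] by (simp add: matrix_transpose_mul sym transpose_mat)
  then have "transpose (matrix_inv S) = matrix_inv S"
    using 1 by (metis matrix_mul_assoc matrix_mul_lid matrix_mul_rid)
  moreover have "0 < x \<bullet> (matrix_inv S *v x)" if "x \<noteq> 0" for x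
  proof -
    define y where "y = matrix_inv S *v x"
    have x: "x = S *v y" using 1(1) by (simp add: y_def matrix_vector_mul_assoc)
    then have "y \<noteq> 0" using that by auto
    then have "0 < y \<bullet> (S *v y)" using S by (simp add: pos_def_def)
    then show ?thesis unfolding y_def[symmetric] using x by (simp add: inner_commute)
  qed
  ultimately show "pos_def (matrix_inv S)" by (simp add: pos_def_def)
qed

lemma gauss_sin_integral:
  fixes S :: "real^'n^'n"
  shows "(\<integral>x. gauss S x * sin (\<xi> \<bullet> x) \<partial>lborel) = 0"
  using integral_affine[of "\<lambda>x. gauss S x * sin (\<xi> \<bullet> x)" "-1" 0] by (simp add: gauss_even)

lemma gauss_cos_shift_integral:
  fixes S R :: "real^'n^'n"
  assumes S: "pos_def S" and inv: "S ** R = mat 1"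
  shows "(\<integral>y. gauss S (y - z) * cos (\<xi> \<bullet> y + \<theta>) \<partial>lborel)
    = (\<integral>x. gauss S x \<partial>lborel) * exp (- (\<xi> \<bullet> (R *v \<xi>)) / 2) * cos (\<xi> \<bullet> z + \<theta>)"
proof -
  have i: "integrable lborel (\<lambda>x. gauss S x * g x)" if "g \<in> borel_measurable borel" "\<And>x. \<bar>g x\<bar> \<le> 1" for g
    by (rule Bochner_Integration.integrable_bound[OF gauss_integrable(2)[OF S]])
      (use that gauss_pos[of S] in \<open>auto simp: abs_mult intro!: mult_left_le\<close>)
  have "(\<integral>y. gauss S (y - z) * cos (\<xi> \<bullet> y + \<theta>) \<partial>lborel) = (\<integral>w. gauss S w * cos (\<xi> \<bullet> (w + z) + \<theta>) \<partial>lborel)"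
    using integral_translate[of "\<lambda>y. gauss S (y - z) * cos (\<xi> \<bullet> y + \<theta>)" z] by simp
  also have "\<dots> = (\<integral>w. cos (\<xi> \<bullet> z + \<theta>) * (gauss S w * cos (\<xi> \<bullet> w)) - sin (\<xi> \<bullet> z + \<theta>) * (gauss S w * sin (\<xi> \<bullet>
      w)) \<partial>lborel)"
  proof (rule Bochner_Integration.integral_cong[OF refl])
    fix w
    have "\<xi> \<bullet> (w + z) + \<theta> = \<xi> \<bullet> w + (\<xi> \<bullet> z + \<theta>)" by (simp add: inner_add_right)
    then show "gauss S w * cos (\<xi> \<bullet> (w + z) + \<theta>) = cos (\<xi> \<bullet> z + \<theta>) * (gauss S w * cos (\<xi> \<bullet> w)) - sin (\<xi> \<bullet> z
        + \<theta>) * (gauss S w * sin (\<xi> \<bullet> w))"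
      by (simp only: cos_add) (simp add: algebra_simps)
  qed
  also have "\<dots> = cos (\<xi> \<bullet> z + \<theta>) * (\<integral>w. gauss S w * cos (\<xi> \<bullet> w) \<partial>lborel)"
    using i[of "\<lambda>w. cos (\<xi> \<bullet> w)"] i[of "\<lambda>w. sin (\<xi> \<bullet> w)"] by (simp add: gauss_sin_integral)
  finally show ?thesis using gauss_cos_integral[OF S inv] by simp
qed

section \<open>Nondegenerate covariance and the reversed Gaussian\<close>

locale fp_kernel = fp_data D C K E for D C K :: "real^'n^'n" and E +
  fixes t :: real
  assumes condC: "condition_C D C" and t: "0 < t"
begin

text \<open>The form starts at 0 and is nondecreasing, so vanishing at time \<open>t\<close> forces
  it, and with it its derivative, to vanish on the whole interval. Then \<open>D\<close> annihilates
  the curve of transposed propagators applied to \<open>\<xi>\<close>, together with all its time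
  derivatives; Condition (C) makes the curve zero, against invertibility of the propagator.\<close>

lemma Q_pos_def: "pos_def (Qf t)"
  unfolding pos_def_def
proof safe
  show "transpose (Qf t) = Qf t"
  proof -
    have "transpose (A - B) = transpose A - transpose B" for A B :: "real^'n^'n"
      by (simp add: transpose_def vec_eq_iff)
    then show ?thesis by (simp add: Qf_def matrix_transpose_mul Ksym matrix_mul_assoc)
  qed
  fix \<xi> :: "real^'n" assume nz: "\<xi> \<noteq> 0"
  let ?b = "\<lambda>s. transpose (E s) *v \<xi>"
  define g where "g = (\<lambda>s. \<xi> \<bullet> (Qf s *v \<xi>))"
  have dg: "(g has_real_derivative 2 * (?b s \<bullet> (D *v ?b s))) (at s)" for s
    unfolding g_def by (rule Qf_quad_deriv)
  have nn: "0 \<le> 2 * (?b s \<bullet> (D *v ?b s))" for s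
    using D by (simp add: pos_semidef_def del: transpose_matrix_vector)
  have mono: "g r \<le> g s" if "r \<le> s" for r s
    by (rule DERIV_nonneg_imp_nondecreasing[OF that]) (use dg nn in blast)
  have g0: "g 0 = 0" unfolding g_def Qf_quad by (simp add: E0 transpose_mat)
  show "0 < \<xi> \<bullet> (Qf t *v \<xi>)"
  proof (rule ccontr)
    assume "\<not> 0 < \<xi> \<bullet> (Qf t *v \<xi>)"
    then have gt: "g t \<le> 0" by (simp add: g_def)
    have gz: "g s = 0" if "s \<in> {0<..<t}" for s
      using mono[of 0 s] mono[of s t] g0 gt that by auto
    have Db: "D *v ?b s = 0" if s: "s \<in> {0<..<t}" for s
    proof -
      have "(g has_real_derivative 0) (at s)"
        by (rule has_field_derivative_transform_within_open[of "\<lambda>_. 0" _ _ "{0<..<t}"]) (use s gz in auto)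
      then have "?b s \<bullet> (D *v ?b s) = 0" using DERIV_unique[OF dg] by fastforce
      then show ?thesis by (rule pos_semidef_zero[OF D])
    qed
    let ?T = "\<lambda>v :: real^'n. transpose C *v v"
    have lT: "bounded_linear (?T ^^ k)" for k
    proof (induction k)
      case (Suc k)
      show ?case using bounded_linear_compose[OF bounded_linear_matrix Suc]
          by (simp add: o_def del: transpose_matrix_vector)
    qed (simp add: bounded_linear_ident id_def)
    \<comment> \<open>Each differentiation of the vanishing curve inserts one more factor
      \<open>transpose C\<close>.\<close>
    have Dk: "\<forall>s\<in>{0<..<t}. D *v ((?T ^^ k) (?b s)) = 0" for k
    proof (induction k)
      case 0
      show ?case using Db by simp
    next
      case (Suc k)
      show ?case
      proof
        fix s assume s: "s \<in> {0<..<t}"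
        have "((\<lambda>s. D *v ((?T ^^ k) (?b s))) has_vector_derivative D *v ((?T ^^ k) (- (transpose C *v ?b
            s)))) (at s)"
          by (rule bounded_linear.has_vector_derivative[OF bounded_linear_matrix
              bounded_linear.has_vector_derivative[OF lT dET]])
        moreover have "((\<lambda>s. D *v ((?T ^^ k) (?b s))) has_vector_derivative 0) (at s)"
          by (rule has_vector_derivative_transform_within_open[of "\<lambda>_. 0" _ _ "{0<..<t}"]) (use s Suc in auto)
        ultimately have "D *v ((?T ^^ k) (- (transpose C *v ?b s))) = 0"
          using vector_derivative_unique_at by blast
        then have "D *v ((?T ^^ k) (transpose C *v ?b s)) = 0"
          by (simp add: linear_neg[OF bounded_linear.linear[OF lT]] linear_neg[OF matrix_vector_mul_linear]
              del: transpose_matrix_vector)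
        then show "D *v ((?T ^^ Suc k) (?b s)) = 0"
          by (simp add: funpow_swap1 del: transpose_matrix_vector)
      qed
    qed
    \<comment> \<open>The largest subspace of the kernel of \<open>D\<close> that is invariant under
      \<open>transpose C\<close>.\<close>
    define V where "V = {v. \<forall>k. D *v ((?T ^^ k) v) = 0}"
    have "subspace V"
      unfolding subspace_def V_def
      using linear_add[OF bounded_linear.linear[OF lT]] linear_scale[OF bounded_linear.linear[OF lT]]
          linear_0[OF bounded_linear.linear[OF lT]]
      by (simp add: matrix_vector_right_distrib linear_scale[OF matrix_vector_mul_linear] del:
          transpose_matrix_vector)
    moreover have "V \<subseteq> {x. D *v x = 0}"
      unfolding V_def by (auto dest: spec[of _ 0])
    moreover have "\<forall>v\<in>V. transpose C *v v \<in> V"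
    proof
      fix v assume "v \<in> V"
      then have "D *v ((?T ^^ Suc k) v) = 0" for k unfolding V_def by blast
      then show "transpose C *v v \<in> V"
        unfolding V_def by (simp add: funpow_swap1 del: transpose_matrix_vector)
    qed
    ultimately have "V = {0}" using condC unfolding condition_C_def by blast
    moreover have "?b (t / 2) \<in> V"
      using Dk t unfolding V_def mem_Collect_eq by (auto simp del: transpose_matrix_vector)
    ultimately have b0: "?b (t / 2) = 0" by blast
    have "\<xi> \<bullet> v = 0" for v
    proof -
      have "\<xi> \<bullet> (E (t / 2) *v (E (- (t / 2)) *v v)) = 0"
        using b0 transpose_inner[of "E (t / 2)" \<xi>] by (metis inner_zero_left)
      then show ?thesis using inv[of "- (t / 2)" v] by simp
    qed
    then show False using nz by (metis inner_eq_zero_iff)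
  qed
qed

text \<open>\<open>S\<close> and \<open>M\<close> complete the square in \<open>gauss_identity\<close> below.\<close>
definition Ki where "Ki = matrix_inv K"
definition Qi where "Qi = matrix_inv (Qf t)"
definition S where "S = Ki + transpose (E t) ** Qi ** E t"
definition M where "M = K ** transpose (E t) ** Ki"

lemma K_inv: "K ** Ki = mat 1" "Ki ** K = mat 1" "pos_def Ki"
  using pos_def_inv[OF K] by (simp_all add: Ki_def)

lemma Q_inv: "Qf t ** Qi = mat 1" "Qi ** Qf t = mat 1" "pos_def Qi"
  using pos_def_inv[OF Q_pos_def] by (simp_all add: Qi_def)

lemma inv_v: "K *v (Ki *v x) = x" "Ki *v (K *v x) = x" "Qf t *v (Qi *v x) = x" "Qi *v (Qf t *v x) = x"
  using K_inv Q_inv by (simp_all add: matrix_vector_mul_assoc)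

lemma EKE: "E t *v (K *v (transpose (E t) *v x)) = K *v x - Qf t *v x"
  by (simp add: Qf_def matrix_vector_mult_diff_rdistrib matrix_vector_mul_assoc[symmetric] del:
      transpose_matrix_vector)

lemma sym_Ki: "transpose Ki = Ki" and sym_Qi: "transpose Qi = Qi"
  using K_inv Q_inv by (simp_all add: pos_def_def)

lemma S_v: "S *v x = Ki *v x + transpose (E t) *v (Qi *v (E t *v x))"
  by (simp add: S_def matrix_vector_mult_add_rdistrib matrix_vector_mul_assoc[symmetric] del:
      transpose_matrix_vector)

lemma M_v: "M *v y = K *v (transpose (E t) *v (Ki *v y))"
  by (simp add: M_def matrix_vector_mul_assoc[symmetric] del: transpose_matrix_vector)

lemma S_pos_def: "pos_def S"
  unfolding pos_def_def
proof safe
  show "transpose S = S"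
  proof -
    have "transpose (transpose (E t) ** Qi ** E t) = transpose (E t) ** Qi ** E t"
      by (simp add: matrix_transpose_mul sym_Qi matrix_mul_assoc)
    moreover have "transpose (A + B) = transpose A + transpose B" for A B :: "real^'n^'n"
      by (simp add: transpose_def vec_eq_iff)
    ultimately show ?thesis by (simp add: S_def sym_Ki)
  qed
  fix x :: "real^'n" assume x: "x \<noteq> 0"
  have "0 \<le> (E t *v x) \<bullet> (Qi *v (E t *v x))"
    using Q_inv(3) by (cases "E t *v x = 0") (auto simp: pos_def_def less_imp_le)
  moreover have "0 < x \<bullet> (Ki *v x)" using K_inv(3) x by (simp add: pos_def_def)
  moreover have "x \<bullet> (transpose (E t) *v (Qi *v (E t *v x))) = (E t *v x) \<bullet> (Qi *v (E t *v x))"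
    using transpose_inner[of "E t" "Qi *v (E t *v x)" x] by (metis inner_commute)
  ultimately show "0 < x \<bullet> (S *v x)" by (simp add: S_v inner_add_right del: transpose_matrix_vector)
qed

text \<open>Matches the mixed terms of the two exponents in \<open>gauss_identity\<close>; the lemma
  after it matches the terms in \<open>y\<close> alone.\<close>

lemma SM: "S *v (M *v y) = transpose (E t) *v (Qi *v y)"
proof -
  have "S *v (M *v y) = transpose (E t) *v (Ki *v y) + transpose (E t) *v (Qi *v (K *v (Ki *v y) - Qf t *v
      (Ki *v y)))"
    unfolding S_v M_v EKE inv_v ..
  also have "\<dots> = transpose (E t) *v (Qi *v y)"
    unfolding matrix_vector_mult_diff_distrib inv_v by simp
  finally show ?thesis .
qed

lemma MSM: "(M *v y) \<bullet> (S *v (M *v y)) = y \<bullet> (Qi *v y) - y \<bullet> (Ki *v y)"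
proof -
  have "(M *v y) \<bullet> (S *v (M *v y)) = (transpose (E t) *v (Qi *v y)) \<bullet> (M *v y)"
    unfolding SM by (simp only: inner_commute)
  also have "\<dots> = (Qi *v y) \<bullet> (E t *v (M *v y))" by (rule transpose_inner)
  also have "E t *v (M *v y) = y - Qf t *v (Ki *v y)" unfolding M_v EKE inv_v ..
  also have "(Qi *v y) \<bullet> (y - Qf t *v (Ki *v y)) = y \<bullet> (Qi *v y) - (Qi *v y) \<bullet> (Qf t *v (Ki *v y))"
    by (simp add: inner_diff_right inner_commute)
  also have "(Qi *v y) \<bullet> (Qf t *v (Ki *v y)) = y \<bullet> (Ki *v y)"
    using symmetric_inner[OF sym_Qi, of y "Qf t *v (Ki *v y)"] by (simp add: inv_v)
  finally show ?thesis .
qed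

text \<open>Both exponents are the same quadratic form in the pair of points. This is detailed
  balance before normalisation.\<close>

lemma gauss_identity: "gauss Ki x * gauss Qi (y - E t *v x) = gauss Ki y * gauss S (x - M *v y)"
proof -
  have 1: "(y - E t *v x) \<bullet> (Qi *v (y - E t *v x)) = y \<bullet> (Qi *v y) - 2 * (y \<bullet> (Qi *v (E t *v x))) + (E t *v
      x) \<bullet> (Qi *v (E t *v x))"
    using symmetric_inner[OF sym_Qi, of y "E t *v x"]
    by (simp add: matrix_vector_mult_diff_distrib inner_diff_left inner_diff_right inner_commute)
  have symS: "transpose S = S" using S_pos_def by (simp add: pos_def_def)
  have 2: "(x - M *v y) \<bullet> (S *v (x - M *v y)) = x \<bullet> (S *v x) - 2 * (x \<bullet> (S *v (M *v y))) + (M *v y) \<bullet> (S *v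
      (M *v y))"
    using symmetric_inner[OF symS, of x "M *v y"]
    by (simp add: matrix_vector_mult_diff_distrib inner_diff_left inner_diff_right inner_commute)
  have 3: "x \<bullet> (S *v (M *v y)) = y \<bullet> (Qi *v (E t *v x))"
  proof -
    have "x \<bullet> (S *v (M *v y)) = (Qi *v y) \<bullet> (E t *v x)"
      unfolding SM using transpose_inner[of "E t" "Qi *v y" x] by (metis inner_commute)
    also have "\<dots> = y \<bullet> (Qi *v (E t *v x))" by (rule symmetric_inner[OF sym_Qi])
    finally show ?thesis .
  qed
  have 4: "x \<bullet> (S *v x) = x \<bullet> (Ki *v x) + (E t *v x) \<bullet> (Qi *v (E t *v x))"
    unfolding S_v inner_add_right using transpose_inner[of "E t" "Qi *v (E t *v x)" x] by (metis inner_commute)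
  have "x \<bullet> (Ki *v x) + (y - E t *v x) \<bullet> (Qi *v (y - E t *v x))
      = y \<bullet> (Ki *v y) + (x - M *v y) \<bullet> (S *v (x - M *v y))"
    unfolding 1 2 3 4 MSM by simp
  then have "exp (- (x \<bullet> (Ki *v x) + (y - E t *v x) \<bullet> (Qi *v (y - E t *v x))) / 2)
    = exp (- (y \<bullet> (Ki *v y) + (x - M *v y) \<bullet> (S *v (x - M *v y))) / 2)" by simp
  then show ?thesis by (simp only: gauss_def exp_add[symmetric]) (simp add: add_divide_distrib)
qed

end

section \<open>Integration by parts for weak gradients without compact support\<close>

lemma hdiff_scale:
  assumes "hdiff f k" shows "hdiff (\<lambda>x. f (c *\<^sub>R x)) k"
  using assms
proof (induction k arbitrary: f)
  case 0
  then have "continuous_on UNIV (f \<circ> (\<lambda>x. c *\<^sub>R x))"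
    by (intro continuous_on_compose) (auto intro!: continuous_intros intro: continuous_on_subset)
  then show ?case by (simp add: o_def)
next
  case (Suc k)
  obtain f' where f': "\<And>x. (f has_derivative f' x) (at x)" "\<And>v. hdiff (\<lambda>x. f' x v) k"
    using hdiff_D[OF Suc.prems] by metis
  have "((\<lambda>x. f (c *\<^sub>R x)) has_derivative (\<lambda>v. c * f' (c *\<^sub>R x) v)) (at x)" for x
  proof -
    have "((f \<circ> (\<lambda>x. c *\<^sub>R x)) has_derivative (f' (c *\<^sub>R x) \<circ> (\<lambda>v. c *\<^sub>R v))) (at x)"
      by (rule diff_chain_at) (auto intro!: derivative_eq_intros f'(1))
    moreover have "f' (c *\<^sub>R x) \<circ> (\<lambda>v. c *\<^sub>R v) = (\<lambda>v. c * f' (c *\<^sub>R x) v)"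
      using linear_scale[OF has_derivative_linear[OF f'(1)]] by (simp add: fun_eq_iff)
    ultimately show ?thesis by (simp add: o_def)
  qed
  then show ?case
    by (rule hdiff_SucI) (intro hdiff_mult hdiff_const Suc.IH f'(2))
qed

text \<open>Admits smooth \<open>\<phi>\<close> such as Gaussians, which are no test functions. A
  bump stretched by \<open>k + 1\<close> is inserted; its derivative contributes
  \<open>O(1 / k)\<close>, while the bump itself tends to the positive constant \<open>b 0\<close>,
  which cancels.\<close>

lemma weak_grad_ibp:
  fixes h \<phi> :: "real^'n \<Rightarrow> real"
  assumes wg: "is_weak_grad h G" and sm: "\<And>k. hdiff \<phi> k"
    and d\<phi>: "\<And>x. (\<phi> has_derivative \<phi>' x) (at x)"
    and i1: "integrable lborel (\<lambda>x. h x * \<phi> x)" and i2: "integrable lborel (\<lambda>x. h x * \<phi>' x v)"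
    and i3: "integrable lborel (\<lambda>x. \<phi> x * (G x \<bullet> v))"
  shows "(\<integral>x. h x * \<phi>' x v \<partial>lborel) = - (\<integral>x. \<phi> x * (G x \<bullet> v) \<partial>lborel)"
proof -
  let ?a = "(\<chi> i. - 1) :: real^'n" and ?b = "(\<chi> i. 1) :: real^'n"
  define b where "b = box_bump ?a ?b"
  have tb: "test_function b"
    unfolding b_def
  proof (rule test_functionI[where S = "box ?a ?b"])
    show "box_bump ?a ?b x \<noteq> 0 \<Longrightarrow> x \<in> box ?a ?b" for x
      using box_bump_pos_iff[of ?a ?b x] box_bump_range(1)[of ?a ?b x] by linarith
  qed (auto intro: hdiff_box_bump)
  let ?Db = "\<lambda>x. frechet_derivative b (at x) v"
  obtain B Sb where B: "0 \<le> B" "compact Sb" "\<And>x. \<bar>?Db x\<bar> \<le> B * indicator Sb x"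
    using test_function_bounded[OF test_function_deriv[OF tb, of v]] by blast
  have Db: "\<bar>?Db x\<bar> \<le> B" for x using B(1) B(3)[of x] by (cases "x \<in> Sb") auto
  have b1: "0 \<le> b x" "b x \<le> 1" for x by (simp_all add: b_def box_bump_range)
  let ?r = "\<lambda>k::nat. 1 / real (Suc k)"
  define \<beta> where "\<beta> k x = b (?r k *\<^sub>R x)" for k x
  define \<beta>' where "\<beta>' k x = ?r k * ?Db (?r k *\<^sub>R x)" for k x
  have d\<beta>: "(\<beta> k has_derivative (\<lambda>w. ?r k * frechet_derivative b (at (?r k *\<^sub>R x)) w)) (at x)" for k x
  proof -
    have "((b \<circ> (\<lambda>x. ?r k *\<^sub>R x)) has_derivative (frechet_derivative b (at (?r k *\<^sub>R x)) \<circ> (\<lambda>w. ?r k *\<^sub>R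
        w))) (at x)"
      by (rule diff_chain_at) (auto intro!: derivative_eq_intros test_function_has_derivative tb)
    moreover have "frechet_derivative b (at (?r k *\<^sub>R x)) \<circ> (\<lambda>w. ?r k *\<^sub>R w)
        = (\<lambda>w. ?r k * frechet_derivative b (at (?r k *\<^sub>R x)) w)"
      by (simp add: fun_eq_iff test_function_grad_inner[OF tb])
    ultimately show ?thesis by (simp add: o_def \<beta>_def[abs_def])
  qed
  have t\<beta>: "test_function (\<beta> k)" for k
  proof (rule test_functionI[where S = "cball 0 (real (Suc k) * real CARD('n))"])
    show "hdiff (\<beta> k) j" for j
      unfolding \<beta>_def[abs_def] by (rule hdiff_scale[OF test_function_hdiff[OF tb]])
    fix x assume "\<beta> k x \<noteq> 0"
    then have "0 < b (?r k *\<^sub>R x)" using b1(1)[of "?r k *\<^sub>R x"] by (simp add: \<beta>_def)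
    then have bx: "?r k *\<^sub>R x \<in> box ?a ?b" unfolding b_def by (simp only: box_bump_pos_iff)
    have xi: "\<bar>x $ i\<bar> \<le> real (Suc k)" for i
    proof -
      have "- 1 < ?r k * x $ i" "?r k * x $ i < 1" using bx unfolding mem_box_cart by (simp_all del: of_nat_Suc)
      then have "\<bar>?r k * x $ i\<bar> < 1" by linarith
      then have "\<bar>x $ i\<bar> / real (Suc k) < 1" by (simp add: abs_mult)
      then show ?thesis by simp
    qed
    have "norm x \<le> (\<Sum>i\<in>UNIV. \<bar>x $ i\<bar>)" by (rule norm_le_l1_cart)
    also have "\<dots> \<le> (\<Sum>i\<in>(UNIV::'n set). real (Suc k))" by (intro sum_mono xi)
    finally show "x \<in> cball 0 (real (Suc k) * real CARD('n))" by (simp add: mult.commute)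
  qed simp
  note [measurable] = test_function_measurable[OF tb] test_function_measurable[OF t\<beta>]
      test_function_measurable[OF test_function_deriv[OF tb, of v]]
  have m: "(\<lambda>x. h x * \<phi> x) \<in> borel_measurable borel" "(\<lambda>x. h x * \<phi>' x v) \<in> borel_measurable borel"
    "(\<lambda>x. \<phi> x * (G x \<bullet> v)) \<in> borel_measurable borel" using i1 i2 i3 by auto
  have \<beta>l: "(\<lambda>k. \<beta> k x) \<longlonglongrightarrow> b 0" for x
  proof -
    have "(\<lambda>k. ?r k *\<^sub>R x) \<longlonglongrightarrow> 0 *\<^sub>R x"
      using LIMSEQ_Suc[OF lim_inverse_n'] by (intro tendsto_intros)
    then have "(\<lambda>k. ?r k *\<^sub>R x) \<longlonglongrightarrow> 0" by simp
    then show ?thesis unfolding \<beta>_def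
      using continuous_on_tendsto_compose[OF test_function_continuous[OF tb]] by force
  qed
  have ib: "integrable lborel (\<lambda>x. \<beta> k x * g x)" if "integrable lborel g" for k and g :: "real^'n \<Rightarrow> real"
    by (rule Bochner_Integration.integrable_bound[OF that])
      (use that b1 in \<open>auto simp: \<beta>_def abs_mult intro!: mult_left_le_one_le\<close>)
  have i\<beta>': "integrable lborel (\<lambda>x. \<beta>' k x * (h x * \<phi> x))" for k
  proof (rule Bochner_Integration.integrable_bound[OF integrable_mult_right[OF i1, of B]])
    show "(\<lambda>x. \<beta>' k x * (h x * \<phi> x)) \<in> borel_measurable lborel" unfolding \<beta>'_def using m(1) by simp
    show "AE x in lborel. norm (\<beta>' k x * (h x * \<phi> x)) \<le> norm (B * (h x * \<phi> x))"
    proof (rule AE_I2)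
      fix x
      have "\<bar>\<beta>' k x\<bar> \<le> 1 * B" unfolding \<beta>'_def abs_mult by (rule mult_mono) (auto intro: Db)
      then show "norm (\<beta>' k x * (h x * \<phi> x)) \<le> norm (B * (h x * \<phi> x))"
        using B(1) unfolding real_norm_def abs_mult by (intro mult_right_mono) auto
    qed
  qed
  have eq: "(\<integral>x. \<beta> k x * (h x * \<phi>' x v) \<partial>lborel) + (\<integral>x. \<beta>' k x * (h x * \<phi> x) \<partial>lborel)
      = - (\<integral>x. \<beta> k x * (\<phi> x * (G x \<bullet> v)) \<partial>lborel)" for k
  proof -
    have tp: "test_function (\<lambda>x. \<phi> x * \<beta> k x)" by (rule test_function_mult[OF t\<beta> sm])
    have "frechet_derivative (\<lambda>x. \<phi> x * \<beta> k x) (at x) v = \<phi> x * \<beta>' k x + \<phi>' x v * \<beta> k x" for x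
      by (subst frechet_derivative_at[symmetric, OF has_derivative_mult[OF d\<phi> d\<beta>]]) (simp add: \<beta>'_def)
    then have "(\<integral>x. h x * (\<phi> x * \<beta>' k x + \<phi>' x v * \<beta> k x) \<partial>lborel) = - (\<integral>x. \<phi> x * \<beta> k x * (G x \<bullet> v) \<partial>lborel)"
      using weak_grad_inner[OF wg tp, of v] by simp
    moreover have "h x * (\<phi> x * \<beta>' k x + \<phi>' x v * \<beta> k x) = \<beta> k x * (h x * \<phi>' x v) + \<beta>' k x * (h x * \<phi> x)" for x
      by (simp add: algebra_simps)
    moreover have "\<phi> x * \<beta> k x * (G x \<bullet> v) = \<beta> k x * (\<phi> x * (G x \<bullet> v))" for x by simp
    ultimately have "(\<integral>x. \<beta> k x * (h x * \<phi>' x v) + \<beta>' k x * (h x * \<phi> x) \<partial>lborel)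
        = - (\<integral>x. \<beta> k x * (\<phi> x * (G x \<bullet> v)) \<partial>lborel)"
      by (simp only:)
    then show ?thesis using Bochner_Integration.integral_add[OF ib[OF i2, of k] i\<beta>'[of k]] by linarith
  qed
  have lim: "(\<lambda>k. \<integral>x. \<beta> k x * g x \<partial>lborel) \<longlonglongrightarrow> (\<integral>x. b 0 * g x \<partial>lborel)" if g: "integrable lborel g"
      for g :: "real^'n \<Rightarrow> real"
  proof (rule integral_dominated_convergence[where w = "\<lambda>x. \<bar>g x\<bar>"])
    show "AE x in lborel. norm (\<beta> k x * g x) \<le> \<bar>g x\<bar>" for k
      using b1 by (auto simp: \<beta>_def abs_mult intro!: mult_left_le_one_le)
    show "AE x in lborel. (\<lambda>k. \<beta> k x * g x) \<longlonglongrightarrow> b 0 * g x"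
      by (intro AE_I2 tendsto_mult tendsto_const \<beta>l)
  qed (use g in auto)
  have lim0: "(\<lambda>k. \<integral>x. \<beta>' k x * (h x * \<phi> x) \<partial>lborel) \<longlonglongrightarrow> 0"
  proof (rule Lim_null_comparison[OF always_eventually])
    show "(\<lambda>k. (B * (\<integral>x. \<bar>h x * \<phi> x\<bar> \<partial>lborel)) * ?r k) \<longlonglongrightarrow> 0"
      using tendsto_mult_left[OF LIMSEQ_Suc[OF lim_inverse_n'], of "B * (\<integral>x. \<bar>h x * \<phi> x\<bar> \<partial>lborel)"] by simp
    show "\<forall>k. norm (\<integral>x. \<beta>' k x * (h x * \<phi> x) \<partial>lborel) \<le> (B * (\<integral>x. \<bar>h x * \<phi> x\<bar> \<partial>lborel)) * ?r k"
    proof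
      fix k
      have "norm (\<integral>x. \<beta>' k x * (h x * \<phi> x) \<partial>lborel) \<le> (\<integral>x. norm (\<beta>' k x * (h x * \<phi> x)) \<partial>lborel)"
          by (rule integral_norm_bound)
      also have "\<dots> \<le> (\<integral>x. (?r k * B) * \<bar>h x * \<phi> x\<bar> \<partial>lborel)"
      proof (rule integral_mono)
        show "integrable lborel (\<lambda>x. norm (\<beta>' k x * (h x * \<phi> x)))" by (rule integrable_norm[OF i\<beta>'])
        show "integrable lborel (\<lambda>x. (?r k * B) * \<bar>h x * \<phi> x\<bar>)" using i1 by (intro integrable_mult_right) auto
        fix x
        have "\<bar>\<beta>' k x\<bar> \<le> ?r k * B" unfolding \<beta>'_def abs_mult by (rule mult_mono) (auto intro: Db)
        then show "norm (\<beta>' k x * (h x * \<phi> x)) \<le> (?r k * B) * \<bar>h x * \<phi> x\<bar>"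
          unfolding real_norm_def abs_mult[of "\<beta>' k x"] by (intro mult_right_mono) auto
      qed
      finally show "norm (\<integral>x. \<beta>' k x * (h x * \<phi> x) \<partial>lborel) \<le> (B * (\<integral>x. \<bar>h x * \<phi> x\<bar> \<partial>lborel)) * ?r k"
        by (simp only: integral_mult_right_zero mult_ac)
    qed
  qed
  have "(\<integral>x. b 0 * (h x * \<phi>' x v) \<partial>lborel) + 0 = - (\<integral>x. b 0 * (\<phi> x * (G x \<bullet> v)) \<partial>lborel)"
    using LIMSEQ_unique[OF tendsto_add[OF lim[OF i2] lim0], unfolded eq, OF tendsto_minus[OF lim[OF i3]]]
        by simp
  then have eq0: "b 0 * (\<integral>x. h x * \<phi>' x v \<partial>lborel) = b 0 * (- (\<integral>x. \<phi> x * (G x \<bullet> v) \<partial>lborel))"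
    by simp
  have "0 < b 0" unfolding b_def by (simp only: box_bump_pos_iff) (simp add: mem_box_cart)
  then have "b 0 \<noteq> 0" by simp
  with mult_cancel_left[THEN iffD1, OF eq0] show ?thesis by blast
qed

lemma is_weak_gradI:
  fixes h :: "real^'n \<Rightarrow> real" and G :: "real^'n \<Rightarrow> real^'n"
  assumes li: "locally_integrable h" "locally_integrable G"
    and eq: "\<And>\<phi> v. test_function \<phi> \<Longrightarrow> (\<integral>x. h x * frechet_derivative \<phi> (at x) v \<partial>lborel)
        = - (\<integral>x. \<phi> x * (G x \<bullet> v) \<partial>lborel)"
  shows "is_weak_grad h G"
  unfolding is_weak_grad_def
proof (intro conjI allI impI li)
  fix \<phi> :: "real^'n \<Rightarrow> real" assume \<phi>: "test_function \<phi>"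
  have "integrable lborel (\<lambda>x. h x *\<^sub>R grad \<phi> x)"
  proof -
    have "integrable lborel (\<lambda>x. \<Sum>i\<in>UNIV. (frechet_derivative \<phi> (at x) (axis i 1) *\<^sub>R h x) *\<^sub>R (axis i 1 ::
        real^'n))"
      by (intro Bochner_Integration.integrable_sum integrable_scaleR_left
        test_function_mult_integrable test_function_deriv \<phi> li)
    moreover have "h x *\<^sub>R grad \<phi> x = (\<Sum>i\<in>UNIV. (frechet_derivative \<phi> (at x) (axis i 1) *\<^sub>R h x) *\<^sub>R (axis i
        1 :: real^'n))" for x
      by (simp add: vec_eq_iff grad_def axis_def if_distrib sum.delta cong: if_cong)
    ultimately show ?thesis by simp
  qed
  note i1 = this
  note i2 = test_function_mult_integrable[OF \<phi> li(2)]
  have "(\<integral>x. h x *\<^sub>R grad \<phi> x \<partial>lborel) \<bullet> v = (- (\<integral>x. \<phi> x *\<^sub>R G x \<partial>lborel)) \<bullet> v" for v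
  proof -
    have "(\<integral>x. h x *\<^sub>R grad \<phi> x \<partial>lborel) \<bullet> v = (\<integral>x. h x * frechet_derivative \<phi> (at x) v \<partial>lborel)"
      unfolding integral_inner_left[OF i1, symmetric] by (simp add: test_function_grad_inner[OF \<phi>])
    also have "\<dots> = - (\<integral>x. (\<phi> x *\<^sub>R G x) \<bullet> v \<partial>lborel)" unfolding eq[OF \<phi>] by simp
    also have "\<dots> = (- (\<integral>x. \<phi> x *\<^sub>R G x \<partial>lborel)) \<bullet> v" unfolding integral_inner_left[OF i2] by simp
    finally show ?thesis .
  qed
  then show "(\<integral>x. h x *\<^sub>R grad \<phi> x \<partial>lborel) = - (\<integral>x. \<phi> x *\<^sub>R G x \<partial>lborel)"
    by (metis inner_commute vector_eq_ldot)
qed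

text \<open>Used with the reciprocal of the stationary state, which is unbounded but continuous,
  hence bounded on compact sets.\<close>

lemma locally_integrable_mult_continuous:
  fixes f :: "real^'n \<Rightarrow> 'b::{banach, second_countable_topology}"
  assumes f: "integrable lborel f" and c: "continuous_on UNIV c"
  shows "locally_integrable (\<lambda>x. c x *\<^sub>R f x)"
  unfolding locally_integrable_def set_integrable_def
proof safe
  fix S :: "(real^'n) set" assume S: "compact S"
  have "compact (c ` S)" by (intro compact_continuous_image continuous_on_subset[OF c] S) auto
  then obtain B where B: "\<And>x. x \<in> S \<Longrightarrow> \<bar>c x\<bar> \<le> B"
    using compact_imp_bounded bounded_iff by (metis imageI real_norm_def)
  note [measurable] = borel_measurable_continuous_onI[OF c] borel_measurable_integrable[OF f]
  have [measurable]: "S \<in> sets borel" using S by (simp add: compact_imp_closed)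
  show "integrable lborel (\<lambda>x. indicator S x *\<^sub>R c x *\<^sub>R f x)"
  proof (rule Bochner_Integration.integrable_bound[OF integrable_scaleR_right[OF f, of B]])
    show "AE x in lborel. norm (indicator S x *\<^sub>R c x *\<^sub>R f x) \<le> norm (B *\<^sub>R f x)"
    proof (rule AE_I2)
      fix x
      show "norm (indicator S x *\<^sub>R c x *\<^sub>R f x) \<le> norm (B *\<^sub>R f x)"
        using B[of x] by (cases "x \<in> S") (auto intro: mult_right_mono)
    qed
  qed measurable
qed

lemma matrix_vector_measurable [measurable]: "(\<lambda>x. (A :: real^'n^'m) *v x) \<in> borel_measurable borel"
  by (intro borel_measurable_continuous_onI linear_continuous_on matrix_vector_mul_bounded_linear)

lemma gauss_has_derivative:
  assumes "transpose S = (S :: real^'n^'n)"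
  shows "((\<lambda>x. gauss S (x - c)) has_derivative (\<lambda>v. - ((x - c) \<bullet> (S *v v)) * gauss S (x - c))) (at x)"
proof -
  have "((\<lambda>x. S *v (x - c)) has_derivative (\<lambda>v. S *v v)) (at x)"
    by (rule bounded_linear.has_derivative[OF bounded_linear_matrix]) (auto intro!: derivative_eq_intros)
  moreover have "((\<lambda>x. x - c) has_derivative (\<lambda>v. v)) (at x)" by (auto intro!: derivative_eq_intros)
  ultimately have "((\<lambda>x. (x - c) \<bullet> (S *v (x - c))) has_derivative (\<lambda>v. (x - c) \<bullet> (S *v v) + v \<bullet> (S *v (x -
      c)))) (at x)"
    by (rule has_derivative_inner[rotated])
  moreover have "v \<bullet> (S *v (x - c)) = (x - c) \<bullet> (S *v v)" for v
    using symmetric_inner[OF assms] by (metis inner_commute)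
  ultimately have "((\<lambda>x. (x - c) \<bullet> (S *v (x - c))) has_derivative (\<lambda>v. 2 * ((x - c) \<bullet> (S *v v)))) (at x)"
    by simp
  then have "((\<lambda>x. exp ((- 1 / 2) * ((x - c) \<bullet> (S *v (x - c))))) has_derivative
    (\<lambda>v. - ((x - c) \<bullet> (S *v v)) * exp ((- 1 / 2) * ((x - c) \<bullet> (S *v (x - c)))))) (at x)"
    by (rule has_derivative_eq_rhs[OF has_derivative_exp[OF has_derivative_mult_right]]) (simp add: fun_eq_iff)
  then show ?thesis unfolding gauss_def by simp
qed

lemma hdiff_gauss: "hdiff (\<lambda>x. gauss S (x - c)) k"
proof -
  have "hdiff (\<lambda>x. (x - c) $ i) k" for i
    using hdiff_diff[OF hdiff_vec_nth hdiff_const] by simp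
  moreover have "hdiff (\<lambda>x. (S *v (x - c)) $ i) k" for i
    unfolding matrix_vector_mult_diff_distrib vector_minus_component
    by (intro hdiff_diff hdiff_const hdiff_linear bounded_linear_compose[OF bounded_linear_vec_nth
        matrix_vector_mul_bounded_linear])
  ultimately have "hdiff (\<lambda>x. (- 1 / 2) * (\<Sum>i\<in>UNIV. (x - c) $ i * (S *v (x - c)) $ i)) k"
    by (intro hdiff_mult hdiff_const hdiff_sum)
  from hdiff_compose[OF hdiff_exp this] show ?thesis
    by (simp add: gauss_def inner_vec_def)
qed

lemma gauss_le_1: "pos_def S \<Longrightarrow> gauss S x \<le> 1"
  unfolding gauss_def pos_def_def by (cases "x = 0") (auto simp: less_imp_le)

section \<open>Transition densities and the representation of solutions\<close>

context fp_kernel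
begin

text \<open>\<open>pt x y\<close> is the transition density from \<open>x\<close> to \<open>y\<close>, and \<open>kk x y\<close> that of the time reversed
  process from \<open>y\<close> to \<open>x\<close>.\<close>
definition Zq where "Zq = (\<integral>x. gauss Qi x \<partial>lborel)"
definition Zk where "Zk = (\<integral>x. gauss Ki x \<partial>lborel)"
definition fi where "fi x = gauss Ki x / Zk"
definition pt where "pt x y = gauss Qi (y - E t *v x) / Zq"
definition kk where "kk x y = gauss S (x - M *v y) / Zq"

lemma Z_pos: "0 < Zq" "0 < Zk"
  unfolding Zq_def Zk_def by (intro gauss_integral_pos Q_inv K_inv)+

lemma fi_steady_state: "fi = steady_state K"
  by (simp add: fun_eq_iff fi_def steady_state_def gauss_def Zk_def Ki_def)

lemma fi_pos: "0 < fi x" by (simp add: fi_def Z_pos gauss_pos divide_pos_pos)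

lemma kernel_pos: "0 < pt x y" "0 < kk x y" by (simp_all add: pt_def kk_def Z_pos gauss_pos divide_pos_pos)

lemma detailed_balance: "fi x * pt x y = fi y * kk x y"
  using gauss_identity[of x y] by (simp add: fi_def pt_def kk_def)

lemma fi_continuous: "continuous_on UNIV fi"
  unfolding fi_def[abs_def] using Z_pos by (intro continuous_intros gauss_continuous) auto

lemma inverse_fi_continuous: "continuous_on UNIV (\<lambda>y. 1 / fi y)"
  using fi_pos by (intro continuous_intros fi_continuous) (metis less_irrefl)

lemma kernel_measurable [measurable]:
  "fi \<in> borel_measurable borel"
  "(\<lambda>p. pt (fst p) (snd p)) \<in> borel_measurable (borel \<Otimes>\<^sub>M borel)"
  "(\<lambda>p. kk (fst p) (snd p)) \<in> borel_measurable (borel \<Otimes>\<^sub>M borel)"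
  by (simp_all add: fi_def[abs_def] pt_def kk_def)

lemma kernel_measurable' [measurable]:
  "pt x \<in> borel_measurable borel" "(\<lambda>x. pt x y) \<in> borel_measurable borel"
  "kk x \<in> borel_measurable borel" "(\<lambda>x. kk x y) \<in> borel_measurable borel"
  by (simp_all add: pt_def[abs_def] kk_def[abs_def])

lemma pt_integral: "(\<integral>y. pt x y \<partial>lborel) = 1" and pt_integrable1: "integrable lborel (pt x)"
proof -
  have "integrable lborel (\<lambda>y. gauss Qi (y + - (E t *v x)))"
    by (rule integrable_translate[OF gauss_integrable(2)[OF Q_inv(3)]])
  then show "integrable lborel (pt x)" unfolding pt_def[abs_def] by simp
  show "(\<integral>y. pt x y \<partial>lborel) = 1"
    unfolding pt_def using integral_translate[of "gauss Qi" "- (E t *v x)"] Z_pos by (simp add: Zq_def)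
qed

lemma fi_integral: "(\<integral>x. fi x \<partial>lborel) = 1" and fi_integrable: "integrable lborel fi"
  unfolding fi_def[abs_def] using Z_pos gauss_integrable(2)[OF K_inv(3)] by (simp_all add: Zk_def)

lemma pt_joint_integrable:
  fixes f :: "real^'n \<Rightarrow> 'b::{banach, second_countable_topology}"
  assumes f: "integrable lborel f"
  shows "integrable (lborel \<Otimes>\<^sub>M lborel) (\<lambda>(x, y). pt x y *\<^sub>R f x)"
proof (rule lborel_pair.Fubini_integrable)
  have [measurable]: "f \<in> borel_measurable borel" using f by auto
  have "(\<lambda>p. pt (fst p) (snd p) *\<^sub>R f (fst p)) \<in> borel_measurable (borel \<Otimes>\<^sub>M borel)" by measurable
  then show "(\<lambda>(x, y). pt x y *\<^sub>R f x) \<in> borel_measurable (lborel \<Otimes>\<^sub>M lborel)" by (simp add: case_prod_unfold)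
  show "integrable lborel (\<lambda>x. \<integral>y. norm (case (x, y) of (x, y) \<Rightarrow> pt x y *\<^sub>R f x) \<partial>lborel)"
    using f kernel_pos(1) by (simp add: pt_integral less_imp_le)
  show "AE x in lborel. integrable lborel (\<lambda>y. case (x, y) of (x, y) \<Rightarrow> pt x y *\<^sub>R f x)"
    using pt_integrable1 by simp
qed

text \<open>By translation invariance the mass does not depend on \<open>y\<close>. Integrating
  detailed balance over both points identifies it as 1, so the normalisation by \<open>Zq\<close> is
  right without computing a determinant.\<close>

lemma kk_integral: "(\<integral>x. kk x y \<partial>lborel) = 1" and kk_integrable: "integrable lborel (\<lambda>x. kk x y)"
proof -
  have i: "integrable lborel (\<lambda>x. kk x y)" for y
    using integrable_translate[OF gauss_integrable(2)[OF S_pos_def], of "- (M *v y)"] by (simp add: kk_def)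
  then show "integrable lborel (\<lambda>x. kk x y)" .
  define c where "c = (\<integral>x. gauss S x \<partial>lborel) / Zq"
  have c: "(\<integral>x. kk x y \<partial>lborel) = c" for y
    unfolding kk_def c_def using integral_translate[of "gauss S" "- (M *v y)"] by simp
  have "1 = (\<integral>x. \<integral>y. pt x y *\<^sub>R fi x \<partial>lborel \<partial>lborel)" by (simp add: pt_integral fi_integral)
  also have "\<dots> = (\<integral>y. \<integral>x. pt x y *\<^sub>R fi x \<partial>lborel \<partial>lborel)"
    by (rule lborel_pair.Fubini_integral[symmetric]) (rule pt_joint_integrable[OF fi_integrable])
  also have "\<dots> = (\<integral>y. \<integral>x. fi y * kk x y \<partial>lborel \<partial>lborel)"
    by (simp add: detailed_balance[symmetric] mult.commute)
  also have "\<dots> = c" by (simp add: c fi_integral)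
  finally show "(\<integral>x. kk x y \<partial>lborel) = 1" using c by simp
qed

lemma pt_le: "pt x y \<le> 1 / Zq"
  unfolding pt_def using gauss_le_1[OF Q_inv(3)] Z_pos by (simp add: divide_right_mono)

lemma kk_eq: "kk x y = pt x y / fi y * fi x"
  using detailed_balance[of x y] fi_pos[of y] by (simp add: field_simps)

text \<open>Both sides have the same Fourier transform: the kernel started at \<open>x\<close> is a
  Gaussian with mean \<open>E t *v x\<close> and covariance \<open>Qf t\<close>, which reproduces
  the formula of \<open>solution_fourier\<close>. Uniqueness for the equation is thereby
  included.\<close>

lemma solution_eq:
  assumes sol: "fp_solution D C f0 f" and f0: "integrable lborel f0"
  shows "AE y in lborel. f t y = (\<integral>x. pt x y * f0 x \<partial>lborel)"
proof -
  have dual: "fp_dual D C K E f f0 t"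
    using sol t by unfold_locales (auto simp: fp_solution_def)
  have it: "integrable lborel (f t)" using sol t by (simp add: fp_solution_def)
  have [measurable]: "f 0 \<in> borel_measurable borel" "f0 \<in> borel_measurable borel"
    using sol f0 by (auto simp: fp_solution_def)
  have J: "integrable (lborel \<Otimes>\<^sub>M lborel) (\<lambda>(x, y). pt x y * f0 x)" using pt_joint_integrable[OF f0] by simp
  let ?f = "\<lambda>y. \<integral>x. pt x y * f0 x \<partial>lborel"
  have ift: "integrable lborel ?f" by (rule lborel_pair.integrable_snd[OF J])
  have four: "(\<integral>y. ?f y * cos (\<xi> \<bullet> y + \<theta>) \<partial>lborel) = (\<integral>y. f t y * cos (\<xi> \<bullet> y + \<theta>) \<partial>lborel)" for \<xi> \<theta>
  proof -
    have Jc: "integrable (lborel \<Otimes>\<^sub>M lborel) (\<lambda>(x, y). pt x y * f0 x * cos (\<xi> \<bullet> y + \<theta>))"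
    proof (rule Bochner_Integration.integrable_bound[OF J])
      show "AE p in lborel \<Otimes>\<^sub>M lborel. norm (case p of (x, y) \<Rightarrow> pt x y * f0 x * cos (\<xi> \<bullet> y + \<theta>))
          \<le> norm (case p of (x, y) \<Rightarrow> pt x y * f0 x)"
        by (intro AE_I2) (clarsimp simp: abs_mult, intro mult_left_le, auto)
      have "(\<lambda>p. pt (fst p) (snd p) * f0 (fst p) * cos (\<xi> \<bullet> snd p + \<theta>)) \<in> borel_measurable (borel \<Otimes>\<^sub>M
          borel)" by measurable
      then show "(\<lambda>(x, y). pt x y * f0 x * cos (\<xi> \<bullet> y + \<theta>)) \<in> borel_measurable (lborel \<Otimes>\<^sub>M lborel)"
        by (simp add: case_prod_unfold)
    qed
    have inner: "(\<integral>y. pt x y * f0 x * cos (\<xi> \<bullet> y + \<theta>) \<partial>lborel)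
        = exp (- (\<xi> \<bullet> (Qf t *v \<xi>)) / 2) * (f0 x * cos ((transpose (E t) *v \<xi>) \<bullet> x + \<theta>))" for x
    proof -
      have "(\<integral>y. pt x y * f0 x * cos (\<xi> \<bullet> y + \<theta>) \<partial>lborel)
          = (\<integral>y. (f0 x / Zq) * (gauss Qi (y - E t *v x) * cos (\<xi> \<bullet> y + \<theta>)) \<partial>lborel)"
        by (simp add: pt_def mult_ac)
      also have "\<dots> = (f0 x / Zq) * (\<integral>y. gauss Qi (y - E t *v x) * cos (\<xi> \<bullet> y + \<theta>) \<partial>lborel)" by simp
      also have "\<dots> = exp (- (\<xi> \<bullet> (Qf t *v \<xi>)) / 2) * (f0 x * cos (\<xi> \<bullet> (E t *v x) + \<theta>))"
        unfolding gauss_cos_shift_integral[OF Q_inv(3,2)] using Z_pos by (simp add: Zq_def[symmetric])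
      finally show ?thesis by (simp only: transpose_inner)
    qed
    have "(\<integral>y. ?f y * cos (\<xi> \<bullet> y + \<theta>) \<partial>lborel) = (\<integral>y. \<integral>x. pt x y * f0 x * cos (\<xi> \<bullet> y + \<theta>) \<partial>lborel \<partial>lborel)"
        by simp
    also have "\<dots> = (\<integral>x. \<integral>y. pt x y * f0 x * cos (\<xi> \<bullet> y + \<theta>) \<partial>lborel \<partial>lborel)"
      by (rule lborel_pair.Fubini_integral[OF Jc])
    also have "\<dots> = exp (- (\<xi> \<bullet> (Qf t *v \<xi>)) / 2) * (\<integral>x. f0 x * cos ((transpose (E t) *v \<xi>) \<bullet> x + \<theta>) \<partial>lborel)"
      unfolding inner by (simp only: integral_mult_right_zero)
    also have "(\<integral>x. f0 x * cos ((transpose (E t) *v \<xi>) \<bullet> x + \<theta>) \<partial>lborel)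
        = (\<integral>x. f 0 x * cos ((transpose (E t) *v \<xi>) \<bullet> x + \<theta>) \<partial>lborel)"
    proof (rule integral_cong_AE)
      show "AE x in lborel. f0 x * cos ((transpose (E t) *v \<xi>) \<bullet> x + \<theta>)
          = f 0 x * cos ((transpose (E t) *v \<xi>) \<bullet> x + \<theta>)"
        using sol by (auto simp: fp_solution_def elim: eventually_mono)
    qed simp_all
    finally show ?thesis using fp_dual.solution_fourier[OF dual] by simp
  qed
  have "AE y in lborel. f t y - ?f y = 0"
  proof (rule fourier_uniqueness)
    show "integrable lborel (\<lambda>y. f t y - ?f y)" using it ift by simp
    fix \<xi> \<theta>
    have bi: "integrable lborel (\<lambda>y. g y * cos (\<xi> \<bullet> y + \<theta>))" if "integrable lborel g" for g :: "real^'n \<Rightarrow> real"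
      by (rule Bochner_Integration.integrable_bound[OF that]) (use that in \<open>auto simp: abs_mult intro!:
          mult_left_le\<close>)
    show "(\<integral>x. (f t x - ?f x) * cos (\<xi> \<bullet> x + \<theta>) \<partial>lborel) = 0"
      using bi[OF it] bi[OF ift] four[of \<xi> \<theta>] by (simp add: left_diff_distrib)
  qed
  then show ?thesis by simp
qed

end

lemma integrable_bounded_mult:
  fixes b g :: "'a \<Rightarrow> real"
  assumes g: "integrable N g" and b: "b \<in> borel_measurable N" "\<And>x. \<bar>b x\<bar> \<le> B"
  shows "integrable N (\<lambda>x. b x * g x)"
proof (rule Bochner_Integration.integrable_bound[OF integrable_mult_right[OF g, of B]])
  show "(\<lambda>x. b x * g x) \<in> borel_measurable N" using g b by auto
  show "AE x in N. norm (b x * g x) \<le> norm (B * g x)"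
  proof (rule AE_I2)
    fix x
    have "\<bar>b x\<bar> * \<bar>g x\<bar> \<le> \<bar>B\<bar> * \<bar>g x\<bar>" using b(2)[of x] by (intro mult_right_mono) auto
    then show "norm (b x * g x) \<le> norm (B * g x)" by (simp add: abs_mult)
  qed
qed

section \<open>The weak gradient of the evolved ratio\<close>

context fp_kernel
begin

lemma symS: "transpose S = S" using S_pos_def by (simp add: pos_def_def)

text \<open>The kernel decays like a Gaussian in \<open>y - E t *v x\<close>, and \<open>x\<close>
  is recovered linearly from this difference and \<open>y\<close> by the inverse propagator. So the
  linear factor costs at most a factor \<open>1 + norm y\<close>, uniformly in
  \<open>x\<close>.\<close>

lemma moment_bound:
  obtains c where "0 \<le> c" "\<And>x y w. \<bar>(x - M *v y) \<bullet> w * pt x y\<bar> \<le> c * norm w * (1 + norm y)"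
proof -
  obtain L1 where L1: "0 < L1" "\<And>v. norm (E (- t) *v v) \<le> norm v * L1"
    using bounded_linear.pos_bounded[OF bounded_linear_matrix[of "E (- t)"]] by blast
  obtain L2 where L2: "0 < L2" "\<And>v. norm (M *v v) \<le> norm v * L2"
    using bounded_linear.pos_bounded[OF bounded_linear_matrix[of M]] by blast
  obtain c B where B: "0 < c" "\<And>x. (1 + norm x) * gauss Qi x \<le> B * exp (- c * (norm x)\<^sup>2)" "0 \<le> B"
    using norm_mult_gauss_bound[OF Q_inv(3)] by blast
  have B': "(1 + norm z) * gauss Qi z \<le> B" for z
  proof -
    have "B * exp (- c * (norm z)\<^sup>2) \<le> B * 1" using B(1,3) by (intro mult_left_mono) auto
    then show ?thesis using B(2)[of z] by simp
  qed
  show thesis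
  proof (rule that[of "(L1 + L2) * B / Zq"])
    show "0 \<le> (L1 + L2) * B / Zq" using L1 L2 B Z_pos by simp
    fix x y w
    let ?z = "y - E t *v x"
    have "norm x \<le> norm (E t *v x) * L1" using L1(2)[of "E t *v x"] by (simp add: inv)
    also have "\<dots> \<le> (norm ?z + norm y) * L1"
      using L1(1) norm_triangle_ineq4[of y ?z] by (intro mult_right_mono) (auto simp: add.commute)
    finally have x: "norm x \<le> (norm ?z + norm y) * L1" .
    have "norm (x - M *v y) \<le> norm x + norm (M *v y)" by (rule norm_triangle_ineq4)
    also have "\<dots> \<le> (norm ?z + norm y) * L1 + norm y * L2" using x L2(2)[of y] by linarith
    also have "\<dots> \<le> (L1 + L2) * ((1 + norm ?z) * (1 + norm y))"
    proof -
      have "(norm ?z + norm y) * L1 \<le> ((1 + norm ?z) * (1 + norm y)) * L1"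
        using L1 by (intro mult_right_mono) (auto simp: algebra_simps)
      moreover have "norm y * L2 \<le> ((1 + norm ?z) * (1 + norm y)) * L2"
        using L2 by (intro mult_right_mono) (auto simp: algebra_simps add_nonneg_nonneg)
      ultimately show ?thesis by (simp add: algebra_simps)
    qed
    finally have n: "norm (x - M *v y) \<le> (L1 + L2) * ((1 + norm ?z) * (1 + norm y))" .
    have "\<bar>(x - M *v y) \<bullet> w\<bar> \<le> norm (x - M *v y) * norm w" by (rule Cauchy_Schwarz_ineq2)
    also have "\<dots> \<le> (L1 + L2) * ((1 + norm ?z) * (1 + norm y)) * norm w" by (intro mult_right_mono n) simp
    finally have 1: "\<bar>(x - M *v y) \<bullet> w\<bar> \<le> (L1 + L2) * ((1 + norm ?z) * (1 + norm y)) * norm w" .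
    have "\<bar>(x - M *v y) \<bullet> w * pt x y\<bar> = \<bar>(x - M *v y) \<bullet> w\<bar> * pt x y"
      using kernel_pos(1)[of x y] by (simp add: abs_mult)
    also have "\<dots> \<le> (L1 + L2) * ((1 + norm ?z) * (1 + norm y)) * norm w * pt x y"
      by (intro mult_right_mono 1) (simp add: less_imp_le kernel_pos)
    also have "\<dots> = ((L1 + L2) * (1 + norm y) * norm w / Zq) * ((1 + norm ?z) * gauss Qi ?z)"
      by (simp add: pt_def mult_ac)
    also have "\<dots> \<le> ((L1 + L2) * (1 + norm y) * norm w / Zq) * B"
      by (rule mult_left_mono[OF B']) (use L1 L2 Z_pos in auto)
    also have "\<dots> = (L1 + L2) * B / Zq * norm w * (1 + norm y)" by (simp add: mult_ac)
    finally show "\<bar>(x - M *v y) \<bullet> w * pt x y\<bar> \<le> (L1 + L2) * B / Zq * norm w * (1 + norm y)" .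
  qed
qed

context
  fixes h0 :: "real^'n \<Rightarrow> real" and G0 :: "real^'n \<Rightarrow> real^'n"
  assumes wg: "is_weak_grad h0 G0"
    and i0: "integrable lborel (\<lambda>x. fi x * h0 x)" and iG: "integrable lborel (\<lambda>x. fi x *\<^sub>R G0 x)"
begin

lemma G0_measurable: "G0 \<in> borel_measurable borel" and h0_measurable: "h0 \<in> borel_measurable borel"
  using wg locally_integrable_measurable by (auto simp: is_weak_grad_def)

text \<open>For fixed \<open>y\<close> the reversed density is at most a multiple of
  \<open>fi\<close>, because \<open>pt\<close> is bounded.\<close>

lemma kk_h0_integrable: "integrable lborel (\<lambda>x. kk x y * h0 x)"
proof -
  have "integrable lborel (\<lambda>x. pt x y / fi y * (fi x * h0 x))"
  proof (rule integrable_bounded_mult[OF i0])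
    show "\<bar>pt x y / fi y\<bar> \<le> 1 / Zq / fi y" for x
      using divide_right_mono[OF pt_le less_imp_le[OF fi_pos], of x y y] kernel_pos(1)[of x y] fi_pos[of y]
          by simp
  qed simp
  then show ?thesis by (simp add: kk_eq[of _ y] mult.assoc)
qed

lemma kk_G0_integrable: "integrable lborel (\<lambda>x. kk x y *\<^sub>R G0 x)"
proof (rule Bochner_Integration.integrable_bound[OF integrable_scaleR_right[OF iG, of "1 / Zq / fi y"]])
  note [measurable] = G0_measurable
  show "(\<lambda>x. kk x y *\<^sub>R G0 x) \<in> borel_measurable lborel" by simp
  show "AE x in lborel. norm (kk x y *\<^sub>R G0 x) \<le> norm ((1 / Zq / fi y) *\<^sub>R fi x *\<^sub>R G0 x)"
  proof (rule AE_I2)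
    fix x
    have "kk x y \<le> 1 / Zq / fi y * fi x"
      unfolding kk_eq[of x y] using pt_le[of x y] fi_pos
          by (intro mult_right_mono divide_right_mono) (auto simp: less_imp_le)
    then have "kk x y * norm (G0 x) \<le> (1 / Zq / fi y * fi x) * norm (G0 x)" by (rule mult_right_mono) simp
    then show "norm (kk x y *\<^sub>R G0 x) \<le> norm ((1 / Zq / fi y) *\<^sub>R fi x *\<^sub>R G0 x)"
      using kernel_pos(2)[of x y] fi_pos[of x] fi_pos[of y] Z_pos by simp
  qed
qed

text \<open>The derivative of the reversed density in its first argument produces the linear factor;
  its sign cancels against the one from the integration by parts.\<close>

lemma kk_ibp: "(\<integral>x. h0 x * (((x - M *v y) \<bullet> (S *v u)) * kk x y) \<partial>lborel) = (\<integral>x. kk x y *\<^sub>R G0 x \<partial>lborel) \<bullet> u"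
proof -
  note [measurable] = G0_measurable h0_measurable
  obtain c where c: "0 \<le> c" "\<And>x y w. \<bar>(x - M *v y) \<bullet> w * pt x y\<bar> \<le> c * norm w * (1 + norm y)"
      using moment_bound by blast
  have "integrable lborel (\<lambda>x. ((x - M *v y) \<bullet> (S *v u) * pt x y) * (fi x * h0 x))"
    by (rule integrable_bounded_mult[OF i0 _ c(2)]) simp
  then have "integrable lborel (\<lambda>x. (- 1 / fi y) * (((x - M *v y) \<bullet> (S *v u) * pt x y) * (fi x * h0 x)))"
    by (rule integrable_mult_right)
  then have i2: "integrable lborel (\<lambda>x. h0 x * (- ((x - M *v y) \<bullet> (S *v u)) * kk x y))"
    by (rule back_subst[where P = "integrable lborel"]) (simp add: fun_eq_iff kk_eq[of _ y])
  have "(\<integral>x. h0 x * (- ((x - M *v y) \<bullet> (S *v u)) * kk x y) \<partial>lborel) = - (\<integral>x. kk x y * (G0 x \<bullet> u) \<partial>lborel)"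
  proof (rule weak_grad_ibp[OF wg, where \<phi> = "\<lambda>x. kk x y" and \<phi>'
      = "\<lambda>x u. - ((x - M *v y) \<bullet> (S *v u)) * kk x y"])
    show "hdiff (\<lambda>x. kk x y) k" for k
      unfolding kk_def divide_inverse by (intro hdiff_mult hdiff_gauss hdiff_const)
    show "((\<lambda>x. kk x y) has_derivative (\<lambda>u. - ((x - M *v y) \<bullet> (S *v u)) * kk x y)) (at x)" for x
      using has_derivative_mult_left[OF gauss_has_derivative[OF symS, of "M *v y" x], of "inverse Zq"]
      by (simp add: kk_def divide_inverse mult.assoc)
    show "integrable lborel (\<lambda>x. h0 x * kk x y)" using kk_h0_integrable by (simp add: mult.commute)
    show "integrable lborel (\<lambda>x. kk x y * (G0 x \<bullet> u))"
      using integrable_inner_left[OF kk_G0_integrable] by simp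
  qed (rule i2)
  also have "(\<integral>x. kk x y * (G0 x \<bullet> u) \<partial>lborel) = (\<integral>x. kk x y *\<^sub>R G0 x \<partial>lborel) \<bullet> u"
    using integral_inner_left[OF kk_G0_integrable, of y u] by simp
  finally show ?thesis by simp
qed

text \<open>The reversed density depends on \<open>x - M *v y\<close> only, so a derivative in
  \<open>y\<close> along \<open>v\<close> is one in \<open>x\<close> along \<open>M *v v\<close>
  with opposite sign. It is first moved off the test function, then exchanged for a derivative in
  \<open>x\<close> and finally put on \<open>h0\<close> by \<open>kk_ibp\<close>.\<close>

lemma weak_grad_transport:
  assumes it: "integrable lborel ft" and eq: "AE y in lborel. ft y = (\<integral>x. pt x y * (fi x * h0 x) \<partial>lborel)"
  shows "is_weak_grad (\<lambda>y. ft y / fi y) (\<lambda>y. transpose M *v (\<integral>x. kk x y *\<^sub>R G0 x \<partial>lborel))"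
proof (rule is_weak_gradI)
  note [measurable] = G0_measurable h0_measurable borel_measurable_integrable[OF it]
  show "locally_integrable (\<lambda>y. ft y / fi y)"
    using locally_integrable_mult_continuous[OF it inverse_fi_continuous] by simp
  have J: "integrable lborel (\<lambda>y. \<integral>x. pt x y *\<^sub>R fi x *\<^sub>R G0 x \<partial>lborel)"
    by (rule lborel_pair.integrable_snd[OF pt_joint_integrable[OF iG]])
  have Gt: "transpose M *v (\<integral>x. kk x y *\<^sub>R G0 x \<partial>lborel)
      = (1 / fi y) *\<^sub>R (transpose M *v (\<integral>x. pt x y *\<^sub>R fi x *\<^sub>R G0 x \<partial>lborel))" for y
  proof -
    have "(\<integral>x. kk x y *\<^sub>R G0 x \<partial>lborel) = (\<integral>x. (1 / fi y) *\<^sub>R (pt x y *\<^sub>R fi x *\<^sub>R G0 x) \<partial>lborel)"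
      by (simp add: kk_eq[of _ y])
    then show ?thesis
      by (simp only: integral_scaleR_right linear_scale[OF matrix_vector_mul_linear])
  qed
  show "locally_integrable (\<lambda>y. transpose M *v (\<integral>x. kk x y *\<^sub>R G0 x \<partial>lborel))"
    unfolding Gt
    by (rule locally_integrable_mult_continuous[OF integrable_bounded_linear[OF bounded_linear_matrix J]
        inverse_fi_continuous])
  fix \<phi> :: "real^'n \<Rightarrow> real" and v assume \<phi>: "test_function \<phi>"
  let ?D = "\<lambda>y. frechet_derivative \<phi> (at y) v"
  let ?f0 = "\<lambda>x. fi x * h0 x"
  let ?w = "S *v (M *v v)"
  have D: "test_function ?D" by (rule test_function_deriv[OF \<phi>])
  note c\<phi> = test_function_continuous[OF \<phi>] and cD = test_function_continuous[OF D]
  note [measurable] = test_function_measurable[OF \<phi>] test_function_measurable[OF D]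
  have sup: "\<exists>r. \<forall>y. \<psi> y \<noteq> 0 \<longrightarrow> y \<in> cball 0 r" if t\<psi>: "test_function \<psi>" for \<psi> :: "real^'n \<Rightarrow> real"
  proof -
    have "bounded (closure {x. \<psi> x \<noteq> 0})" using t\<psi> by (auto simp: test_function_def compact_imp_bounded)
    then obtain r where "\<forall>y\<in>closure {x. \<psi> x \<noteq> 0}. norm y \<le> r" unfolding bounded_iff by blast
    then have "\<forall>y. \<psi> y \<noteq> 0 \<longrightarrow> y \<in> cball 0 r" using closure_subset[of "{x. \<psi> x \<noteq> 0}"] by auto
    then show ?thesis by blast
  qed
  obtain r1 where r1: "\<And>y. \<phi> y \<noteq> 0 \<Longrightarrow> y \<in> cball 0 r1" using sup[OF \<phi>] by blast
  obtain r2 where r2: "\<And>y. ?D y \<noteq> 0 \<Longrightarrow> y \<in> cball 0 r2" using sup[OF D] by blast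
  have ifD: "integrable lborel (\<lambda>y. ?D y * (1 / fi y))"
    by (rule integrable_continuous_compact_support[where r = r2])
      (use r2 in \<open>auto intro!: continuous_on_mult cD inverse_fi_continuous simp del: mem_cball
          times_divide_eq_right\<close>)
  have int1: "integrable (lborel \<Otimes>\<^sub>M lborel) (\<lambda>(x, y). ?f0 x * (?D y * (1 / fi y)) * pt x y)"
    by (rule integrable_prod_bounded[OF i0 ifD, where B = "1 / Zq"])
      (use kernel_measurable(2) pt_le kernel_pos(1) in \<open>auto simp: case_prod_unfold abs_of_pos\<close>)
  obtain c where c: "0 \<le> c" "\<And>x y w. \<bar>(x - M *v y) \<bullet> w * pt x y\<bar> \<le> c * norm w * (1 + norm y)"
      using moment_bound by blast
  \<comment> \<open>The growth allowed by \<open>moment_bound\<close> is placed on the compactly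
    supported factor, which leaves a bounded kernel for
    \<open>integrable_prod_bounded\<close>.\<close>
  have if\<phi>: "integrable lborel (\<lambda>y. \<phi> y * ((1 + norm y) * (1 / fi y)))"
    by (rule integrable_continuous_compact_support[where r = r1])
      (use r1 in \<open>auto intro!: continuous_on_mult c\<phi> inverse_fi_continuous continuous_intros simp del:
          mem_cball times_divide_eq_right\<close>)
  have "integrable (lborel \<Otimes>\<^sub>M lborel) (\<lambda>(x, y). ?f0 x * (\<phi> y * ((1 + norm y) * (1 / fi y))) * ((x - M *v y)
      \<bullet> ?w * pt x y / (1 + norm y)))"
  proof (rule integrable_prod_bounded[OF i0 if\<phi>])
    have "(\<lambda>p. (fst p - M *v snd p) \<bullet> ?w * pt (fst p) (snd p) / (1 + norm (snd p))) \<in> borel_measurable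
        (borel \<Otimes>\<^sub>M borel)" by measurable
    then show "(\<lambda>(x, y). (x - M *v y) \<bullet> ?w * pt x y / (1 + norm y)) \<in> borel_measurable (borel \<Otimes>\<^sub>M borel)"
      by (simp add: case_prod_unfold)
    fix x y :: "real^'n"
    have p: "0 < 1 + norm y" by (simp add: add_pos_nonneg)
    show "\<bar>(x - M *v y) \<bullet> ?w * pt x y / (1 + norm y)\<bar> \<le> c * norm ?w"
      using c(2)[of x y ?w] p by (simp add: pos_divide_le_eq)
  qed
  moreover have "?f0 x * (\<phi> y * ((1 + norm y) * (1 / fi y))) * ((x - M *v y) \<bullet> ?w * pt x y / (1 + norm y))
      = ?f0 x * (\<phi> y * (1 / fi y)) * ((x - M *v y) \<bullet> ?w * pt x y)" for x y
  proof -
    have "1 + norm y \<noteq> 0" using norm_ge_zero[of y] by linarith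
    then show ?thesis by simp
  qed
  ultimately have int2: "integrable (lborel \<Otimes>\<^sub>M lborel) (\<lambda>(x, y). ?f0 x * (\<phi> y * (1 / fi y)) * ((x - M *v y)
      \<bullet> ?w * pt x y))"
    by (simp only:)
  have inner: "(\<integral>y. ?D y * kk x y \<partial>lborel) = - (\<integral>y. \<phi> y * (((x - M *v y) \<bullet> ?w) * kk x y) \<partial>lborel)" for x
  proof -
    have ckk: "continuous_on UNIV (kk x)"
      unfolding kk_def[abs_def] using Z_pos
      by (intro continuous_intros continuous_on_compose2[OF gauss_continuous] linear_continuous_on
          bounded_linear_matrix) auto
    have cm: "continuous_on UNIV (\<lambda>y. (x - M *v y) \<bullet> ?w)"
      by (intro continuous_intros linear_continuous_on bounded_linear_matrix)
    have j1: "integrable lborel (\<lambda>y. ?D y * kk x y)"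
      by (rule integrable_continuous_compact_support[where r = r2])
        (use r2 in \<open>auto intro!: continuous_on_mult cD ckk simp del: mem_cball\<close>)
    have j2: "integrable lborel (\<lambda>y. \<phi> y * (((x - M *v y) \<bullet> ?w) * kk x y))"
      by (rule integrable_continuous_compact_support[where r = r1])
        (use r1 in \<open>auto intro!: continuous_on_mult c\<phi> ckk cm simp del: mem_cball\<close>)
    have "(\<integral>y. ?D y * kk x y + \<phi> y * (((x - M *v y) \<bullet> ?w) * kk x y) \<partial>lborel) = 0"
    proof (rule integral_directional_derivative_zero[where v = v])
      show "integrable lborel (\<lambda>y. \<phi> y * kk x y)"
        by (rule integrable_continuous_compact_support[where r = r1])
          (use r1 in \<open>auto intro!: continuous_on_mult c\<phi> ckk simp del: mem_cball\<close>)
      show "integrable lborel (\<lambda>y. ?D y * kk x y + \<phi> y * (((x - M *v y) \<bullet> ?w) * kk x y))" using j1 j2 by simp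
      show "continuous_on UNIV (\<lambda>y. ?D y * kk x y + \<phi> y * (((x - M *v y) \<bullet> ?w) * kk x y))"
        by (intro continuous_on_add continuous_on_mult c\<phi> cD ckk cm)
      fix y
      have d1: "((\<lambda>u. \<phi> (y + u *\<^sub>R v)) has_real_derivative ?D y) (at 0)"
      proof -
        have "((\<phi> \<circ> (\<lambda>u. y + u *\<^sub>R v)) has_derivative (frechet_derivative \<phi> (at y) \<circ> (\<lambda>u. u *\<^sub>R v))) (at 0)"
          by (rule diff_chain_at) (use test_function_has_derivative[OF \<phi>, of y] in \<open>auto intro!:
              derivative_eq_intros\<close>)
        moreover have "frechet_derivative \<phi> (at y) \<circ> (\<lambda>u. u *\<^sub>R v) = (*) (?D y)"
          by (simp add: fun_eq_iff test_function_grad_inner[OF \<phi>])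
        ultimately show ?thesis by (simp add: o_def has_field_derivative_def)
      qed
      have "((\<lambda>u. gauss S ((x - M *v y) + u *\<^sub>R (- (M *v v)))) has_real_derivative ((x - M *v y) \<bullet> ?w) *
          gauss S (x - M *v y)) (at 0)"
        using gauss_deriv[OF symS, of "x - M *v y" "- (M *v v)"]
            by (simp add: linear_neg[OF matrix_vector_mul_linear])
      moreover have "(x - M *v y) + u *\<^sub>R (- (M *v v)) = x - M *v (y + u *\<^sub>R v)" for u
        by (simp add: matrix_vector_right_distrib linear_scale[OF matrix_vector_mul_linear])
      ultimately have "((\<lambda>u. gauss S (x - M *v (y + u *\<^sub>R v))) has_real_derivative ((x - M *v y) \<bullet> ?w) *
          gauss S (x - M *v y)) (at 0)"
        by (simp only:)
      from DERIV_cdivide[OF this, of Zq]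
      have d2: "((\<lambda>u. kk x (y + u *\<^sub>R v)) has_real_derivative ((x - M *v y) \<bullet> ?w) * kk x y) (at 0)"
        by (simp add: kk_def)
      from DERIV_mult[OF d1 d2]
      show "((\<lambda>u. \<phi> (y + u *\<^sub>R v) * kk x (y + u *\<^sub>R v)) has_real_derivative ?D y * kk x y + \<phi> y * (((x - M
          *v y) \<bullet> ?w) * kk x y)) (at 0)"
        by (simp add: mult.commute)
    qed
    then show ?thesis using j1 j2 by simp
  qed
  have "(\<integral>y. ft y / fi y * ?D y \<partial>lborel) = (\<integral>y. (\<integral>x. pt x y * ?f0 x \<partial>lborel) * (?D y * (1 / fi y)) \<partial>lborel)"
  proof (rule integral_cong_AE)
    show "AE y in lborel. ft y / fi y * ?D y = (\<integral>x. pt x y * ?f0 x \<partial>lborel) * (?D y * (1 / fi y))"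
      using eq by eventually_elim simp
    have "(\<lambda>y. \<integral>x. pt x y * ?f0 x \<partial>lborel) \<in> borel_measurable lborel"
      using lborel_pair.integrable_snd[OF pt_joint_integrable[OF i0]] by auto
    then show "(\<lambda>y. (\<integral>x. pt x y * ?f0 x \<partial>lborel) * (?D y * (1 / fi y))) \<in> borel_measurable lborel" by simp
  qed simp
  also have "\<dots> = (\<integral>y. \<integral>x. ?f0 x * (?D y * (1 / fi y)) * pt x y \<partial>lborel \<partial>lborel)"
    unfolding integral_mult_left_zero[symmetric] by (simp only: mult_ac)
  also have "\<dots> = (\<integral>x. \<integral>y. ?f0 x * (?D y * (1 / fi y)) * pt x y \<partial>lborel \<partial>lborel)"
    by (rule lborel_pair.Fubini_integral[OF int1])
  also have "\<dots> = (\<integral>x. h0 x * (\<integral>y. ?D y * kk x y \<partial>lborel) \<partial>lborel)"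
    unfolding integral_mult_right_zero[symmetric] by (simp add: kk_eq mult_ac)
  also have "\<dots> = - (\<integral>x. h0 x * (\<integral>y. \<phi> y * (((x - M *v y) \<bullet> ?w) * kk x y) \<partial>lborel) \<partial>lborel)"
    unfolding inner by simp
  also have "(\<integral>x. h0 x * (\<integral>y. \<phi> y * (((x - M *v y) \<bullet> ?w) * kk x y) \<partial>lborel) \<partial>lborel)
    = (\<integral>x. \<integral>y. ?f0 x * (\<phi> y * (1 / fi y)) * ((x - M *v y) \<bullet> ?w * pt x y) \<partial>lborel \<partial>lborel)"
    unfolding integral_mult_right_zero[symmetric] by (simp add: kk_eq mult_ac)
  also have "\<dots> = (\<integral>y. \<integral>x. ?f0 x * (\<phi> y * (1 / fi y)) * ((x - M *v y) \<bullet> ?w * pt x y) \<partial>lborel \<partial>lborel)"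
    by (rule lborel_pair.Fubini_integral[OF int2, symmetric])
  also have "\<dots> = (\<integral>y. \<phi> y * (\<integral>x. h0 x * (((x - M *v y) \<bullet> ?w) * kk x y) \<partial>lborel) \<partial>lborel)"
    unfolding integral_mult_right_zero[symmetric] by (simp add: kk_eq mult_ac)
  also have "\<dots> = (\<integral>y. \<phi> y * ((transpose M *v (\<integral>x. kk x y *\<^sub>R G0 x \<partial>lborel)) \<bullet> v) \<partial>lborel)"
    by (simp only: kk_ibp transpose_inner)
  finally show "(\<integral>y. ft y / fi y * ?D y \<partial>lborel) = - (\<integral>y. \<phi> y * ((transpose M *v (\<integral>x. kk x y *\<^sub>R G0 x
      \<partial>lborel)) \<bullet> v) \<partial>lborel)" .
qed

end

end

section \<open>Contraction of the Fisher information\<close>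

text \<open>The tangent plane inequality for the jointly convex function \<open>(h, G) \<mapsto> h\<^sup>p\<^sup>-\<^sup>2 (G \<bullet> P G)\<close> at
  \<open>(a, b)\<close>.\<close>
lemma perspective_tangent:
  fixes P :: "real^'n^'n"
  assumes P: "pos_def P" and p: "1 < p" "p \<le> 2" and h: "0 < h" and a: "0 < a"
  shows "2 * a powr (p - 2) * (G \<bullet> (P *v b)) - ((2 - p) * h / a + (p - 1)) * (a powr (p - 2) * (b \<bullet> (P *v b)))
    \<le> h powr (p - 2) * (G \<bullet> (P *v G))"
proof -
  define r1 where "r1 = h powr (p - 2)"
  define r2 where "r2 = a powr (p - 2)"
  \<comment> \<open>The multiple of \<open>b\<close> for which the square of
    \<open>G - s *\<^sub>R b\<close> yields the mixed term \<open>r2\<close>. It equals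
    \<open>(h / a) powr (2 - p)\<close>, which Young's inequality with weights \<open>2 - p\<close>
    and \<open>p - 1\<close> replaces by an affine function of \<open>h\<close>.\<close>
  define s where "s = r2 / r1"
  have r: "0 < r1" "0 < r2" using h a by (simp_all add: r1_def r2_def)
  have psd: "0 \<le> x \<bullet> (P *v x)" for x using P by (cases "x = 0") (auto simp: pos_def_def less_imp_le)
  have sym: "transpose P = P" using P by (simp add: pos_def_def)
  have bG: "b \<bullet> (P *v G) = G \<bullet> (P *v b)" using symmetric_inner[OF sym, of b G] by (metis inner_commute)
  have "s = (h / a) powr (2 - p)"
    unfolding s_def r1_def r2_def using h a powr_minus_divide[of h "p - 2"] powr_minus_divide[of a "p - 2"]
    by (simp add: powr_divide)
  then have s: "s \<le> (2 - p) * h / a + (p - 1)"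
    using Youngs_inequality_0[of "2 - p" "p - 1" "h / a" 1] p h a by simp
  have "0 \<le> r1 * ((G - s *\<^sub>R b) \<bullet> (P *v (G - s *\<^sub>R b)))" using psd r by simp
  also have "\<dots> = r1 * (G \<bullet> (P *v G)) - 2 * (r1 * s) * (G \<bullet> (P *v b)) + (r1 * s) * s * (b \<bullet> (P *v b))"
    by (simp add: matrix_vector_mult_diff_distrib linear_scale[OF matrix_vector_mul_linear] inner_diff_left
        inner_diff_right bG algebra_simps)
  also have "r1 * s = r2" using r by (simp add: s_def)
  finally have 1: "2 * r2 * (G \<bullet> (P *v b)) - r2 * s * (b \<bullet> (P *v b)) \<le> r1 * (G \<bullet> (P *v G))" by simp
  have "s * (r2 * (b \<bullet> (P *v b))) \<le> ((2 - p) * h / a + (p - 1)) * (r2 * (b \<bullet> (P *v b)))"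
    by (rule mult_right_mono[OF s]) (use psd r in simp)
  with 1 show ?thesis unfolding r1_def[symmetric] r2_def[symmetric] by (simp add: mult_ac)
qed

lemma ennreal_integral_le_nn_integral:
  fixes g :: "'a \<Rightarrow> real"
  assumes g: "integrable M g"
  shows "ennreal (\<integral>x. g x \<partial>M) \<le> (\<integral>\<^sup>+x. ennreal (g x) \<partial>M)"
proof -
  have i: "integrable M (\<lambda>x. max 0 (g x))" using g by simp
  have "(\<integral>x. g x \<partial>M) \<le> (\<integral>x. max 0 (g x) \<partial>M)" by (rule integral_mono[OF g i]) simp
  then have "ennreal (\<integral>x. g x \<partial>M) \<le> ennreal (\<integral>x. max 0 (g x) \<partial>M)" by (rule ennreal_leI)
  also have "\<dots> = (\<integral>\<^sup>+x. ennreal (max 0 (g x)) \<partial>M)" by (rule nn_integral_eq_integral[OF i, symmetric]) simp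
  also have "\<dots> = (\<integral>\<^sup>+x. ennreal (g x) \<partial>M)"
    by (intro nn_integral_cong) (simp add: max_def ennreal_neg)
  finally show ?thesis .
qed

text \<open>The tangent inequality is taken at the averages \<open>a\<close> and \<open>b\<close> of
  \<open>h\<close> and \<open>G\<close> and integrated against \<open>k\<close>. The tangent plane
  integrates to its value at the point of contact, which is the left side.\<close>

lemma fisher_jensen:
  fixes P :: "real^'n^'n" and k h :: "'a \<Rightarrow> real" and G :: "'a \<Rightarrow> real^'n"
  assumes P: "pos_def P" and p: "1 < p" "p \<le> 2"
    and k: "\<And>x. 0 \<le> k x" "integrable N k" "(\<integral>x. k x \<partial>N) = 1"
    and ih: "integrable N (\<lambda>x. k x * h x)" and iG: "integrable N (\<lambda>x. k x *\<^sub>R G x)"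
    and pos: "AE x in N. 0 \<le> h x" and zero: "AE x in N. h x = 0 \<longrightarrow> G x = 0"
    and a: "0 < (\<integral>x. k x * h x \<partial>N)"
  shows "ennreal ((\<integral>x. k x * h x \<partial>N) powr (p - 2) * ((\<integral>x. k x *\<^sub>R G x \<partial>N) \<bullet> (P *v (\<integral>x. k x *\<^sub>R G x \<partial>N))))
    \<le> (\<integral>\<^sup>+x. ennreal (h x powr (p - 2) * (G x \<bullet> (P *v G x))) * ennreal (k x) * indicator {x. 0 < h x} x \<partial>N)"
proof -
  define a where "a = (\<integral>x. k x * h x \<partial>N)"
  define b where "b = (\<integral>x. k x *\<^sub>R G x \<partial>N)"
  define q where "q = a powr (p - 2) * (b \<bullet> (P *v b))"
  have a0: "0 < a" using assms(11) by (simp add: a_def)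
  have psd: "0 \<le> x \<bullet> (P *v x)" for x using P by (cases "x = 0") (auto simp: pos_def_def less_imp_le)
  have q0: "0 \<le> q" using psd by (simp add: q_def)
  let ?r = "\<lambda>x. 2 * a powr (p - 2) * (G x \<bullet> (P *v b)) - ((2 - p) * h x / a + (p - 1)) * q"
  have iGb: "integrable N (\<lambda>x. k x * (G x \<bullet> (P *v b)))" using integrable_inner_left[OF iG, of "P *v b"] by simp
  have eq: "?r x * k x = (2 * a powr (p - 2)) * (k x * (G x \<bullet> (P *v b))) - (((2 - p) / a * q) * (k x * h x)
      + ((p - 1) * q) * k x)" for x
    by (simp add: algebra_simps)
  have ir: "integrable N (\<lambda>x. ?r x * k x)" unfolding eq using iGb ih k(2) by simp
  have "(\<integral>x. ?r x * k x \<partial>N) = (2 * a powr (p - 2)) * (\<integral>x. k x * (G x \<bullet> (P *v b)) \<partial>N) - (((2 - p) / a * q) *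
      a + ((p - 1) * q) * 1)"
    unfolding eq using iGb ih k by (simp add: a_def)
  also have "(\<integral>x. k x * (G x \<bullet> (P *v b)) \<partial>N) = b \<bullet> (P *v b)"
    using integral_inner_left[OF iG, of "P *v b"] by (simp add: b_def)
  also have "(2 * a powr (p - 2)) * (b \<bullet> (P *v b)) - (((2 - p) / a * q) * a + ((p - 1) * q) * 1) = q"
  proof -
    have "(2 - p) / a * q * a = (2 - p) * q" using a0 by simp
    moreover have "(2 * a powr (p - 2)) * (b \<bullet> (P *v b)) = 2 * q" by (simp add: q_def)
    ultimately show ?thesis by (simp add: algebra_simps)
  qed
  finally have "ennreal q \<le> (\<integral>\<^sup>+x. ennreal (?r x * k x) \<partial>N)"
    using ennreal_integral_le_nn_integral[OF ir] by simp
  also have "\<dots> \<le> (\<integral>\<^sup>+x. ennreal (h x powr (p - 2) * (G x \<bullet> (P *v G x))) * ennreal (k x) * indicator {x. 0 <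
      h x} x \<partial>N)"
  proof (rule nn_integral_mono_AE)
    show "AE x in N. ennreal (?r x * k x) \<le> ennreal (h x powr (p - 2) * (G x \<bullet> (P *v G x))) * ennreal (k x)
        * indicator {x. 0 < h x} x"
      using pos zero
    proof eventually_elim
      case (elim x)
      show ?case
      proof (cases "0 < h x")
        case True
        have "?r x \<le> h x powr (p - 2) * (G x \<bullet> (P *v G x))"
          using perspective_tangent[OF P p True a0, of "G x" b] by (simp add: q_def)
        then have "ennreal (?r x * k x) \<le> ennreal (h x powr (p - 2) * (G x \<bullet> (P *v G x)) * k x)"
          by (intro ennreal_leI mult_right_mono k)
        then show ?thesis using True k(1)[of x] psd[of "G x"] by (simp add: ennreal_mult'')
      next
        \<comment> \<open>On the zero set the gradient vanishes and the tangent plane takes the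
          value \<open>- (p - 1) * q\<close>, which is not positive. So restricting the right side
          to positive \<open>h\<close> loses nothing.\<close>
        case False
        then have z: "h x = 0" "G x = 0" using elim by auto
        then have "?r x * k x \<le> 0" using p q0 k(1)[of x] by (simp add: mult_nonneg_nonneg)
        then show ?thesis by (simp add: ennreal_neg)
      qed
    qed
  qed
  finally show ?thesis unfolding q_def a_def b_def .
qed

section \<open>Evaluating and comparing Fisher informations\<close>

lemma deriv_deriv_psi:
  assumes "1 < p" "0 < y"
  shows "deriv (deriv (psi p)) y = y powr (p - 2)"
proof -
  have d1: "deriv (psi p) z = (z powr (p - 1) - 1) / (p - 1)" if "0 < z" for z
  proof (rule DERIV_imp_deriv)
    have "(psi p has_real_derivative (p * z powr (p - 1) - p) / (p * (p - 1))) (at z)"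
      unfolding psi_def[abs_def] using that assms(1)
      by (auto intro!: derivative_eq_intros)
    moreover have "(p * z powr (p - 1) - p) / (p * (p - 1)) = (z powr (p - 1) - 1) / (p - 1)"
    proof -
      have "p * z powr (p - 1) - p = p * (z powr (p - 1) - 1)" by (simp add: algebra_simps)
      then show ?thesis using assms(1) by simp
    qed
    ultimately show "(psi p has_real_derivative (z powr (p - 1) - 1) / (p - 1)) (at z)" by simp
  qed
  have "((\<lambda>z. (z powr (p - 1) - 1) / (p - 1)) has_real_derivative y powr (p - 2)) (at y)"
    using assms by (auto intro!: derivative_eq_intros simp: diff_diff_eq)
  then have "(deriv (psi p) has_real_derivative y powr (p - 2)) (at y)"
    by (rule has_field_derivative_transform_within_open[where S = "{0<..}"]) (use assms d1 in auto)
  then show ?thesis by (rule DERIV_imp_deriv)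
qed

text \<open>The gradient chosen by the definition is replaced by any convenient one, and the ratio
  by any function equal to it almost everywhere, since weak gradients are unique up to null
  sets.\<close>

lemma fisher_p_eq:
  fixes f g :: "real^'n \<Rightarrow> real"
  assumes p: "1 < p" and wg: "is_weak_grad (\<lambda>x. f x / g x) G"
    and h: "AE x in lborel. f x / g x = h x"
  shows "fisher_p p P f g = (\<integral>\<^sup>+x. ennreal (h x powr (p - 2) * (G x \<bullet> (P *v G x)) * g x) * indicator {x. 0 <
      h x} x \<partial>lborel)"
proof -
  let ?G = "SOME G. is_weak_grad (\<lambda>x. f x / g x) G"
  have "is_weak_grad (\<lambda>x. f x / g x) ?G" by (rule someI[of "\<lambda>G. is_weak_grad (\<lambda>x. f x / g x) G", OF wg])
  then have G: "AE x in lborel. ?G x = G x" by (rule weak_grad_unique[OF _ wg]) simp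
  have "fisher_p p P f g = (\<integral>\<^sup>+x. ennreal (deriv (deriv (psi p)) (f x / g x) * (?G x \<bullet> (P *v ?G x)) * g x) *
      indicator {x. 0 < f x / g x} x \<partial>lborel)"
    unfolding fisher_p_def fisher_information_def Let_def using wg by auto
  also have "\<dots> = (\<integral>\<^sup>+x. ennreal (h x powr (p - 2) * (G x \<bullet> (P *v G x)) * g x) * indicator {x. 0 < h x} x
      \<partial>lborel)"
  proof (rule nn_integral_cong_AE)
    show "AE x in lborel. ennreal (deriv (deriv (psi p)) (f x / g x) * (?G x \<bullet> (P *v ?G x)) * g x) *
        indicator {x. 0 < f x / g x} x
      = ennreal (h x powr (p - 2) * (G x \<bullet> (P *v G x)) * g x) * indicator {x. 0 < h x} x"
      using G h
    proof eventually_elim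
      case (elim x)
      show ?case
      proof (cases "0 < h x")
        case True
        then show ?thesis using elim deriv_deriv_psi[OF p, of "h x"] by simp
      next
        case False
        then show ?thesis using elim by simp
      qed
    qed
  qed
  finally show ?thesis .
qed

lemma fisher_p_infinite: "\<nexists>G. is_weak_grad (\<lambda>x. f x / g x) G \<Longrightarrow> fisher_p p P f g = \<infinity>"
  unfolding fisher_p_def fisher_information_def Let_def by auto

lemma fisher_p_mono:
  fixes P P' :: "real^'n^'n"
  assumes p: "1 < p" and c: "0 < c" and g: "\<And>x. 0 < g x" "g \<in> borel_measurable borel"
    and le: "\<And>x. x \<bullet> (P *v x) \<le> c * (x \<bullet> (P' *v x))"
  shows "fisher_p p P f g \<le> ennreal c * fisher_p p P' f g"
proof (cases "\<exists>G. is_weak_grad (\<lambda>x. f x / g x) G")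
  \<comment> \<open>Without a weak gradient both sides are infinite, \<open>c\<close> being
    positive.\<close>
  case False
  then show ?thesis using c by (simp add: fisher_p_infinite ennreal_mult_top)
next
  case True
  then obtain G where G: "is_weak_grad (\<lambda>x. f x / g x) G" by blast
  note [measurable] = g(2)
  have [measurable]: "G \<in> borel_measurable borel" "(\<lambda>x. f x / g x) \<in> borel_measurable borel"
    using G locally_integrable_measurable by (auto simp: is_weak_grad_def)
  have r: "AE x in lborel. f x / g x = f x / g x" by simp
  have pw: "ennreal ((f x / g x) powr (p - 2) * (G x \<bullet> (P *v G x)) * g x) * indicator {x. 0 < f x / g x} x
      \<le> ennreal c * (ennreal ((f x / g x) powr (p - 2) * (G x \<bullet> (P' *v G x)) * g x) * indicator {x. 0 < f x
          / g x} x)" for x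
  proof -
    have "(f x / g x) powr (p - 2) * (G x \<bullet> (P *v G x)) * g x
        \<le> (f x / g x) powr (p - 2) * (c * (G x \<bullet> (P' *v G x))) * g x"
      using g(1)[of x] by (intro mult_right_mono mult_left_mono le) auto
    also have "\<dots> = c * ((f x / g x) powr (p - 2) * (G x \<bullet> (P' *v G x)) * g x)" by simp
    finally have "ennreal ((f x / g x) powr (p - 2) * (G x \<bullet> (P *v G x)) * g x)
        \<le> ennreal c * ennreal ((f x / g x) powr (p - 2) * (G x \<bullet> (P' *v G x)) * g x)"
      using c by (subst ennreal_mult'[symmetric]) (auto intro: ennreal_leI)
    then show ?thesis by (auto simp: indicator_def)
  qed
  have "fisher_p p P f g \<le> (\<integral>\<^sup>+x. ennreal c * (ennreal ((f x / g x) powr (p - 2) * (G x \<bullet> (P' *v G x)) * g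
      x) * indicator {x. 0 < f x / g x} x) \<partial>lborel)"
    unfolding fisher_p_eq[OF p G r] by (intro nn_integral_mono pw)
  also have "\<dots> = ennreal c * fisher_p p P' f g"
    unfolding fisher_p_eq[OF p G r] by (rule nn_integral_cmult) measurable
  finally show ?thesis .
qed

lemma pos_def_upper_bound:
  fixes P :: "real^'n^'n"
  obtains L where "0 < L" "\<And>x. x \<bullet> (P *v x) \<le> L * (norm x)\<^sup>2"
proof -
  obtain L where L: "0 < L" "\<And>v. norm (P *v v) \<le> norm v * L"
    using bounded_linear.pos_bounded[OF bounded_linear_matrix[of P]] by blast
  have "x \<bullet> (P *v x) \<le> L * (norm x)\<^sup>2" for x
  proof -
    have "x \<bullet> (P *v x) \<le> norm x * norm (P *v x)" by (rule norm_cauchy_schwarz)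
    also have "\<dots> \<le> norm x * (norm x * L)" by (intro mult_left_mono L) simp
    finally show ?thesis by (simp add: power2_eq_square mult_ac)
  qed
  then show thesis using that L(1) by blast
qed

lemma is_weak_grad_cong_AE:
  assumes wg: "is_weak_grad h G" and li: "locally_integrable h'" and eq: "AE x in lborel. h x = h' x"
  shows "is_weak_grad h' G"
proof (rule is_weak_gradI[OF li])
  note [measurable] = locally_integrable_measurable[OF li]
  have lh: "locally_integrable h" "locally_integrable G" using wg by (auto simp: is_weak_grad_def)
  note [measurable] = locally_integrable_measurable[OF lh(1)]
  show "locally_integrable G" by (rule lh)
  fix \<phi> :: "real^'a \<Rightarrow> real" and v assume \<phi>: "test_function \<phi>"
  note [measurable] = test_function_measurable[OF test_function_deriv[OF \<phi>, of v]]
  have "(\<integral>x. h' x * frechet_derivative \<phi> (at x) v \<partial>lborel) = (\<integral>x. h x * frechet_derivative \<phi> (at x) v \<partial>lborel)"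
    by (rule integral_cong_AE) (use eq in \<open>auto elim: eventually_mono\<close>)
  then show "(\<integral>x. h' x * frechet_derivative \<phi> (at x) v \<partial>lborel) = - (\<integral>x. \<phi> x * (G x \<bullet> v) \<partial>lborel)"
    using weak_grad_inner[OF wg \<phi>, of v] by simp
qed

section \<open>Contraction under the flow\<close>

context fp_kernel
begin

text \<open>With \<open>r = h0 powr (p - 2)\<close>, the norm of the gradient is split by
  \<open>2 * norm G \<le> r * (norm G)\<^sup>2 + 1 / r\<close>. The first part is controlled by the
  Fisher information, and the second by \<open>1 + h0\<close>, as its exponent \<open>2 - p\<close>
  lies between 0 and 1; on the zero set the gradient vanishes.\<close>

lemma fi_gradient_integrable:
  fixes P0 :: "real^'n^'n"
  assumes P0: "pos_def P0" and p: "1 < p" "p \<le> 2" and wg: "is_weak_grad h0 G0"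
    and i0: "integrable lborel (\<lambda>x. fi x * h0 x)" and pos: "AE x in lborel. 0 \<le> h0 x"
    and zero: "AE x in lborel. h0 x = 0 \<longrightarrow> G0 x = 0"
    and fin: "(\<integral>\<^sup>+x. ennreal (h0 x powr (p - 2) * (G0 x \<bullet> (P0 *v G0 x)) * fi x) * indicator {x. 0 < h0 x} x
        \<partial>lborel) < \<infinity>"
  shows "integrable lborel (\<lambda>x. fi x *\<^sub>R G0 x)"
proof (rule integrableI_bounded)
  have [measurable]: "G0 \<in> borel_measurable borel" "h0 \<in> borel_measurable borel"
    using wg locally_integrable_measurable by (auto simp: is_weak_grad_def)
  show "(\<lambda>x. fi x *\<^sub>R G0 x) \<in> borel_measurable lborel" by simp
  obtain c where c: "0 < c" "\<And>x. c * (norm x)\<^sup>2 \<le> x \<bullet> (P0 *v x)" using pos_def_lower_bound[OF P0] by blast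
  let ?J = "\<lambda>x. ennreal (h0 x powr (p - 2) * (G0 x \<bullet> (P0 *v G0 x)) * fi x) * indicator {x. 0 < h0 x} x"
  have psd: "0 \<le> x \<bullet> (P0 *v x)" for x using P0 by (cases "x = 0") (auto simp: pos_def_def less_imp_le)
  have "(\<integral>\<^sup>+x. ennreal (norm (fi x *\<^sub>R G0 x)) \<partial>lborel)
    \<le> (\<integral>\<^sup>+x. ennreal (1 / c) * ?J x + ennreal (fi x + fi x * h0 x) \<partial>lborel)"
  proof (rule nn_integral_mono_AE)
    show "AE x in lborel. ennreal (norm (fi x *\<^sub>R G0 x))
        \<le> ennreal (1 / c) * ?J x + ennreal (fi x + fi x * h0 x)"
      using pos zero
    proof eventually_elim
      case (elim x)
      show ?case
      proof (cases "0 < h0 x")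
        case True
        define r where "r = h0 x powr (p - 2)"
        have r: "0 < r" using True by (simp add: r_def)
        have "0 \<le> r * (norm (G0 x) - 1 / r)\<^sup>2" using r by simp
        also have "\<dots> = r * (norm (G0 x))\<^sup>2 - 2 * norm (G0 x) + 1 / r"
          using r by (simp add: power2_eq_square algebra_simps)
        finally have 1: "2 * norm (G0 x) \<le> r * (norm (G0 x))\<^sup>2 + 1 / r" by simp
        have "1 / r = h0 x powr (2 - p)" using powr_minus_divide[of "h0 x" "p - 2"] by (simp add: r_def)
        also have "\<dots> \<le> (2 - p) * h0 x + (p - 1)"
          using Youngs_inequality_0[of "2 - p" "p - 1" "h0 x" 1] p True by simp
        also have "\<dots> \<le> 1 * h0 x + 1" using p True by (intro add_mono mult_right_mono) auto
        finally have 2: "1 / r \<le> 1 + h0 x" by simp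
        have "r * (norm (G0 x))\<^sup>2 \<le> 1 / c * (r * (G0 x \<bullet> (P0 *v G0 x)))"
          using c(2)[of "G0 x"] c(1) r by (simp add: pos_le_divide_eq mult.commute)
        with 1 2 have "2 * norm (G0 x) \<le> 1 / c * (r * (G0 x \<bullet> (P0 *v G0 x))) + (1 + h0 x)" by linarith
        moreover have "norm (G0 x) \<le> 2 * norm (G0 x)" by simp
        ultimately have "norm (G0 x) \<le> 1 / c * (r * (G0 x \<bullet> (P0 *v G0 x))) + (1 + h0 x)" by linarith
        then have "norm (G0 x) * fi x \<le> (1 / c * (r * (G0 x \<bullet> (P0 *v G0 x))) + (1 + h0 x)) * fi x"
          by (rule mult_right_mono) (simp add: fi_pos less_imp_le)
        then have 3: "norm (fi x *\<^sub>R G0 x) \<le> 1 / c * (r * (G0 x \<bullet> (P0 *v G0 x)) * fi x) + (fi x + fi x * h0 x)"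
          using fi_pos[of x] by (simp add: algebra_simps)
        have n1: "0 \<le> r * (G0 x \<bullet> (P0 *v G0 x)) * fi x" using r psd fi_pos[of x] by (simp add: less_imp_le)
        have "ennreal (norm (fi x *\<^sub>R G0 x)) \<le> ennreal (1 / c * (r * (G0 x \<bullet> (P0 *v G0 x)) * fi x) + (fi x +
            fi x * h0 x))"
          by (rule ennreal_leI[OF 3])
        also have "\<dots> = ennreal (1 / c * (r * (G0 x \<bullet> (P0 *v G0 x)) * fi x)) + ennreal (fi x + fi x * h0 x)"
          by (rule ennreal_plus) (use n1 c(1) True fi_pos[of x] in \<open>auto simp: less_imp_le\<close>)
        also have "ennreal (1 / c * (r * (G0 x \<bullet> (P0 *v G0 x)) * fi x))
            = ennreal (1 / c) * ennreal (r * (G0 x \<bullet> (P0 *v G0 x)) * fi x)"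
          by (rule ennreal_mult) (use n1 c(1) in auto)
        finally show ?thesis using True by (simp add: r_def)
      next
        case False
        then have "G0 x = 0" using elim by auto
        then show ?thesis by simp
      qed
    qed
  qed
  also have "\<dots> = ennreal (1 / c) * (\<integral>\<^sup>+x. ?J x \<partial>lborel) + (\<integral>\<^sup>+x. ennreal (fi x + fi x * h0 x) \<partial>lborel)"
    by (subst nn_integral_add; (subst nn_integral_cmult)?; measurable)
  also have "\<dots> < \<infinity>"
  proof -
    have "(\<integral>\<^sup>+x. ennreal (fi x + fi x * h0 x) \<partial>lborel) = ennreal (\<integral>x. fi x + fi x * h0 x \<partial>lborel)"
    proof (rule nn_integral_eq_integral)
      show "integrable lborel (\<lambda>x. fi x + fi x * h0 x)" using fi_integrable i0 by simp
      show "AE x in lborel. 0 \<le> fi x + fi x * h0 x"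
        using pos by eventually_elim (simp add: fi_pos less_imp_le)
    qed
    then show ?thesis using fin by (simp add: ennreal_mult_less_top)
  qed
  finally show "(\<integral>\<^sup>+x. ennreal (norm (fi x *\<^sub>R G0 x)) \<partial>lborel) < \<infinity>" .
qed

text \<open>The matrix \<open>transpose M\<close> in front of the averaged gradient accounts for the
  factor \<open>\<rho>\<close>. What remains is Jensen's inequality at each \<open>y\<close>,
  integrated against the stationary state.\<close>

lemma fisher_contraction:
  fixes P0 :: "real^'n^'n"
  assumes P0: "pos_def P0" and p: "1 < p" "p \<le> 2" and f0: "L1_plus f0"
    and fin: "fisher_p p P0 f0 fi < \<infinity>" and sol: "fp_solution D C f0 f"
    and \<rho>: "0 \<le> \<rho>" "\<And>b. (transpose M *v b) \<bullet> (P0 *v (transpose M *v b)) \<le> \<rho> * (b \<bullet> (P0 *v b))"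
  shows "fisher_p p P0 (f t) fi \<le> ennreal \<rho> * fisher_p p P0 f0 fi"
proof -
  define h0 where "h0 = (\<lambda>x. f0 x / fi x)"
  have fh: "fi x * h0 x = f0 x" for x using fi_pos[of x] by (simp add: h0_def)
  have if0: "integrable lborel f0" using f0 by (simp add: L1_plus_def)
  have i0: "integrable lborel (\<lambda>x. fi x * h0 x)" using if0 by (simp add: fh)
  obtain G0 where wg: "is_weak_grad h0 G0"
    using fin fisher_p_infinite[of f0 fi p P0] unfolding h0_def by (metis infinity_ennreal_def less_irrefl)
  have pos: "AE x in lborel. 0 \<le> h0 x"
    using f0 fi_pos by (auto simp: L1_plus_def h0_def less_imp_le elim: eventually_mono)
  have zero: "AE x in lborel. h0 x = 0 \<longrightarrow> G0 x = 0" by (rule weak_grad_zero_on_zeros[OF wg pos])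
  have I0: "fisher_p p P0 f0 fi = (\<integral>\<^sup>+x. ennreal (h0 x powr (p - 2) * (G0 x \<bullet> (P0 *v G0 x)) * fi x) *
      indicator {x. 0 < h0 x} x \<partial>lborel)"
    by (rule fisher_p_eq[OF p(1)]) (use wg in \<open>simp_all add: h0_def\<close>)
  have iG: "integrable lborel (\<lambda>x. fi x *\<^sub>R G0 x)"
    by (rule fi_gradient_integrable[OF P0 p wg i0 pos zero]) (use fin I0 in simp)
  have it: "integrable lborel (f t)" using sol t by (simp add: fp_solution_def)
  have eq: "AE y in lborel. f t y = (\<integral>x. pt x y * (fi x * h0 x) \<partial>lborel)"
    unfolding fh by (rule solution_eq[OF sol if0])
  note wgt = weak_grad_transport[OF wg i0 iG it eq]
  define ht where "ht y = (\<integral>x. kk x y * h0 x \<partial>lborel)" for y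
  define bt where "bt y = (\<integral>x. kk x y *\<^sub>R G0 x \<partial>lborel)" for y
  have hteq: "AE y in lborel. f t y / fi y = ht y"
    using eq
  proof eventually_elim
    case (elim y)
    have "ht y = (\<integral>x. (1 / fi y) * (pt x y * (fi x * h0 x)) \<partial>lborel)"
      unfolding ht_def by (simp add: kk_eq[of _ y] mult_ac)
    also have "\<dots> = (1 / fi y) * f t y" unfolding elim by (rule integral_mult_right_zero)
    finally show ?case by simp
  qed
  have [measurable]: "G0 \<in> borel_measurable borel" "h0 \<in> borel_measurable borel"
    using wg locally_integrable_measurable by (auto simp: is_weak_grad_def)
  have [measurable]: "(\<lambda>q. pt (snd q) (fst q)) \<in> borel_measurable (borel \<Otimes>\<^sub>M borel)"
    using measurable_compose[OF measurable_Pair[OF measurable_snd measurable_fst] kernel_measurable(2)] by simp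
  have psd: "0 \<le> x \<bullet> (P0 *v x)" for x using P0 by (cases "x = 0") (auto simp: pos_def_def less_imp_le)
  let ?J = "\<lambda>x. ennreal (h0 x powr (p - 2) * (G0 x \<bullet> (P0 *v G0 x))) * indicator {x. 0 < h0 x} x"
  have "fisher_p p P0 (f t) fi = (\<integral>\<^sup>+y. ennreal (ht y powr (p - 2) * ((transpose M *v bt y) \<bullet> (P0 *v
      (transpose M *v bt y))) * fi y) * indicator {y. 0 < ht y} y \<partial>lborel)"
    unfolding bt_def by (rule fisher_p_eq[OF p(1) wgt hteq])
  also have "\<dots> \<le> (\<integral>\<^sup>+y. ennreal \<rho> * (\<integral>\<^sup>+x. ?J x * ennreal (fi x * pt x y) \<partial>lborel) \<partial>lborel)"
  proof (rule nn_integral_mono)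
    fix y :: "real^'n"
    show "ennreal (ht y powr (p - 2) * ((transpose M *v bt y) \<bullet> (P0 *v (transpose M *v bt y))) * fi y) *
        indicator {y. 0 < ht y} y
      \<le> ennreal \<rho> * (\<integral>\<^sup>+x. ?J x * ennreal (fi x * pt x y) \<partial>lborel)"
    proof (cases "0 < ht y")
      case True
      have j: "ennreal (ht y powr (p - 2) * (bt y \<bullet> (P0 *v bt y)))
        \<le> (\<integral>\<^sup>+x. ennreal (h0 x powr (p - 2) * (G0 x \<bullet> (P0 *v G0 x))) * ennreal (kk x y) * indicator {x. 0 <
            h0 x} x \<partial>lborel)"
        unfolding ht_def bt_def
        by (rule fisher_jensen[OF P0 p _ kk_integrable kk_integral kk_h0_integrable[OF wg i0 iG]
            kk_G0_integrable[OF wg i0 iG] pos zero])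
          (use True in \<open>simp_all add: ht_def kernel_pos less_imp_le\<close>)
      have "ht y powr (p - 2) * ((transpose M *v bt y) \<bullet> (P0 *v (transpose M *v bt y))) * fi y
        \<le> ht y powr (p - 2) * (\<rho> * (bt y \<bullet> (P0 *v bt y))) * fi y"
        by (intro mult_right_mono mult_left_mono \<rho>(2)) (auto simp: fi_pos less_imp_le)
      also have "\<dots> = \<rho> * ((ht y powr (p - 2) * (bt y \<bullet> (P0 *v bt y))) * fi y)" by (simp add: mult_ac)
      finally have "ennreal (ht y powr (p - 2) * ((transpose M *v bt y) \<bullet> (P0 *v (transpose M *v bt y))) * fi y)
        \<le> ennreal (\<rho> * ((ht y powr (p - 2) * (bt y \<bullet> (P0 *v bt y))) * fi y))" by (rule ennreal_leI)
      also have "\<dots> = ennreal \<rho> * (ennreal (ht y powr (p - 2) * (bt y \<bullet> (P0 *v bt y))) * ennreal (fi y))"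
        using \<rho>(1) psd[of "bt y"] fi_pos[of y] by (simp add: ennreal_mult less_imp_le)
      also have "\<dots> \<le> ennreal \<rho> * ((\<integral>\<^sup>+x. ennreal (h0 x powr (p - 2) * (G0 x \<bullet> (P0 *v G0 x))) * ennreal (kk x
          y) * indicator {x. 0 < h0 x} x \<partial>lborel) * ennreal (fi y))"
        by (intro mult_left_mono mult_right_mono j) auto
      also have "(\<integral>\<^sup>+x. ennreal (h0 x powr (p - 2) * (G0 x \<bullet> (P0 *v G0 x))) * ennreal (kk x y) * indicator
          {x. 0 < h0 x} x \<partial>lborel) * ennreal (fi y)
        = (\<integral>\<^sup>+x. ennreal (h0 x powr (p - 2) * (G0 x \<bullet> (P0 *v G0 x))) * ennreal (kk x y) * indicator {x. 0 <
            h0 x} x * ennreal (fi y) \<partial>lborel)"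
        by (rule nn_integral_multc[symmetric]) measurable
      \<comment> \<open>Detailed balance trades the reversed density weighted at \<open>y\<close>
        for the forward density weighted at \<open>x\<close>, whose integral over \<open>y\<close>
        is 1; this recovers the initial Fisher information.\<close>
      also have "\<dots> = (\<integral>\<^sup>+x. ?J x * ennreal (fi x * pt x y) \<partial>lborel)"
        unfolding detailed_balance
        by (intro nn_integral_cong) (use fi_pos[of y] kernel_pos(2) in \<open>simp add: ennreal_mult less_imp_le
            mult_ac\<close>)
      finally show ?thesis using True by simp
    qed simp
  qed
  also have "\<dots> = ennreal \<rho> * (\<integral>\<^sup>+y. \<integral>\<^sup>+x. ?J x * ennreal (fi x * pt x y) \<partial>lborel \<partial>lborel)"
    by (rule nn_integral_cmult) measurable
  also have "(\<integral>\<^sup>+y. \<integral>\<^sup>+x. ?J x * ennreal (fi x * pt x y) \<partial>lborel \<partial>lborel)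
      = (\<integral>\<^sup>+x. \<integral>\<^sup>+y. ?J x * ennreal (fi x * pt x y) \<partial>lborel \<partial>lborel)"
  proof (rule lborel_pair.Fubini')
    show "(\<lambda>(x, y). ?J x * ennreal (fi x * pt x y)) \<in> borel_measurable (lborel \<Otimes>\<^sub>M lborel)"
      unfolding case_prod_unfold by measurable
  qed
  also have "\<dots> = (\<integral>\<^sup>+x. ?J x * ennreal (fi x) \<partial>lborel)"
  proof (rule nn_integral_cong)
    fix x :: "real^'n"
    have "(\<integral>\<^sup>+y. ?J x * ennreal (fi x * pt x y) \<partial>lborel) = ?J x * (\<integral>\<^sup>+y. ennreal (fi x * pt x y) \<partial>lborel)"
      by (rule nn_integral_cmult) measurable
    also have "(\<integral>\<^sup>+y. ennreal (fi x * pt x y) \<partial>lborel) = ennreal (\<integral>y. fi x * pt x y \<partial>lborel)"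
      by (rule nn_integral_eq_integral) (use pt_integrable1 fi_pos kernel_pos(1) in \<open>auto simp: less_imp_le\<close>)
    also have "(\<integral>y. fi x * pt x y \<partial>lborel) = fi x" by (simp add: pt_integral)
    finally show "(\<integral>\<^sup>+y. ?J x * ennreal (fi x * pt x y) \<partial>lborel) = ?J x * ennreal (fi x)" .
  qed
  also have "\<dots> = fisher_p p P0 f0 fi"
    unfolding I0 by (intro nn_integral_cong) (use psd fi_pos in \<open>simp add: ennreal_mult less_imp_le mult_ac\<close>)
  finally show ?thesis .
qed

text \<open>Shows that \<open>transpose M\<close> is conjugate to the propagator, so its norm decays
  at the same rate up to constants depending on \<open>K\<close>.\<close>

lemma transpose_M: "transpose M *v b = Ki *v (E t *v (K *v b))"
  by (simp add: M_def matrix_transpose_mul sym_Ki Ksym matrix_vector_mul_assoc matrix_mul_assoc)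

end

text \<open>Needed at time 0, where the solution agrees with its datum only almost
  everywhere.\<close>

lemma fisher_p_cong_AE:
  fixes f g w :: "real^'n \<Rightarrow> real"
  assumes p: "1 < p" and f: "integrable lborel f" and w: "continuous_on UNIV (\<lambda>x. 1 / w x)"
    and eq: "AE x in lborel. f x = g x" and fin: "fisher_p p P g w < \<infinity>"
  shows "fisher_p p P f w = fisher_p p P g w"
proof -
  obtain G where G: "is_weak_grad (\<lambda>x. g x / w x) G"
    using fin fisher_p_infinite[of g w p P] by (metis infinity_ennreal_def less_irrefl)
  have e: "AE x in lborel. g x / w x = f x / w x" using eq by eventually_elim simp
  have "locally_integrable (\<lambda>x. f x / w x)"
    using locally_integrable_mult_continuous[OF f w] by simp
  from is_weak_grad_cong_AE[OF G this e] have G': "is_weak_grad (\<lambda>x. f x / w x) G" .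
  show ?thesis unfolding fisher_p_eq[OF p G e] by (rule fisher_p_eq[OF p G']) simp
qed

text \<open>The first inequality compares \<open>D\<close> with \<open>P0\<close> as quadratic
  forms. The second is \<open>fisher_contraction\<close> at each positive time, with
  \<open>\<rho>\<close> obtained from the propagator bound by comparing \<open>P0\<close> with the
  Euclidean norm.\<close>

theorem theorem5p3:
  fixes D C K P0 :: "real^'n^'n" and \<mu> :: real and n :: nat
    and f_inf :: "real^'n \<Rightarrow> real"
  assumes A: "condition_A D"
    and B: "condition_B C"
    and C: "condition_C D C"
    and K: "pos_def K" "2 *\<^sub>R D = C ** K + K ** transpose C"
    and f_inf: "f_inf = steady_state K"
    and P0: "pos_def P0"
      "\<exists>l::real>0. \<forall>p f. 1 < p \<and> p \<le> 2 \<and> L1_plus f \<and> unit_mass f \<longrightarrow>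
         ennreal l * entropy_p p f f_inf \<le> fisher_p p P0 f f_inf"
    and \<mu>: "\<mu> = spectral_gap C"
    and defective: "\<exists>z\<in>eigenvalues C. Re z = \<mu> \<and> 0 < defect C z"
    and n: "n = Max (defect C ` {z\<in>eigenvalues C. Re z = \<mu>})"
  shows "\<exists>c::real>0. \<forall>p. 1 < p \<and> p \<le> 2 \<longrightarrow>
    (\<exists>c\<^sub>p :: ennreal \<Rightarrow> real. \<forall>f0 f.
       L1_plus f0 \<and> unit_mass f0 \<and> fisher_p p P0 f0 f_inf < \<infinity> \<and> fp_solution D C f0 f \<longrightarrow>
       (\<forall>t\<ge>0.
          fisher_p p D (f t) f_inf \<le> ennreal c * fisher_p p P0 (f t) f_inf \<and>
          ennreal c * fisher_p p P0 (f t) f_inf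
            \<le> ennreal (c\<^sub>p (fisher_p p P0 f0 f_inf) * (1 + t ^ (2 * n)) * exp (- 2 * \<mu> * t))))"
proof -
  obtain E :: "real \<Rightarrow> real^'n^'n" and Kc where E: "E 0 = mat 1"
    "\<And>t v. ((\<lambda>t. E t *v v) has_vector_derivative - (C *v (E t *v v))) (at t)"
    "\<And>t v. C *v (E t *v v) = E t *v (C *v v)" "\<And>t v. E (- t) *v (E t *v v) = v"
    "0 \<le> Kc" "\<And>t v. 0 \<le> t \<Longrightarrow> norm (E t *v v) \<le> Kc * (1 + t ^ n) * exp (- \<mu> * t) * norm v"
    by (rule propagator_exists[OF \<mu> n]) (rule that)
  have kernel: "fp_kernel D C K E t" if "0 < t" for t
    by unfold_locales (use A K E C that in \<open>simp_all add: condition_A_def\<close>)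
  \<comment> \<open>The stationary state does not depend on time; the instance at time 1 only gives
    access to its properties.\<close>
  interpret one: fp_kernel D C K E 1 by (rule kernel) simp
  have finf: "f_inf = one.fi" by (simp add: f_inf one.fi_steady_state)
  obtain c0 where c0: "0 < c0" "\<And>x. c0 * (norm x)\<^sup>2 \<le> x \<bullet> (P0 *v x)" using pos_def_lower_bound[OF P0(1)]
      by blast
  obtain L0 where L0: "0 < L0" "\<And>x. x \<bullet> (P0 *v x) \<le> L0 * (norm x)\<^sup>2" using pos_def_upper_bound by blast
  obtain LD where LD: "0 < LD" "\<And>x. x \<bullet> (D *v x) \<le> LD * (norm x)\<^sup>2" using pos_def_upper_bound by blast
  obtain L1 where L1: "0 < L1" "\<And>v. norm (matrix_inv K *v v) \<le> norm v * L1"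
    using bounded_linear.pos_bounded[OF bounded_linear_matrix[of "matrix_inv K"]] by blast
  obtain L2 where L2: "0 < L2" "\<And>v. norm (K *v v) \<le> norm v * L2"
    using bounded_linear.pos_bounded[OF bounded_linear_matrix[of K]] by blast
  \<comment> \<open>The form of \<open>D\<close> is at most \<open>LD\<close> times, that of
    \<open>P0\<close> at least \<open>c0\<close> times the squared norm.\<close>
  define c where "c = LD / c0"
  have c: "0 < c" using LD c0 by (simp add: c_def)
  have P0c0: "(norm x)\<^sup>2 \<le> (x \<bullet> (P0 *v x)) / c0" for x
    using c0 by (simp add: pos_le_divide_eq mult.commute)
  have DP0: "x \<bullet> (D *v x) \<le> c * (x \<bullet> (P0 *v x))" for x
  proof -
    have "x \<bullet> (D *v x) \<le> LD * (norm x)\<^sup>2" by (rule LD)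
    also have "\<dots> \<le> LD * ((x \<bullet> (P0 *v x)) / c0)" using LD(1) P0c0 by (intro mult_left_mono) auto
    finally show ?thesis by (simp add: c_def)
  qed
  \<comment> \<open>The factor 2 is from
    \<open>(1 + t ^ n)\<^sup>2 \<le> 2 * (1 + t ^ (2 * n))\<close>; the rest compares
    \<open>P0\<close>, \<open>K\<close> and its inverse with the Euclidean norm.\<close>
  define A where "A = 2 * (L0 * (Kc * L1 * L2)\<^sup>2 / c0)"
  have A0: "0 \<le> A" using L0 c0 by (simp add: A_def)
  \<comment> \<open>The maximum with 1 covers time 0, where the Fisher information equals its
    initial value.\<close>
  define c2 where "c2 = max 1 A"
  have decay: "fisher_p p P0 (f t) f_inf \<le> ennreal (c2 * (1 + t ^ (2 * n)) * exp (- 2 * \<mu> * t)) * fisher_p p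
      P0 f0 f_inf"
    if p: "1 < p" "p \<le> 2" and f0: "L1_plus f0" and fin: "fisher_p p P0 f0 f_inf < \<infinity>" and sol: "fp_solution D
        C f0 f"
      and t: "0 \<le> t" for p f0 f t
  proof (cases "t = 0")
    \<comment> \<open>At time 0 the transition kernel degenerates, so this case rests on the initial
      condition instead.\<close>
    case True
    have "AE x in lborel. f 0 x = f0 x" "integrable lborel (f 0)" using sol by (simp_all add: fp_solution_def)
    then have "fisher_p p P0 (f 0) f_inf = fisher_p p P0 f0 f_inf"
      by (intro fisher_p_cong_AE p fin) (simp_all add: finf one.inverse_fi_continuous)
    moreover have "1 \<le> c2 * (1 + 0 ^ (2 * n)) * exp (- 2 * \<mu> * 0)"
      using mult_mono[of 1 c2 1 "1 + 0 ^ (2 * n)"] by (simp add: c2_def)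
    then have "ennreal 1 * fisher_p p P0 f0 f_inf \<le> ennreal (c2 * (1 + 0 ^ (2 * n)) * exp (- 2 * \<mu> * 0)) *
        fisher_p p P0 f0 f_inf"
      by (intro mult_right_mono ennreal_leI) auto
    ultimately show ?thesis by (simp add: True)
  next
    case False
    then have t0: "0 < t" using t by simp
    interpret fp_kernel D C K E t by (rule kernel[OF t0])
    have ft: "f_inf = fi" by (simp add: f_inf fi_steady_state)
    \<comment> \<open>A bound for the operator norm of \<open>transpose M\<close>: the propagator
      bound times bounds for \<open>K\<close> and its inverse.\<close>
    define s where "s = Kc * L1 * L2 * ((1 + t ^ n) * exp (- \<mu> * t))"
    have s0: "0 \<le> s" using E(5) L1(1) L2(1) t by (simp add: s_def)
    have ns: "norm (transpose M *v b) \<le> s * norm b" for b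
    proof -
      have "norm (transpose M *v b) \<le> norm (E t *v (K *v b)) * L1"
        unfolding transpose_M Ki_def by (rule L1)
      also have "\<dots> \<le> (Kc * (1 + t ^ n) * exp (- \<mu> * t) * norm (K *v b)) * L1"
        using L1(1) E(6)[OF less_imp_le[OF t0]] by (intro mult_right_mono) auto
      also have "\<dots> \<le> (Kc * (1 + t ^ n) * exp (- \<mu> * t) * (norm b * L2)) * L1"
        using L1(1) E(5) t by (intro mult_right_mono mult_left_mono L2) auto
      finally show ?thesis by (simp add: s_def mult_ac)
    qed
    define \<rho> where "\<rho> = L0 * s\<^sup>2 / c0"
    have \<rho>0: "0 \<le> \<rho>" using L0 c0 by (simp add: \<rho>_def)
    have \<rho>: "(transpose M *v b) \<bullet> (P0 *v (transpose M *v b)) \<le> \<rho> * (b \<bullet> (P0 *v b))" for b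
    proof -
      have "(transpose M *v b) \<bullet> (P0 *v (transpose M *v b)) \<le> L0 * (norm (transpose M *v b))\<^sup>2" by (rule L0)
      also have "\<dots> \<le> L0 * (s * norm b)\<^sup>2" using L0(1) ns by (intro mult_left_mono power_mono) auto
      also have "\<dots> = L0 * s\<^sup>2 * (norm b)\<^sup>2" by (simp add: power_mult_distrib)
      also have "\<dots> \<le> L0 * s\<^sup>2 * ((b \<bullet> (P0 *v b)) / c0)" using L0(1) P0c0 by (intro mult_left_mono) auto
      finally show ?thesis by (simp add: \<rho>_def)
    qed
    have "fisher_p p P0 (f t) fi \<le> ennreal \<rho> * fisher_p p P0 f0 fi"
      by (rule fisher_contraction[OF P0(1) p f0 _ sol \<rho>0 \<rho>]) (use fin ft in simp)
    also have "\<dots> \<le> ennreal (c2 * (1 + t ^ (2 * n)) * exp (- 2 * \<mu> * t)) * fisher_p p P0 f0 fi"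
    proof (intro mult_right_mono ennreal_leI)
      have "0 \<le> (1 - t ^ n)\<^sup>2" by simp
      then have "(1 + t ^ n)\<^sup>2 \<le> 2 * (1 + t ^ (2 * n))"
        unfolding power_even_eq by (simp add: power2_eq_square algebra_simps)
      then have "(L0 * (Kc * L1 * L2)\<^sup>2 / c0) * ((1 + t ^ n)\<^sup>2 * exp (- 2 * \<mu> * t))
        \<le> (L0 * (Kc * L1 * L2)\<^sup>2 / c0) * (2 * (1 + t ^ (2 * n)) * exp (- 2 * \<mu> * t))"
        using L0(1) c0(1) by (intro mult_left_mono mult_right_mono) auto
      moreover have "\<rho> = (L0 * (Kc * L1 * L2)\<^sup>2 / c0) * ((1 + t ^ n)\<^sup>2 * exp (- 2 * \<mu> * t))"
      proof -
        have "(exp (- \<mu> * t))\<^sup>2 = exp (- 2 * \<mu> * t)" by (simp add: power2_eq_square exp_add[symmetric])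
        then show ?thesis by (simp add: \<rho>_def s_def power_mult_distrib)
      qed
      ultimately have "\<rho> \<le> A * (1 + t ^ (2 * n)) * exp (- 2 * \<mu> * t)" by (simp only: A_def mult_ac)
      also have "\<dots> \<le> c2 * (1 + t ^ (2 * n)) * exp (- 2 * \<mu> * t)"
        using t by (intro mult_right_mono) (auto simp: c2_def)
      finally show "\<rho> \<le> c2 * (1 + t ^ (2 * n)) * exp (- 2 * \<mu> * t)" .
    qed simp
    finally show ?thesis by (simp add: ft)
  qed
  have first: "fisher_p p D (f t) f_inf \<le> ennreal c * fisher_p p P0 (f t) f_inf" if "1 < p"
      for p t and f :: "real \<Rightarrow> real^'n \<Rightarrow> real"
    unfolding finf by (rule fisher_p_mono[OF that c one.fi_pos one.kernel_measurable(1) DP0])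
  have second: "ennreal c * fisher_p p P0 (f t) f_inf
      \<le> ennreal ((c * c2 * enn2real (fisher_p p P0 f0 f_inf)) * (1 + t ^ (2 * n)) * exp (- 2 * \<mu> * t))"
    if "1 < p" "p \<le> 2" "L1_plus f0" "fisher_p p P0 f0 f_inf < \<infinity>" "fp_solution D C f0 f" "0 \<le> t" for p f0 f t
  proof -
    let ?I = "fisher_p p P0 f0 f_inf" and ?e = "c2 * (1 + t ^ (2 * n)) * exp (- 2 * \<mu> * t)"
    have e0: "0 \<le> ?e" using that(6) by (simp add: c2_def)
    have "ennreal c * fisher_p p P0 (f t) f_inf \<le> ennreal c * (ennreal ?e * ?I)"
      by (intro mult_left_mono decay that) simp
    also have "?I = ennreal (enn2real ?I)" using that(4) by (simp add: less_top)
    also have "ennreal c * (ennreal ?e * ennreal (enn2real ?I)) = ennreal (c * (?e * enn2real ?I))"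
      using c e0 by (simp add: ennreal_mult)
    finally show ?thesis by (simp add: mult_ac)
  qed
  \<comment> \<open>The witness for \<open>c\<^sub>p\<close> is linear and the same for all
    \<open>p\<close>. On finite Fisher informations \<open>enn2real\<close> loses nothing, and the
    hypothesis on \<open>f0\<close> guarantees finiteness.\<close>
  show ?thesis
    using c first second by (intro exI[of _ c] conjI allI impI exI[of _ "\<lambda>i. c * c2 * enn2real i"]) auto
qed

end
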